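(* Let $k\neq l$ in $\{1,\dots,d\}$ with $\rho_k\le\rho_l$, let $N\ge1$ and let $c_1,\dots,c_N>0$. Consider $N$-tuples $(a_1,\dots,a_N)$ of elements of $\mathcal A$ of type $(k,l)$ satisfying $\varphi_k(a_ia_i^* )=c_i$ for all $i\in\{1,\dots,N\}$; it is assumed that among these there is one which is free with amalgamation over $\mathcal D$ and such that the distribution of each $a_ia_i^*$ in $(\mathcal A_{kk},\varphi_k)$ is the push-forward, by $t\mapsto\frac{c_i\rho_k}{\rho_l}t$, of the Marchenko–Pastur distribution with parameter $\frac{\rho_l}{\rho_k}$ (the maximum of $\chi^{\mathcal D}(a_1,\dots,a_N)$ over these $N$-tuples is realized on such families). If the maximum of $\chi^{\mathcal D}$ over these $N$-tuples is realized on a family $(a_1,\dots,a_N)$, then this family is free with amalgamation over $\mathcal D$, and the distribution of each $a_ia_i^*$ in $(\mathcal A_{kk},\varphi_k)$ is the push-forward, by $t\mapsto\frac{c_i\rho_k}{\rho_l}t$, of the Marchenko–Pastur distribution with parameter $\frac{\rho_l}{\rho_k}$.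
   Context: $(\mathcal A,\varphi)$ is a tracial $W^*$-probability space with nonzero self-adjoint pairwise orthogonal projections $p_1,\dots,p_d$ with sum $1$; $\rho_i=\varphi(p_i)$; $\mathcal D=\mathrm{Span}\{p_1,\dots,p_d\}$; $\mathcal A_{ij}=p_i\mathcal Ap_j$; $\varphi_i=\rho_i^{-1}\varphi|_{\mathcal A_{ii}}$; $E(x)=\sum_i\varphi_i(p_ixp_i)p_i$. An element has type $(k,l)$ if it is a nonzero element of $\mathcal A_{kl}$. $*$-subalgebras $(\mathcal A_i)$ containing $\mathcal D$ are free with amalgamation over $\mathcal D$ if $E(x(1)\cdots x(m))=0$ whenever $i_1\ne\cdots\ne i_m$ (consecutive indices distinct) and $x(j)\in\mathcal A_{i_j}\cap\ker E$; elements are free with amalgamation over $\mathcal D$ if they belong respectively to such $*$-subalgebras. Let $q_k(n)$ be the integer part of $\rho_kn$, and let $p_1(n),\dots,p_d(n)$ be the diagonal projections of the $n\times n$ complex matrices $\mathfrak M_n$ onto consecutive disjoint blocks of coordinates of sizes $q_1(n),\dots,q_d(n)$. For matrices, $E(A)=\sum_k\frac{1}{q_k(n)}\mathrm{Tr}(p_k(n)Ap_k(n))\,p_k\in\mathcal D$. Put $\mathfrak M_n(k,l)=p_k(n)\mathfrak M_np_l(n)$, with Lebesgue measure from the Euclidean structure $\langle M,N\rangle=\mathrm{Re}\,\mathrm{Tr}(M^*N)$; $\Lambda$ denotes the product measure on $\mathfrak M_n(k,l)^N$. $\|\cdot\|$ is the operator norm (on $\mathcal D$ too). For $a_1,\dots,a_N$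 of type $(k,l)$, $k\neq l$, positive integers $n,r$ and $\varepsilon,R>0$, $\Gamma_R(a_1,\dots,a_N;n,r,\varepsilon)$ is the set of $(A_1,\dots,A_N)\in\mathfrak M_n(k,l)^N$ with $\|A_i\|\le R$ and $\|E(A_{i_1}^{\varepsilon_1}\cdots A_{i_p}^{\varepsilon_p})-E(a_{i_1}^{\varepsilon_1}\cdots a_{i_p}^{\varepsilon_p})\|\le\varepsilon$ for all $1\le p\le r$, $i_1,\dots,i_p\in\{1,\dots,N\}$, $\varepsilon_1,\dots,\varepsilon_p\in\{1,*\}$. The free entropy is $\chi^{\mathcal D}(a_1,\dots,a_N)=\sup_R\inf_{r,\varepsilon}\limsup_{n\to\infty}\big[\frac1{n^2}\log\Lambda(\Gamma_R(a_1,\dots,a_N;n,r,\varepsilon))+N\rho_k\rho_l\log n\big]$ (with $\log 0=-\infty$). The Marchenko–Pastur distribution with parameter $\lambda\ge1$ has density $\frac{\sqrt{4\lambda-(x-1-\lambda)^2}}{2\pi x}$ on $[(1-\sqrt\lambda)^2,(1+\sqrt\lambda)^2]$. *)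

theory Defs
  imports "HOL-Probability.Probability" "Jordan_Normal_Form.Schur_Decomposition"
begin

section \<open>Tracial W*-probability spaces\<close>

text \<open>Unital C*-algebras.\<close>

class cstar_algebra = real_normed_algebra_1 + banach +
  fixes scaleC :: "complex \<Rightarrow> 'a \<Rightarrow> 'a" (infixr \<open>*\<^sub>C\<close> 75)
    and adj :: "'a \<Rightarrow> 'a"
  assumes scaleC_of_real: "complex_of_real r *\<^sub>C x = r *\<^sub>R x"
    and scaleC_add_right: "z *\<^sub>C (x + y) = z *\<^sub>C x + z *\<^sub>C y"
    and scaleC_add_left: "(z + w) *\<^sub>C x = z *\<^sub>C x + w *\<^sub>C x"
    and scaleC_scaleC: "z *\<^sub>C (w *\<^sub>C x) = (z * w) *\<^sub>C x"
    and mult_scaleC_left: "(z *\<^sub>C x) * y = z *\<^sub>C (x * y)"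
    and mult_scaleC_right: "x * (z *\<^sub>C y) = z *\<^sub>C (x * y)"
    and norm_scaleC: "norm (z *\<^sub>C x) = cmod z * norm x"
    and adj_add: "adj (x + y) = adj x + adj y"
    and adj_scaleC: "adj (z *\<^sub>C x) = cnj z *\<^sub>C adj x"
    and adj_mult: "adj (x * y) = adj y * adj x"
    and adj_adj: "adj (adj x) = x"
    and norm_adj_mult_self: "norm (adj x * x) = (norm x)\<^sup>2"

text \<open>The Banach space dual: bounded complex-linear functionals, normed by \<^term>\<open>onorm\<close>.\<close>

definition cdual :: "('a::cstar_algebra \<Rightarrow> complex) set" where
  "cdual = {f. bounded_linear f \<and> (\<forall>z x. f (z *\<^sub>C x) = z * f x)}"

text \<open>A predual, realised as a norm-closed subspace of the dual: evaluation identifies the algebra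
  isometrically with the dual Banach space of this subspace. By Sakai's theorem a C*-algebra is a
  W*-algebra (is isomorphic to a von Neumann algebra) iff it has a predual; the predual is then
  unique and consists of the normal (ultraweakly continuous) functionals.\<close>

definition is_predual :: "('a::cstar_algebra \<Rightarrow> complex) set \<Rightarrow> bool" where
  "is_predual F \<longleftrightarrow>
     F \<subseteq> cdual \<and> (\<lambda>x. 0) \<in> F
     \<and> (\<forall>f\<in>F. \<forall>g\<in>F. (\<lambda>x. f x + g x) \<in> F)
     \<and> (\<forall>f\<in>F. \<forall>z. (\<lambda>x. z * f x) \<in> F)
     \<and> (\<forall>g\<in>cdual. (\<forall>e>0. \<exists>f\<in>F. onorm (\<lambda>x. g x - f x) < e) \<longrightarrow> g \<in> F)
     \<and> (\<forall>x. norm x = (SUP f\<in>{f\<in>F. onorm f \<le> 1}. cmod (f x)))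
     \<and> (\<forall>\<Phi> :: ('a \<Rightarrow> complex) \<Rightarrow> complex.
          (\<forall>f\<in>F. \<forall>g\<in>F. \<Phi> (\<lambda>x. f x + g x) = \<Phi> f + \<Phi> g)
          \<and> (\<forall>f\<in>F. \<forall>z. \<Phi> (\<lambda>x. z * f x) = z * \<Phi> f)
          \<and> (\<exists>K. \<forall>f\<in>F. cmod (\<Phi> f) \<le> K * onorm f)
          \<longrightarrow> (\<exists>x. \<forall>f\<in>F. \<Phi> f = f x))"

text \<open>The type \<^typ>\<open>'a\<close> itself is the algebra: it is a W*-algebra and \<open>\<phi>\<close> is a faithful normal
  tracial state on it.\<close>

definition tracial_wstar_prob_space :: "('a::cstar_algebra \<Rightarrow> complex) \<Rightarrow> bool" where
  "tracial_wstar_prob_space \<phi> \<longleftrightarrow>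
     (\<exists>F. is_predual F \<and> \<phi> \<in> F)
     \<and> \<phi> 1 = 1
     \<and> (\<forall>x. \<phi> (adj x * x) \<in> \<real>\<^sub>\<ge>\<^sub>0)
     \<and> (\<forall>x. \<phi> (adj x * x) = 0 \<longrightarrow> x = 0)
     \<and> (\<forall>x y. \<phi> (x * y) = \<phi> (y * x))"

definition projection_decomposition :: "nat \<Rightarrow> (nat \<Rightarrow> 'a::cstar_algebra) \<Rightarrow> bool" where
  "projection_decomposition d p \<longleftrightarrow>
     (\<forall>i\<in>{1..d}. p i \<noteq> 0 \<and> adj (p i) = p i \<and> p i * p i = p i)
     \<and> (\<forall>i\<in>{1..d}. \<forall>j\<in>{1..d}. i \<noteq> j \<longrightarrow> p i * p j = 0)
     \<and> (\<Sum>i=1..d. p i) = 1"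


section \<open>Rectangular structure and freeness with amalgamation\<close>

definition weight :: "('a::cstar_algebra \<Rightarrow> complex) \<Rightarrow> (nat \<Rightarrow> 'a) \<Rightarrow> nat \<Rightarrow> real" where
  "weight \<phi> p i = Re (\<phi> (p i))"

definition diag_algebra :: "nat \<Rightarrow> (nat \<Rightarrow> 'a::cstar_algebra) \<Rightarrow> 'a set" where
  "diag_algebra d p = range (\<lambda>z. \<Sum>i=1..d. z i *\<^sub>C p i)"

definition corner :: "(nat \<Rightarrow> 'a::cstar_algebra) \<Rightarrow> nat \<Rightarrow> nat \<Rightarrow> 'a set" where
  "corner p i j = range (\<lambda>x. p i * x * p j)"

definition has_type :: "(nat \<Rightarrow> 'a::cstar_algebra) \<Rightarrow> nat \<Rightarrow> nat \<Rightarrow> 'a \<Rightarrow> bool" where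
  "has_type p k l x \<longleftrightarrow> x \<in> corner p k l \<and> x \<noteq> 0"

text \<open>Only meaningful on \<^term>\<open>corner p i i\<close>.\<close>

definition corner_state ::
    "('a::cstar_algebra \<Rightarrow> complex) \<Rightarrow> (nat \<Rightarrow> 'a) \<Rightarrow> nat \<Rightarrow> 'a \<Rightarrow> complex" where
  "corner_state \<phi> p i x = \<phi> x / complex_of_real (weight \<phi> p i)"

definition cond_exp ::
    "('a::cstar_algebra \<Rightarrow> complex) \<Rightarrow> nat \<Rightarrow> (nat \<Rightarrow> 'a) \<Rightarrow> 'a \<Rightarrow> 'a" where
  "cond_exp \<phi> d p x = (\<Sum>i=1..d. corner_state \<phi> p i (p i * x * p i) *\<^sub>C p i)"

definition star_subalgebra :: "'a::cstar_algebra set \<Rightarrow> bool" where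
  "star_subalgebra B \<longleftrightarrow>
     0 \<in> B
     \<and> (\<forall>x\<in>B. \<forall>y\<in>B. x + y \<in> B \<and> x * y \<in> B)
     \<and> (\<forall>x\<in>B. adj x \<in> B \<and> (\<forall>z. z *\<^sub>C x \<in> B))"

text \<open>The factors \<open>x(1), \<dots>, x(m)\<close> are listed as \<open>xs\<close>, the indices of the subalgebras
  containing them as \<open>js\<close>; \<^const>\<open>distinct_adj\<close> says that consecutive entries differ.\<close>

definition free_subalgebras ::
    "('a::cstar_algebra \<Rightarrow> complex) \<Rightarrow> nat \<Rightarrow> (nat \<Rightarrow> 'a) \<Rightarrow> 'i set \<Rightarrow> ('i \<Rightarrow> 'a set) \<Rightarrow> bool" where
  "free_subalgebras \<phi> d p I B \<longleftrightarrow>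
     (\<forall>js xs. js \<noteq> [] \<and> set js \<subseteq> I \<and> distinct_adj js
        \<and> list_all2 (\<lambda>j x. x \<in> B j \<and> cond_exp \<phi> d p x = 0) js xs
        \<longrightarrow> cond_exp \<phi> d p (prod_list xs) = 0)"

definition free_elements ::
    "('a::cstar_algebra \<Rightarrow> complex) \<Rightarrow> nat \<Rightarrow> (nat \<Rightarrow> 'a) \<Rightarrow> 'i set \<Rightarrow> ('i \<Rightarrow> 'a) \<Rightarrow> bool" where
  "free_elements \<phi> d p I a \<longleftrightarrow>
     (\<exists>B. (\<forall>i\<in>I. star_subalgebra (B i) \<and> diag_algebra d p \<subseteq> B i \<and> a i \<in> B i)
        \<and> free_subalgebras \<phi> d p I B)"


section \<open>Distributions\<close>

text \<open>\<open>\<mu>\<close> is the distribution of the self-adjoint element \<open>x\<close> with respect to \<open>\<psi>\<close>: the compactly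
  supported (hence unique) probability measure with the same moments.\<close>

definition has_distribution ::
    "('a::cstar_algebra \<Rightarrow> complex) \<Rightarrow> 'a \<Rightarrow> real measure \<Rightarrow> bool" where
  "has_distribution \<psi> x \<mu> \<longleftrightarrow>
     prob_space \<mu> \<and> sets \<mu> = sets borel
     \<and> (\<exists>K. AE t in \<mu>. \<bar>t\<bar> \<le> K)
     \<and> (\<forall>m\<ge>1. \<psi> (x ^ m) = complex_of_real (\<integral>t. t ^ m \<partial>\<mu>))"

definition marchenko_pastur_density :: "real \<Rightarrow> real \<Rightarrow> real" where
  "marchenko_pastur_density \<gamma> x =
     (if x \<in> {(1 - sqrt \<gamma>)\<^sup>2..(1 + sqrt \<gamma>)\<^sup>2}
      then sqrt (4 * \<gamma> - (x - 1 - \<gamma>)\<^sup>2) / (2 * pi * x) else 0)"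

definition marchenko_pastur :: "real \<Rightarrow> real measure" where
  "marchenko_pastur \<gamma> = density lborel (\<lambda>x. ennreal (marchenko_pastur_density \<gamma> x))"


section \<open>Matricial microstates\<close>

definition block_size ::
    "('a::cstar_algebra \<Rightarrow> complex) \<Rightarrow> (nat \<Rightarrow> 'a) \<Rightarrow> nat \<Rightarrow> nat \<Rightarrow> nat" where
  "block_size \<phi> p n k = nat \<lfloor>weight \<phi> p k * real n\<rfloor>"

text \<open>Coordinates of matrices are numbered from \<open>0\<close>, the blocks from \<open>1\<close>.\<close>

definition block ::
    "('a::cstar_algebra \<Rightarrow> complex) \<Rightarrow> (nat \<Rightarrow> 'a) \<Rightarrow> nat \<Rightarrow> nat \<Rightarrow> nat set" where
  "block \<phi> p n k = {(\<Sum>j=1..<k. block_size \<phi> p n j)..<(\<Sum>j=1..k. block_size \<phi> p n j)}"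

definition block_proj ::
    "('a::cstar_algebra \<Rightarrow> complex) \<Rightarrow> (nat \<Rightarrow> 'a) \<Rightarrow> nat \<Rightarrow> nat \<Rightarrow> complex mat" where
  "block_proj \<phi> p n k = mat_diag n (\<lambda>i. if i \<in> block \<phi> p n k then 1 else 0)"

definition block_matrices ::
    "('a::cstar_algebra \<Rightarrow> complex) \<Rightarrow> (nat \<Rightarrow> 'a) \<Rightarrow> nat \<Rightarrow> nat \<Rightarrow> nat \<Rightarrow> complex mat set" where
  "block_matrices \<phi> p n k l =
     (\<lambda>M. block_proj \<phi> p n k * M * block_proj \<phi> p n l) ` carrier_mat n n"

definition mat_trace :: "complex mat \<Rightarrow> complex" where
  "mat_trace A = (\<Sum>i<dim_row A. A $$ (i, i))"

definition vec_l2_norm :: "complex vec \<Rightarrow> real" where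
  "vec_l2_norm v = sqrt (\<Sum>i<dim_vec v. (cmod (v $ i))\<^sup>2)"

definition mat_op_norm :: "complex mat \<Rightarrow> real" where
  "mat_op_norm A =
     (SUP v\<in>{v \<in> carrier_vec (dim_col A). vec_l2_norm v \<le> 1}. vec_l2_norm (A *\<^sub>v v))"

definition mat_cond_exp ::
    "('a::cstar_algebra \<Rightarrow> complex) \<Rightarrow> nat \<Rightarrow> (nat \<Rightarrow> 'a) \<Rightarrow> nat \<Rightarrow> complex mat \<Rightarrow> 'a" where
  "mat_cond_exp \<phi> d p n A =
     (\<Sum>k=1..d. (mat_trace (block_proj \<phi> p n k * A * block_proj \<phi> p n k)
                  / of_nat (block_size \<phi> p n k)) *\<^sub>C p k)"

text \<open>Lebesgue measure on \<^term>\<open>block_matrices \<phi> p n k l\<close> for the inner product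
  \<open>Re (Tr (M\<^sup>* N)) = (\<Sum>i j. Re (cnj (M i j) * N i j))\<close>: the entries in the block \<open>(k, l)\<close>
  identify this space isometrically with a power of the Euclidean plane of complex numbers.\<close>

definition block_lebesgue ::
    "('a::cstar_algebra \<Rightarrow> complex) \<Rightarrow> (nat \<Rightarrow> 'a) \<Rightarrow> nat \<Rightarrow> nat \<Rightarrow> nat \<Rightarrow> complex mat measure" where
  "block_lebesgue \<phi> p n k l =
     embed_measure (\<Pi>\<^sub>M ij\<in>block \<phi> p n k \<times> block \<phi> p n l. lborel)
       (\<lambda>M. mat n n (\<lambda>ij. if ij \<in> block \<phi> p n k \<times> block \<phi> p n l then M ij else 0))"

definition tuple_lebesgue ::
    "('a::cstar_algebra \<Rightarrow> complex) \<Rightarrow> (nat \<Rightarrow> 'a) \<Rightarrow> nat \<Rightarrow> nat \<Rightarrow> nat \<Rightarrow> nat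
      \<Rightarrow> (nat \<Rightarrow> complex mat) measure" where
  "tuple_lebesgue \<phi> p n k l N = (\<Pi>\<^sub>M i\<in>{1..N}. block_lebesgue \<phi> p n k l)"

text \<open>Words in letters and their adjoints: \<open>(i, True)\<close> stands for the adjoint of the \<open>i\<close>-th letter.\<close>

definition word_eval :: "(nat \<Rightarrow> 'a::cstar_algebra) \<Rightarrow> (nat \<times> bool) list \<Rightarrow> 'a" where
  "word_eval a w = prod_list (map (\<lambda>(i, s). if s then adj (a i) else a i) w)"

definition mat_word_eval ::
    "nat \<Rightarrow> (nat \<Rightarrow> complex mat) \<Rightarrow> (nat \<times> bool) list \<Rightarrow> complex mat" where
  "mat_word_eval n A w =
     foldr (*) (map (\<lambda>(i, s). if s then mat_adjoint (A i) else A i) w) (1\<^sub>m n)"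

definition microstates ::
    "('a::cstar_algebra \<Rightarrow> complex) \<Rightarrow> nat \<Rightarrow> (nat \<Rightarrow> 'a) \<Rightarrow> nat \<Rightarrow> nat \<Rightarrow> nat \<Rightarrow> (nat \<Rightarrow> 'a)
      \<Rightarrow> real \<Rightarrow> nat \<Rightarrow> nat \<Rightarrow> real \<Rightarrow> (nat \<Rightarrow> complex mat) set" where
  "microstates \<phi> d p k l N a R n r \<epsilon> =
     {A \<in> {1..N} \<rightarrow>\<^sub>E block_matrices \<phi> p n k l.
        (\<forall>i\<in>{1..N}. mat_op_norm (A i) \<le> R)
        \<and> (\<forall>w. 1 \<le> length w \<and> length w \<le> r \<and> fst ` set w \<subseteq> {1..N} \<longrightarrow>
             norm (mat_cond_exp \<phi> d p n (mat_word_eval n A w)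
                   - cond_exp \<phi> d p (word_eval a w)) \<le> \<epsilon>)}"


section \<open>Free entropy\<close>

definition log_ennreal :: "ennreal \<Rightarrow> ereal" where
  "log_ennreal x = (if x = 0 then -\<infinity> else if x = \<infinity> then \<infinity> else ereal (ln (enn2real x)))"

definition free_entropy ::
    "('a::cstar_algebra \<Rightarrow> complex) \<Rightarrow> nat \<Rightarrow> (nat \<Rightarrow> 'a) \<Rightarrow> nat \<Rightarrow> nat \<Rightarrow> nat \<Rightarrow> (nat \<Rightarrow> 'a)
      \<Rightarrow> ereal" where
  "free_entropy \<phi> d p k l N a =
     (SUP R\<in>{0::real<..}. INF (r, \<epsilon>)\<in>{1::nat..} \<times> {0::real<..}.
        limsup (\<lambda>n. ereal (1 / (real n)\<^sup>2)
                      * log_ennreal (emeasure (tuple_lebesgue \<phi> p n k l N)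
                                       (microstates \<phi> d p k l N a R n r \<epsilon>))
                    + ereal (real N * weight \<phi> p k * weight \<phi> p l * ln (real n))))"


section \<open>The variational problem\<close>

definition admissible_tuples ::
    "('a::cstar_algebra \<Rightarrow> complex) \<Rightarrow> (nat \<Rightarrow> 'a) \<Rightarrow> nat \<Rightarrow> nat \<Rightarrow> nat \<Rightarrow> (nat \<Rightarrow> real)
      \<Rightarrow> (nat \<Rightarrow> 'a) set" where
  "admissible_tuples \<phi> p k l N c =
     {a. \<forall>i\<in>{1..N}. has_type p k l (a i)
           \<and> corner_state \<phi> p k (a i * adj (a i)) = complex_of_real (c i)}"

definition free_marchenko_pastur ::
    "('a::cstar_algebra \<Rightarrow> complex) \<Rightarrow> nat \<Rightarrow> (nat \<Rightarrow> 'a) \<Rightarrow> nat \<Rightarrow> nat \<Rightarrow> nat \<Rightarrow> (nat \<Rightarrow> real)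
      \<Rightarrow> (nat \<Rightarrow> 'a) \<Rightarrow> bool" where
  "free_marchenko_pastur \<phi> d p k l N c a \<longleftrightarrow>
     free_elements \<phi> d p {1..N} a
     \<and> (\<forall>i\<in>{1..N}. has_distribution (corner_state \<phi> p k) (a i * adj (a i))
           (distr (marchenko_pastur (weight \<phi> p l / weight \<phi> p k)) borel
              (\<lambda>t. c i * weight \<phi> p k / weight \<phi> p l * t)))"

end

theory Submission
  imports Defs
begin

text \<open>Let \<open>b\<close> be the free Marchenko-Pastur family, and let \<open>\<gamma>\<close> be the law of \<open>N\<close> independent Gaussian block matrices
  whose entries have variance \<open>c i / q\<^sub>l(n)\<close>. The density of \<open>\<gamma>\<close> is \<open>exp (- Q) / Z\<close> with \<open>Q(A) = \<Sum>i. q\<^sub>l(n) / c i * Tr (A\<^sub>i A\<^sub>i\<^sup>*)\<close>,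
  and \<open>Q\<close> equals \<open>N q\<^sub>k(n) q\<^sub>l(n)\<close> up to \<open>O(\<epsilon> n\<^sup>2)\<close> on the microstates of every admissible tuple; so at the scale \<open>n\<^sup>2\<close>
  the free entropies of admissible tuples compare the \<open>\<gamma>\<close>-measures of their microstates. The loop equations of \<open>\<gamma>\<close>
  converge to the Schwinger-Dyson equations of \<open>b\<close>; together with Chebyshev's inequality and a net argument for the
  operator norm, the microstates of \<open>b\<close> have \<open>\<gamma>\<close>-measure at least \<open>1 / 2\<close> for one fixed norm bound.
  If a moment of \<open>a\<close> differs from that of \<open>b\<close>, the microstates of \<open>a\<close> and \<open>b\<close> are separated by \<open>\<delta> n\<^sup>2\<close> in the
  metric of \<open>Q\<close>, and by the Prekopa-Leindler inequality the product of their \<open>\<gamma>\<close>-measures is at most \<open>exp (- \<delta> n\<^sup>2 / 2)\<close>,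
  whence \<open>\<chi>(a) < \<chi>(b)\<close>. A maximiser thus has the moments of \<open>b\<close>, and these determine both freeness over
  \<open>\<D>\<close> and the distributions.\<close>

section \<open>Prekopa-Leindler inequality\<close>

lemma emeasure_lborel_approx_left:
  fixes A :: "real set"
  assumes A: "A \<in> sets borel" and ne: "A \<noteq> {}" and M: "M < emeasure lborel A"
  shows "\<exists>a\<in>A. M < emeasure lborel (A \<inter> {..a})"
proof (cases "\<exists>a\<in>A. \<forall>x\<in>A. x \<le> a")
  case True
  then obtain a where a: "a \<in> A" "\<forall>x\<in>A. x \<le> a" by blast
  then have "A \<inter> {..a} = A" by auto
  with a M show ?thesis by (metis (lifting))
next
  case False
  then have nomax: "\<And>a. a \<in> A \<Longrightarrow> \<exists>x\<in>A. a < x" by (meson not_le)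
  obtain s :: "nat \<Rightarrow> real" where s: "incseq s" "\<And>n. \<exists>a\<in>A. s n \<le> a" "\<And>x. x \<in> A \<Longrightarrow> \<exists>n. x \<le> s n"
  proof (cases "bdd_above A")
    case bdd: True
    define S where "S = Sup A"
    have letter_of: "x < S" if xA: "x \<in> A" for x
    proof -
      obtain y where "y \<in> A" "x < y" using nomax[OF xA] by blast
      then show ?thesis using cSup_upper[of y A] bdd unfolding S_def by linarith
    qed
    have ex: "\<exists>a\<in>A. y < a" if "y < S" for y
      using that less_cSup_iff[OF ne bdd] unfolding S_def by auto
    show ?thesis
    proof (rule that[of "\<lambda>n. S - 1 / real (Suc n)"])
      show "incseq (\<lambda>n. S - 1 / real (Suc n))"
        by (intro monoI) (simp add: frac_le)
      show "\<exists>a\<in>A. S - 1 / real (Suc n) \<le> a" for n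
      proof -
        obtain a where "a \<in> A" "S - 1 / real (Suc n) < a" using ex[of "S - 1 / real (Suc n)"] by auto
        then show ?thesis by (intro bexI[of _ a] less_imp_le)
      qed
      fix x assume "x \<in> A"
      then have "0 < S - x" using letter_of by simp
      then obtain n where "1 / real (Suc n) < S - x" using reals_Archimedean[of "S - x"]
        by (auto simp: inverse_eq_divide)
      then show "\<exists>n. x \<le> S - 1 / real (Suc n)" by (intro exI[of _ n]) auto
    qed
  next
    case False
    show ?thesis
    proof (rule that[of real])
      show "incseq real" by (auto simp: incseq_def)
      show "\<exists>a\<in>A. real n \<le> a" for n using False unfolding bdd_above_def by (meson linear)
      show "\<exists>n. x \<le> real n" for x by (rule real_arch_simple)
    qed
  qed
  have un: "(\<Union>n. A \<inter> {..s n}) = A" using s(3) by auto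
  have "(SUP n. emeasure lborel (A \<inter> {..s n})) = emeasure lborel (\<Union>n. A \<inter> {..s n})"
    by (rule SUP_emeasure_incseq) (use A s(1) in \<open>auto simp: incseq_def le_fun_def dest: order_trans\<close>)
  with M un have "M < (SUP n. emeasure lborel (A \<inter> {..s n}))" by simp
  then obtain n where n: "M < emeasure lborel (A \<inter> {..s n})" by (auto simp: less_SUP_iff)
  obtain a where a: "a \<in> A" "s n \<le> a" using s(2) by blast
  have "emeasure lborel (A \<inter> {..s n}) \<le> emeasure lborel (A \<inter> {..a})"
    by (rule emeasure_mono) (use a A in auto)
  with n a show ?thesis by (meson less_le_trans)
qed

lemma emeasure_lborel_uminus:
  fixes A :: "real set"
  assumes "A \<in> sets borel"
  shows "emeasure lborel (uminus -` A) = emeasure lborel A"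
proof -
  have "lborel = distr lborel borel (uminus :: real \<Rightarrow> real)"
    using lborel_real_affine[of "-1" 0] by (simp add: density_1 one_ennreal_def[symmetric])
  then have "emeasure lborel A = emeasure (distr lborel borel (uminus :: real \<Rightarrow> real)) A" by simp
  also have "\<dots> = emeasure lborel (uminus -` A)"
    using assms by (subst emeasure_distr) auto
  finally show ?thesis by simp
qed

lemma emeasure_lborel_approx_right:
  fixes A :: "real set"
  assumes A: "A \<in> sets borel" and ne: "A \<noteq> {}" and M: "M < emeasure lborel A"
  shows "\<exists>a\<in>A. M < emeasure lborel (A \<inter> {a..})"
proof -
  have m: "uminus -` A \<in> sets borel"
    using measurable_sets[of "uminus :: real \<Rightarrow> real" borel borel A] A by simp
  have ne': "uminus -` A \<noteq> {}" using ne by (metis ex_in_conv minus_minus vimage_eq)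
  obtain a where a: "a \<in> uminus -` A" "M < emeasure lborel (uminus -` A \<inter> {..a})"
    using emeasure_lborel_approx_left[OF m ne', of M] M emeasure_lborel_uminus[OF A] by auto
  have "uminus -` A \<inter> {..a} = uminus -` (A \<inter> {-a..})" by auto
  with a(2) emeasure_lborel_uminus[of "A \<inter> {-a..}"] A have "M < emeasure lborel (A \<inter> {-a..})" by simp
  with a(1) show ?thesis by (intro bexI[of _ "-a"]) auto
qed

lemma emeasure_lborel_affine:
  fixes A :: "real set"
  assumes A: "A \<in> sets borel" and t: "t > 0"
  shows "emeasure lborel A = ennreal t * emeasure lborel ((\<lambda>x. b + t * x) -` A)"
proof -
  have m: "(\<lambda>x. b + t * x) -` A \<in> sets borel"
    using A by (intro measurable_sets_borel[of "\<lambda>x. b + t * x" borel A]) auto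
  have "emeasure lborel A = (\<integral>\<^sup>+x. indicator A x \<partial>lborel)" using A by simp
  also have "\<dots> = ennreal t * (\<integral>\<^sup>+x. indicator A (b + t * x) \<partial>lborel)"
    using t A by (subst nn_integral_real_affine[of _ t b]) auto
  also have "(\<lambda>x. indicator A (b + t * x)) = (\<lambda>x. indicator ((\<lambda>x. b + t * x) -` A) x :: ennreal)"
    by (auto simp: indicator_def fun_eq_iff)
  finally show ?thesis using m by simp
qed

text \<open>The translates \<open>a + (B \<inter> {b..})\<close> and \<open>b + (A \<inter> {..a})\<close> meet in one point only.\<close>

lemma brunn_minkowski_real:
  fixes A B C :: "real set"
  assumes A: "A \<in> sets borel" "A \<noteq> {}" and B: "B \<in> sets borel" "B \<noteq> {}" and C: "C \<in> sets borel"
    and sub: "\<And>x y. x \<in> A \<Longrightarrow> y \<in> B \<Longrightarrow> (x + y) / 2 \<in> C"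
  shows "emeasure lborel A + emeasure lborel B \<le> 2 * emeasure lborel C"
proof -
  have main: "M1 + M2 \<le> 2 * emeasure lborel C"
    if M: "M1 < emeasure lborel A" "M2 < emeasure lborel B" for M1 M2
  proof -
    obtain a where a: "a \<in> A" "M1 < emeasure lborel (A \<inter> {..a})"
      using emeasure_lborel_approx_left[OF A M(1)] by blast
    obtain b where b: "b \<in> B" "M2 < emeasure lborel (B \<inter> {b..})"
      using emeasure_lborel_approx_right[OF B M(2)] by blast
    define X where "X = (\<lambda>x. - b + 2 * x) -` (A \<inter> {..a})"
    define Y where "Y = (\<lambda>x. - a + 2 * x) -` (B \<inter> {b..})"
    have mX: "X \<in> sets borel" unfolding X_def using A
      by (intro measurable_sets_borel[of _ borel]) (auto intro!: borel_measurable_continuous_onI continuous_intros)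
    have mY: "Y \<in> sets borel" unfolding Y_def using B
      by (intro measurable_sets_borel[of _ borel]) (auto intro!: borel_measurable_continuous_onI continuous_intros)
    have eX: "2 * emeasure lborel X = emeasure lborel (A \<inter> {..a})"
      unfolding X_def using emeasure_lborel_affine[of "A \<inter> {..a}" 2 "- b"] A by simp
    have eY: "2 * emeasure lborel Y = emeasure lborel (B \<inter> {b..})"
      unfolding Y_def using emeasure_lborel_affine[of "B \<inter> {b..}" 2 "- a"] B by simp
    have XC: "X \<subseteq> C"
    proof
      fix x assume "x \<in> X"
      then have "2 * x - b \<in> A" by (auto simp: X_def)
      from sub[OF this b(1)] show "x \<in> C" by simp
    qed
    have YC: "Y \<subseteq> C"
    proof
      fix x assume "x \<in> Y"
      then have "2 * x - a \<in> B" by (auto simp: Y_def)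
      from sub[OF a(1) this] show "x \<in> C" by simp
    qed
    have "Y = (Y - {(a + b)/2}) \<union> (Y \<inter> {(a + b)/2})" by auto
    have "emeasure lborel Y = emeasure lborel (Y - {(a + b)/2})"
      using mY by (subst emeasure_Diff_null_set) (auto intro: finite_imp_null_set_lborel)
    moreover have "X \<inter> (Y - {(a+b)/2}) = {}"
      by (auto simp: X_def Y_def field_simps)
    then have "emeasure lborel X + emeasure lborel (Y - {(a+b)/2}) = emeasure lborel (X \<union> (Y - {(a+b)/2}))"
      using mX mY by (intro plus_emeasure) auto
    moreover have "\<dots> \<le> emeasure lborel C" using XC YC C by (intro emeasure_mono) auto
    ultimately have "emeasure lborel X + emeasure lborel Y \<le> emeasure lborel C" by simp
    then have "2 * (emeasure lborel X + emeasure lborel Y) \<le> 2 * emeasure lborel C" by (rule mult_left_mono) simp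
    then have "emeasure lborel (A \<inter> {..a}) + emeasure lborel (B \<inter> {b..}) \<le> 2 * emeasure lborel C"
      by (simp add: distrib_left eX eY)
    moreover have "M1 + M2 \<le> emeasure lborel (A \<inter> {..a}) + emeasure lborel (B \<inter> {b..})"
      using a(2) b(2) by (intro add_mono) auto
    ultimately show ?thesis by (rule order_trans[rotated])
  qed
  have one: "emeasure lborel A \<le> 2 * emeasure lborel C"
  proof -
    obtain b where b: "b \<in> B" using B by blast
    define X where "X = (\<lambda>x. - b + 2 * x) -` A"
    have eX: "2 * emeasure lborel X = emeasure lborel A"
      unfolding X_def using emeasure_lborel_affine[of "A" 2 "- b"] A by simp
    have "X \<subseteq> C"
    proof
      fix x assume "x \<in> X"
      then have "2 * x - b \<in> A" by (auto simp: X_def)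
      from sub[OF this b] show "x \<in> C" by simp
    qed
    then have "emeasure lborel X \<le> emeasure lborel C" using C by (intro emeasure_mono) auto
    then show ?thesis unfolding eX[symmetric] by (rule mult_left_mono) simp
  qed
  have two: "emeasure lborel B \<le> 2 * emeasure lborel C"
  proof -
    obtain a where a: "a \<in> A" using A by blast
    define Y where "Y = (\<lambda>x. - a + 2 * x) -` B"
    have eY: "2 * emeasure lborel Y = emeasure lborel B"
      unfolding Y_def using emeasure_lborel_affine[of "B" 2 "- a"] B by simp
    have "Y \<subseteq> C"
    proof
      fix x assume "x \<in> Y"
      then have "2 * x - a \<in> B" by (auto simp: Y_def)
      from sub[OF a this] show "x \<in> C" by simp
    qed
    then have "emeasure lborel Y \<le> emeasure lborel C" using C by (intro emeasure_mono) auto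
    then show ?thesis unfolding eY[symmetric] by (rule mult_left_mono) simp
  qed
  show ?thesis
  proof (cases "emeasure lborel A = 0 \<or> emeasure lborel B = 0")
    case True then show ?thesis using one two by auto
  next
    case False
    have "0 \<in> {..<emeasure lborel A}" "0 \<in> {..<emeasure lborel B}"
      using False by (simp_all add: zero_less_iff_neq_zero)
    then have neA: "{..<emeasure lborel A} \<noteq> {}" and neB: "{..<emeasure lborel B} \<noteq> {}" by blast+
    have *: "emeasure lborel A + M2 \<le> 2 * emeasure lborel C" if "M2 < emeasure lborel B" for M2
    proof -
      have "(SUP M1\<in>{..<emeasure lborel A}. M1 + M2) \<le> 2 * emeasure lborel C"
        using main that by (intro SUP_least) auto
      also have "(SUP M1\<in>{..<emeasure lborel A}. M1 + M2) = (SUP M1\<in>{..<emeasure lborel A}. M1) + M2"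
        using neA by (rule ennreal_SUP_add_left)
      also have "(SUP M1\<in>{..<emeasure lborel A}. M1) = emeasure lborel A"
        using Sup_lessThan[of "emeasure lborel A"] by simp
      finally show ?thesis .
    qed
    have "(SUP M2\<in>{..<emeasure lborel B}. emeasure lborel A + M2) \<le> 2 * emeasure lborel C"
      using * by (intro SUP_least) auto
    also have "(SUP M2\<in>{..<emeasure lborel B}. emeasure lborel A + M2) = emeasure lborel A + (SUP M2\<in>{..<emeasure lborel B}. M2)"
      using neB by (rule ennreal_SUP_add_right[symmetric])
    also have "(SUP M2\<in>{..<emeasure lborel B}. M2) = emeasure lborel B"
      using Sup_lessThan[of "emeasure lborel B"] by simp
    finally show ?thesis .
  qed
qed

lemma nn_integral_min_layer_cake:
  fixes u :: "real \<Rightarrow> ennreal"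
  assumes [measurable]: "u \<in> borel_measurable borel" and c: "c > 0"
  shows "(\<integral>\<^sup>+x. min (u x) (ennreal c) \<partial>lborel) =
    ennreal c * (\<integral>\<^sup>+t. emeasure lborel {x. ennreal (c * t) < u x} * indicator {0<..<1} t \<partial>lborel)"
proof -
  let ?\<chi> = "\<lambda>(x, t). indicator {p. ennreal (c * snd p) < u (fst p)} (x, t) * indicator {0<..<1::real} t :: ennreal"
  have m: "?\<chi> \<in> borel_measurable (lborel \<Otimes>\<^sub>M lborel)"
    by measurable
  have pt: "min (u x) (ennreal c) = ennreal c * (\<integral>\<^sup>+t. ?\<chi> (x, t) \<partial>lborel)" for x
  proof -
    define v where "v = enn2real (min (u x) (ennreal c))"
    have "min (u x) (ennreal c) < \<top>" by (rule le_less_trans[of _ "ennreal c"]) auto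
    then have v: "min (u x) (ennreal c) = ennreal v" "0 \<le> v" by (simp_all add: v_def)
    have "ennreal v \<le> ennreal c" unfolding v(1)[symmetric] by simp
    then have "v \<le> c" using c by simp
    note v = v this
    have *: "ennreal (c * t) < u x \<longleftrightarrow> t < v / c" if "0 < t" "t < 1" for t
    proof -
      have "ennreal (c * t) < ennreal c" using that c by (simp add: ennreal_lessI)
      then have "ennreal (c * t) < u x \<longleftrightarrow> ennreal (c * t) < ennreal v"
        unfolding v(1)[symmetric] by simp
      also have "\<dots> \<longleftrightarrow> t < v / c" using that c v by (simp add: ennreal_less_iff field_simps)
      finally show ?thesis .
    qed
    have "?\<chi> (x, t) = indicator {0<..<v/c} t" for t
    proof -
      have "v / c \<le> 1" using c v by simp
      with * show ?thesis by (auto simp: indicator_def)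
    qed
    then have "(\<integral>\<^sup>+t. ?\<chi> (x, t) \<partial>lborel) = ennreal (v / c)"
      using c v by simp
    then show ?thesis using v c by (simp add: ennreal_mult[symmetric])
  qed
  have "(\<integral>\<^sup>+x. min (u x) (ennreal c) \<partial>lborel) = ennreal c * (\<integral>\<^sup>+x. (\<integral>\<^sup>+t. ?\<chi> (x, t) \<partial>lborel) \<partial>lborel)"
    unfolding pt by (rule nn_integral_cmult) measurable
  also have "(\<integral>\<^sup>+x. (\<integral>\<^sup>+t. ?\<chi> (x, t) \<partial>lborel) \<partial>lborel) = (\<integral>\<^sup>+t. (\<integral>\<^sup>+x. ?\<chi> (x, t) \<partial>lborel) \<partial>lborel)"
    using lborel_pair.Fubini'[OF m] by simp
  also have "(\<lambda>t. \<integral>\<^sup>+x. ?\<chi> (x, t) \<partial>lborel) = (\<lambda>t. emeasure lborel {x. ennreal (c * t) < u x} * indicator {0<..<1} t)"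
  proof
    fix t :: real
    have "(\<integral>\<^sup>+x. ?\<chi> (x, t) \<partial>lborel) = (\<integral>\<^sup>+x. indicator {x. ennreal (c * t) < u x} x * indicator {0<..<1} t \<partial>lborel)"
      by (intro nn_integral_cong) (auto simp: indicator_def)
    also have "\<dots> = emeasure lborel {x. ennreal (c * t) < u x} * indicator {0<..<1} t"
      by (subst nn_integral_multc) auto
    finally show "(\<integral>\<^sup>+x. ?\<chi> (x, t) \<partial>lborel) = \<dots>" .
  qed
  finally show ?thesis .
qed

lemma four_mult_le_square_ennreal: "4 * (x * y) \<le> (x + y :: ennreal)\<^sup>2"
proof (cases "x = \<top> \<or> y = \<top>")
  case True
  then show ?thesis by (auto simp: power2_eq_square ennreal_mult_eq_top_iff top_unique)
next
  case False
  then obtain a b where ab: "x = ennreal a" "a \<ge> 0" "y = ennreal b" "b \<ge> 0"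
    by (metis ennreal_cases)
  have "4 * (a * b) \<le> (a + b)\<^sup>2" using sum_squares_bound[of a b] by (simp add: power2_eq_square algebra_simps)
  then show ?thesis using ab
    by (simp add: ennreal_mult[symmetric] ennreal_plus[symmetric] ennreal_power ennreal_numeral[symmetric] del: ennreal_plus ennreal_numeral)
qed

text \<open>The Prekopa-Leindler inequality for the midpoint map \<open>m\<close>, with squares in place of square roots, which
  \<^typ>\<open>ennreal\<close> lacks.\<close>

definition prekopa :: "'a measure \<Rightarrow> ('a \<Rightarrow> 'a \<Rightarrow> 'a) \<Rightarrow> bool" where
  "prekopa M m \<longleftrightarrow> (\<forall>f g h :: 'a \<Rightarrow> ennreal. f \<in> borel_measurable M \<longrightarrow> g \<in> borel_measurable M
     \<longrightarrow> h \<in> borel_measurable M \<longrightarrow> (\<forall>x\<in>space M. \<forall>y\<in>space M. f x * g y \<le> (h (m x y))\<^sup>2)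
     \<longrightarrow> (\<integral>\<^sup>+x. f x \<partial>M) * (\<integral>\<^sup>+x. g x \<partial>M) \<le> (\<integral>\<^sup>+x. h x \<partial>M)\<^sup>2)"

lemma prekopa_real_bounded:
  fixes f g h :: "real \<Rightarrow> ennreal"
  assumes [measurable]: "f \<in> borel_measurable borel" "g \<in> borel_measurable borel" "h \<in> borel_measurable borel"
    and le: "\<And>x y. f x * g y \<le> (h ((x + y) / 2))\<^sup>2"
    and bd: "\<And>x. f x \<le> of_nat B" "\<And>x. g x \<le> of_nat B"
  shows "(\<integral>\<^sup>+x. f x \<partial>lborel) * (\<integral>\<^sup>+x. g x \<partial>lborel) \<le> (\<integral>\<^sup>+x. h x \<partial>lborel)\<^sup>2"
proof (cases "(\<forall>x. f x = 0) \<or> (\<forall>x. g x = 0)")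
  case True then show ?thesis by auto
next
  case False
  then obtain x0 y0 where xy0: "f x0 > 0" "g y0 > 0" by (auto simp: zero_less_iff_neq_zero)
  define F where "F = enn2real (SUP x. f x)"
  define G where "G = enn2real (SUP x. g x)"
  have "(SUP x. f x) \<le> of_nat B" using bd by (auto intro: SUP_least)
  moreover have "(SUP x. f x) > 0" using xy0 by (metis less_SUP_iff UNIV_I)
  ultimately have F: "(SUP x. f x) = ennreal F" "F > 0"
    by (auto simp: F_def enn2real_positive_iff less_top[symmetric] top_unique ennreal_of_nat_eq_real_of_nat
       dest: order_le_less_trans[OF _ ennreal_less_top])
  have "(SUP x. g x) \<le> of_nat B" using bd by (auto intro: SUP_least)
  moreover have "(SUP x. g x) > 0" using xy0 by (metis less_SUP_iff UNIV_I)
  ultimately have G: "(SUP x. g x) = ennreal G" "G > 0"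
    by (auto simp: G_def enn2real_positive_iff less_top[symmetric] top_unique ennreal_of_nat_eq_real_of_nat
       dest: order_le_less_trans[OF _ ennreal_less_top])
  have fF: "min (f x) (ennreal F) = f x" "min (g x) (ennreal G) = g x" for x
    unfolding F(1)[symmetric] G(1)[symmetric] by (auto intro!: min_absorb1 SUP_upper)
  define c where "c = sqrt (F * G)"
  have c: "c > 0" "c * c = F * G" using F G by (auto simp: c_def)
  have cFG: "(ennreal c)\<^sup>2 = ennreal F * ennreal G"
    using c F G by (simp add: power2_eq_square ennreal_mult[symmetric])
  let ?a = "\<lambda>t. emeasure lborel {x. ennreal (F * t) < f x} * indicator {0<..<1} t"
  let ?b = "\<lambda>t. emeasure lborel {x. ennreal (G * t) < g x} * indicator {0<..<1} t"
  let ?h = "\<lambda>t. emeasure lborel {x. ennreal (c * t) < h x} * indicator {0<..<1} t"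
  have msr [measurable]: "(\<lambda>t. emeasure lborel {x. ennreal (C * t) < u x}) \<in> borel_measurable borel"
    if "u \<in> borel_measurable borel" for C u
  proof -
    note that[measurable]
    have "(\<lambda>t. emeasure lborel (Pair t -` {p \<in> space (lborel \<Otimes>\<^sub>M lborel). ennreal (C * fst p) < u (snd p)})) \<in> borel_measurable lborel"
      by (rule lborel.measurable_emeasure_Pair) measurable
    then show ?thesis by (simp add: vimage_def space_pair_measure)
  qed
  have fe: "(\<integral>\<^sup>+x. f x \<partial>lborel) = ennreal F * (\<integral>\<^sup>+t. ?a t \<partial>lborel)"
    using nn_integral_min_layer_cake[of f F] F by (simp add: fF)
  have ge: "(\<integral>\<^sup>+x. g x \<partial>lborel) = ennreal G * (\<integral>\<^sup>+t. ?b t \<partial>lborel)"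
    using nn_integral_min_layer_cake[of g G] G by (simp add: fF)
  have pt: "?a t + ?b t \<le> 2 * ?h t" for t
  proof (cases "t \<in> {0<..<1}")
    case True
    have "ennreal (F * t) < (SUP x. f x)" unfolding F using True F by (intro ennreal_lessI) auto
    then have ne1: "{x. ennreal (F * t) < f x} \<noteq> {}" by (auto simp: less_SUP_iff)
    have "ennreal (G * t) < (SUP x. g x)" unfolding G using True G by (intro ennreal_lessI) auto
    then have ne2: "{x. ennreal (G * t) < g x} \<noteq> {}" by (auto simp: less_SUP_iff)
    have "ennreal (c * t) < h ((x + y) / 2)" if "ennreal (F * t) < f x" "ennreal (G * t) < g y" for x y
    proof (rule ccontr)
      assume "\<not> ?thesis"
      then have "(h ((x + y) / 2))\<^sup>2 \<le> (ennreal (c * t))\<^sup>2" by (intro power_mono) auto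
      also have "\<dots> = (ennreal c)\<^sup>2 * (ennreal t)\<^sup>2"
        using c True by (simp add: ennreal_mult power_mult_distrib)
      also have "\<dots> = ennreal (F * t) * ennreal (G * t)"
        unfolding cFG using F G True by (simp add: ennreal_mult power2_eq_square mult_ac)
      also have "\<dots> < f x * g y"
      proof -
        obtain f' where f': "f x = ennreal f'" "f' \<ge> 0"
          using bd(1)[of x] by (cases "f x") (auto simp: top_unique)
        obtain g' where g': "g y = ennreal g'" "g' \<ge> 0"
          using bd(2)[of y] by (cases "g y") (auto simp: top_unique)
        have "(F * t) * (G * t) < f' * g'"
          using that f' g' F G True
          by (intro mult_strict_mono) (auto simp: ennreal_less_iff intro: le_less_trans[of 0 "F * t"])
        then show ?thesis using f' g' F G True
          by (simp add: ennreal_mult[symmetric] ennreal_less_iff)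
      qed
      finally show False using le[of x y] by auto
    qed
    then have "emeasure lborel {x. ennreal (F * t) < f x} + emeasure lborel {x. ennreal (G * t) < g x}
       \<le> 2 * emeasure lborel {x. ennreal (c * t) < h x}"
      using ne1 ne2 by (intro brunn_minkowski_real) auto
    then show ?thesis using True by simp
  qed auto
  have "(\<integral>\<^sup>+t. ?a t \<partial>lborel) + (\<integral>\<^sup>+t. ?b t \<partial>lborel) = (\<integral>\<^sup>+t. ?a t + ?b t \<partial>lborel)"
    by (rule nn_integral_add[symmetric]) measurable
  also have "\<dots> \<le> (\<integral>\<^sup>+t. 2 * ?h t \<partial>lborel)" by (intro nn_integral_mono pt)
  also have "\<dots> = 2 * (\<integral>\<^sup>+t. ?h t \<partial>lborel)" by (rule nn_integral_cmult) measurable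
  finally have ab: "(\<integral>\<^sup>+t. ?a t \<partial>lborel) + (\<integral>\<^sup>+t. ?b t \<partial>lborel) \<le> 2 * (\<integral>\<^sup>+t. ?h t \<partial>lborel)" .
  have hh: "ennreal c * (\<integral>\<^sup>+t. ?h t \<partial>lborel) \<le> (\<integral>\<^sup>+x. h x \<partial>lborel)"
    unfolding nn_integral_min_layer_cake[OF assms(3) c(1), symmetric] by (intro nn_integral_mono) auto
  have "4 * ((\<integral>\<^sup>+x. f x \<partial>lborel) * (\<integral>\<^sup>+x. g x \<partial>lborel))
     = (ennreal c)\<^sup>2 * (4 * ((\<integral>\<^sup>+t. ?a t \<partial>lborel) * (\<integral>\<^sup>+t. ?b t \<partial>lborel)))"
    unfolding fe ge cFG by (simp only: mult_ac)
  also have "\<dots> \<le> (ennreal c)\<^sup>2 * ((\<integral>\<^sup>+t. ?a t \<partial>lborel) + (\<integral>\<^sup>+t. ?b t \<partial>lborel))\<^sup>2"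
    by (intro mult_left_mono four_mult_le_square_ennreal) simp
  also have "\<dots> \<le> (ennreal c)\<^sup>2 * (2 * (\<integral>\<^sup>+t. ?h t \<partial>lborel))\<^sup>2"
    by (intro mult_left_mono power_mono ab) auto
  also have "\<dots> = 4 * (ennreal c * (\<integral>\<^sup>+t. ?h t \<partial>lborel))\<^sup>2"
    by (simp add: power_mult_distrib mult_ac)
  also have "\<dots> \<le> 4 * (\<integral>\<^sup>+x. h x \<partial>lborel)\<^sup>2"
    by (intro mult_left_mono power_mono hh) auto
  finally have "4 * ((\<integral>\<^sup>+x. f x \<partial>lborel) * (\<integral>\<^sup>+x. g x \<partial>lborel)) \<le> 4 * (\<integral>\<^sup>+x. h x \<partial>lborel)\<^sup>2" .
  moreover have "(4::ennreal) \<noteq> 0" "(4::ennreal) \<noteq> \<top>" by simp_all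
  ultimately show ?thesis using ennreal_mult_le_mult_iff by blast
qed

lemma prekopa_real: "prekopa lborel (\<lambda>x y. (x + y) / 2 :: real)"
  unfolding prekopa_def
proof (intro allI impI)
  fix f g h :: "real \<Rightarrow> ennreal"
  assume m: "f \<in> borel_measurable lborel" "g \<in> borel_measurable lborel" "h \<in> borel_measurable lborel"
    and le: "\<forall>x\<in>space lborel. \<forall>y\<in>space lborel. f x * g y \<le> (h ((x + y) / 2))\<^sup>2"
  have m'[measurable]: "f \<in> borel_measurable borel" "g \<in> borel_measurable borel" "h \<in> borel_measurable borel"
    using m by simp_all
  let ?t = "\<lambda>u n x. min (u x) (of_nat n :: ennreal)"
  have sup: "(\<integral>\<^sup>+x. u x \<partial>lborel) = (SUP n. \<integral>\<^sup>+x. ?t u n x \<partial>lborel)"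
    if "u \<in> borel_measurable borel" for u :: "real \<Rightarrow> ennreal"
  proof -
    note that[measurable]
    have "(SUP n. ?t u n x) = u x" for x
    proof -
      have "(SUP n. ?t u n x) = min (u x) (SUP n. of_nat n)"
        unfolding inf_min[symmetric] by (rule inf_SUP[symmetric])
      then show ?thesis by (simp add: ennreal_SUP_of_nat_eq_top)
    qed
    then have "(\<integral>\<^sup>+x. u x \<partial>lborel) = (\<integral>\<^sup>+x. (SUP n. ?t u n x) \<partial>lborel)" by simp
    also have "\<dots> = (SUP n. \<integral>\<^sup>+x. ?t u n x \<partial>lborel)"
      by (rule nn_integral_monotone_convergence_SUP)
        (auto intro!: monoI le_funI min.mono)
    finally show ?thesis .
  qed
  have "(\<integral>\<^sup>+x. ?t f n x \<partial>lborel) * (\<integral>\<^sup>+x. ?t g k x \<partial>lborel) \<le> (\<integral>\<^sup>+x. h x \<partial>lborel)\<^sup>2" for n k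
  proof (rule prekopa_real_bounded[where B = "max n k"])
    fix x y
    have "?t f n x * ?t g k y \<le> f x * g y" by (intro mult_mono) simp_all
    also have "\<dots> \<le> (h ((x + y) / 2))\<^sup>2" using le by simp
    finally show "?t f n x * ?t g k y \<le> (h ((x + y) / 2))\<^sup>2" .
  next
    fix x
    have "(of_nat n :: ennreal) \<le> of_nat (max n k)" by (rule of_nat_mono) simp
    then show "?t f n x \<le> of_nat (max n k)" by (rule min.coboundedI2)
    have "(of_nat k :: ennreal) \<le> of_nat (max n k)" by (rule of_nat_mono) simp
    then show "?t g k x \<le> of_nat (max n k)" by (rule min.coboundedI2)
  qed measurable
  then have le2: "(\<integral>\<^sup>+x. ?t f n x \<partial>lborel) * (SUP k. \<integral>\<^sup>+x. ?t g k x \<partial>lborel) \<le> (\<integral>\<^sup>+x. h x \<partial>lborel)\<^sup>2" for n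
    by (subst SUP_mult_left_ennreal) (rule SUP_least)
  have "(SUP n. \<integral>\<^sup>+x. ?t f n x \<partial>lborel) * (SUP k. \<integral>\<^sup>+x. ?t g k x \<partial>lborel) \<le> (\<integral>\<^sup>+x. h x \<partial>lborel)\<^sup>2"
    by (subst SUP_mult_right_ennreal) (rule SUP_least, rule le2)
  then show "(\<integral>\<^sup>+x. f x \<partial>lborel) * (\<integral>\<^sup>+x. g x \<partial>lborel) \<le> (\<integral>\<^sup>+x. h x \<partial>lborel)\<^sup>2"
    by (simp only: sup[OF m'(1)] sup[OF m'(2)])
qed

lemma prekopa_distr:
  assumes M: "prekopa M m" and [measurable]: "T \<in> measurable M N"
    and T: "\<And>x y. x \<in> space M \<Longrightarrow> y \<in> space M \<Longrightarrow> T (m x y) = m' (T x) (T y)"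
  shows "prekopa (distr M N T) m'"
  unfolding prekopa_def
proof (intro allI impI)
  fix f g h :: "_ \<Rightarrow> ennreal"
  assume m: "f \<in> borel_measurable (distr M N T)" "g \<in> borel_measurable (distr M N T)" "h \<in> borel_measurable (distr M N T)"
    and le: "\<forall>x\<in>space (distr M N T). \<forall>y\<in>space (distr M N T). f x * g y \<le> (h (m' x y))\<^sup>2"
  have m'[measurable]: "f \<in> borel_measurable N" "g \<in> borel_measurable N" "h \<in> borel_measurable N"
    using m by simp_all
  have "f (T x) * g (T y) \<le> (h (T (m x y)))\<^sup>2" if "x \<in> space M" "y \<in> space M" for x y
    using le that measurable_space[OF assms(2)] T by auto
  with M show "(\<integral>\<^sup>+x. f x \<partial>distr M N T) * (\<integral>\<^sup>+x. g x \<partial>distr M N T) \<le> (\<integral>\<^sup>+x. h x \<partial>distr M N T)\<^sup>2"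
    by (auto simp: nn_integral_distr prekopa_def)
qed

lemma prekopa_PiM:
  fixes M :: "'i \<Rightarrow> 'a measure"
  assumes fin: "finite I" and sf: "\<And>i. sigma_finite_measure (M i)" and M: "\<And>i. i \<in> I \<Longrightarrow> prekopa (M i) (m i)"
    and cl: "\<And>i x y. i \<in> I \<Longrightarrow> x \<in> space (M i) \<Longrightarrow> y \<in> space (M i) \<Longrightarrow> m i x y \<in> space (M i)"
  shows "prekopa (PiM I M) (\<lambda>x y. \<lambda>i\<in>I. m i (x i) (y i))"
proof -
  interpret product_sigma_finite M by (simp add: product_sigma_finite_def sf)
  show ?thesis using fin M cl
  proof (induction I)
    case empty
    then show ?case
      by (auto simp: prekopa_def nn_integral_empty space_PiM_empty restrict_def)
  next
    case (insert i I)
    then have IH: "prekopa (PiM I M) (\<lambda>x y. \<lambda>i\<in>I. m i (x i) (y i))" using insert.prems by (intro insert.IH) auto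
    show ?case unfolding prekopa_def
    proof (intro allI impI)
      fix f g h :: "_ \<Rightarrow> ennreal"
      assume m[measurable]: "f \<in> borel_measurable (PiM (insert i I) M)" "g \<in> borel_measurable (PiM (insert i I) M)"
          "h \<in> borel_measurable (PiM (insert i I) M)"
        and le: "\<forall>x\<in>space (PiM (insert i I) M). \<forall>y\<in>space (PiM (insert i I) M).
             f x * g y \<le> (h (\<lambda>j\<in>insert i I. m j (x j) (y j)))\<^sup>2"
      let ?J = "\<lambda>u x. \<integral>\<^sup>+s. u (x(i := s)) \<partial>M i"
      have ms: "?J u \<in> borel_measurable (PiM I M)" if "u \<in> borel_measurable (PiM (insert i I) M)" for u
      proof -
        interpret sigma_finite_measure "M i" by (rule sf)
        note that[measurable]
        show ?thesis by measurable
      qed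
      have "?J f x * ?J g y \<le> (?J h (\<lambda>i\<in>I. m i (x i) (y i)))\<^sup>2"
        if xy: "x \<in> space (PiM I M)" "y \<in> space (PiM I M)" for x y
      proof -
        let ?z = "\<lambda>i\<in>I. m i (x i) (y i)"
        have z: "?z \<in> space (PiM I M)" using xy insert.prems(2) by (auto simp: space_PiM PiE_def Pi_def)
        have ms1: "(\<lambda>s. u (w(i := s))) \<in> borel_measurable (M i)"
          if "u \<in> borel_measurable (PiM (insert i I) M)" "w \<in> space (PiM I M)" for u w
          using that insert(2) by (intro measurable_compose[OF measurable_component_update])
        have "f (x(i := s)) * g (y(i := t)) \<le> (h (?z(i := m i s t)))\<^sup>2"
          if st: "s \<in> space (M i)" "t \<in> space (M i)" for s t
        proof -
          have a: "x(i := s) \<in> space (PiM (insert i I) M)" "y(i := t) \<in> space (PiM (insert i I) M)"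
            using xy st by (auto simp: space_PiM PiE_def Pi_def extensional_def)
          have "(\<lambda>j\<in>insert i I. m j ((x(i := s)) j) ((y(i := t)) j)) = ?z(i := m i s t)"
            using insert(2) by (auto simp: fun_eq_iff)
          with le a show ?thesis by metis
        qed
        with insert.prems(1)[of i] show ?thesis
          unfolding prekopa_def using ms1[OF m(1) xy(1)] ms1[OF m(2) xy(2)] ms1[OF m(3) z] by auto
      qed
      with IH ms[OF m(1)] ms[OF m(2)] ms[OF m(3)]
      have "(\<integral>\<^sup>+x. ?J f x \<partial>PiM I M) * (\<integral>\<^sup>+x. ?J g x \<partial>PiM I M) \<le> (\<integral>\<^sup>+x. ?J h x \<partial>PiM I M)\<^sup>2"
        unfolding prekopa_def by blast
      then show "integral\<^sup>N (PiM (insert i I) M) f * integral\<^sup>N (PiM (insert i I) M) g \<le> (integral\<^sup>N (PiM (insert i I) M) h)\<^sup>2"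
        using insert(1,2) m by (simp add: product_nn_integral_insert)
    qed
  qed
qed

lemma prekopa_lborel: "prekopa lborel (\<lambda>x y. (1/2) *\<^sub>R (x + y) :: 'a :: euclidean_space)"
proof -
  have "prekopa (PiM Basis (\<lambda>_::'a. lborel)) (\<lambda>x y. \<lambda>b\<in>Basis. (x b + y b) / 2 :: real)"
    by (rule prekopa_PiM) (auto simp: prekopa_real intro: lborel.sigma_finite_measure_axioms)
  then have "prekopa (distr (PiM Basis (\<lambda>_::'a. lborel)) borel (\<lambda>f. \<Sum>b\<in>Basis. f b *\<^sub>R b)) (\<lambda>x y. (1/2) *\<^sub>R (x + y) :: 'a)"
    by (rule prekopa_distr) (auto simp: scaleR_sum_right sum.distrib[symmetric] algebra_simps add_divide_distrib)
  then show ?thesis by (simp add: lborel_eq[symmetric])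
qed

section \<open>Gaussian integration by parts\<close>

lemma prod_fun_upd:
  assumes "finite A" "a \<in> A"
  shows "(\<Prod>b\<in>A. f b (if b = a then u else m b)) = f a u * (\<Prod>b\<in>A - {a}. f b (m b))"
proof -
  have "(\<Prod>b\<in>A. f b (if b = a then u else m b)) = f a u * (\<Prod>b\<in>A - {a}. f b (if b = a then u else m b))"
    using assms by (subst prod.remove[of A a]) auto
  also have "(\<Prod>b\<in>A - {a}. f b (if b = a then u else m b)) = (\<Prod>b\<in>A - {a}. f b (m b))"
    by (intro prod.cong) auto
  finally show ?thesis .
qed

definition normal_moment :: "real \<Rightarrow> nat \<Rightarrow> real" where
  "normal_moment \<sigma> m = (\<integral>t. normal_density 0 \<sigma> t * t ^ m \<partial>lborel)"

lemma normal_moment_Suc: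
  assumes "\<sigma> > 0"
  shows "normal_moment \<sigma> (Suc m) = \<sigma>\<^sup>2 * real m * normal_moment \<sigma> (m - 1)"
proof (cases "odd m")
  case False
  then have e: "even m" by simp
  then have 1: "normal_moment \<sigma> (Suc m) = 0"
    using integral_normal_moment_odd[OF assms, of 0 "m div 2"] by (auto simp: normal_moment_def elim!: evenE)
  show ?thesis
  proof (cases m)
    case 0 then show ?thesis using 1 by simp
  next
    case (Suc k)
    with e have "odd k" by simp
    then have "normal_moment \<sigma> k = 0"
      using integral_normal_moment_odd[OF assms, of 0 "k div 2"] by (auto simp: normal_moment_def elim!: oddE)
    then show ?thesis using 1 Suc by simp
  qed
next
  case True
  then obtain k where k: "m = 2 * k + 1" by (auto elim: oddE)
  have "normal_moment \<sigma> (Suc m) = fact (2 * Suc k) / ((2 / \<sigma>\<^sup>2) ^ Suc k * fact (Suc k))"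
    using integral_normal_moment_even[OF assms, of 0 "Suc k"] k by (simp add: normal_moment_def)
  also have "\<dots> = \<sigma>\<^sup>2 * real m * (fact (2 * k) / ((2 / \<sigma>\<^sup>2)^k * fact k))"
  proof -
    have gen: "(c * d) * F / (2 / S * P * (c / 2 * G)) = S * d * (F / (P * G))"
      if "c > 0" "S > 0" "P > 0" "G > 0" for c d F S P G :: real
      using that by (simp add: field_simps)
    have 1: "fact (2 * Suc k) = (real (2 * k + 2) * real m) * fact (2 * k)"
      using k by (simp add: algebra_simps)
    have 2: "(2 / \<sigma>\<^sup>2) ^ Suc k * fact (Suc k) = 2 / \<sigma>\<^sup>2 * (2 / \<sigma>\<^sup>2) ^ k * (real (2 * k + 2) / 2 * fact k)"
    proof -
      have "real (2 * k + 2) / 2 = real (Suc k)" by simp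
      then show ?thesis by (simp only: power_Suc fact_Suc of_nat_mult of_nat_Suc mult_ac)
    qed
    show ?thesis unfolding 1 2 by (rule gen) (use assms in auto)
  qed
  also have "(fact (2 * k) / ((2 / \<sigma>\<^sup>2)^k * fact k)) = normal_moment \<sigma> (m - 1)"
    using integral_normal_moment_even[OF assms, of 0 "k"] k by (simp add: normal_moment_def)
  finally show ?thesis .
qed

locale gauss =
  fixes M :: "'w measure" and A :: "'i set" and x :: "'i \<Rightarrow> 'w \<Rightarrow> real" and s :: "'i \<Rightarrow> real"
  assumes finA: "finite A" and s_pos: "\<And>a. a \<in> A \<Longrightarrow> s a > 0"
    and x_measurable [measurable]: "\<And>a. a \<in> A \<Longrightarrow> x a \<in> borel_measurable M"
    and nn_indep: "\<And>f :: 'i \<Rightarrow> real \<Rightarrow> ennreal. (\<And>a. a \<in> A \<Longrightarrow> f a \<in> borel_measurable borel) \<Longrightarrow>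
      (\<integral>\<^sup>+w. (\<Prod>a\<in>A. f a (x a w)) \<partial>M) = (\<Prod>a\<in>A. \<integral>\<^sup>+t. ennreal (normal_density 0 (s a) t) * f a t \<partial>lborel)"
begin

lemma emeasure_space_eq_1: "emeasure M (space M) = 1"
proof -
  have "emeasure M (space M) = (\<integral>\<^sup>+w. (\<Prod>a\<in>A. (\<lambda>_. 1) (x a w)) \<partial>M)" by simp
  also have "\<dots> = (\<Prod>a\<in>A. \<integral>\<^sup>+t. ennreal (normal_density 0 (s a) t) * 1 \<partial>lborel)"
    by (rule nn_indep) auto
  also have "\<dots> = (\<Prod>a\<in>A. 1)"
  proof (intro prod.cong refl)
    fix a assume "a \<in> A"
    then show "(\<integral>\<^sup>+t. ennreal (normal_density 0 (s a) t) * 1 \<partial>lborel) = 1"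
      using s_pos by (simp add: nn_integral_eq_integral)
  qed
  finally show ?thesis by simp
qed

sublocale prob_space M
  by (rule prob_spaceI) (rule emeasure_space_eq_1)

abbreviation law :: "'i \<Rightarrow> real measure" where
  "law a \<equiv> if a \<in> A then density lborel (\<lambda>t. ennreal (normal_density 0 (s a) t)) else return borel 0"

lemma distr_law: "distr M (PiM A law) (\<lambda>w. \<lambda>a\<in>A. x a w) = PiM A law"
proof -
  have ps: "prob_space (law a)" for a
    using prob_space_normal_density[of "s a" 0] s_pos by (cases "a \<in> A") (simp_all add: prob_space_return)
  interpret product_prob_space law
    by (simp add: product_prob_space_def product_sigma_finite_def product_prob_space_axioms_def ps
        prob_space_imp_sigma_finite)
  show ?thesis
  proof (rule PiM_eqI[OF finA])
    fix B assume B: "\<And>a. a \<in> A \<Longrightarrow> B a \<in> sets (law a)"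
    have xm: "(\<lambda>w. \<lambda>a\<in>A. x a w) \<in> measurable M (PiM A law)"
      by (intro measurable_restrict) auto
    have PE: "Pi\<^sub>E A B \<in> sets (PiM A law)" using B finA by (intro sets_PiM_I_finite) 
    have B': "B a \<in> sets borel" if "a \<in> A" for a using B[OF that] that by simp
    have "emeasure (distr M (PiM A law) (\<lambda>w. \<lambda>a\<in>A. x a w)) (Pi\<^sub>E A B)
        = emeasure M ((\<lambda>w. \<lambda>a\<in>A. x a w) -` Pi\<^sub>E A B \<inter> space M)"
      by (rule emeasure_distr[OF xm PE])
    also have "\<dots> = (\<integral>\<^sup>+w. indicator ((\<lambda>w. \<lambda>a\<in>A. x a w) -` Pi\<^sub>E A B \<inter> space M) w \<partial>M)"
      by (rule nn_integral_indicator[OF measurable_sets[OF xm PE], symmetric])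
    also have "\<dots> = (\<integral>\<^sup>+w. (\<Prod>a\<in>A. indicator (B a) (x a w)) \<partial>M)"
    proof (intro nn_integral_cong)
      fix w assume "w \<in> space M"
      then show "indicator ((\<lambda>w. \<lambda>a\<in>A. x a w) -` Pi\<^sub>E A B \<inter> space M) w = (\<Prod>a\<in>A. indicator (B a) (x a w) :: ennreal)"
        using finA by (auto simp: indicator_def PiE_iff prod_zero_iff)
    qed
    also have "\<dots> = (\<Prod>a\<in>A. \<integral>\<^sup>+t. ennreal (normal_density 0 (s a) t) * indicator (B a) t \<partial>lborel)"
      using B' by (intro nn_indep) auto
    also have "\<dots> = (\<Prod>a\<in>A. emeasure (law a) (B a))"
      using B' by (intro prod.cong) (auto simp: emeasure_density)
    finally show "emeasure (distr M (PiM A law) (\<lambda>w. \<lambda>a\<in>A. x a w)) (Pi\<^sub>E A B) = (\<Prod>a\<in>A. emeasure (law a) (B a))" .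
  qed simp
qed

lemma has_bochner_integral_prod:
  fixes f :: "'i \<Rightarrow> real \<Rightarrow> real"
  assumes f: "\<And>a. a \<in> A \<Longrightarrow> f a \<in> borel_measurable borel"
    and i: "\<And>a. a \<in> A \<Longrightarrow> integrable lborel (\<lambda>t. normal_density 0 (s a) t * f a t)"
  shows "has_bochner_integral M (\<lambda>w. \<Prod>a\<in>A. f a (x a w)) (\<Prod>a\<in>A. \<integral>t. normal_density 0 (s a) t * f a t \<partial>lborel)"
proof -
  have ps: "prob_space (law a)" for a
    using prob_space_normal_density[of "s a" 0] s_pos by (cases "a \<in> A") (simp_all add: prob_space_return)
  interpret product_prob_space law
    by (simp add: product_prob_space_def product_sigma_finite_def product_prob_space_axioms_def ps
        prob_space_imp_sigma_finite)
  have il: "integrable (law a) (f a)" if "a \<in> A" for a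
    using i[OF that] f[OF that] that by (simp add: integrable_density)
  have el: "integral\<^sup>L (law a) (f a) = (\<integral>t. normal_density 0 (s a) t * f a t \<partial>lborel)" if "a \<in> A" for a
    using f[OF that] that by (simp add: integral_density)
  have msr: "(\<lambda>y. \<Prod>a\<in>A. f a (y a)) \<in> borel_measurable (PiM A law)"
    using f by (intro borel_measurable_prod measurable_compose[OF measurable_component_singleton]) auto
  have msr2: "(\<lambda>w. \<lambda>a\<in>A. x a w) \<in> measurable M (PiM A law)"
    by (intro measurable_restrict) auto
  have "integrable (PiM A law) (\<lambda>y. \<Prod>a\<in>A. f a (y a))"
    by (rule product_integrable_prod[OF finA il])
  then have "integrable (distr M (PiM A law) (\<lambda>w. \<lambda>a\<in>A. x a w)) (\<lambda>y. \<Prod>a\<in>A. f a (y a))"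
    by (simp only: distr_law)
  then have 1: "integrable M (\<lambda>w. \<Prod>a\<in>A. f a (x a w))"
    using integrable_distr_eq[OF msr2 msr] by simp
  have "(\<integral>w. (\<Prod>a\<in>A. f a (x a w)) \<partial>M) = (\<integral>y. (\<Prod>a\<in>A. f a (y a)) \<partial>distr M (PiM A law) (\<lambda>w. \<lambda>a\<in>A. x a w))"
    using integral_distr[OF msr2 msr] by simp
  also have "\<dots> = (\<Prod>a\<in>A. integral\<^sup>L (law a) (f a))"
    unfolding distr_law by (rule product_integral_prod[OF finA il])
  also have "\<dots> = (\<Prod>a\<in>A. \<integral>t. normal_density 0 (s a) t * f a t \<partial>lborel)"
    by (intro prod.cong refl el)
  finally show ?thesis using 1 by (simp add: has_bochner_integral_iff)
qed

definition mon :: "('i \<Rightarrow> nat) \<Rightarrow> 'w \<Rightarrow> real" where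
  "mon m w = (\<Prod>a\<in>A. x a w ^ m a)"

lemma has_bochner_integral_mon:
  "has_bochner_integral M (mon m) (\<Prod>a\<in>A. normal_moment (s a) (m a))"
proof -
  have "integrable lborel (\<lambda>t. normal_density 0 (s a) t * t ^ m a)" if "a \<in> A" for a
    using integrable_normal_moment[OF s_pos[OF that], of 0 "m a"] by simp
  from has_bochner_integral_prod[where f = "\<lambda>a t. t ^ m a", OF _ this] show ?thesis
    by (simp add: mon_def[abs_def] normal_moment_def)
qed

lemma integrable_mon [simp]: "integrable M (mon m)"
  using has_bochner_integral_mon by (auto simp: has_bochner_integral_iff)

lemma mon_upd:
  assumes "a \<in> A" shows "mon (m(a := k)) w = x a w ^ k * (\<Prod>b\<in>A - {a}. x b w ^ m b)"
proof -
  have "mon (m(a := k)) w = (\<Prod>b\<in>A. x b w ^ (if b = a then k else m b))"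
    unfolding mon_def by (intro prod.cong) auto
  then show ?thesis using prod_fun_upd[OF finA assms, of "\<lambda>b k. x b w ^ k" k m] by simp
qed

lemma mon_upd': "a \<in> A \<Longrightarrow> mon m w = x a w ^ m a * (\<Prod>b\<in>A - {a}. x b w ^ m b)"
  using mon_upd[of a m "m a" w] by simp

lemma x_mon: "a \<in> A \<Longrightarrow> x a w * mon m w = mon (m(a := Suc (m a))) w"
  by (simp add: mon_upd mon_upd'[of a m])

definition dmon :: "'i \<Rightarrow> ('i \<Rightarrow> nat) \<Rightarrow> 'w \<Rightarrow> real" where
  "dmon a m w = real (m a) * mon (m(a := m a - 1)) w"

lemma stein_mon:
  assumes a: "a \<in> A"
  shows "(\<integral>w. x a w * mon m w \<partial>M) = (s a)\<^sup>2 * (\<integral>w. dmon a m w \<partial>M)"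
proof -
  have e: "(\<integral>w. mon (m(a := k)) w \<partial>M) = normal_moment (s a) k * (\<Prod>b\<in>A - {a}. normal_moment (s b) (m b))" for k
  proof -
    have "(\<integral>w. mon (m(a := k)) w \<partial>M) = (\<Prod>b\<in>A. normal_moment (s b) (if b = a then k else m b))"
      using has_bochner_integral_integral_eq[OF has_bochner_integral_mon, of "m(a := k)"] by (simp add: fun_upd_def)
    then show ?thesis using prod_fun_upd[OF finA a, of "\<lambda>b. normal_moment (s b)" k m] by simp
  qed
  show ?thesis unfolding dmon_def using a
    by (simp add: x_mon e normal_moment_Suc s_pos)
qed

lemma dmon_x:
  assumes a: "a \<in> A" and b: "b \<in> A"
  shows "dmon a (m(b := Suc (m b))) w = of_bool (a = b) * mon m w + x b w * dmon a m w"
proof (cases "a = b")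
  case True
  have "dmon a (m(b := Suc (m b))) w = (1 + real (m a)) * mon m w" using True by (simp add: dmon_def)
  also have "\<dots> = mon m w + x a w * dmon a m w"
  proof (cases "m a")
    case 0 then show ?thesis by (simp add: dmon_def)
  next
    case (Suc k)
    have "x a w * mon (m(a := k)) w = mon m w"
      using x_mon[OF a, of w "m(a := k)"] Suc by (metis fun_upd_same fun_upd_triv fun_upd_upd)
    then show ?thesis using Suc by (simp add: dmon_def algebra_simps)
  qed
  finally show ?thesis using True by simp
next
  case False
  then show ?thesis using x_mon[OF b, of w "m(a := m a - 1)"]
    by (simp add: dmon_def fun_upd_twist)
qed

inductive stein :: "'i \<Rightarrow> ('w \<Rightarrow> complex) \<Rightarrow> ('w \<Rightarrow> complex) \<Rightarrow> bool" for a where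
  stein_const: "stein a (\<lambda>_. c) (\<lambda>_. 0)"
| stein_coord: "b \<in> A \<Longrightarrow> stein a f f' \<Longrightarrow>
    stein a (\<lambda>w. of_real (x b w) * f w) (\<lambda>w. of_bool (a = b) * f w + of_real (x b w) * f' w)"
| stein_add: "stein a f f' \<Longrightarrow> stein a g g' \<Longrightarrow> stein a (\<lambda>w. f w + g w) (\<lambda>w. f' w + g' w)"

lemma stein_integral_aux:
  assumes "stein a f f'" and a: "a \<in> A"
  shows "integrable M (\<lambda>w. of_real (mon m w) * f w) \<and> integrable M (\<lambda>w. of_real (mon m w) * f' w) \<and>
    (\<integral>w. of_real (x a w * mon m w) * f w \<partial>M) =
      of_real ((s a)\<^sup>2) * (\<integral>w. of_real (dmon a m w) * f w + of_real (mon m w) * f' w \<partial>M)"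
  using assms(1)
proof (induction arbitrary: m)
  case (stein_const c)
  have "(\<integral>w. of_real (x a w * mon m w) * c \<partial>M) = of_real (\<integral>w. x a w * mon m w \<partial>M) * c"
    by (simp only: integral_mult_left_zero integral_complex_of_real)
  also have "\<dots> = of_real ((s a)\<^sup>2) * (of_real (\<integral>w. dmon a m w \<partial>M) * c)"
    unfolding stein_mon[OF a] by simp
  also have "of_real (\<integral>w. dmon a m w \<partial>M) * c = (\<integral>w. of_real (dmon a m w) * c \<partial>M)"
    by (simp only: integral_mult_left_zero integral_complex_of_real)
  finally show ?case by simp
next
  case (stein_coord b f f')
  let ?m = "m(b := Suc (m b))"
  have xm: "mon ?m w = x b w * mon m w" for w
    by (rule x_mon[OF stein_coord.hyps(1), symmetric])
  have eq: "(\<lambda>w. complex_of_real (mon m w) * (of_real (x b w) * h w)) = (\<lambda>w. of_real (mon ?m w) * h w)" for h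
    unfolding xm of_real_mult by (simp add: fun_eq_iff)
  have 1: "integrable M (\<lambda>w. of_real (mon m w) * (of_real (x b w) * f w))"
    unfolding eq using stein_coord.IH by blast
  have 2: "integrable M (\<lambda>w. of_real (mon m w) * (of_real (x b w) * f' w))"
    unfolding eq using stein_coord.IH by blast
  have 3: "integrable M (\<lambda>w. of_real (mon m w) * (of_bool (a = b) * f w))"
    using stein_coord.IH[of m] by (cases "a = b") auto
  have 4: "integrable M (\<lambda>w. of_real (mon m w) * (of_bool (a = b) * f w + of_real (x b w) * f' w))"
    using 2 3 by (simp add: ring_distribs)
  have "(\<integral>w. of_real (x a w * mon m w) * (of_real (x b w) * f w) \<partial>M)
      = (\<integral>w. of_real (x a w * mon ?m w) * f w \<partial>M)"
    unfolding xm of_real_mult by (simp add: mult.assoc mult.left_commute)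
  also have "\<dots> = of_real ((s a)\<^sup>2) * (\<integral>w. of_real (dmon a ?m w) * f w + of_real (mon ?m w) * f' w \<partial>M)"
    using stein_coord.IH[of ?m] by blast
  also have "(\<lambda>w. of_real (dmon a ?m w) * f w + of_real (mon ?m w) * f' w) =
     (\<lambda>w. of_real (dmon a m w) * (of_real (x b w) * f w) + of_real (mon m w) * (of_bool (a = b) * f w + of_real (x b w) * f' w))"
    unfolding dmon_x[OF a stein_coord.hyps(1)] xm by (cases "a = b") (simp_all add: algebra_simps)
  finally show ?case using 1 4 by blast
next
  case (stein_add f f' g g')
  have i: "integrable M (\<lambda>w. of_real (mon m w) * h w)" if "h \<in> {f, f', g, g'}" for h m
    using stein_add.IH[of m] that by blast
  have ix: "integrable M (\<lambda>w. of_real (x a w * mon m w) * h w)" if "h \<in> {f, f', g, g'}" for h m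
    using i[OF that] a by (simp add: x_mon)
  have id: "integrable M (\<lambda>w. of_real (dmon a m w) * h w)" if "h \<in> {f, f', g, g'}" for h m
    using integrable_mult_right[OF i[OF that, of "m(a := m a - 1)"], of "of_nat (m a)"]
    by (simp add: dmon_def mult.assoc)
  show ?case
    using stein_add.IH[of m] i ix id
    by (simp add: distrib_left integrable_add integral_add)
qed

lemma stein_integrable: assumes "stein a f f'" "a \<in> A" shows "integrable M f" "integrable M f'"
  using stein_integral_aux[OF assms, of "\<lambda>_. 0"] by (auto simp: mon_def)

lemma stein_integral:
  assumes "stein a f f'" "a \<in> A"
  shows "integrable M (\<lambda>w. of_real (x a w) * f w)"
    and "(\<integral>w. of_real (x a w) * f w \<partial>M) = of_real ((s a)\<^sup>2) * (\<integral>w. f' w \<partial>M)"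
proof -
  show "(\<integral>w. of_real (x a w) * f w \<partial>M) = of_real ((s a)\<^sup>2) * (\<integral>w. f' w \<partial>M)"
    using stein_integral_aux[OF assms, of "\<lambda>_. 0"] by (auto simp: mon_def dmon_def)
  have "x a w = mon ((\<lambda>_. 0)(a := Suc 0)) w" for w
    using x_mon[OF assms(2), of w "\<lambda>_. 0"] by (simp add: mon_def)
  then show "integrable M (\<lambda>w. of_real (x a w) * f w)"
    using stein_integral_aux[OF assms, of "(\<lambda>_. 0)(a := Suc 0)"] by simp
qed

lemma stein_cmult: "stein a f f' \<Longrightarrow> stein a (\<lambda>w. c * f w) (\<lambda>w. c * f' w)"
proof (induction rule: stein.induct)
  case (stein_const c')
  then show ?case using stein.stein_const[of a "c * c'"] by simp
next
  case (stein_coord b f f')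
  have "(\<lambda>w. of_bool (a = b) * (c * f w) + of_real (x b w) * (c * f' w)) = (\<lambda>w. c * (of_bool (a = b) * f w + of_real (x b w) * f' w))"
    by (auto simp: algebra_simps)
  then show ?case using stein.stein_coord[OF stein_coord.hyps(1) stein_coord.IH]
    by (simp add: mult.left_commute)
next
  case (stein_add f f' g g')
  then show ?case using stein.stein_add[OF stein_add.IH] by (simp add: distrib_left)
qed

lemma stein_mult:
  "stein a f f' \<Longrightarrow> stein a g g' \<Longrightarrow> stein a (\<lambda>w. f w * g w) (\<lambda>w. f' w * g w + f w * g' w)"
proof (induction rule: stein.induct)
  case (stein_const c)
  then show ?case using stein_cmult by simp
next
  case (stein_coord b f f')
  have "(\<lambda>w. of_bool (a = b) * (f w * g w) + of_real (x b w) * (f' w * g w + f w * g' w)) =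
     (\<lambda>w. (of_bool (a = b) * f w + of_real (x b w) * f' w) * g w + of_real (x b w) * f w * g' w)"
    by (auto simp: algebra_simps)
  then show ?case using stein.stein_coord[OF stein_coord.hyps(1) stein_coord.IH[OF stein_coord.prems]]
    by (simp add: mult.assoc)
next
  case (stein_add f1 f1' f2 f2')
  have "(\<lambda>w. (f1' w * g w + f1 w * g' w) + (f2' w * g w + f2 w * g' w)) =
     (\<lambda>w. (f1' w + f2' w) * g w + (f1 w + f2 w) * g' w)"
    by (auto simp: algebra_simps)
  then show ?case using stein.stein_add[OF stein_add.IH(1)[OF stein_add.prems] stein_add.IH(2)[OF stein_add.prems]]
    by (simp add: distrib_right)
qed

lemma stein_x: assumes "b \<in> A" shows "stein a (\<lambda>w. of_real (x b w)) (\<lambda>_. of_bool (a = b))"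
  using stein_coord[OF assms stein_const[of a 1]] by simp

end

text \<open>Letters of words in rectangular elements: \<open>Pr \<kappa>\<close> is the projection onto the smaller (\<open>False\<close>) or
  the larger (\<open>True\<close>) of the two corners, \<open>Ge i False\<close> the \<open>i\<close>-th element and \<open>Ge i True\<close> its adjoint.
  In both cases the Boolean is the corner of the rows.\<close>

datatype letter = Pr bool | Ge nat bool

fun adjl :: "letter \<Rightarrow> letter" where
  "adjl (Pr \<kappa>) = Pr \<kappa>"
| "adjl (Ge i s) = Ge i (\<not> s)"

definition letters :: "nat \<Rightarrow> letter set" where
  "letters N = range Pr \<union> {Ge i s |i s. i \<in> {1..N}}"

definition gindex :: "nat \<Rightarrow> (bool \<Rightarrow> nat set) \<Rightarrow> (nat \<times> (nat \<times> nat) \<times> bool) set" where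
  "gindex N blk = {1..N} \<times> (blk False \<times> blk True) \<times> UNIV"

definition sg :: "bool \<Rightarrow> complex" where "sg s = (if s then - \<i> else \<i>)"

locale gaussian_matrices = gauss M "gindex N blk" X "\<lambda>\<alpha>. sqrt (v (fst \<alpha>) / 2)"
  for M :: "'w measure" and N :: nat and blk :: "bool \<Rightarrow> nat set"
    and X :: "nat \<times> (nat \<times> nat) \<times> bool \<Rightarrow> 'w \<Rightarrow> real" and v :: "nat \<Rightarrow> real" +
  fixes U :: "nat set"
  assumes v_pos: "\<And>i. i \<in> {1..N} \<Longrightarrow> v i > 0"
    and finU: "finite U" and blkU: "blk \<kappa> \<subseteq> U" and disj: "blk False \<inter> blk True = {}"
    and blk_ne: "blk \<kappa> \<noteq> {}"
begin

lemma fin_blk [simp]: "finite (blk \<kappa>)" using finU blkU by (rule rev_finite_subset)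

fun ent :: "letter \<Rightarrow> nat \<Rightarrow> nat \<Rightarrow> 'w \<Rightarrow> complex" where
  "ent (Pr \<kappa>) x z w = of_bool (x = z \<and> x \<in> blk \<kappa>)"
| "ent (Ge i s) x z w = (if x \<in> blk s \<and> z \<in> blk (\<not> s) then
     (if s then of_real (X (i, (z, x), False) w) - \<i> * of_real (X (i, (z, x), True) w)
      else of_real (X (i, (x, z), False) w) + \<i> * of_real (X (i, (x, z), True) w)) else 0)"

fun W :: "letter list \<Rightarrow> nat \<Rightarrow> nat \<Rightarrow> 'w \<Rightarrow> complex" where
  "W [] x y w = of_bool (x = y)"
| "W (e # l) x y w = (\<Sum>z\<in>U. ent e x z w * W l z y w)"

definition pos :: "nat \<Rightarrow> bool \<Rightarrow> nat \<Rightarrow> nat \<Rightarrow> bool \<Rightarrow> nat \<times> (nat \<times> nat) \<times> bool" where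
  "pos i s p q r = (i, (if s then (q, p) else (p, q)), r)"

text \<open>Complex Gaussian integration by parts: \<open>f'\<close> is the Wirtinger derivative of \<open>f\<close> with respect to the
  conjugate of the entry \<open>(p, q)\<close> of the letter \<open>Ge i s\<close>.\<close>

definition cst :: "nat \<Rightarrow> bool \<Rightarrow> nat \<Rightarrow> nat \<Rightarrow> ('w \<Rightarrow> complex) \<Rightarrow> ('w \<Rightarrow> complex) \<Rightarrow> bool" where
  "cst i s p q f f' \<longleftrightarrow> (\<exists>f1 f2. stein (pos i s p q False) f f1 \<and> stein (pos i s p q True) f f2 \<and>
     f' = (\<lambda>w. (f1 w + sg s * f2 w) / 2))"

lemma cst_const: "cst i s p q (\<lambda>_. c) (\<lambda>_. 0)"
  unfolding cst_def by (rule exI[of _ "\<lambda>_. 0"], rule exI[of _ "\<lambda>_. 0"]) (simp add: stein_const)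

lemma cst_add: "cst i s p q f f' \<Longrightarrow> cst i s p q g g' \<Longrightarrow> cst i s p q (\<lambda>w. f w + g w) (\<lambda>w. f' w + g' w)"
  unfolding cst_def
proof (elim exE conjE)
  fix f1 f2 g1 g2
  assume "stein (pos i s p q False) f f1" "stein (pos i s p q True) f f2"
    "f' = (\<lambda>w. (f1 w + sg s * f2 w) / 2)"
    "stein (pos i s p q False) g g1" "stein (pos i s p q True) g g2"
    "g' = (\<lambda>w. (g1 w + sg s * g2 w) / 2)"
  then show "\<exists>h1 h2. stein (pos i s p q False) (\<lambda>w. f w + g w) h1 \<and> stein (pos i s p q True) (\<lambda>w. f w + g w) h2 \<and>
     (\<lambda>w. f' w + g' w) = (\<lambda>w. (h1 w + sg s * h2 w) / 2)"
    by (intro exI[of _ "\<lambda>w. f1 w + g1 w"] exI[of _ "\<lambda>w. f2 w + g2 w"])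
      (simp_all add: stein_add fun_eq_iff field_simps)
qed

lemma cst_mult: "cst i s p q f f' \<Longrightarrow> cst i s p q g g' \<Longrightarrow>
  cst i s p q (\<lambda>w. f w * g w) (\<lambda>w. f' w * g w + f w * g' w)"
proof -
  assume f: "cst i s p q f f'" and g: "cst i s p q g g'"
  obtain f1 f2 where f': "stein (pos i s p q False) f f1" "stein (pos i s p q True) f f2"
    "f' = (\<lambda>w. (f1 w + sg s * f2 w) / 2)" using f unfolding cst_def by blast
  obtain g1 g2 where g': "stein (pos i s p q False) g g1" "stein (pos i s p q True) g g2"
    "g' = (\<lambda>w. (g1 w + sg s * g2 w) / 2)" using g unfolding cst_def by blast
  have "(\<lambda>w. f' w * g w + f w * g' w) = (\<lambda>w. ((f1 w * g w + f w * g1 w) + sg s * (f2 w * g w + f w * g2 w)) / 2)"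
    unfolding f' g' by (simp add: fun_eq_iff field_simps)
  then show ?thesis unfolding cst_def using stein_mult[OF f'(1) g'(1)] stein_mult[OF f'(2) g'(2)] by blast
qed

lemma cst_sum:
  assumes "finite I" "\<And>k. k \<in> I \<Longrightarrow> cst i s p q (f k) (f' k)"
  shows "cst i s p q (\<lambda>w. \<Sum>k\<in>I. f k w) (\<lambda>w. \<Sum>k\<in>I. f' k w)"
  using assms by (induction I) (auto intro: cst_add cst_const)

lemma cst_cmult: "cst i s p q f f' \<Longrightarrow> cst i s p q (\<lambda>w. c * f w) (\<lambda>w. c * f' w)"
  using cst_mult[OF cst_const[of i s p q c]] by simp

lemma pos_in: "i \<in> {1..N} \<Longrightarrow> p \<in> blk s \<Longrightarrow> q \<in> blk (\<not> s) \<Longrightarrow> pos i s p q r \<in> gindex N blk"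
  by (cases s) (auto simp: pos_def gindex_def)

lemma ent_pos: "p \<in> blk s \<Longrightarrow> q \<in> blk (\<not> s) \<Longrightarrow>
  ent (Ge i s) p q = (\<lambda>w. of_real (X (pos i s p q False) w) + sg s * of_real (X (pos i s p q True) w))"
  by (auto simp: fun_eq_iff pos_def sg_def)

lemma cst_ent:
  assumes e: "e \<in> letters N" and pq: "p \<in> blk s" "q \<in> blk (\<not> s)"
  shows "cst i s p q (ent e x z) (\<lambda>_. of_bool (e = Ge i (\<not> s) \<and> x = q \<and> z = p))"
proof (cases e)
  case (Pr \<kappa>)
  then have "ent e x z = (\<lambda>_. of_bool (x = z \<and> x \<in> blk \<kappa>))" by auto
  then show ?thesis using cst_const Pr by simp
next
  case (Ge j s')
  show ?thesis
  proof (cases "x \<in> blk s' \<and> z \<in> blk (\<not> s')")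
    case True
    have j: "j \<in> {1..N}" using e Ge by (auto simp: letters_def)
    note P = pos_in[OF j, of x s' z] True
    let ?c = "sg s'"
    have st: "stein (pos i s p q r) (ent e x z)
        (\<lambda>_. of_bool (pos i s p q r = pos j s' x z False) + ?c * of_bool (pos i s p q r = pos j s' x z True))" for r
      unfolding Ge using True by (subst ent_pos) (simp_all add: stein_add stein_cmult stein_x P)
    have "(\<lambda>_. of_bool (e = Ge i (\<not> s) \<and> x = q \<and> z = p)) =
      (\<lambda>w::'w. ((of_bool (pos i s p q False = pos j s' x z False) + ?c * of_bool (pos i s p q False = pos j s' x z True)) +
         sg s * (of_bool (pos i s p q True = pos j s' x z False) + ?c * of_bool (pos i s p q True = pos j s' x z True))) / 2 :: complex)"
      using True pq disj Ge by (cases s; cases s'; auto simp: pos_def fun_eq_iff sg_def)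
    then show ?thesis unfolding cst_def using st by blast
  next
    case False
    then have "ent e x z = (\<lambda>_. 0)" using Ge by (auto simp: fun_eq_iff)
    moreover have "\<not> (e = Ge i (\<not> s) \<and> x = q \<and> z = p)" using False Ge pq by (cases s) auto
    then have "(\<lambda>_::'w. of_bool (e = Ge i (\<not> s) \<and> x = q \<and> z = p) :: complex) = (\<lambda>_. 0)" by (simp only: of_bool_def if_False)
    ultimately show ?thesis using cst_const[of i s p q 0] by simp
  qed
qed

definition dW :: "nat \<Rightarrow> bool \<Rightarrow> nat \<Rightarrow> nat \<Rightarrow> letter list \<Rightarrow> nat \<Rightarrow> nat \<Rightarrow> 'w \<Rightarrow> complex" where
  "dW i s p q l x y w = (\<Sum>j<length l. if l ! j = Ge i (\<not> s) then W (take j l) x q w * W (drop (Suc j) l) p y w else 0)"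

lemma cst_W:
  assumes "set l \<subseteq> letters N" "p \<in> blk s" "q \<in> blk (\<not> s)" "x \<in> U" "y \<in> U"
  shows "cst i s p q (W l x y) (dW i s p q l x y)"
  using assms
proof (induction l arbitrary: x)
  case Nil
  have "W [] x y = (\<lambda>_. of_bool (x = y))" "dW i s p q [] x y = (\<lambda>_. 0)" by (auto simp: dW_def fun_eq_iff)
  then show ?case using cst_const by simp
next
  case (Cons e l)
  have p: "p \<in> U" using blkU Cons.prems by blast
  have 1: "cst i s p q (\<lambda>w. \<Sum>z\<in>U. ent e x z w * W l z y w)
     (\<lambda>w. \<Sum>z\<in>U. of_bool (e = Ge i (\<not> s) \<and> x = q \<and> z = p) * W l z y w + ent e x z w * dW i s p q l z y w)"
    using Cons.prems by (intro cst_sum finU cst_mult cst_ent Cons.IH) auto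
  have "dW i s p q (e # l) x y w = (\<Sum>z\<in>U. of_bool (e = Ge i (\<not> s) \<and> x = q \<and> z = p) * W l z y w + ent e x z w * dW i s p q l z y w)" for w
  proof -
    have "dW i s p q (e # l) x y w = of_bool (e = Ge i (\<not> s) \<and> x = q) * W l p y w +
      (\<Sum>j<length l. if l ! j = Ge i (\<not> s) then (\<Sum>z\<in>U. ent e x z w * W (take j l) z q w) * W (drop (Suc j) l) p y w else 0)"
      unfolding dW_def length_Cons sum.lessThan_Suc_shift by (simp add: if_distrib cong: if_cong)
    also have "(\<Sum>j<length l. if l ! j = Ge i (\<not> s) then (\<Sum>z\<in>U. ent e x z w * W (take j l) z q w) * W (drop (Suc j) l) p y w else 0)
      = (\<Sum>j<length l. \<Sum>z\<in>U. ent e x z w * (if l ! j = Ge i (\<not> s) then W (take j l) z q w * W (drop (Suc j) l) p y w else 0))"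
      by (intro sum.cong refl) (auto simp: sum_distrib_right mult.assoc)
    also have "\<dots> = (\<Sum>z\<in>U. ent e x z w * dW i s p q l z y w)"
      by (subst sum.swap) (simp add: dW_def sum_distrib_left)
    also have "of_bool (e = Ge i (\<not> s) \<and> x = q) * W l p y w = (\<Sum>z\<in>U. of_bool (e = Ge i (\<not> s) \<and> x = q \<and> z = p) * W l z y w)"
    proof -
      have "(\<Sum>z\<in>U. of_bool (e = Ge i (\<not> s) \<and> x = q \<and> z = p) * W l z y w) =
        (\<Sum>z\<in>U. if z = p then of_bool (e = Ge i (\<not> s) \<and> x = q) * W l z y w else 0)"
        by (intro sum.cong) auto
      then show ?thesis using finU p by (simp add: sum.delta)
    qed
    finally show ?thesis by (simp add: sum.distrib)
  qed
  then have "dW i s p q (e # l) x y = (\<lambda>w. \<Sum>z\<in>U. of_bool (e = Ge i (\<not> s) \<and> x = q \<and> z = p) * W l z y w + ent e x z w * dW i s p q l z y w)"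
    by auto
  moreover have "W (e # l) x y = (\<lambda>w. \<Sum>z\<in>U. ent e x z w * W l z y w)" by auto
  ultimately show ?case using 1 by simp
qed

lemma W_append: "x \<in> U \<Longrightarrow> W (l1 @ l2) x y w = (\<Sum>z\<in>U. W l1 x z w * W l2 z y w)"
proof (induction l1 arbitrary: x)
  case Nil
  have "(\<Sum>z\<in>U. W [] x z w * W l2 z y w) = (\<Sum>z\<in>U. if z = x then W l2 z y w else 0)"
    by (intro sum.cong) auto
  then show ?case using Nil finU by simp
next
  case (Cons e l1)
  have "W ((e # l1) @ l2) x y w = (\<Sum>z\<in>U. ent e x z w * (\<Sum>z'\<in>U. W l1 z z' w * W l2 z' y w))"
    using Cons.IH by simp
  also have "\<dots> = (\<Sum>z\<in>U. \<Sum>z'\<in>U. ent e x z w * W l1 z z' w * W l2 z' y w)"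
    by (simp add: sum_distrib_left mult.assoc)
  also have "\<dots> = (\<Sum>z'\<in>U. \<Sum>z\<in>U. ent e x z w * W l1 z z' w * W l2 z' y w)" by (rule sum.swap)
  finally show ?case by (simp add: sum_distrib_right)
qed

lemma W_Pr: "x \<in> U \<Longrightarrow> W (Pr \<kappa> # l) x y w = (if x \<in> blk \<kappa> then W l x y w else 0)"
proof -
  assume x: "x \<in> U"
  have "W (Pr \<kappa> # l) x y w = (\<Sum>z\<in>U. if z = x then of_bool (x \<in> blk \<kappa>) * W l z y w else 0)"
    unfolding W.simps by (intro sum.cong) auto
  then show ?thesis using x finU by simp
qed

definition T :: "bool \<Rightarrow> letter list \<Rightarrow> 'w \<Rightarrow> complex" where
  "T \<kappa> l w = (\<Sum>x\<in>blk \<kappa>. W l x x w) / of_nat (card (blk \<kappa>))"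

definition TP :: "(bool \<times> letter list) list \<Rightarrow> 'w \<Rightarrow> complex" where
  "TP L w = prod_list (map (\<lambda>(\<kappa>, l). T \<kappa> l w) L)"

lemma TP_simps [simp]: "TP [] w = 1" "TP ((\<kappa>, l) # L) w = T \<kappa> l w * TP L w"
  by (simp_all add: TP_def)

definition dT :: "nat \<Rightarrow> bool \<Rightarrow> nat \<Rightarrow> nat \<Rightarrow> bool \<Rightarrow> letter list \<Rightarrow> 'w \<Rightarrow> complex" where
  "dT i s p q \<kappa> l w = (\<Sum>x\<in>blk \<kappa>. dW i s p q l x x w) / of_nat (card (blk \<kappa>))"

lemma cst_T:
  assumes "set l \<subseteq> letters N" "p \<in> blk s" "q \<in> blk (\<not> s)"
  shows "cst i s p q (T \<kappa> l) (dT i s p q \<kappa> l)"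
proof -
  have "cst i s p q (\<lambda>w. (1 / of_nat (card (blk \<kappa>))) * (\<Sum>x\<in>blk \<kappa>. W l x x w)) (\<lambda>w. (1 / of_nat (card (blk \<kappa>))) * (\<Sum>x\<in>blk \<kappa>. dW i s p q l x x w))"
    using blkU assms by (intro cst_cmult cst_sum cst_W) auto
  then show ?thesis by (simp add: T_def[abs_def] dT_def[abs_def])
qed

definition dTP :: "nat \<Rightarrow> bool \<Rightarrow> nat \<Rightarrow> nat \<Rightarrow> (bool \<times> letter list) list \<Rightarrow> 'w \<Rightarrow> complex" where
  "dTP i s p q L w = (\<Sum>m<length L. dT i s p q (fst (L ! m)) (snd (L ! m)) w * TP (take m L @ drop (Suc m) L) w)"

lemma cst_TP:
  assumes "\<forall>(\<kappa>, l)\<in>set L. set l \<subseteq> letters N" "p \<in> blk s" "q \<in> blk (\<not> s)"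
  shows "cst i s p q (TP L) (dTP i s p q L)"
  using assms(1)
proof (induction L)
  case Nil
  have "TP [] = (\<lambda>_. 1)" "dTP i s p q [] = (\<lambda>_. 0)" by (auto simp: dTP_def fun_eq_iff)
  then show ?case using cst_const[of i s p q 1] by simp
next
  case (Cons h L)
  obtain \<kappa> l where h: "h = (\<kappa>, l)" by (cases h)
  have "cst i s p q (\<lambda>w. T \<kappa> l w * TP L w) (\<lambda>w. dT i s p q \<kappa> l w * TP L w + T \<kappa> l w * dTP i s p q L w)"
    using Cons h assms by (intro cst_mult cst_T Cons.IH) auto
  moreover have "dTP i s p q (h # L) w = dT i s p q \<kappa> l w * TP L w + T \<kappa> l w * dTP i s p q L w" for w
    unfolding dTP_def h by (simp add: sum.lessThan_Suc_shift sum_distrib_left mult.left_commute del: sum.lessThan_Suc)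
  then have "dTP i s p q (h # L) = (\<lambda>w. dT i s p q \<kappa> l w * TP L w + T \<kappa> l w * dTP i s p q L w)" by auto
  moreover have "TP (h # L) = (\<lambda>w. T \<kappa> l w * TP L w)" by (auto simp: h)
  ultimately show ?case by simp
qed

lemma cst_integral:
  assumes f: "cst i s p q f f'" and i: "i \<in> {1..N}" and pq: "p \<in> blk s" "q \<in> blk (\<not> s)"
  shows "integrable M (\<lambda>w. ent (Ge i s) p q w * f w)" "integrable M f" "integrable M f'"
    and "(\<integral>w. ent (Ge i s) p q w * f w \<partial>M) = of_real (v i) * (\<integral>w. f' w \<partial>M)"
proof -
  let ?c = "sg s"
  obtain f1 f2 where f12: "stein (pos i s p q False) f f1" "stein (pos i s p q True) f f2"
     "f' = (\<lambda>w. (f1 w + ?c * f2 w) / 2)" using f by (auto simp: cst_def)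
  note P = pos_in[OF i pq]
  note S = stein_integral[OF f12(1) P] stein_integral[OF f12(2) P]
  note I = stein_integrable[OF f12(1) P] stein_integrable[OF f12(2) P]
  have e: "ent (Ge i s) p q w * f w = of_real (X (pos i s p q False) w) * f w + ?c * (of_real (X (pos i s p q True) w) * f w)" for w
    unfolding ent_pos[OF pq] by (simp only: distrib_right mult.assoc)
  show "integrable M f" by (rule I)
  show "integrable M f'" unfolding f12(3) using I by (simp add: Bochner_Integration.integrable_add)
  show "integrable M (\<lambda>w. ent (Ge i s) p q w * f w)"
    unfolding e using S by (simp add: Bochner_Integration.integrable_add)
  have sq: "complex_of_real ((sqrt (v (fst (pos i s p q r)) / 2))\<^sup>2) = of_real (v i) / 2" for r
    using v_pos[OF i] by (simp add: pos_def)
  have "(\<integral>w. ent (Ge i s) p q w * f w \<partial>M) =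
    (\<integral>w. of_real (X (pos i s p q False) w) * f w \<partial>M) + ?c * (\<integral>w. of_real (X (pos i s p q True) w) * f w \<partial>M)"
    unfolding e using S by (simp add: Bochner_Integration.integral_add integrable_mult_right)
  also have "\<dots> = of_real (v i) / 2 * (\<integral>w. f1 w \<partial>M) + ?c * (of_real (v i) / 2 * (\<integral>w. f2 w \<partial>M))"
    unfolding S sq by simp
  also have "of_real (v i) / 2 * (\<integral>w. f1 w \<partial>M) + ?c * (of_real (v i) / 2 * (\<integral>w. f2 w \<partial>M)) = of_real (v i) * (((\<integral>w. f1 w \<partial>M) + ?c * (\<integral>w. f2 w \<partial>M)) / 2)"
    by (simp add: field_simps)
  also have "((\<integral>w. f1 w \<partial>M) + ?c * (\<integral>w. f2 w \<partial>M)) / 2 = (\<integral>w. f' w \<partial>M)"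
    unfolding f12(3) using I by (simp add: Bochner_Integration.integral_add)
  finally show "(\<integral>w. ent (Ge i s) p q w * f w \<partial>M) = of_real (v i) * (\<integral>w. f' w \<partial>M)" .
qed


abbreviation q :: "bool \<Rightarrow> complex" where "q \<kappa> \<equiv> of_nat (card (blk \<kappa>))"

lemma q_ne [simp]: "card (blk \<kappa>) \<noteq> 0" using blk_ne by simp

lemma integrable_If: "(P \<Longrightarrow> integrable M f) \<Longrightarrow> integrable M (\<lambda>x. if P then f x else 0)" for f :: "'w \<Rightarrow> complex"
  by (cases P) auto

lemma sum_W_blk:
  "(\<Sum>x\<in>blk \<kappa>. \<Sum>y\<in>blk \<kappa>'. \<Sum>z\<in>blk \<kappa>2. W l z x w * W l' x y w * W l'' y z w) = q \<kappa>2 * T \<kappa>2 (l @ Pr \<kappa> # l' @ Pr \<kappa>' # l'') w"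
proof -
  have sb: "(\<Sum>x\<in>blk k. f x) = (\<Sum>x\<in>U. if x \<in> blk k then f x else 0)" for f :: "nat \<Rightarrow> complex" and k
    using finU blkU by (simp add: sum.inter_restrict[symmetric] Int_absorb1)
  have W1: "W (l' @ Pr \<kappa>' # l'') x z w = (\<Sum>y\<in>blk \<kappa>'. W l' x y w * W l'' y z w)" if "x \<in> U" for x z
    using that unfolding sb by (simp add: W_append W_Pr if_distrib del: W.simps cong: if_cong sum.cong)
  have W2: "W (l @ Pr \<kappa> # l' @ Pr \<kappa>' # l'') z z w = (\<Sum>x\<in>blk \<kappa>. \<Sum>y\<in>blk \<kappa>'. W l z x w * W l' x y w * W l'' y z w)" if "z \<in> U" for z
  proof -
    have "W (l @ Pr \<kappa> # l' @ Pr \<kappa>' # l'') z z w = (\<Sum>x\<in>U. if x \<in> blk \<kappa> then W l z x w * W (l' @ Pr \<kappa>' # l'') x z w else 0)"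
      using that by (simp add: W_append[of z l] W_Pr if_distrib cong: if_cong sum.cong del: W.simps)
    also have "\<dots> = (\<Sum>x\<in>blk \<kappa>. W l z x w * W (l' @ Pr \<kappa>' # l'') x z w)" unfolding sb ..
    also have "\<dots> = (\<Sum>x\<in>blk \<kappa>. \<Sum>y\<in>blk \<kappa>'. W l z x w * W l' x y w * W l'' y z w)"
    proof (intro sum.cong refl)
      fix x assume "x \<in> blk \<kappa>"
      then have "x \<in> U" using blkU by blast
      then show "W l z x w * W (l' @ Pr \<kappa>' # l'') x z w = (\<Sum>y\<in>blk \<kappa>'. W l z x w * W l' x y w * W l'' y z w)"
        by (simp only: W1 sum_distrib_left mult.assoc)
    qed
    finally show ?thesis .
  qed
  have "q \<kappa>2 * T \<kappa>2 (l @ Pr \<kappa> # l' @ Pr \<kappa>' # l'') w = (\<Sum>z\<in>blk \<kappa>2. W (l @ Pr \<kappa> # l' @ Pr \<kappa>' # l'') z z w)"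
    by (simp add: T_def)
  also have "\<dots> = (\<Sum>z\<in>blk \<kappa>2. \<Sum>x\<in>blk \<kappa>. \<Sum>y\<in>blk \<kappa>'. W l z x w * W l' x y w * W l'' y z w)"
    using blkU by (intro sum.cong refl W2) auto
  also have "\<dots> = (\<Sum>x\<in>blk \<kappa>. \<Sum>z\<in>blk \<kappa>2. \<Sum>y\<in>blk \<kappa>'. W l z x w * W l' x y w * W l'' y z w)" by (rule sum.swap)
  also have "\<dots> = (\<Sum>x\<in>blk \<kappa>. \<Sum>y\<in>blk \<kappa>'. \<Sum>z\<in>blk \<kappa>2. W l z x w * W l' x y w * W l'' y z w)"
    by (intro sum.cong refl sum.swap)
  finally show ?thesis by simp
qed

definition split_sum :: "nat \<Rightarrow> bool \<Rightarrow> letter list \<Rightarrow> (bool \<times> letter list) list \<Rightarrow> 'w \<Rightarrow> complex" where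
  "split_sum i s l L w = (\<Sum>j<length l. if l ! j = Ge i (\<not> s) then TP ((\<not> s, take j l) # (s, drop (Suc j) l) # L) w else 0)"

definition merge_sum :: "nat \<Rightarrow> bool \<Rightarrow> letter list \<Rightarrow> (bool \<times> letter list) list \<Rightarrow> 'w \<Rightarrow> complex" where
  "merge_sum i s l L w = (\<Sum>m<length L. \<Sum>j<length (snd (L ! m)). if snd (L ! m) ! j = Ge i (\<not> s) then
      TP ((\<not> s, l @ Pr s # drop (Suc j) (snd (L ! m)) @ Pr (fst (L ! m)) # take j (snd (L ! m))) # take m L @ drop (Suc m) L) w
        / q (fst (L ! m)) else 0)"

lemma sum_dW: "(\<Sum>x\<in>blk s. \<Sum>z\<in>blk (\<not> s). dW i s x z l z x w * t) =
   q s * q (\<not> s) * (\<Sum>j<length l. if l ! j = Ge i (\<not> s) then T (\<not> s) (take j l) w * T s (drop (Suc j) l) w * t else 0)"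
proof -
  have "(\<Sum>x\<in>blk s. \<Sum>z\<in>blk (\<not> s). dW i s x z l z x w * t) =
    (\<Sum>x\<in>blk s. \<Sum>z\<in>blk (\<not> s). \<Sum>j<length l. if l ! j = Ge i (\<not> s) then W (take j l) z z w * W (drop (Suc j) l) x x w * t else 0)"
    by (simp add: dW_def sum_distrib_right if_distrib[of "\<lambda>u. u * t"] cong: if_cong)
  also have "\<dots> = (\<Sum>j<length l. \<Sum>x\<in>blk s. \<Sum>z\<in>blk (\<not> s). if l ! j = Ge i (\<not> s) then W (take j l) z z w * W (drop (Suc j) l) x x w * t else 0)"
    by (subst (2) sum.swap) (subst sum.swap, rule refl)
  also have "\<dots> = (\<Sum>j<length l. if l ! j = Ge i (\<not> s) then (\<Sum>z\<in>blk (\<not> s). W (take j l) z z w) * (\<Sum>x\<in>blk s. W (drop (Suc j) l) x x w) * t else 0)"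
  proof -
    have "(\<Sum>x\<in>A. \<Sum>z\<in>B. a z * b x * t) = (\<Sum>z\<in>B. a z) * (\<Sum>x\<in>A. b x) * t" for a b :: "nat \<Rightarrow> complex" and A B
      by (simp only: sum_distrib_left sum_distrib_right)
    then have "(\<Sum>x\<in>blk s. \<Sum>z\<in>blk (\<not> s). if P then a z * b x * t else 0) = (if P then (\<Sum>z\<in>blk (\<not> s). a z) * (\<Sum>x\<in>blk s. b x) * t else 0)" for P a b
      by (cases P) (simp_all only: if_True if_False sum.neutral_const)
    then show ?thesis by (intro sum.cong refl)
  qed
  also have "\<dots> = q s * q (\<not> s) * (\<Sum>j<length l. if l ! j = Ge i (\<not> s) then T (\<not> s) (take j l) w * T s (drop (Suc j) l) w * t else 0)"
    by (subst sum_distrib_left) (intro sum.cong refl, simp add: T_def)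
  finally show ?thesis .
qed

lemma sum_dTP: "(\<Sum>x\<in>blk s. \<Sum>z\<in>blk (\<not> s). W l z x w * dTP i s x z L w) = q (\<not> s) * merge_sum i s l L w"
proof -
  have one: "(\<Sum>x\<in>blk s. \<Sum>z\<in>blk (\<not> s). W l z x w * dT i s x z \<kappa> l' w) =
    q (\<not> s) * (\<Sum>j<length l'. if l' ! j = Ge i (\<not> s) then T (\<not> s) (l @ Pr s # drop (Suc j) l' @ Pr \<kappa> # take j l') w / q \<kappa> else 0)" for \<kappa> l'
  proof -
    have "(\<Sum>x\<in>blk s. \<Sum>z\<in>blk (\<not> s). W l z x w * dT i s x z \<kappa> l' w) =
      (\<Sum>x\<in>blk s. \<Sum>z\<in>blk (\<not> s). \<Sum>y\<in>blk \<kappa>. \<Sum>j<length l'. if l' ! j = Ge i (\<not> s) then W l z x w * W (drop (Suc j) l') x y w * W (take j l') y z w / q \<kappa> else 0)"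
      unfolding dT_def dW_def sum_divide_distrib sum_distrib_left
      by (intro sum.cong refl) (auto simp: mult_ac)
    also have "\<dots> = (\<Sum>j<length l'. \<Sum>x\<in>blk s. \<Sum>y\<in>blk \<kappa>. \<Sum>z\<in>blk (\<not> s). if l' ! j = Ge i (\<not> s) then W l z x w * W (drop (Suc j) l') x y w * W (take j l') y z w / q \<kappa> else 0)"
      by (subst (3) sum.swap, subst (2) sum.swap, subst sum.swap) (intro sum.cong refl sum.swap)
    also have "\<dots> = (\<Sum>j<length l'. if l' ! j = Ge i (\<not> s) then (\<Sum>x\<in>blk s. \<Sum>y\<in>blk \<kappa>. \<Sum>z\<in>blk (\<not> s). W l z x w * W (drop (Suc j) l') x y w * W (take j l') y z w) / q \<kappa> else 0)"
      by (intro sum.cong refl) (simp add: sum_divide_distrib)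
    finally show ?thesis unfolding sum_W_blk sum_distrib_left by (simp add: if_distrib cong: if_cong)
  qed
  have "(\<Sum>x\<in>blk s. \<Sum>z\<in>blk (\<not> s). W l z x w * dTP i s x z L w) =
    (\<Sum>x\<in>blk s. \<Sum>z\<in>blk (\<not> s). \<Sum>m<length L. W l z x w * dT i s x z (fst (L ! m)) (snd (L ! m)) w * TP (take m L @ drop (Suc m) L) w)"
    by (simp add: dTP_def sum_distrib_left mult.assoc)
  also have "\<dots> = (\<Sum>m<length L. (\<Sum>x\<in>blk s. \<Sum>z\<in>blk (\<not> s). W l z x w * dT i s x z (fst (L ! m)) (snd (L ! m)) w) * TP (take m L @ drop (Suc m) L) w)"
  proof -
    have "(\<Sum>x\<in>blk s. \<Sum>z\<in>blk (\<not> s). \<Sum>m<length L. f x z m) = (\<Sum>m<length L. \<Sum>x\<in>blk s. \<Sum>z\<in>blk (\<not> s). f x z m)"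
      for f :: "nat \<Rightarrow> nat \<Rightarrow> nat \<Rightarrow> complex"
      by (subst sum.swap[of _ _ "blk (\<not> s)"]) (rule sum.swap)
    then show ?thesis unfolding sum_distrib_right .
  qed
  also have "\<dots> = q (\<not> s) * merge_sum i s l L w"
    unfolding one merge_sum_def sum_distrib_left sum_distrib_right
    by (intro sum.cong refl) auto
  finally show ?thesis .
qed

lemma integrable_TP:
  assumes "\<forall>(\<kappa>, l)\<in>set L. set l \<subseteq> letters N" and N: "N \<ge> 1"
  shows "integrable M (TP L)"
proof -
  obtain x z where "x \<in> blk False" "z \<in> blk True" using blk_ne by (metis ex_in_conv)
  then show ?thesis using cst_integral(2)[OF cst_TP[OF assms(1), where i = 1 and s = False]] N by auto
qed

lemma loop_equation:
  assumes l: "set l \<subseteq> letters N" and L: "\<forall>(\<kappa>, l)\<in>set L. set l \<subseteq> letters N" and i: "i \<in> {1..N}"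
  shows "(\<integral>w. TP ((s, Ge i s # l) # L) w \<partial>M) =
    of_real (v i) * q (\<not> s) * (\<integral>w. split_sum i s l L w \<partial>M) + of_real (v i) * q (\<not> s) / q s * (\<integral>w. merge_sum i s l L w \<partial>M)"
proof -
  have N: "N \<ge> 1" using i by auto
  have Le: "TP ((s, Ge i s # l) # L) w = (\<Sum>x\<in>blk s. \<Sum>z\<in>blk (\<not> s). ent (Ge i s) x z w * (W l z x w * TP L w)) / q s" for w
  proof -
    have "(\<Sum>z\<in>U. ent (Ge i s) x z w * W l z x w) = (\<Sum>z\<in>blk (\<not> s). ent (Ge i s) x z w * W l z x w)" for x
      using finU blkU by (intro sum.mono_neutral_right) auto
    then show ?thesis by (simp add: T_def sum_distrib_right mult.assoc del: ent.simps)
  qed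
  have IS: "(\<integral>w. (\<Sum>x\<in>blk s. \<Sum>z\<in>blk (\<not> s). g x z w) \<partial>M) = (\<Sum>x\<in>blk s. \<Sum>z\<in>blk (\<not> s). \<integral>w. g x z w \<partial>M)"
    if "\<And>x z. x \<in> blk s \<Longrightarrow> z \<in> blk (\<not> s) \<Longrightarrow> integrable M (g x z)" for g :: "nat \<Rightarrow> nat \<Rightarrow> 'w \<Rightarrow> complex"
    using that by (simp add: Bochner_Integration.integral_sum Bochner_Integration.integrable_sum)
  have d: "cst i s x z (\<lambda>w. W l z x w * TP L w) (\<lambda>w. dW i s x z l z x w * TP L w + W l z x w * dTP i s x z L w)"
    if "x \<in> blk s" "z \<in> blk (\<not> s)" for x z
    using that blkU l L by (intro cst_mult cst_W cst_TP) auto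
  note ci = cst_integral[OF d i]
  have "(\<integral>w. TP ((s, Ge i s # l) # L) w \<partial>M) = (\<Sum>x\<in>blk s. \<Sum>z\<in>blk (\<not> s). \<integral>w. ent (Ge i s) x z w * (W l z x w * TP L w) \<partial>M) / q s"
    unfolding Le using IS[OF ci(1)] by simp
  also have "\<dots> = (\<Sum>x\<in>blk s. \<Sum>z\<in>blk (\<not> s). of_real (v i) * (\<integral>w. dW i s x z l z x w * TP L w + W l z x w * dTP i s x z L w \<partial>M)) / q s"
    using ci(4) by (intro arg_cong[of _ _ "\<lambda>u. u / q s"] sum.cong refl) auto
  also have "\<dots> = of_real (v i) / q s * (\<integral>w. (\<Sum>x\<in>blk s. \<Sum>z\<in>blk (\<not> s). dW i s x z l z x w * TP L w + W l z x w * dTP i s x z L w) \<partial>M)"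
  proof -
    have "(\<integral>w. (\<Sum>x\<in>blk s. \<Sum>z\<in>blk (\<not> s). dW i s x z l z x w * TP L w + W l z x w * dTP i s x z L w) \<partial>M) =
      (\<Sum>x\<in>blk s. \<Sum>z\<in>blk (\<not> s). \<integral>w. dW i s x z l z x w * TP L w + W l z x w * dTP i s x z L w \<partial>M)"
      by (rule IS) (rule ci(3))
    then show ?thesis by (simp only: sum_distrib_left sum_divide_distrib times_divide_eq_left)
  qed
  also have "(\<lambda>w. (\<Sum>x\<in>blk s. \<Sum>z\<in>blk (\<not> s). dW i s x z l z x w * TP L w + W l z x w * dTP i s x z L w)) =
    (\<lambda>w. q s * q (\<not> s) * split_sum i s l L w + q (\<not> s) * merge_sum i s l L w)"
    by (simp only: sum.distrib sum_dW sum_dTP) (simp add: split_sum_def mult.assoc cong: if_cong)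
  also have "(\<integral>w. q s * q (\<not> s) * split_sum i s l L w + q (\<not> s) * merge_sum i s l L w \<partial>M) =
    q s * q (\<not> s) * (\<integral>w. split_sum i s l L w \<partial>M) + q (\<not> s) * (\<integral>w. merge_sum i s l L w \<partial>M)"
  proof -
    have "integrable M (split_sum i s l L)"
      unfolding split_sum_def[abs_def] using l L N
      by (intro Bochner_Integration.integrable_sum integrable_If integrable_TP) (auto dest: in_set_takeD in_set_dropD)
    moreover have "integrable M (merge_sum i s l L)"
    proof -
      have "integrable M (TP ((\<not> s, l @ Pr s # drop (Suc j) (snd (L ! m)) @ Pr (fst (L ! m)) # take j (snd (L ! m))) # take m L @ drop (Suc m) L))"
        if "m < length L" for m j
      proof -
        have "L ! m \<in> set L" using that by simp
        from bspec[OF L this] have "case L ! m of (\<kappa>, l) \<Rightarrow> set l \<subseteq> letters N" .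
        then have "set (snd (L ! m)) \<subseteq> letters N" by (simp add: case_prod_beta)
        then have "set (take j (snd (L ! m))) \<subseteq> letters N" "set (drop (Suc j) (snd (L ! m))) \<subseteq> letters N"
          by (meson order_trans set_take_subset, meson order_trans set_drop_subset)
        moreover have "Pr \<kappa> \<in> letters N" for \<kappa> by (auto simp: letters_def)
        ultimately have new: "set (l @ Pr s # drop (Suc j) (snd (L ! m)) @ Pr (fst (L ! m)) # take j (snd (L ! m))) \<subseteq> letters N"
          using l by simp
        have "\<forall>(\<kappa>, l)\<in>set ((\<not> s, l @ Pr s # drop (Suc j) (snd (L ! m)) @ Pr (fst (L ! m)) # take j (snd (L ! m))) # take m L @ drop (Suc m) L). set l \<subseteq> letters N"
        proof (rule ballI)
          fix h assume "h \<in> set ((\<not> s, l @ Pr s # drop (Suc j) (snd (L ! m)) @ Pr (fst (L ! m)) # take j (snd (L ! m))) # take m L @ drop (Suc m) L)"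
          then consider "h = (\<not> s, l @ Pr s # drop (Suc j) (snd (L ! m)) @ Pr (fst (L ! m)) # take j (snd (L ! m)))"
            | "h \<in> set (take m L)" | "h \<in> set (drop (Suc m) L)" by (metis set_ConsD Un_iff set_append)
          then show "case h of (\<kappa>, l) \<Rightarrow> set l \<subseteq> letters N"
          proof cases
            case 1 then show ?thesis using new by (simp only: prod.case)
          next
            case 2 then show ?thesis using L in_set_takeD by fast
          next
            case 3 then show ?thesis using L in_set_dropD by fast
          qed
        qed
        then show ?thesis using N by (rule integrable_TP)
      qed
      then show ?thesis unfolding merge_sum_def[abs_def]
        by (intro Bochner_Integration.integrable_sum integrable_If Bochner_Integration.integrable_divide) (auto simp del: TP_simps)
    qed
    ultimately show ?thesis by simp
  qed
  finally show ?thesis by (simp add: field_simps)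
qed

end

section \<open>Limits of loop equations\<close>

text \<open>Merging two words removes two matrices and inserts two projections, so the induction along the loop
  equations terminates only if matrices weigh more than projections.\<close>

fun letter_weight :: "letter \<Rightarrow> nat" where
  "letter_weight (Pr \<kappa>) = 1"
| "letter_weight (Ge i s) = 2"

definition word_weight :: "letter list \<Rightarrow> nat" where
  "word_weight l = sum_list (map letter_weight l)"

definition words_weight :: "(bool \<times> letter list) list \<Rightarrow> nat" where
  "words_weight L = sum_list (map (\<lambda>h. Suc (word_weight (snd h))) L)"

lemma word_weight_split: "j < length l \<Longrightarrow> word_weight l = word_weight (take j l) + letter_weight (l ! j) + word_weight (drop (Suc j) l)"
  unfolding word_weight_def by (subst id_take_nth_drop[of j l]) simp_all

lemma words_weight_split: "m < length L \<Longrightarrow> words_weight L = words_weight (take m L @ drop (Suc m) L) + Suc (word_weight (snd (L ! m)))"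
  unfolding words_weight_def by (subst id_take_nth_drop[of m L]) simp_all

definition lvalid :: "nat \<Rightarrow> (bool \<times> letter list) list \<Rightarrow> bool" where
  "lvalid N L \<longleftrightarrow> (\<forall>(\<kappa>, l)\<in>set L. set l \<subseteq> letters N)"

lemma lvalid_simps [simp]: "lvalid N []" "lvalid N ((\<kappa>, l) # L) \<longleftrightarrow> set l \<subseteq> letters N \<and> lvalid N L"
  by (auto simp: lvalid_def)

lemma Pr_letters [simp]: "Pr \<kappa> \<in> letters N" by (auto simp: letters_def)

lemma lvalid_remove: "lvalid N L \<Longrightarrow> lvalid N (take m L @ drop (Suc m) L)"
  unfolding lvalid_def set_append by (meson Un_iff in_set_takeD in_set_dropD)

lemma lvalid_nth: "lvalid N L \<Longrightarrow> m < length L \<Longrightarrow> set (snd (L ! m)) \<subseteq> letters N"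
  unfolding lvalid_def by (drule bspec[OF _ nth_mem]) (auto simp: case_prod_beta)

lemma set_take_letters: "set l \<subseteq> letters N \<Longrightarrow> set (take j l) \<subseteq> letters N"
  by (meson order_trans set_take_subset)

lemma set_drop_letters: "set l \<subseteq> letters N \<Longrightarrow> set (drop j l) \<subseteq> letters N"
  by (meson order_trans set_drop_subset)

definition schwinger_dyson :: "nat \<Rightarrow> (nat \<Rightarrow> bool \<Rightarrow> complex) \<Rightarrow> (bool \<Rightarrow> letter list \<Rightarrow> complex) \<Rightarrow> bool" where
  "schwinger_dyson N c t \<longleftrightarrow> (\<forall>\<kappa>. t \<kappa> [] = 1) \<and>
     (\<forall>\<kappa> \<kappa>' l. set l \<subseteq> letters N \<longrightarrow> t \<kappa> (Pr \<kappa>' # l) = (if \<kappa> = \<kappa>' then t \<kappa> l else 0)) \<and>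
     (\<forall>i\<in>{1..N}. \<forall>s l. set l \<subseteq> letters N \<longrightarrow> t (\<not> s) (Ge i s # l) = 0 \<and>
       t s (Ge i s # l) = c i s * (\<Sum>j<length l. if l ! j = Ge i (\<not> s) then t (\<not> s) (take j l) * t s (drop (Suc j) l) else 0))"

lemma schwinger_dyson_limit:
  fixes \<Phi> :: "nat \<Rightarrow> (bool \<times> letter list) list \<Rightarrow> complex"
  assumes t: "schwinger_dyson N c t"
    and nil: "\<forall>\<^sub>F n in sequentially. \<Phi> n [] = 1"
    and emp: "\<And>\<kappa> L. lvalid N L \<Longrightarrow> \<forall>\<^sub>F n in sequentially. \<Phi> n ((\<kappa>, []) # L) = \<Phi> n L"
    and pr: "\<And>\<kappa> \<kappa>' l L. lvalid N ((\<kappa>, l) # L) \<Longrightarrow>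
      \<forall>\<^sub>F n in sequentially. \<Phi> n ((\<kappa>, Pr \<kappa>' # l) # L) = (if \<kappa> = \<kappa>' then \<Phi> n ((\<kappa>, l) # L) else 0)"
    and off: "\<And>s i l L. lvalid N ((s, l) # L) \<Longrightarrow> i \<in> {1..N} \<Longrightarrow> \<forall>\<^sub>F n in sequentially. \<Phi> n ((\<not> s, Ge i s # l) # L) = 0"
    and loop: "\<And>s i l L. lvalid N ((s, l) # L) \<Longrightarrow> i \<in> {1..N} \<Longrightarrow>
      \<forall>\<^sub>F n in sequentially. \<Phi> n ((s, Ge i s # l) # L) =
        C n i s * (\<Sum>j<length l. if l ! j = Ge i (\<not> s) then \<Phi> n ((\<not> s, take j l) # (s, drop (Suc j) l) # L) else 0) +
        (\<Sum>m<length L. \<Sum>j<length (snd (L ! m)). if snd (L ! m) ! j = Ge i (\<not> s) then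
          B n i s (fst (L ! m)) * \<Phi> n ((\<not> s, l @ Pr s # drop (Suc j) (snd (L ! m)) @ Pr (fst (L ! m)) # take j (snd (L ! m))) # take m L @ drop (Suc m) L)
          else 0)"
    and C: "\<And>i s. i \<in> {1..N} \<Longrightarrow> (\<lambda>n. C n i s) \<longlonglongrightarrow> c i s"
    and B: "\<And>i s \<kappa>. i \<in> {1..N} \<Longrightarrow> (\<lambda>n. B n i s \<kappa>) \<longlonglongrightarrow> 0"
    and L: "lvalid N L"
  shows "(\<lambda>n. \<Phi> n L) \<longlonglongrightarrow> prod_list (map (\<lambda>(\<kappa>, l). t \<kappa> l) L)"
  using L
proof (induction "words_weight L" arbitrary: L rule: less_induct)
  case less
  let ?p = "\<lambda>L. prod_list (map (\<lambda>(\<kappa>, l). t \<kappa> l) L)"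
  have tr: "(\<lambda>n. \<Phi> n L) \<longlonglongrightarrow> x" if "\<forall>\<^sub>F n in sequentially. \<Phi> n L = f n" "f \<longlonglongrightarrow> x" for f L x
    using that by (simp add: tendsto_cong)
  consider "L = []" | \<kappa> L' where "L = (\<kappa>, []) # L'" | \<kappa> \<kappa>' l L' where "L = (\<kappa>, Pr \<kappa>' # l) # L'"
    | \<kappa> i s l L' where "L = (\<kappa>, Ge i s # l) # L'"
    by (metis letter.exhaust list.exhaust prod.exhaust)
  then show ?case
  proof cases
    case 1
    then show ?thesis using tr[OF nil tendsto_const] by simp
  next
    case 2
    have "(\<lambda>n. \<Phi> n L') \<longlonglongrightarrow> ?p L'"
      using less.prems 2 by (intro less.hyps) (auto simp: words_weight_def)
    then show ?thesis using tr[OF emp, of L' _ \<kappa>] t less.prems 2 by (simp add: schwinger_dyson_def)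
  next
    case 3
    have v: "lvalid N ((\<kappa>, l) # L')" using less.prems 3 by auto
    have "(\<lambda>n. \<Phi> n ((\<kappa>, l) # L')) \<longlonglongrightarrow> ?p ((\<kappa>, l) # L')"
      using v 3 by (intro less.hyps) (auto simp: words_weight_def word_weight_def)
    then have "(\<lambda>n. if \<kappa> = \<kappa>' then \<Phi> n ((\<kappa>, l) # L') else 0) \<longlonglongrightarrow> (if \<kappa> = \<kappa>' then ?p ((\<kappa>, l) # L') else 0)"
      by auto
    from tr[OF pr[OF v] this] have "(\<lambda>n. \<Phi> n L) \<longlonglongrightarrow> (if \<kappa> = \<kappa>' then ?p ((\<kappa>, l) # L') else 0)"
      using 3 by simp
    moreover have "(if \<kappa> = \<kappa>' then ?p ((\<kappa>, l) # L') else 0) = ?p L"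
      using t v unfolding 3 by (simp add: schwinger_dyson_def)
    ultimately show ?thesis by simp
  next
    case 4
    have v: "lvalid N ((s, l) # L')" and i: "i \<in> {1..N}" using less.prems 4 by (auto simp: letters_def)
    show ?thesis
    proof (cases "\<kappa> = s")
      case False
      then have \<kappa>: "\<kappa> = (\<not> s)" by auto
      then have z: "?p L = 0" using t v i unfolding 4 by (simp add: schwinger_dyson_def)
      show ?thesis unfolding z using tr[OF off[OF v i] tendsto_const] 4 \<kappa> by simp
    next
      case True
      have sz: "words_weight L = word_weight l + 3 + words_weight L'" using 4 by (simp add: words_weight_def word_weight_def)
      have a: "(\<lambda>n. \<Phi> n ((\<not> s, take j l) # (s, drop (Suc j) l) # L')) \<longlonglongrightarrow> t (\<not> s) (take j l) * t s (drop (Suc j) l) * ?p L'"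
        if j: "j < length l" "l ! j = Ge i (\<not> s)" for j
      proof -
        have "(\<lambda>n. \<Phi> n ((\<not> s, take j l) # (s, drop (Suc j) l) # L')) \<longlonglongrightarrow> ?p ((\<not> s, take j l) # (s, drop (Suc j) l) # L')"
        proof (rule less.hyps)
          show "words_weight ((\<not> s, take j l) # (s, drop (Suc j) l) # L') < words_weight L"
            using sz word_weight_split[OF j(1)] j(2) by (simp add: words_weight_def)
          show "lvalid N ((\<not> s, take j l) # (s, drop (Suc j) l) # L')"
            using v set_take_letters set_drop_letters by (simp add: lvalid_simps)
        qed
        then show ?thesis by (simp add: mult.assoc)
      qed
      have b: "(\<lambda>n. B n i s (fst (L' ! m)) * \<Phi> n ((\<not> s, l @ Pr s # drop (Suc j) (snd (L' ! m)) @ Pr (fst (L' ! m)) # take j (snd (L' ! m))) # take m L' @ drop (Suc m) L')) \<longlonglongrightarrow> 0"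
        if m: "m < length L'" and j: "j < length (snd (L' ! m))" "snd (L' ! m) ! j = Ge i (\<not> s)" for m j
      proof -
        let ?K = "(\<not> s, l @ Pr s # drop (Suc j) (snd (L' ! m)) @ Pr (fst (L' ! m)) # take j (snd (L' ! m))) # take m L' @ drop (Suc m) L'"
        have v': "lvalid N L'" "set l \<subseteq> letters N" using v by auto
        have "words_weight ?K < words_weight L"
          using sz word_weight_split[OF j(1)] j(2) words_weight_split[OF m] by (simp add: words_weight_def word_weight_def)
        moreover have "lvalid N ?K"
          using v' lvalid_remove[OF v'(1), of m] set_take_letters[OF lvalid_nth[OF v'(1) m]] set_drop_letters[OF lvalid_nth[OF v'(1) m]]
          by simp
        ultimately have "(\<lambda>n. \<Phi> n ?K) \<longlonglongrightarrow> ?p ?K" by (rule less.hyps)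
        from tendsto_mult[OF B[OF i] this] show ?thesis by simp
      qed
      have "(\<lambda>n. C n i s * (\<Sum>j<length l. if l ! j = Ge i (\<not> s) then \<Phi> n ((\<not> s, take j l) # (s, drop (Suc j) l) # L') else 0) +
        (\<Sum>m<length L'. \<Sum>j<length (snd (L' ! m)). if snd (L' ! m) ! j = Ge i (\<not> s) then
          B n i s (fst (L' ! m)) * \<Phi> n ((\<not> s, l @ Pr s # drop (Suc j) (snd (L' ! m)) @ Pr (fst (L' ! m)) # take j (snd (L' ! m))) # take m L' @ drop (Suc m) L')
          else 0)) \<longlonglongrightarrow>
        c i s * (\<Sum>j<length l. if l ! j = Ge i (\<not> s) then t (\<not> s) (take j l) * t s (drop (Suc j) l) * ?p L' else 0) + (\<Sum>m<length L'. \<Sum>j<length (snd (L' ! m)). 0)"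
      proof (intro tendsto_add tendsto_mult C[OF i] tendsto_sum)
        fix j assume j: "j \<in> {..<length l}"
        show "(\<lambda>n. if l ! j = Ge i (\<not> s) then \<Phi> n ((\<not> s, take j l) # (s, drop (Suc j) l) # L') else 0) \<longlonglongrightarrow>
          (if l ! j = Ge i (\<not> s) then t (\<not> s) (take j l) * t s (drop (Suc j) l) * ?p L' else 0)"
          using a[of j] j by (cases "l ! j = Ge i (\<not> s)") auto
      next
        fix m j assume m: "m \<in> {..<length L'}" and j: "j \<in> {..<length (snd (L' ! m))}"
        show "(\<lambda>n. if snd (L' ! m) ! j = Ge i (\<not> s) then
          B n i s (fst (L' ! m)) * \<Phi> n ((\<not> s, l @ Pr s # drop (Suc j) (snd (L' ! m)) @ Pr (fst (L' ! m)) # take j (snd (L' ! m))) # take m L' @ drop (Suc m) L')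
          else 0) \<longlonglongrightarrow> 0"
          using b[of m j] m j by (cases "snd (L' ! m) ! j = Ge i (\<not> s)") auto
      qed
      from tr[OF loop[OF v i] this] have "(\<lambda>n. \<Phi> n L) \<longlonglongrightarrow>
        c i s * (\<Sum>j<length l. if l ! j = Ge i (\<not> s) then t (\<not> s) (take j l) * t s (drop (Suc j) l) * ?p L' else 0)"
        using 4 True by simp
      also have "c i s * (\<Sum>j<length l. if l ! j = Ge i (\<not> s) then t (\<not> s) (take j l) * t s (drop (Suc j) l) * ?p L' else 0) = ?p L"
      proof -
        have "(\<Sum>j<length l. if l ! j = Ge i (\<not> s) then t (\<not> s) (take j l) * t s (drop (Suc j) l) * ?p L' else 0) =
          (\<Sum>j<length l. if l ! j = Ge i (\<not> s) then t (\<not> s) (take j l) * t s (drop (Suc j) l) else 0) * ?p L'"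
          unfolding sum_distrib_right by (intro sum.cong) auto
        then show ?thesis using t v i unfolding 4 True by (simp add: schwinger_dyson_def)
      qed
      finally show ?thesis .
    qed
  qed
qed

section \<open>Moments of the Marchenko-Pastur distribution\<close>

lemma fps_linear_ode_unique:
  fixes D :: "real fps"
  assumes ode: "Q * fps_deriv D = R * D" and Q: "fps_nth Q 0 = 1" and D: "fps_nth D 0 = 0"
  shows "D = 0"
proof -
  have "fps_nth D n = 0" for n
  proof (induction n rule: less_induct)
    case (less n)
    show ?case
    proof (cases n)
      case 0 then show ?thesis using D by simp
    next
      case (Suc m)
      have "fps_nth (Q * fps_deriv D) m = (\<Sum>i=0..m. fps_nth Q i * fps_nth (fps_deriv D) (m - i))" by (rule fps_mult_nth)
      also have "\<dots> = fps_nth Q 0 * fps_nth (fps_deriv D) m + (\<Sum>i=1..m. fps_nth Q i * fps_nth (fps_deriv D) (m - i))"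
        by (simp add: sum.atLeast_Suc_atMost)
      also have "(\<Sum>i=1..m. fps_nth Q i * fps_nth (fps_deriv D) (m - i)) = 0"
        using Suc by (intro sum.neutral) (auto intro!: less.IH)
      finally have "real (Suc m) * fps_nth D (Suc m) = fps_nth (R * D) m" using ode Q by simp
      also have "fps_nth (R * D) m = 0"
        unfolding fps_mult_nth using Suc by (intro sum.neutral) (auto intro!: less.IH)
      finally show ?thesis using Suc by simp
    qed
  qed
  then show ?thesis by (simp add: fps_eq_iff)
qed

lemma quadratic_recurrence_of_linear:
  fixes u :: "nat \<Rightarrow> real"
  assumes u0: "u 0 = 1" and u1: "u 1 = g"
    and rec: "\<And>r. r \<ge> 1 \<Longrightarrow> (real r + 2) * u (Suc r) = (2 * real r + 1) * (1 + g) * u r - (real r - 1) * (g - 1)\<^sup>2 * u (r - 1)"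
  shows "u (Suc r) = (g - 1) * u r + (\<Sum>j\<le>r. u j * u (r - j))"
proof -
  define M where "M = Abs_fps u"
  define S where "S = 1 - fps_const (g - 1) * fps_X - 2 * fps_X * M"
  define Q where "Q = 1 - fps_const (2 * (g + 1)) * fps_X + fps_const ((g - 1)\<^sup>2) * fps_X\<^sup>2"
  define R where "R = fps_const ((g - 1)\<^sup>2) * fps_X - fps_const (g + 1)"
  have Q': "fps_deriv Q = 2 * R"
    by (simp add: Q_def R_def fps_eq_iff power2_eq_square algebra_simps numeral_fps_const)
  have S0: "fps_nth S 0 = 1" by (simp add: S_def)
  have S1: "fps_nth S (Suc 0) = - (g + 1)" by (simp add: S_def M_def u0 mult.assoc numeral_fps_const)
  have S2: "fps_nth S (Suc (Suc r)) = - 2 * u (Suc r)" for r by (simp add: S_def M_def mult.assoc numeral_fps_const)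
  have "Q * fps_deriv S = R * S"
  proof (rule fps_ext)
    fix n
    have gen: "fps_nth (Q * D) n = fps_nth D n - 2 * (g + 1) * (if n = 0 then 0 else fps_nth D (n - 1))
       + (g - 1)\<^sup>2 * (if n < 2 then 0 else fps_nth D (n - 2))" for D :: "real fps"
      unfolding Q_def by (simp add: ring_distribs mult.assoc fps_X_power_mult_nth) 
    have l: "fps_nth (Q * fps_deriv S) n = real (Suc n) * fps_nth S (Suc n) - 2 * (g + 1) * (if n = 0 then 0 else real n * fps_nth S n)
       + (g - 1)\<^sup>2 * (if n < 2 then 0 else real (n - 1) * fps_nth S (n - 1))"
      unfolding gen by (cases n; cases "n - 1") auto
    have r: "fps_nth (R * S) n = (g - 1)\<^sup>2 * (if n = 0 then 0 else fps_nth S (n - 1)) - (g + 1) * fps_nth S n"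
      by (auto simp: R_def algebra_simps mult.assoc)
    consider "n = 0" | "n = 1" | "n = 2" | r where "n = Suc (Suc (Suc r))"
      by (metis One_nat_def Suc_1 not0_implies_Suc)
    then show "fps_nth (Q * fps_deriv S) n = fps_nth (R * S) n"
    proof cases
      case 1 then show ?thesis unfolding l r by (simp add: S0 S1)
    next
      case 2 then show ?thesis unfolding l r
        using S2[of 0] u1 by (simp add: S0 S1 power2_eq_square numeral_2_eq_2 algebra_simps)
    next
      case 3
      have "3 * u 2 = 3 * (1 + g) * u 1" using rec[of 1] by (simp add: numeral_2_eq_2)
      then show ?thesis unfolding l r unfolding 3
        using S2[of 0] S2[of 1] u1 by (simp add: S1 numeral_2_eq_2 algebra_simps)
    next
      case 4
      have "(real r + 4) * u (r + 3) = (2 * real r + 5) * (1 + g) * u (r + 2) - (real r + 1) * (g - 1)\<^sup>2 * u (r + 1)"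
        using rec[of "r + 2"] by (simp add: numeral_3_eq_3 numeral_2_eq_2 algebra_simps)
      then show ?thesis unfolding l r unfolding 4
        using S2[of r] S2[of "Suc r"] S2[of "Suc (Suc r)"]
        by (simp add: numeral_3_eq_3 numeral_2_eq_2 algebra_simps)
    qed
  qed
  then have ode: "Q * fps_deriv S = R * S" .
  have "S\<^sup>2 - Q = 0"
  proof (rule fps_linear_ode_unique)
    have "Q * fps_deriv (S\<^sup>2 - Q) = 2 * S * (Q * fps_deriv S) - Q * (2 * R)"
      by (simp add: Q' power2_eq_square algebra_simps)
    also have "\<dots> = (2 * R) * (S\<^sup>2 - Q)" unfolding ode by (simp add: power2_eq_square algebra_simps)
    finally show "Q * fps_deriv (S\<^sup>2 - Q) = (2 * R) * (S\<^sup>2 - Q)" .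
    show "fps_nth Q 0 = 1" by (simp add: Q_def)
    then show "fps_nth (S\<^sup>2 - Q) 0 = 0" by (simp add: S0 power2_eq_square)
  qed
  moreover have "S\<^sup>2 - Q = 4 * fps_X * (1 + fps_const (g - 1) * fps_X * M + fps_X * M\<^sup>2 - M)"
  proof -
    have c: "fps_const (2 * (g + 1)) = 2 * fps_const (g - 1) + (4 :: real fps)" "fps_const ((g - 1)\<^sup>2) = fps_const (g - 1) * fps_const (g - 1)"
      by (simp_all add: numeral_fps_const power2_eq_square algebra_simps)
    show ?thesis unfolding S_def Q_def c by (simp add: power2_eq_square algebra_simps)
  qed
  ultimately have "4 * fps_X * (1 + fps_const (g - 1) * fps_X * M + fps_X * M\<^sup>2 - M) = 0" by simp
  then have "1 + fps_const (g - 1) * fps_X * M + fps_X * M\<^sup>2 - M = 0" by simp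
  then have eq: "M = 1 + fps_const (g - 1) * (fps_X * M) + fps_X * (M * M)" by (simp add: power2_eq_square algebra_simps)
  have "fps_nth M (Suc r) = fps_nth (1 + fps_const (g - 1) * (fps_X * M) + fps_X * (M * M)) (Suc r)" using eq by simp
  also have "\<dots> = (g - 1) * u r + (\<Sum>j=0..r. u j * u (r - j))"
    by (simp add: M_def fps_mult_nth[of "Abs_fps u" "Abs_fps u"])
  finally show ?thesis by (simp add: M_def atMost_atLeast0)
qed

definition mp_int :: "real \<Rightarrow> nat \<Rightarrow> real" where
  "mp_int g m = integral {(1 - sqrt g)\<^sup>2..(1 + sqrt g)\<^sup>2} (\<lambda>x. x ^ m * sqrt (4 * g - (x - 1 - g)\<^sup>2))"

lemma mp_factor:
  assumes "g \<ge> 0"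
  shows "4 * g - (x - 1 - g)\<^sup>2 = (x - (1 - sqrt g)\<^sup>2) * ((1 + sqrt g)\<^sup>2 - x)"
proof -
  define h where "h = sqrt g"
  have "g = h * h" using assms by (simp add: h_def)
  then show ?thesis unfolding h_def[symmetric] by (simp add: power2_eq_square algebra_simps)
qed

lemma DERIV_sqrt_mp:
  assumes q: "4 * g - (x - 1 - g)\<^sup>2 > 0"
  shows "((\<lambda>x. sqrt (4 * g - (x - 1 - g)\<^sup>2)) has_real_derivative (- (x - 1 - g) / sqrt (4 * g - (x - 1 - g)\<^sup>2))) (at x)"
proof -
  have d: "((\<lambda>x. 4 * g - (x - 1 - g)\<^sup>2) has_real_derivative (- 2 * (x - 1 - g))) (at x)"
    by (rule derivative_eq_intros refl)+ simp
  have e: "inverse S / 2 * (- 2 * y) = - y / S" for S y :: real by (cases "S = 0") (auto simp: field_simps)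
  have "((\<lambda>x. sqrt (4 * g - (x - 1 - g)\<^sup>2)) has_real_derivative inverse (sqrt (4 * g - (x - 1 - g)\<^sup>2)) / 2 * (- 2 * (x - 1 - g))) (at x)"
    by (rule DERIV_chain2[where f = sqrt and g = "\<lambda>x. 4 * g - (x - 1 - g)\<^sup>2" and x = x, OF DERIV_real_sqrt[OF q] d])
  then show ?thesis unfolding e .
qed

lemma mp_int_rec:
  assumes g: "g \<ge> 1"
  shows "(real m + 3) * mp_int g (Suc m) = (2 * real m + 3) * (1 + g) * mp_int g m - real m * (g - 1)\<^sup>2 * mp_int g (m - 1)"
proof -
  let ?a = "(1 - sqrt g)\<^sup>2" and ?b = "(1 + sqrt g)\<^sup>2"
  let ?q = "\<lambda>x. 4 * g - (x - 1 - g)\<^sup>2"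
  let ?s = "\<lambda>x. sqrt (?q x)"
  have ab: "?a \<le> ?b" using g by (simp add: power2_eq_square algebra_simps)
  have end0: "?q ?a = 0" "?q ?b = 0" using mp_factor[of g] g by auto
  have pos: "?q x > 0" if "x \<in> {?a<..<?b}" for x
    using that g by (subst mp_factor) auto
  let ?F = "\<lambda>x. x ^ m * (?q x * ?s x)"
  let ?f = "\<lambda>x. (real m * x ^ (m - 1) * ?q x - 3 * x ^ m * (x - 1 - g)) * ?s x"
  have "(?f has_integral (?F ?b - ?F ?a)) {?a..?b}"
  proof (rule fundamental_theorem_of_calculus_interior[OF ab])
    show "continuous_on {?a..?b} ?F" by (intro continuous_intros)
    fix x assume x: "x \<in> {?a<..<?b}"
    have s: "?s x \<noteq> 0" "?s x * ?s x = ?q x" using pos[OF x] by auto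
    have d: "((\<lambda>x. ?q x) has_real_derivative (- 2 * (x - 1 - g))) (at x)"
      by (rule derivative_eq_intros refl)+ simp
    have ds: "((\<lambda>x. ?s x) has_real_derivative (- (x - 1 - g) / ?s x)) (at x)"
      by (rule DERIV_sqrt_mp[OF pos[OF x]])
    have dp: "((\<lambda>x. x ^ m) has_real_derivative (real m * x ^ (m - 1))) (at x)"
      by (auto intro!: derivative_eq_intros)
    have 1: "((\<lambda>x. ?q x * ?s x) has_real_derivative (- 2 * (x - 1 - g)) * ?s x + (- (x - 1 - g) / ?s x) * ?q x) (at x)"
      by (rule DERIV_mult[OF d ds])
    have "(?F has_real_derivative (real m * x ^ (m - 1)) * (?q x * ?s x) + ((- 2 * (x - 1 - g)) * ?s x + (- (x - 1 - g) / ?s x) * ?q x) * x ^ m) (at x)"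
      by (rule DERIV_mult[OF dp 1])
    moreover have "(- (x - 1 - g) / ?s x) * ?q x = - (x - 1 - g) * ?s x"
    proof -
      have "a / S * Q = a * S" if "S \<noteq> 0" "S * S = Q" for a S Q :: real using that by auto
      from this[OF s] show ?thesis .
    qed
    moreover have "a * (Q * S) + ((- 2 * y) * S + w) * p = (a * Q - 3 * p * y) * S" if "w = - y * S" for a Q S y w p :: real
      unfolding that by (simp add: algebra_simps)
    ultimately have "(?F has_real_derivative ?f x) (at x)" by metis
    then show "(?F has_vector_derivative ?f x) (at x)" by (simp add: has_real_derivative_iff_has_vector_derivative)
  qed
  then have "integral {?a..?b} ?f = 0" unfolding end0 by (simp add: integral_unique)
  moreover have "integral {?a..?b} ?f = - (real m + 3) * mp_int g (Suc m) + (2 * real m + 3) * (1 + g) * mp_int g m - real m * (g - 1)\<^sup>2 * mp_int g (m - 1)"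
  proof -
    have i: "(\<lambda>x. x ^ k * ?s x) integrable_on {?a..?b}" for k
      by (intro integrable_continuous_real continuous_intros)
    have "?f = (\<lambda>x. (- (real m + 3)) * (x ^ Suc m * ?s x) + ((2 * real m + 3) * (1 + g)) * (x ^ m * ?s x) + (- (real m * (g - 1)\<^sup>2)) * (x ^ (m - 1) * ?s x))"
      by (cases m) (auto simp: fun_eq_iff power2_eq_square algebra_simps)
    then have "(?f has_integral ((- (real m + 3)) * mp_int g (Suc m) + ((2 * real m + 3) * (1 + g)) * mp_int g m + (- (real m * (g - 1)\<^sup>2)) * mp_int g (m - 1))) {?a..?b}"
      unfolding mp_int_def by (simp only:) (intro has_integral_add has_integral_mult_right integrable_integral i)
    then show ?thesis by (simp add: integral_unique)
  qed
  ultimately show ?thesis by (simp add: algebra_simps)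
qed

lemma mp_int_0:
  assumes g: "g \<ge> 1"
  shows "mp_int g 0 = 2 * pi * g"
proof -
  let ?a = "(1 - sqrt g)\<^sup>2" and ?b = "(1 + sqrt g)\<^sup>2"
  let ?r = "2 * sqrt g"
  have r: "?r > 0" "?r\<^sup>2 = 4 * g" using g by (auto simp: power_mult_distrib)
  have ab: "?a = 1 + g - ?r" "?b = 1 + g + ?r" using g by (auto simp: power2_eq_square algebra_simps)
  let ?F = "\<lambda>x. ((x - 1 - g) * sqrt (4 * g - (x - 1 - g)\<^sup>2) + 4 * g * arcsin ((x - 1 - g) / ?r)) / 2"
  have "((\<lambda>x. sqrt (4 * g - (x - 1 - g)\<^sup>2)) has_integral (?F ?b - ?F ?a)) {?a..?b}"
  proof (rule fundamental_theorem_of_calculus_interior)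
    show "?a \<le> ?b" unfolding ab using r by simp
    have "\<And>x. x \<in> {?a..?b} \<Longrightarrow> -1 \<le> (x - 1 - g) / ?r \<and> (x - 1 - g) / ?r \<le> 1"
      unfolding ab using r by (simp add: field_simps)
    then show "continuous_on {?a..?b} ?F"
      using r by (intro continuous_intros) auto
    fix x assume x: "x \<in> {?a<..<?b}"
    define y where "y = x - 1 - g"
    have y: "-?r < y" "y < ?r" using x unfolding ab y_def by auto
    have "\<bar>y\<bar> < ?r" using y by linarith
    then have "\<bar>y\<bar>\<^sup>2 < ?r\<^sup>2" by (intro power_strict_mono) auto
    then have y2: "y\<^sup>2 < 4 * g" using r by simp
    have s: "sqrt (4 * g - y\<^sup>2) > 0" "sqrt (4 * g - y\<^sup>2) * sqrt (4 * g - y\<^sup>2) = 4 * g - y\<^sup>2" using y2 by auto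
    show "(?F has_vector_derivative sqrt (4 * g - (x - 1 - g)\<^sup>2)) (at x)"
    proof -
      have d: "((\<lambda>x. x - 1 - g) has_real_derivative 1) (at x)" by (auto intro!: derivative_eq_intros)
      have "4 * g - (x - 1 - g)\<^sup>2 > 0" using y2 by (simp add: y_def)
      then have ds: "((\<lambda>x. sqrt (4 * g - (x - 1 - g)\<^sup>2)) has_real_derivative (- y / sqrt (4 * g - y\<^sup>2))) (at x)"
        unfolding y_def by (rule DERIV_sqrt_mp)
      have "-1 < (x - 1 - g) / ?r" "(x - 1 - g) / ?r < 1" using y r by (simp_all add: y_def field_simps)
      then have a: "(arcsin has_real_derivative inverse (sqrt (1 - ((x - 1 - g) / ?r)\<^sup>2))) (at ((x - 1 - g) / ?r))"
        by (rule DERIV_arcsin)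
      have "((\<lambda>x. (x - 1 - g) / ?r) has_real_derivative 1 / ?r) (at x)" using d by (rule DERIV_cdivide)
      from DERIV_chain2[where f = arcsin and g = "\<lambda>x. (x - 1 - g) / ?r" and x = x, OF a this]
      have da: "((\<lambda>x. arcsin ((x - 1 - g) / ?r)) has_real_derivative (inverse (sqrt (1 - (y / ?r)\<^sup>2)) * (1 / ?r))) (at x)"
        by (simp add: y_def)
      have "1 - (y / ?r)\<^sup>2 = (4 * g - y\<^sup>2) / ?r\<^sup>2" using r by (simp add: power_divide diff_divide_distrib)
      then have "sqrt (1 - (y / ?r)\<^sup>2) = sqrt (4 * g - y\<^sup>2) / ?r" using r by (simp add: real_sqrt_divide real_sqrt_mult)
      then have da': "((\<lambda>x. arcsin ((x - 1 - g) / ?r)) has_real_derivative (1 / sqrt (4 * g - y\<^sup>2))) (at x)"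
        using da r by simp
      have "(?F has_real_derivative ((y * (- y / sqrt (4 * g - y\<^sup>2)) + 1 * sqrt (4 * g - y\<^sup>2) + 4 * g * (1 / sqrt (4 * g - y\<^sup>2))) / 2)) (at x)"
      proof -
        have 1: "((\<lambda>x. (x - 1 - g) * sqrt (4 * g - (x - 1 - g)\<^sup>2)) has_real_derivative y * (- y / sqrt (4 * g - y\<^sup>2)) + 1 * sqrt (4 * g - y\<^sup>2)) (at x)"
          by (rule DERIV_cong[OF DERIV_mult[OF d ds]]) (simp add: y_def mult.commute)
        have 2: "((\<lambda>x. 4 * g * arcsin ((x - 1 - g) / ?r)) has_real_derivative 4 * g * (1 / sqrt (4 * g - y\<^sup>2))) (at x)"
          by (rule DERIV_cmult[OF da'])
        show ?thesis by (rule DERIV_cdivide[OF DERIV_add[OF 1 2]])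
      qed
      also have "(y * (- y / sqrt (4 * g - y\<^sup>2)) + 1 * sqrt (4 * g - y\<^sup>2) + 4 * g * (1 / sqrt (4 * g - y\<^sup>2))) / 2 = sqrt (4 * g - y\<^sup>2)"
        using s by (simp add: field_simps power2_eq_square)
      finally show ?thesis by (simp add: y_def has_real_derivative_iff_has_vector_derivative)
    qed
  qed
  then have "integral {?a..?b} (\<lambda>x. sqrt (4 * g - (x - 1 - g)\<^sup>2)) = ?F ?b - ?F ?a" by (rule integral_unique)
  also have "\<dots> = 2 * pi * g"
    unfolding ab using r g by (simp add: power2_eq_square field_simps)
  finally show ?thesis by (simp add: mp_int_def)
qed

lemma integral_marchenko_pastur:
  assumes g: "g \<ge> 1"
  shows "(\<integral>t. t ^ Suc m \<partial>marchenko_pastur g) = mp_int g m / (2 * pi)"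
proof -
  let ?I = "{(1 - sqrt g)\<^sup>2..(1 + sqrt g)\<^sup>2}"
  let ?s = "\<lambda>x. sqrt (4 * g - (x - 1 - g)\<^sup>2)"
  have nn: "0 \<le> marchenko_pastur_density g x" for x
  proof (cases "x \<in> ?I")
    case True
    then have "0 \<le> x" by (meson atLeastAtMost_iff order_trans zero_le_power2)
    moreover have "0 \<le> 4 * g - (x - 1 - g)\<^sup>2" using True g by (subst mp_factor) auto
    ultimately show ?thesis by (auto simp: marchenko_pastur_density_def)
  qed (auto simp: marchenko_pastur_density_def)
  have msr: "marchenko_pastur_density g \<in> borel_measurable borel"
    unfolding marchenko_pastur_density_def[abs_def] by measurable
  have "(\<integral>t. t ^ Suc m \<partial>marchenko_pastur g) = (\<integral>t. marchenko_pastur_density g t * t ^ Suc m \<partial>lborel)"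
    unfolding marchenko_pastur_def using nn msr by (subst integral_density) auto
  also have "(\<lambda>t. marchenko_pastur_density g t * t ^ Suc m) = (\<lambda>t. indicator ?I t *\<^sub>R ((t ^ m * ?s t) / (2 * pi)))"
  proof
    fix t
    show "marchenko_pastur_density g t * t ^ Suc m = indicator ?I t *\<^sub>R ((t ^ m * ?s t) / (2 * pi))"
    proof (cases "t = 0")
      case True
      have "0 \<in> ?I \<Longrightarrow> 4 * g - (0 - 1 - g)\<^sup>2 = 0" using g by (subst mp_factor) auto
      then show ?thesis using True by (auto simp: indicator_def)
    qed (auto simp: marchenko_pastur_density_def indicator_def)
  qed
  also have "(\<integral>t. indicator ?I t *\<^sub>R ((t ^ m * ?s t) / (2 * pi)) \<partial>lborel) = integral ?I (\<lambda>t. (t ^ m * ?s t) / (2 * pi))"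
  proof -
    have "set_integrable lborel ?I (\<lambda>t. (t ^ m * ?s t) / (2 * pi))"
      by (intro borel_integrable_atLeastAtMost' continuous_intros) auto
    from set_borel_integral_eq_integral(2)[OF this] show ?thesis unfolding set_lebesgue_integral_def .
  qed
  also have "\<dots> = mp_int g m / (2 * pi)" by (simp add: mp_int_def)
  finally show ?thesis .
qed

text \<open>The zeroth moment is replaced by its value \<open>1\<close>, so that normalisation of the density is not used.\<close>

definition mp_moment :: "real \<Rightarrow> nat \<Rightarrow> real" where
  "mp_moment g r = (if r = 0 then 1 else (\<integral>t. t ^ r \<partial>marchenko_pastur g))"

lemma mp_moment_rec:
  assumes g: "g \<ge> 1"
  shows "mp_moment g (Suc r) = (g - 1) * mp_moment g r + (\<Sum>j\<le>r. mp_moment g j * mp_moment g (r - j))"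
proof (rule quadratic_recurrence_of_linear)
  have S: "mp_moment g (Suc m) = mp_int g m / (2 * pi)" for m
    using integral_marchenko_pastur[OF g, of m] by (simp add: mp_moment_def)
  show "mp_moment g 0 = 1" by (simp add: mp_moment_def)
  show "mp_moment g 1 = g" using S[of 0] mp_int_0[OF g] by simp
  fix r :: nat assume "r \<ge> 1"
  then obtain m where m: "r = Suc m" by (cases r) auto
  have z: "real m * mp_moment g m = real m * (mp_int g (m - 1) / (2 * pi))"
    by (cases m) (auto simp: S)
  have "(real r + 2) * mp_moment g (Suc r) = ((real m + 3) * mp_int g (Suc m)) / (2 * pi)"
    by (simp add: S m algebra_simps)
  also have "\<dots> = (2 * real m + 3) * (1 + g) * (mp_int g m / (2 * pi)) - (g - 1)\<^sup>2 * (real m * (mp_int g (m - 1) / (2 * pi)))"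
    unfolding mp_int_rec[OF g] by (simp add: diff_divide_distrib mult_ac)
  also have "\<dots> = (2 * real r + 1) * (1 + g) * mp_moment g r - (real r - 1) * (g - 1)\<^sup>2 * mp_moment g (r - 1)"
    unfolding z[symmetric] by (simp add: S m algebra_simps)
  finally show "(real r + 2) * mp_moment g (Suc r) = (2 * real r + 1) * (1 + g) * mp_moment g r - (real r - 1) * (g - 1)\<^sup>2 * mp_moment g (r - 1)" .
qed

section \<open>Moments of rectangular elements\<close>

lemma scaleC_minus1: "(-1) *\<^sub>C x = - (x :: 'a::cstar_algebra)"
  using scaleC_of_real[of "-1" x] by simp

lemma scaleC_one [simp]: "1 *\<^sub>C x = (x :: 'a::cstar_algebra)"
  using scaleC_of_real[of 1 x] by simp

lemma scaleC_zero_left [simp]: "0 *\<^sub>C x = (0 :: 'a::cstar_algebra)"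
  using scaleC_of_real[of 0 x] by simp

lemma scaleC_zero_right [simp]: "z *\<^sub>C (0 :: 'a::cstar_algebra) = 0"
  using scaleC_add_right[of z "0::'a" 0] by simp

lemma adj_one [simp]: "adj (1 :: 'a::cstar_algebra) = 1"
proof -
  have "adj (1::'a) = adj 1 * adj (adj 1)" by (simp only: adj_adj mult_1_right)
  also have "\<dots> = adj (adj 1 * 1)" by (rule adj_mult[symmetric])
  also have "\<dots> = 1" by (simp only: mult_1_right adj_adj)
  finally show ?thesis .
qed

locale rect =
  fixes \<phi> :: "'a::cstar_algebra \<Rightarrow> complex" and d :: nat and p :: "nat \<Rightarrow> 'a" and k l :: nat
  assumes tw: "tracial_wstar_prob_space \<phi>" and pd: "projection_decomposition d p"
    and k: "k \<in> {1..d}" and l: "l \<in> {1..d}" and kl: "k \<noteq> l"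
begin

lemma \<phi>_lin: "bounded_linear \<phi>" and \<phi>_scale: "\<phi> (z *\<^sub>C x) = z * \<phi> x"
proof -
  obtain F where F: "is_predual F" "\<phi> \<in> F" using tw unfolding tracial_wstar_prob_space_def by (elim conjE exE) 
  from F(1) have "F \<subseteq> cdual" unfolding is_predual_def by (elim conjE)
  with F(2) have "\<phi> \<in> cdual" by (rule rev_subsetD)
  then show "bounded_linear \<phi>" "\<phi> (z *\<^sub>C x) = z * \<phi> x" by (auto simp: cdual_def)
qed

lemmas \<phi>_add = bounded_linear.linear[OF \<phi>_lin, THEN linear_add]
lemmas \<phi>_0 = bounded_linear.linear[OF \<phi>_lin, THEN linear_0]
lemmas \<phi>_diff = bounded_linear.linear[OF \<phi>_lin, THEN linear_diff]
lemmas \<phi>_sum = bounded_linear.linear[OF \<phi>_lin, THEN linear_sum]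

lemma \<phi>_tr: "\<phi> (x * y) = \<phi> (y * x)" and \<phi>_1: "\<phi> 1 = 1"
  and \<phi>_pos: "\<phi> (adj x * x) \<in> \<real>\<^sub>\<ge>\<^sub>0" and \<phi>_faithful: "\<phi> (adj x * x) = 0 \<Longrightarrow> x = 0"
  using tw unfolding tracial_wstar_prob_space_def by blast+

lemma \<phi>_adj: "\<phi> (adj x) = cnj (\<phi> x)"
proof -
  have re: "Im (\<phi> (adj y * y)) = 0" for y using \<phi>_pos[of y] by (auto simp: nonneg_Reals_def complex_nonneg_Reals_iff)
  have 1: "Im (\<phi> x) + Im (\<phi> (adj x)) = 0"
  proof -
    have "adj (1 + x) * (1 + x) = 1 + x + adj x + adj x * x"
      by (simp add: adj_add algebra_simps)
    then show ?thesis using re[of "1 + x"] re[of x] by (simp add: \<phi>_add \<phi>_1)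
  qed
  have 2: "Re (\<phi> x) - Re (\<phi> (adj x)) = 0"
  proof -
    have "adj (1 + \<i> *\<^sub>C x) * (1 + \<i> *\<^sub>C x) = 1 + \<i> *\<^sub>C x + (- \<i>) *\<^sub>C adj x + adj x * x"
      by (simp add: adj_add adj_scaleC distrib_left distrib_right mult_scaleC_left mult_scaleC_right scaleC_scaleC scaleC_add_right add_ac)
    then show ?thesis using re[of "1 + \<i> *\<^sub>C x"] re[of x] by (simp add: \<phi>_add \<phi>_1 \<phi>_scale)
  qed
  show ?thesis using 1 2 by (simp add: complex_eq_iff)
qed

lemma p_adj: "i \<in> {1..d} \<Longrightarrow> adj (p i) = p i" and p_ne: "i \<in> {1..d} \<Longrightarrow> p i \<noteq> 0"
  and p_mult: "i \<in> {1..d} \<Longrightarrow> j \<in> {1..d} \<Longrightarrow> p i * p j = (if i = j then p i else 0)"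
  and p_sum: "(\<Sum>i=1..d. p i) = 1"
  using pd unfolding projection_decomposition_def by auto

lemma norm_p: assumes "i \<in> {1..d}" shows "norm (p i) = 1"
proof -
  have "norm (p i) = (norm (p i))\<^sup>2" using norm_adj_mult_self[of "p i"] assms by (simp add: p_adj p_mult)
  then show ?thesis using p_ne[OF assms] by (simp add: power2_eq_square)
qed

lemma weight_pos: assumes "i \<in> {1..d}" shows "weight \<phi> p i > 0" and weight_eq: "\<phi> (p i) = of_real (weight \<phi> p i)"
proof -
  have pp: "adj (p i) * p i = p i" using assms by (simp add: p_adj p_mult)
  have "\<phi> (p i) \<in> \<real>\<^sub>\<ge>\<^sub>0" using \<phi>_pos[of "p i"] pp by simp
  then obtain r where r: "\<phi> (p i) = of_real r" "r \<ge> 0" by (auto simp: nonneg_Reals_def)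
  moreover have "\<phi> (p i) \<noteq> 0" using \<phi>_faithful[of "p i"] pp p_ne[OF assms] by auto
  ultimately show "weight \<phi> p i > 0" "\<phi> (p i) = of_real (weight \<phi> p i)" by (auto simp: weight_def)
qed

lemma weight_sum: "(\<Sum>i=1..d. weight \<phi> p i) = 1"
proof -
  have "(\<Sum>i=1..d. weight \<phi> p i) = Re (\<phi> (\<Sum>i=1..d. p i))" by (simp add: weight_def \<phi>_sum)
  then show ?thesis by (simp only: p_sum \<phi>_1 one_complex.sel)
qed

definition ix :: "bool \<Rightarrow> nat" where "ix \<kappa> = (if \<kappa> then l else k)"

abbreviation rho :: "bool \<Rightarrow> real" where "rho \<kappa> \<equiv> weight \<phi> p (ix \<kappa>)"

lemma ix_in [simp]: "ix \<kappa> \<in> {1..d}" "Suc 0 \<le> ix \<kappa>" "ix \<kappa> \<le> d" and ix_inj [simp]: "ix \<kappa> = ix \<kappa>' \<longleftrightarrow> \<kappa> = \<kappa>'"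
  using k l kl by (auto simp: ix_def)

definition pp :: "bool \<Rightarrow> 'a" where "pp \<kappa> = p (ix \<kappa>)"

lemma pp_mult [simp]: "pp \<kappa> * pp \<kappa>' = (if \<kappa> = \<kappa>' then pp \<kappa> else 0)"
  by (simp add: pp_def p_mult)

lemma pp_mult3 [simp]: "pp \<kappa> * (pp \<kappa>' * x) = (if \<kappa> = \<kappa>' then pp \<kappa> * x else 0)"
  by (simp add: mult.assoc[symmetric])

lemma pp_adj [simp]: "adj (pp \<kappa>) = pp \<kappa>" by (simp add: pp_def p_adj)

lemma rho_pos: "rho \<kappa> > 0" using weight_pos[of "ix \<kappa>"] by simp

definition tr :: "bool \<Rightarrow> 'a \<Rightarrow> complex" where "tr \<kappa> x = \<phi> (pp \<kappa> * x) / of_real (rho \<kappa>)"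

lemma tr_add: "tr \<kappa> (x + y) = tr \<kappa> x + tr \<kappa> y" by (simp add: tr_def distrib_left \<phi>_add add_divide_distrib)
lemma tr_diff: "tr \<kappa> (x - y) = tr \<kappa> x - tr \<kappa> y" by (simp add: tr_def right_diff_distrib \<phi>_diff diff_divide_distrib)
lemma tr_scale: "tr \<kappa> (z *\<^sub>C x) = z * tr \<kappa> x" by (simp add: tr_def mult_scaleC_right \<phi>_scale)
lemma tr_0 [simp]: "tr \<kappa> 0 = 0" by (simp add: tr_def \<phi>_0)
lemma tr_1 [simp]: "tr \<kappa> 1 = 1" using rho_pos[of \<kappa>] by (simp add: tr_def pp_def weight_eq)
lemma tr_pp [simp]: "tr \<kappa> (pp \<kappa>' * x) = (if \<kappa> = \<kappa>' then tr \<kappa> x else 0)" by (simp add: tr_def \<phi>_0)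
lemma tr_pp_right [simp]: "tr \<kappa> (x * pp \<kappa>') = (if \<kappa> = \<kappa>' then tr \<kappa> x else 0)"
proof -
  have "\<phi> (pp \<kappa> * (x * pp \<kappa>')) = \<phi> (pp \<kappa>' * (pp \<kappa> * x))" by (metis \<phi>_tr mult.assoc)
  then show ?thesis by (simp add: tr_def \<phi>_0)
qed
lemma tr_pp1 [simp]: "tr \<kappa> (pp \<kappa>') = (if \<kappa> = \<kappa>' then 1 else 0)" using tr_pp[of \<kappa> \<kappa>' 1] by simp
lemma tr_adj: "tr \<kappa> (adj x) = cnj (tr \<kappa> x)"
proof -
  have "\<phi> (pp \<kappa> * adj x) = cnj (\<phi> (x * pp \<kappa>))" unfolding \<phi>_adj[symmetric] by (simp add: adj_mult)
  then show ?thesis by (simp add: tr_def \<phi>_tr)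
qed

definition trd :: "nat \<Rightarrow> 'a \<Rightarrow> complex" where "trd m x = \<phi> (p m * x) / of_real (weight \<phi> p m)"

lemma tr_trd: "tr \<kappa> = trd (ix \<kappa>)" by (simp add: tr_def trd_def pp_def fun_eq_iff)

lemma cond_exp_trd: "cond_exp \<phi> d p x = (\<Sum>m=1..d. trd m x *\<^sub>C p m)"
  unfolding cond_exp_def
proof (intro sum.cong refl)
  fix m assume m: "m \<in> {1..d}"
  have "\<phi> (p m * x * p m) = \<phi> (p m * (p m * x))" by (metis \<phi>_tr mult.assoc)
  also have "p m * (p m * x) = p m * x" using m by (simp add: p_mult mult.assoc[symmetric])
  finally show "corner_state \<phi> p m (p m * x * p m) *\<^sub>C p m = trd m x *\<^sub>C p m" by (simp add: corner_state_def trd_def)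
qed

lemma p_cond_exp: "m \<in> {1..d} \<Longrightarrow> p m * cond_exp \<phi> d p x = trd m x *\<^sub>C p m"
  "m \<in> {1..d} \<Longrightarrow> cond_exp \<phi> d p x * p m = trd m x *\<^sub>C p m"
proof -
  assume m: "m \<in> {1..d}"
  have "p m * cond_exp \<phi> d p x = (\<Sum>i=1..d. if i = m then trd m x *\<^sub>C p m else 0)"
    unfolding cond_exp_trd sum_distrib_left using m by (intro sum.cong) (auto simp: mult_scaleC_right p_mult)
  then show "p m * cond_exp \<phi> d p x = trd m x *\<^sub>C p m" using m by simp
  have "cond_exp \<phi> d p x * p m = (\<Sum>i=1..d. if i = m then trd m x *\<^sub>C p m else 0)"
    unfolding cond_exp_trd sum_distrib_right using m by (intro sum.cong) (auto simp: mult_scaleC_left p_mult)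
  then show "cond_exp \<phi> d p x * p m = trd m x *\<^sub>C p m" using m by simp
qed

lemma trd_p1: "m \<in> {1..d} \<Longrightarrow> trd m (p m) = 1"
  using weight_pos[of m] by (simp add: trd_def p_mult weight_eq)

lemma trd_cond_exp: "m \<in> {1..d} \<Longrightarrow> trd m (cond_exp \<phi> d p x) = trd m x"
  using trd_p1[of m] by (simp add: trd_def[of m "cond_exp \<phi> d p x"] p_cond_exp \<phi>_scale)
    (simp add: trd_def p_mult)

lemma trd_cond_exp_0: "cond_exp \<phi> d p x = 0 \<Longrightarrow> m \<in> {1..d} \<Longrightarrow> trd m x = 0"
  using trd_cond_exp[of m x] by (simp add: trd_def \<phi>_0)

lemma cond_exp_eqI: "(\<And>m. m \<in> {1..d} \<Longrightarrow> trd m x = trd m y) \<Longrightarrow> cond_exp \<phi> d p x = cond_exp \<phi> d p y"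
  by (simp add: cond_exp_trd)

lemma tr_cond_exp_left: "tr \<kappa> (cond_exp \<phi> d p y * x) = tr \<kappa> y * tr \<kappa> x"
proof -
  have "pp \<kappa> * (cond_exp \<phi> d p y * x) = tr \<kappa> y *\<^sub>C (pp \<kappa> * x)"
    using p_cond_exp(1)[of "ix \<kappa>" y] by (simp add: pp_def tr_trd mult.assoc[symmetric] mult_scaleC_left)
  then have "\<phi> (pp \<kappa> * (cond_exp \<phi> d p y * x)) = tr \<kappa> y * \<phi> (pp \<kappa> * x)" by (simp add: \<phi>_scale)
  then show ?thesis unfolding tr_def[of \<kappa> "cond_exp \<phi> d p y * x"] tr_def[of \<kappa> x] by simp
qed

lemma tr_cond_exp_right: "tr \<kappa> (x * cond_exp \<phi> d p y) = tr \<kappa> x * tr \<kappa> y"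
proof -
  have "\<phi> (pp \<kappa> * (x * cond_exp \<phi> d p y)) = \<phi> (cond_exp \<phi> d p y * pp \<kappa> * x)" by (metis \<phi>_tr mult.assoc)
  also have "cond_exp \<phi> d p y * pp \<kappa> = tr \<kappa> y *\<^sub>C pp \<kappa>" using p_cond_exp(2)[of "ix \<kappa>" y] by (simp add: pp_def tr_trd)
  finally show ?thesis unfolding tr_def[of \<kappa> "x * cond_exp \<phi> d p y"] tr_def[of \<kappa> x] by (simp add: mult_scaleC_left \<phi>_scale)
qed

definition val :: "(nat \<Rightarrow> 'a) \<Rightarrow> letter \<Rightarrow> 'a" where
  "val a e = (case e of Pr \<kappa> \<Rightarrow> pp \<kappa> | Ge i s \<Rightarrow> if s then adj (a i) else a i)"

lemma val_simps [simp]: "val a (Pr \<kappa>) = pp \<kappa>" "val a (Ge i s) = (if s then adj (a i) else a i)"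
  by (simp_all add: val_def)

definition wv :: "(nat \<Rightarrow> 'a) \<Rightarrow> letter list \<Rightarrow> 'a" where "wv a w = prod_list (map (val a) w)"

lemma wv_simps [simp]: "wv a [] = 1" "wv a (e # w) = val a e * wv a w" "wv a (w @ w') = wv a w * wv a w'"
  by (simp_all add: wv_def)

lemma type_mult:
  assumes "has_type p k l (a i)"
  shows "pp \<kappa> * val a (Ge i s) = (if \<kappa> = s then val a (Ge i s) else 0)"
    and "val a (Ge i s) * pp \<kappa> = (if \<kappa> = s then 0 else val a (Ge i s))"
    and "m \<in> {1..d} \<Longrightarrow> p m * val a (Ge i s) = (if m = ix s then val a (Ge i s) else 0)"
    and "m \<in> {1..d} \<Longrightarrow> val a (Ge i s) * p m = (if m = ix (\<not> s) then val a (Ge i s) else 0)"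
proof -
  obtain x where x: "a i = pp False * x * pp True" using assms by (auto simp: has_type_def corner_def pp_def ix_def)
  have x': "adj (a i) = pp True * adj x * pp False" unfolding x by (simp add: adj_mult mult.assoc)
  have 1: "pp \<kappa> * val a (Ge i s) = (if \<kappa> = s then val a (Ge i s) else 0)" for \<kappa>
    by (auto simp: x' mult.assoc) (auto simp: x mult.assoc)
  have 2: "val a (Ge i s) * pp \<kappa> = (if \<kappa> = s then 0 else val a (Ge i s))" for \<kappa>
    by (auto simp: x' mult.assoc) (auto simp: x mult.assoc)
  show "pp \<kappa> * val a (Ge i s) = (if \<kappa> = s then val a (Ge i s) else 0)" by (rule 1)
  show "val a (Ge i s) * pp \<kappa> = (if \<kappa> = s then 0 else val a (Ge i s))" by (rule 2)
  assume m: "m \<in> {1..d}"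
  have "p m * val a (Ge i s) = p m * pp s * val a (Ge i s)" using 1[of s] by (simp add: mult.assoc del: val_simps)
  also have "p m * pp s = (if m = ix s then pp s else 0)" using m by (simp add: pp_def p_mult)
  finally show "p m * val a (Ge i s) = (if m = ix s then val a (Ge i s) else 0)" using 1[of s] by (simp del: val_simps)
  have "val a (Ge i s) * p m = val a (Ge i s) * (pp (\<not> s) * p m)" using 2[of "\<not> s"] by (simp add: mult.assoc[symmetric] del: val_simps)
  also have "pp (\<not> s) * p m = (if m = ix (\<not> s) then pp (\<not> s) else 0)" using m by (simp add: pp_def p_mult)
  finally show "val a (Ge i s) * p m = (if m = ix (\<not> s) then val a (Ge i s) else 0)" using 2[of "\<not> s"] by (simp del: val_simps)
qed

end

locale rect_free = rect +
  fixes N :: nat and b :: "nat \<Rightarrow> 'a" and B :: "nat \<Rightarrow> 'a set" and C :: "nat \<Rightarrow> bool \<Rightarrow> complex"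
  assumes type: "\<And>i. i \<in> {1..N} \<Longrightarrow> has_type p k l (b i)"
    and B: "\<And>i. i \<in> {1..N} \<Longrightarrow> star_subalgebra (B i)" "\<And>i. i \<in> {1..N} \<Longrightarrow> diag_algebra d p \<subseteq> B i"
      "\<And>i. i \<in> {1..N} \<Longrightarrow> b i \<in> B i"
    and free: "free_subalgebras \<phi> d p {1..N} B"
begin

abbreviation g :: "nat \<Rightarrow> bool \<Rightarrow> 'a" where "g i s \<equiv> val b (Ge i s)"

lemma B_closed:
  assumes "i \<in> {1..N}"
  shows "x \<in> B i \<Longrightarrow> y \<in> B i \<Longrightarrow> x + y \<in> B i" "x \<in> B i \<Longrightarrow> y \<in> B i \<Longrightarrow> x * y \<in> B i" "x \<in> B i \<Longrightarrow> z *\<^sub>C x \<in> B i" "x \<in> B i \<Longrightarrow> adj x \<in> B i"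
    and B_p: "m \<in> {1..d} \<Longrightarrow> p m \<in> B i" and B_1: "1 \<in> B i" and B_g: "g i s \<in> B i" and B_0: "0 \<in> B i"
    and B_E: "cond_exp \<phi> d p x \<in> B i"
proof -
  show "x \<in> B i \<Longrightarrow> y \<in> B i \<Longrightarrow> x + y \<in> B i" "x \<in> B i \<Longrightarrow> y \<in> B i \<Longrightarrow> x * y \<in> B i" "x \<in> B i \<Longrightarrow> z *\<^sub>C x \<in> B i" "x \<in> B i \<Longrightarrow> adj x \<in> B i" "0 \<in> B i"
    using B(1)[OF assms] by (auto simp: star_subalgebra_def)
  then show "g i s \<in> B i" using B(1,3)[OF assms] by (auto simp: star_subalgebra_def)
  have D: "(\<Sum>i=1..d. z i *\<^sub>C p i) \<in> B i" for z using B(2)[OF assms] by (auto simp: diag_algebra_def)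
  show "cond_exp \<phi> d p x \<in> B i" unfolding cond_exp_trd by (rule D)
  have "(\<Sum>i=1..d. 1 *\<^sub>C p i) = 1" using p_sum by simp
  then show "1 \<in> B i" using D[of "\<lambda>_. 1"] by simp
  assume m: "m \<in> {1..d}"
  have "(\<Sum>i=1..d. (if i = m then 1 else 0) *\<^sub>C p i) = (\<Sum>i=1..d. if i = m then p i else 0)"
    by (intro sum.cong) auto
  then have "(\<Sum>i=1..d. (if i = m then 1 else 0) *\<^sub>C p i) = p m" using m by simp
  then show "p m \<in> B i" using D[of "\<lambda>i. if i = m then 1 else 0"] by simp
qed

abbreviation E :: "'a \<Rightarrow> 'a" where "E \<equiv> cond_exp \<phi> d p"

definition alternating :: "nat list \<Rightarrow> 'a list \<Rightarrow> bool" where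
  "alternating js xs \<longleftrightarrow> set js \<subseteq> {1..N} \<and> distinct_adj js \<and> list_all2 (\<lambda>j x. x \<in> B j \<and> E x = 0) js xs"

lemma alternating_E: "alternating js xs \<Longrightarrow> js \<noteq> [] \<Longrightarrow> E (prod_list xs) = 0"
  using free unfolding free_subalgebras_def alternating_def by blast

lemma tr_E_0: "E x = 0 \<Longrightarrow> tr \<kappa> x = 0"
  using trd_cond_exp_0[of x "ix \<kappa>"] by (simp add: tr_trd)

lemma E_diff_E: "E (x - E x) = 0"
proof -
  have "trd m (x - E x) = 0" if "m \<in> {1..d}" for m
  proof -
    have "trd m (x - E x) = trd m x - trd m (E x)" by (simp add: trd_def right_diff_distrib \<phi>_diff diff_divide_distrib)
    then show ?thesis using trd_cond_exp[OF that, of x] by simp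
  qed
  then show ?thesis by (simp add: cond_exp_trd[of "x - E x"])
qed

lemma diff_in_B: assumes "i \<in> {1..N}" "x \<in> B i" "y \<in> B i" shows "x - y \<in> B i"
  using B_closed(1)[OF assms(1,2) B_closed(3)[OF assms(1,3), of "-1"]] by (simp add: scaleC_minus1)

lemma free_left:
  assumes y: "i \<in> {1..N}" "y \<in> B i" and a: "alternating (j # js) xs" and ij: "i \<noteq> j"
  shows "tr \<kappa> (y * prod_list xs) = 0"
proof -
  have "alternating (i # j # js) ((y - E y) # xs)"
    using a ij y diff_in_B[OF y(1,2) B_E[OF y(1)]] E_diff_E[of y] by (auto simp: alternating_def)
  from alternating_E[OF this] have "tr \<kappa> ((y - E y) * prod_list xs) = 0" by (auto intro: tr_E_0)
  moreover have "tr \<kappa> (prod_list xs) = 0" using alternating_E[OF a] by (auto intro: tr_E_0)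
  ultimately show ?thesis by (simp add: left_diff_distrib tr_diff tr_cond_exp_left)
qed

lemma free_right:
  assumes y: "i \<in> {1..N}" "y \<in> B i" and a: "alternating js xs" and ij: "js \<noteq> []" "last js \<noteq> i"
  shows "tr \<kappa> (prod_list xs * y) = 0"
proof -
  have "alternating (js @ [i]) (xs @ [y - E y])"
    using a ij y diff_in_B[OF y(1,2) B_E[OF y(1)]] E_diff_E[of y]
    by (auto simp: alternating_def distinct_adj_append_iff list_all2_appendI)
  from alternating_E[OF this] have "tr \<kappa> (prod_list xs * (y - E y)) = 0" by (auto intro: tr_E_0)
  moreover have "tr \<kappa> (prod_list xs) = 0" using alternating_E[OF a ij(1)] by (rule tr_E_0)
  ultimately show ?thesis by (simp add: right_diff_distrib tr_diff tr_cond_exp_right)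
qed

lemma tr_g: "i \<in> {1..N} \<Longrightarrow> tr \<kappa> (g i s) = 0"
proof -
  assume i: "i \<in> {1..N}"
  note T = type_mult[of b i, OF type[OF i]]
  have "tr \<kappa> (g i s) = tr \<kappa> (pp s * g i s * pp (\<not> s))" using T(1)[of s s] T(2)[of s "\<not> s"] by (simp del: val_simps)
  then show ?thesis using tr_pp_right[of \<kappa> "pp s * g i s" "\<not> s"] tr_pp[of \<kappa> s "g i s"] by (cases \<kappa>; cases s) (simp_all del: val_simps)
qed

text \<open>Polynomials in the \<open>j\<close>-th element, together with the functional
  \<open>(\<alpha>, \<beta>) \<mapsto> \<Sum> tr (\<alpha> u) tr (v \<beta>)\<close> induced by their free difference quotient
  \<open>\<Sum> u \<otimes> v\<close> with respect to the letter \<open>g i (\<not> s)\<close>.\<close>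

inductive poly :: "nat \<Rightarrow> bool \<Rightarrow> nat \<Rightarrow> 'a \<Rightarrow> ('a \<Rightarrow> 'a \<Rightarrow> complex) \<Rightarrow> bool" for i s j where
  poly_1: "poly i s j 1 (\<lambda>\<alpha> \<beta>. 0)"
| poly_p: "m \<in> {1..d} \<Longrightarrow> poly i s j x D \<Longrightarrow> poly i s j (p m * x) (\<lambda>\<alpha> \<beta>. D (\<alpha> * p m) \<beta>)"
| poly_g: "poly i s j x D \<Longrightarrow> poly i s j (g j r * x)
    (\<lambda>\<alpha> \<beta>. (if j = i \<and> r = (\<not> s) then tr (\<not> s) \<alpha> * tr s (x * \<beta>) else 0) + D (\<alpha> * g j r) \<beta>)"
| poly_add: "poly i s j x D \<Longrightarrow> poly i s j y D' \<Longrightarrow> poly i s j (x + y) (\<lambda>\<alpha> \<beta>. D \<alpha> \<beta> + D' \<alpha> \<beta>)"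
| poly_scale: "poly i s j x D \<Longrightarrow> poly i s j (z *\<^sub>C x) (\<lambda>\<alpha> \<beta>. z * D \<alpha> \<beta>)"

lemma poly_mult: "poly i s j x D \<Longrightarrow> poly i s j y D' \<Longrightarrow> poly i s j (x * y) (\<lambda>\<alpha> \<beta>. D \<alpha> (y * \<beta>) + D' (\<alpha> * x) \<beta>)"
proof (induction rule: poly.induct)
  case poly_1
  then show ?case by simp
next
  case (poly_p m x D)
  from poly.poly_p[OF poly_p.hyps(1) poly_p.IH[OF poly_p.prems]] show ?case by (simp add: mult.assoc)
next
  case (poly_g x D r)
  from poly.poly_g[OF poly_g.IH[OF poly_g.prems], of r] show ?case
    by (simp add: mult.assoc add.assoc del: val_simps cong: if_cong)
next
  case (poly_add x D x' D2)
  from poly.poly_add[OF poly_add.IH(1)[OF poly_add.prems] poly_add.IH(2)[OF poly_add.prems]]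
  have "poly i s j (x * y + x' * y) (\<lambda>\<alpha> \<beta>. (D \<alpha> (y * \<beta>) + D' (\<alpha> * x) \<beta>) + (D2 \<alpha> (y * \<beta>) + D' (\<alpha> * x') \<beta>))" .
  moreover have lin: "D' (\<alpha> + \<alpha>') \<beta> = D' \<alpha> \<beta> + D' \<alpha>' \<beta>" for \<alpha> \<alpha>' \<beta>
    using poly_add.prems by (induction arbitrary: \<alpha> \<alpha>' rule: poly.induct) (auto simp: distrib_right tr_add algebra_simps)
  ultimately show ?case by (simp add: distrib_left distrib_right add_ac)
next
  case (poly_scale x D z)
  from poly.poly_scale[OF poly_scale.IH[OF poly_scale.prems], of z]
  have "poly i s j (z *\<^sub>C (x * y)) (\<lambda>\<alpha> \<beta>. z * (D \<alpha> (y * \<beta>) + D' (\<alpha> * x) \<beta>))" .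
  moreover have lin: "D' (z *\<^sub>C \<alpha>) \<beta> = z * D' \<alpha> \<beta>" for z \<alpha> \<beta>
    using poly_scale.prems by (induction arbitrary: \<alpha> rule: poly.induct) (auto simp: mult_scaleC_left tr_scale algebra_simps)
  ultimately show ?case by (simp add: mult_scaleC_left mult_scaleC_right distrib_left)
qed

lemma poly_0_left: "poly i s j x D \<Longrightarrow> D 0 \<beta> = 0"
  by (induction rule: poly.induct) auto

lemma poly_0: "poly i s j 0 (\<lambda>\<alpha> \<beta>. 0)"
  using poly_scale[OF poly_1, of i s j 0] by simp

lemma poly_diag: "finite I \<Longrightarrow> I \<subseteq> {1..d} \<Longrightarrow> poly i s j (\<Sum>m\<in>I. z m *\<^sub>C p m) (\<lambda>\<alpha> \<beta>. 0)"
proof (induction I rule: finite_induct)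
  case empty then show ?case using poly_0 by simp
next
  case (insert m I)
  have "poly i s j (p m * 1) (\<lambda>\<alpha> \<beta>. 0)" using insert.prems by (intro poly_p[of m, OF _ poly_1]) auto
  from poly_add[OF poly_scale[OF this, of "z m"] insert.IH] insert show ?case by simp
qed

lemma poly_E: "poly i s j (E x) (\<lambda>\<alpha> \<beta>. 0)"
  unfolding cond_exp_trd by (rule poly_diag) auto

lemma poly_in_B: "poly i s j x D \<Longrightarrow> j \<in> {1..N} \<Longrightarrow> x \<in> B j"
  by (induction rule: poly.induct) (auto intro!: B_closed B_1 B_p B_g simp del: val_simps)

lemma poly_other: "poly i s j x D \<Longrightarrow> j \<noteq> i \<Longrightarrow> D \<alpha> \<beta> = 0"
  by (induction arbitrary: \<alpha> \<beta> rule: poly.induct) auto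

lemma poly_vanish:
  "poly i s i x D \<Longrightarrow> i \<in> {1..N} \<Longrightarrow> (\<forall>y\<in>B i. tr (\<not> s) (\<alpha> * y) = 0) \<or> (\<forall>y\<in>B i. tr s (y * \<beta>) = 0) \<Longrightarrow> D \<alpha> \<beta> = 0"
proof (induction arbitrary: \<alpha> rule: poly.induct)
  case (poly_p m x D)
  have "(\<forall>y\<in>B i. tr (\<not> s) (\<alpha> * p m * y) = 0) \<or> (\<forall>y\<in>B i. tr s (y * \<beta>) = 0)"
    using poly_p.prems(2) B_closed(2)[OF poly_p.prems(1) B_p[OF poly_p.prems(1) poly_p.hyps(1)]] by (auto simp: mult.assoc)
  then show ?case using poly_p by blast
next
  case (poly_g x D r)
  note i = poly_g.prems(1)
  have x: "x \<in> B i" using poly_in_B[OF poly_g.hyps i] .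
  have "(\<forall>y\<in>B i. tr (\<not> s) (\<alpha> * g i r * y) = 0) \<or> (\<forall>y\<in>B i. tr s (y * \<beta>) = 0)"
    using poly_g.prems(2) B_closed(2)[OF i B_g[OF i]] by (auto simp: mult.assoc simp del: val_simps)
  then have "D (\<alpha> * g i r) \<beta> = 0" using poly_g i by blast
  moreover have "tr (\<not> s) \<alpha> * tr s (x * \<beta>) = 0"
  proof -
    from poly_g.prems(2) have "tr (\<not> s) (\<alpha> * 1) = 0 \<or> tr s (x * \<beta>) = 0" using B_1[OF i] x by blast
    then show ?thesis by auto
  qed
  ultimately show ?case by simp
qed auto

end

context rect_free begin

fun alt :: "nat \<Rightarrow> bool \<Rightarrow> nat \<Rightarrow> 'a" where
  "alt i s 0 = pp s"
| "alt i s (Suc r) = alt i s r * g i (if even r then s else \<not> s)"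

lemma alt_Suc_left: "i \<in> {1..N} \<Longrightarrow> alt i s (Suc r) = g i s * alt i (\<not> s) r"
proof (induction r)
  case 0
  note T = type_mult[of b i, OF type[OF 0]]
  show ?case using T(1)[of s s] T(2)[of s "\<not> s"] by (simp del: val_simps)
next
  case (Suc r)
  have "alt i s (Suc (Suc r)) = alt i s (Suc r) * g i (if even (Suc r) then s else \<not> s)" by (rule alt.simps(2))
  also have "\<dots> = g i s * (alt i (\<not> s) r * g i (if even r then \<not> s else s))"
    unfolding Suc.IH[OF Suc.prems] by (simp add: mult.assoc del: val_simps)
  finally show ?case by (simp del: val_simps)
qed

lemma alt_pp_left: "i \<in> {1..N} \<Longrightarrow> pp s * alt i s r = alt i s r"
  by (induction r) (simp_all add: mult.assoc[symmetric] del: val_simps)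

lemma alt_p: "i \<in> {1..N} \<Longrightarrow> m \<in> {1..d} \<Longrightarrow> alt i s r * p m = (if m = ix (if even r then s else \<not> s) then alt i s r else 0)"
proof (cases r)
  case 0
  assume "m \<in> {1..d}" then show ?thesis using 0 by (auto simp: pp_def p_mult)
next
  case (Suc q)
  assume i: "i \<in> {1..N}" and m: "m \<in> {1..d}"
  note T = type_mult[of b i, OF type[OF i]]
  show ?thesis unfolding Suc alt.simps mult.assoc T(4)[OF m] by (auto simp del: val_simps)
qed

lemma alt_g: "i \<in> {1..N} \<Longrightarrow> alt i s r * g i s' = (if s' = (if even r then s else \<not> s) then alt i s (Suc r) else 0)"
proof -
  assume i: "i \<in> {1..N}"
  note T = type_mult[of b i, OF type[OF i]]
  have "alt i s r * g i s' = alt i s r * p (ix s') * g i s'"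
    using T(3)[of "ix s'" s'] by (simp add: mult.assoc del: val_simps)
  then show ?thesis using alt_p[OF i, of "ix s'" s r] by (auto simp del: val_simps)
qed

lemma alt_odd: "i \<in> {1..N} \<Longrightarrow> odd r \<Longrightarrow> tr \<kappa> (alt i s r) = 0"
proof -
  assume i: "i \<in> {1..N}" and r: "odd r"
  have "alt i s r = pp s * alt i s r * pp (\<not> s)"
    using alt_pp_left[OF i] alt_p[OF i, of "ix (\<not> s)" s r] r by (simp add: pp_def)
  then show ?thesis using tr_pp_right[of \<kappa> "pp s * alt i s r" "\<not> s"] tr_pp[of \<kappa> s "alt i s r"]
    by (cases \<kappa>; cases s) simp_all
qed

definition alt_recursion :: bool where
  "alt_recursion \<longleftrightarrow> (\<forall>i\<in>{1..N}. \<forall>s h. tr s (alt i s (2 * Suc h)) =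
     C i s * (\<Sum>r\<le>h. tr (\<not> s) (alt i (\<not> s) (2 * r)) * tr s (alt i s (2 * (h - r)))))"

definition dalt :: "nat \<Rightarrow> bool \<Rightarrow> nat \<Rightarrow> 'a \<Rightarrow> complex" where
  "dalt i s r x = (\<Sum>j<r. if even j then tr (\<not> s) (alt i (\<not> s) j) * tr s (alt i s (r - 1 - j) * x) else 0)"

lemma sum_even: "(\<Sum>j<Suc (2 * h). if even j then f j else 0) = (\<Sum>r\<le>h. f (2 * r))" for f :: "nat \<Rightarrow> complex"
  by (induction h) auto

lemma dalt_Suc: "i \<in> {1..N} \<Longrightarrow> dalt i s (Suc r) x = (if even r then tr (\<not> s) (alt i (\<not> s) r) * tr s x else 0) +
    (\<Sum>j<r. if even j then tr (\<not> s) (alt i (\<not> s) j) * tr s (alt i s (r - j) * x) else 0)"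
  unfolding dalt_def by (simp cong: if_cong)

lemma poly_single:
  assumes rec: alt_recursion and i: "i \<in> {1..N}" and px: "poly i s i x D"
  shows "tr s (g i s * (alt i (\<not> s) r * x)) = C i s * (dalt i s r x + D (alt i (\<not> s) r) 1)"
  using px
proof (induction arbitrary: r rule: poly.induct)
  case poly_1
  show ?case
  proof (cases "even r")
    case True
    have "tr s (g i s * (alt i (\<not> s) r * 1)) = 0"
      using alt_odd[OF i, of "Suc r" s s] True alt_Suc_left[OF i, of s r] by (simp del: val_simps alt.simps)
    moreover have "dalt i s r 1 = 0"
      unfolding dalt_def using True by (intro sum.neutral ballI) (auto simp: alt_odd[OF i])
    ultimately show ?thesis by simp
  next
    case False
    then obtain h where h: "r = Suc (2 * h)" by (auto elim: oddE)
    have "tr s (g i s * (alt i (\<not> s) r * 1)) = tr s (alt i s (2 * Suc h))"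
      using alt_Suc_left[OF i, of s r] h by (simp del: val_simps alt.simps)
    also have "\<dots> = C i s * (\<Sum>q\<le>h. tr (\<not> s) (alt i (\<not> s) (2 * q)) * tr s (alt i s (2 * (h - q))))"
      using rec i unfolding alt_recursion_def by blast
    also have "(\<Sum>q\<le>h. tr (\<not> s) (alt i (\<not> s) (2 * q)) * tr s (alt i s (2 * (h - q)))) = dalt i s r 1"
      unfolding dalt_def h sum_even by (intro sum.cong) (auto simp: diff_mult_distrib2)
    finally show ?thesis by simp
  qed
next
  case (poly_p m x D)
  have d: "dalt i s r (p m * x) = (if m = ix (if even r then \<not> s else s) then dalt i s r x else 0)"
  proof -
    have "tr s (alt i s (r - 1 - j) * (p m * x)) = (if m = ix (if even r then \<not> s else s) then tr s (alt i s (r - 1 - j) * x) else 0)"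
      if "j < r" "even j" for j
      using alt_p[OF i poly_p.hyps(1), of s "r - 1 - j"] that by (auto simp: mult.assoc[symmetric])
    then show ?thesis unfolding dalt_def by (auto intro!: sum.cong sum.neutral)
  qed
  have a: "alt i (\<not> s) r * p m = (if m = ix (if even r then \<not> s else s) then alt i (\<not> s) r else 0)"
    using alt_p[OF i poly_p.hyps(1), of "\<not> s" r] by simp
  show ?case
  proof (cases "m = ix (if even r then \<not> s else s)")
    case True
    have "tr s (g i s * (alt i (\<not> s) r * (p m * x))) = tr s (g i s * (alt i (\<not> s) r * x))"
      using a True by (simp add: mult.assoc[symmetric] del: val_simps)
    also have "\<dots> = C i s * (dalt i s r x + D (alt i (\<not> s) r) 1)" by (rule poly_p.IH)
    finally show ?thesis using a d True by (simp del: val_simps)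
  next
    case False
    then have "alt i (\<not> s) r * (p m * x) = 0" using a by (simp add: mult.assoc[symmetric])
    then show ?thesis using d False a poly_0_left[OF poly_p.hyps(2)] by simp
  qed
next
  case (poly_g x D r')
  show ?case
  proof (cases "r' = (if even r then \<not> s else s)")
    case True
    have a: "alt i (\<not> s) r * g i r' = alt i (\<not> s) (Suc r)" using alt_g[OF i, of "\<not> s" r r'] True by (simp del: val_simps)
    have "tr s (g i s * (alt i (\<not> s) r * (g i r' * x))) = tr s (g i s * (alt i (\<not> s) (Suc r) * x))"
      using a by (simp add: mult.assoc[symmetric] del: val_simps alt.simps)
    also have "\<dots> = C i s * (dalt i s (Suc r) x + D (alt i (\<not> s) (Suc r)) 1)" by (rule poly_g.IH)
    also have "dalt i s (Suc r) x = (if r' = (\<not> s) then tr (\<not> s) (alt i (\<not> s) r) * tr s x else 0) + dalt i s r (g i r' * x)"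
    proof -
      have "tr s (alt i s (r - 1 - j) * (g i r' * x)) = tr s (alt i s (r - j) * x)" if "j < r" "even j" for j
        using alt_g[OF i, of s "r - 1 - j" r'] that True
        by (auto simp: mult.assoc[symmetric] Suc_diff_Suc simp del: val_simps alt.simps)
      then have "(\<Sum>j<r. if even j then tr (\<not> s) (alt i (\<not> s) j) * tr s (alt i s (r - j) * x) else 0) = dalt i s r (g i r' * x)"
        unfolding dalt_def by (intro sum.cong) auto
      then show ?thesis unfolding dalt_Suc[OF i] using True by auto
    qed
    finally show ?thesis using a by (simp add: algebra_simps del: val_simps alt.simps)
  next
    case False
    have a: "alt i (\<not> s) r * g i r' = 0" using alt_g[OF i, of "\<not> s" r r'] False by (simp del: val_simps)
    have "dalt i s r (g i r' * x) = 0"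
    proof -
      have "tr s (alt i s (r - 1 - j) * (g i r' * x)) = 0" if "j < r" "even j" for j
        using alt_g[OF i, of s "r - 1 - j" r'] that False
        by (auto simp: mult.assoc[symmetric] simp del: val_simps alt.simps split: if_splits)
      then show ?thesis unfolding dalt_def by (intro sum.neutral) auto
    qed
    moreover have "(if i = i \<and> r' = (\<not> s) then tr (\<not> s) (alt i (\<not> s) r) * tr s (x * 1) else 0) = 0"
      using False alt_odd[OF i, of r "\<not> s" "\<not> s"] by auto
    moreover have "alt i (\<not> s) r * (g i r' * x) = 0" using a by (simp add: mult.assoc[symmetric] del: val_simps)
    ultimately show ?thesis using a poly_0_left[OF poly_g.hyps] by (simp del: val_simps)
  qed
next
  case (poly_add x D y D')
  have "dalt i s r (x + y) = dalt i s r x + dalt i s r y"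
    unfolding dalt_def sum.distrib[symmetric] by (intro sum.cong) (auto simp: distrib_left tr_add)
  then show ?case using poly_add.IH[of r] by (simp add: distrib_left tr_add algebra_simps del: val_simps)
next
  case (poly_scale x D z)
  have "dalt i s r (z *\<^sub>C x) = z * dalt i s r x"
    unfolding dalt_def sum_distrib_left by (intro sum.cong) (auto simp: mult_scaleC_right tr_scale)
  then show ?case using poly_scale.IH[of r] by (simp add: mult_scaleC_right tr_scale algebra_simps del: val_simps)
qed

lemma poly_pp: "poly i s j x D \<Longrightarrow> D (pp (\<not> s) * \<alpha>) \<beta> = D \<alpha> \<beta>"
  by (induction arbitrary: \<alpha> rule: poly.induct) (simp_all add: mult.assoc del: val_simps)

lemma poly_add_left: "poly i s j x D \<Longrightarrow> D (\<alpha> + \<alpha>') \<beta> = D \<alpha> \<beta> + D \<alpha>' \<beta>"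
  by (induction arbitrary: \<alpha> \<alpha>' rule: poly.induct) (auto simp: distrib_right tr_add algebra_simps simp del: val_simps)

lemma poly_add_right: "poly i s j x D \<Longrightarrow> D \<alpha> (\<beta> + \<beta>') = D \<alpha> \<beta> + D \<alpha> \<beta>'"
  by (induction arbitrary: \<alpha> rule: poly.induct) (auto simp: distrib_left tr_add algebra_simps simp del: val_simps)

type_synonym 'b entry = "nat \<times> 'b \<times> ('b \<Rightarrow> 'b \<Rightarrow> complex)"

definition PR :: "'a entry list \<Rightarrow> 'a" where "PR R = prod_list (map (fst \<circ> snd) R)"

lemma PR_simps [simp]: "PR [] = 1" "PR ((j, x, D) # R) = x * PR R" "PR (R1 @ R2) = PR R1 * PR R2"
  by (simp_all add: PR_def)

fun DR :: "'a entry list \<Rightarrow> 'a \<Rightarrow> 'a \<Rightarrow> complex" where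
  "DR [] \<alpha> \<beta> = 0"
| "DR ((j, x, D) # R) \<alpha> \<beta> = D \<alpha> (PR R * \<beta>) + DR R (\<alpha> * x) \<beta>"

lemma DR_append: "DR (R1 @ R2) \<alpha> \<beta> = DR R1 \<alpha> (PR R2 * \<beta>) + DR R2 (\<alpha> * PR R1) \<beta>"
  by (induction R1 arbitrary: \<alpha>) (auto simp: mult.assoc)

definition polys :: "nat \<Rightarrow> bool \<Rightarrow> 'a entry list \<Rightarrow> bool" where
  "polys i s R \<longleftrightarrow> (\<forall>(j, x, D)\<in>set R. j \<in> {1..N} \<and> poly i s j x D)"

lemma polys_simps [simp]: "polys i s []" "polys i s ((j, x, D) # R) \<longleftrightarrow> j \<in> {1..N} \<and> poly i s j x D \<and> polys i s R"
  "polys i s (R1 @ R2) \<longleftrightarrow> polys i s R1 \<and> polys i s R2"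
  by (auto simp: polys_def ball_Un)

lemma DR_add_left: "polys i s R \<Longrightarrow> DR R (\<alpha> + \<alpha>') \<beta> = DR R \<alpha> \<beta> + DR R \<alpha>' \<beta>"
proof (induction R arbitrary: \<alpha> \<alpha>')
  case (Cons h R)
  obtain j x D where h: "h = (j, x, D)" by (cases h)
  show ?case using Cons poly_add_left[of i s j x D] by (simp add: h distrib_right)
qed simp

lemma DR_add_right: "polys i s R \<Longrightarrow> DR R \<alpha> (\<beta> + \<beta>') = DR R \<alpha> \<beta> + DR R \<alpha> \<beta>'"
proof (induction R arbitrary: \<alpha>)
  case (Cons h R)
  obtain j x D where h: "h = (j, x, D)" by (cases h)
  show ?case using Cons poly_add_right[of i s j x D] by (simp add: h distrib_left)
qed simp

lemma DR_zero:
  assumes "polys i s (R1 @ R2)" "alternating (map fst (R1 @ R2)) (map (fst \<circ> snd) (R1 @ R2))" "length (R1 @ R2) \<ge> 2" and i: "i \<in> {1..N}"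
  shows "DR R2 (PR R1) 1 = 0"
  using assms(1-3)
proof (induction R2 arbitrary: R1)
  case (Cons h R2)
  obtain j x D where h: "h = (j, x, D)" by (cases h)
  have "DR R2 (PR (R1 @ [h])) 1 = 0" using Cons.prems by (intro Cons.IH) auto
  moreover have "D (PR R1) (PR R2) = 0"
  proof (cases "j = i")
    case False
    then show ?thesis using Cons.prems(1) poly_other[of i s j x D] by (simp add: h)
  next
    case True
    have px: "poly i s i x D" using Cons.prems(1) True by (simp add: h)
    show ?thesis
    proof (rule poly_vanish[OF px i])
      show "(\<forall>y\<in>B i. tr (\<not> s) (PR R1 * y) = 0) \<or> (\<forall>y\<in>B i. tr s (y * PR R2) = 0)"
      proof (cases R2)
        case (Cons h2 R3)
        obtain j2 x2 D2 where h2: "h2 = (j2, x2, D2)" by (cases h2)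
        have a: "alternating (j2 # map fst R3) (map (fst \<circ> snd) R2)" "i \<noteq> j2"
          using Cons.prems(2) Cons h h2 True
          by (auto simp: alternating_def list_all2_append distinct_adj_append_iff comp_def)
        have "tr s (y * PR R2) = 0" if "y \<in> B i" for y
          unfolding PR_def by (rule free_left[OF i that a])
        then show ?thesis by blast
      next
        case Nil
        then have ne: "R1 \<noteq> []" using Cons.prems(3) by auto
        have a: "alternating (map fst R1) (map (fst \<circ> snd) R1)" "map fst R1 \<noteq> []" "last (map fst R1) \<noteq> i"
          using Cons.prems(2) Nil h True ne
          by (auto simp: alternating_def list_all2_append distinct_adj_append_iff comp_def)
        have "tr (\<not> s) (PR R1 * y) = 0" if "y \<in> B i" for y
          unfolding PR_def by (rule free_right[OF i that a])
        then show ?thesis by blast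
      qed
    qed
  qed
  ultimately show ?case by (simp add: h)
qed simp


lemma poly_product:
  assumes rec: alt_recursion and i: "i \<in> {1..N}" and R: "polys i s R"
  shows "tr s (g i s * PR R) = C i s * DR R 1 1"
  using R
proof (induction "length R * Suc (length R) + length (filter (\<lambda>h. E (fst (snd h)) \<noteq> 0) R)" arbitrary: R rule: less_induct)
  case less
  have shorter: "tr s (g i s * PR R') = C i s * DR R' 1 1" if "length R' < length R" "polys i s R'" for R'
  proof (rule less.hyps[OF _ that(2)])
    have "length (filter (\<lambda>h. E (fst (snd h)) \<noteq> 0) R') \<le> length R'" by simp
    moreover have "Suc (length R') * Suc (length R') \<le> length R * Suc (length R)" using that(1) by (intro mult_mono) auto
    ultimately show "length R' * Suc (length R') + length (filter (\<lambda>h. E (fst (snd h)) \<noteq> 0) R') <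
      length R * Suc (length R) + length (filter (\<lambda>h. E (fst (snd h)) \<noteq> 0) R)"
      unfolding mult_Suc mult_Suc_right by linarith
  qed
  have merge: "tr s (g i s * PR (R1 @ (j, x, D) # (j, y, D') # R2)) = C i s * DR (R1 @ (j, x, D) # (j, y, D') # R2) 1 1"
    if "length (R1 @ (j, x, D) # (j, y, D') # R2) = length R" "polys i s (R1 @ (j, x, D) # (j, y, D') # R2)" for R1 R2 j x y D D'
  proof -
    let ?R = "R1 @ (j, x * y, \<lambda>\<alpha> \<beta>. D \<alpha> (y * \<beta>) + D' (\<alpha> * x) \<beta>) # R2"
    have "polys i s ?R" "length ?R < length R" using that poly_mult[of i s j x D y D'] by auto
    with shorter[of ?R] show ?thesis by (simp add: DR_append mult.assoc add.assoc del: val_simps)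
  qed
  show ?case
  proof (cases "distinct_adj (map fst R)")
    case False
    have "\<exists>R1 j xx yy R2. R = R1 @ (j, xx) # (j, yy) # R2" using False
    proof (induction R rule: induct_list012)
      case (3 h1 h2 R)
      show ?case
      proof (cases "fst h1 = fst h2")
        case True
        then show ?thesis by (metis append_Nil prod.collapse)
      next
        case False
        then have "\<not> distinct_adj (map fst (h2 # R))" using "3.prems" by auto
        then obtain R1 j xx yy R2 where "h2 # R = R1 @ (j, xx) # (j, yy) # R2" using "3.IH"(2) by blast
        then show ?thesis by (metis append_Cons)
      qed
    qed auto
    then obtain R1 j x D y D' R2 where "R = R1 @ (j, x, D) # (j, y, D') # R2" by (metis prod.exhaust)
    then show ?thesis using merge[of R1 j x D y D' R2] less.prems by simp
  next
    case dist: True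
    show ?thesis
    proof (cases "\<exists>h\<in>set R. E (fst (snd h)) \<noteq> 0")
      case True
      then obtain h R1 R2 where hR: "R = R1 @ h # R2" "E (fst (snd h)) \<noteq> 0" by (metis split_list)
      obtain j x D where h: "h = (j, x, D)" by (cases h)
      have j: "j \<in> {1..N}" and px: "poly i s j x D" and p1: "polys i s R1" "polys i s R2" using less.prems hR h by auto
      let ?R' = "R1 @ (j, x - E x, D) # R2"
      have p': "poly i s j (x - E x) D"
        using poly_add[OF px poly_scale[OF poly_E[of i s j x], of "-1"]] by (simp add: scaleC_minus1)
      have c1: "tr s (g i s * PR ?R') = C i s * DR ?R' 1 1"
      proof (rule less.hyps)
        show "length ?R' * Suc (length ?R') + length (filter (\<lambda>h. E (fst (snd h)) \<noteq> 0) ?R') <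
          length R * Suc (length R) + length (filter (\<lambda>h. E (fst (snd h)) \<noteq> 0) R)"
          using hR h by (simp add: E_diff_E)
        show "polys i s ?R'" using j p' p1 by simp
      qed
      let ?Z = "\<lambda>\<alpha> \<beta>. 0 :: complex"
      have c2: "tr s (g i s * PR (R1 @ (j, E x, ?Z) # R2)) = C i s * DR (R1 @ (j, E x, ?Z) # R2) 1 1"
      proof (cases R2)
        case (Cons h2 R3)
        obtain j2 x2 D2 where h2: "h2 = (j2, x2, D2)" by (cases h2)
        have "tr s (g i s * PR (R1 @ (j2, E x, ?Z) # (j2, x2, D2) # R3)) = C i s * DR (R1 @ (j2, E x, ?Z) # (j2, x2, D2) # R3) 1 1"
          using p1 Cons h2 hR poly_E[of i s j2 x] by (intro merge) auto
        then show ?thesis using Cons h2 by (simp add: DR_append del: val_simps)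
      next
        case Nil
        show ?thesis
        proof (cases R1 rule: rev_cases)
          case 1: Nil
          have "tr s (g i s * E x) = 0" using tr_cond_exp_right[of s "g i s" x] tr_g[OF i] by (simp del: val_simps)
          then show ?thesis using Nil 1 by (simp del: val_simps)
        next
          case (snoc R0 h2)
          obtain j2 x2 D2 where h2: "h2 = (j2, x2, D2)" by (cases h2)
          have "tr s (g i s * PR (R0 @ (j2, x2, D2) # (j2, E x, ?Z) # [])) = C i s * DR (R0 @ (j2, x2, D2) # (j2, E x, ?Z) # []) 1 1"
            using p1 Nil snoc h2 hR poly_E[of i s j2 x] by (intro merge) auto
          then show ?thesis using Nil snoc h2 by (simp add: DR_append del: val_simps)
        qed
      qed
      have "PR R = PR ?R' + PR (R1 @ (j, E x, ?Z) # R2)"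
        unfolding hR h by (simp add: algebra_simps)
      moreover have "DR R 1 1 = DR ?R' 1 1 + DR (R1 @ (j, E x, ?Z) # R2) 1 1"
      proof -
        have 1: "DR R1 1 (x * PR R2) = DR R1 1 ((x - E x) * PR R2) + DR R1 1 (E x * PR R2)"
          using DR_add_right[OF p1(1), of 1 "(x - E x) * PR R2" "E x * PR R2"] by (simp add: algebra_simps)
        have 2: "DR R2 (PR R1 * x) 1 = DR R2 (PR R1 * (x - E x)) 1 + DR R2 (PR R1 * E x) 1"
          using DR_add_left[OF p1(2), of "PR R1 * (x - E x)" "PR R1 * E x" 1] by (simp add: algebra_simps)
        show ?thesis unfolding hR h by (simp add: DR_append 1 2)
      qed
      ultimately show ?thesis using c1 c2 by (simp add: distrib_left tr_add del: val_simps)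
    next
      case False
      then have cen: "\<And>h. h \<in> set R \<Longrightarrow> E (fst (snd h)) = 0" by blast
      have al: "alternating (map fst R) (map (fst \<circ> snd) R)"
        unfolding alternating_def
      proof (intro conjI dist)
        show "set (map fst R) \<subseteq> {1..N}" using less.prems by (auto simp: polys_def)
        show "list_all2 (\<lambda>j x. x \<in> B j \<and> E x = 0) (map fst R) (map (fst \<circ> snd) R)"
          using cen less.prems unfolding polys_def list_all2_map1 list_all2_map2
          by (intro list_all2_same[THEN iffD2] ballI) (auto dest!: bspec intro: poly_in_B)
      qed
      consider "R = []" | j x D where "R = [(j, x, D)]" | j x D h2 R2 where "R = (j, x, D) # h2 # R2"
        by (metis list.exhaust prod.exhaust)
      then show ?thesis
      proof cases
        case 1 then show ?thesis using tr_g[OF i] by (simp del: val_simps)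
      next
        case 2
        show ?thesis
        proof (cases "j = i")
          case True
          have px: "poly i s i x D" using less.prems 2 True by simp
          have e: "g i s * (pp (\<not> s) * x) = g i s * x"
            using type_mult(2)[of b i, OF type[OF i], of s "\<not> s"] by (simp add: mult.assoc[symmetric] del: val_simps)
          have "D (pp (\<not> s)) 1 = D 1 1" using poly_pp[OF px, of 1 1] by simp
          then show ?thesis using poly_single[OF rec i px, of 0] 2 e by (simp add: dalt_def del: val_simps)
        next
          case False
          have "tr s (g i s * prod_list (map (fst \<circ> snd) R)) = 0"
            using al 2 False by (intro free_left[OF i B_g[OF i], of j "[]"]) auto
          then show ?thesis using 2 poly_other[of i s j x D 1 1] False less.prems by (simp del: val_simps)
        qed
      next
        case 3
        have "DR R 1 1 = 0" using DR_zero[of i s "[]" R] less.prems al 3 i by simp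
        moreover have "tr s (g i s * PR R) = 0"
        proof (cases "j = i")
          case False
          have "tr s (g i s * prod_list (map (fst \<circ> snd) R)) = 0"
            using al 3 False by (intro free_left[OF i B_g[OF i], of j "map fst (h2 # R2)"]) auto
          then show ?thesis unfolding PR_def .
        next
          case True
          have "x \<in> B i" using less.prems 3 True poly_in_B[of i s i x D] i by simp
          then have gx: "g i s * x \<in> B i" using B_closed(2)[OF i B_g[OF i]] by blast
          have "tr s (g i s * x * prod_list (map (fst \<circ> snd) (h2 # R2))) = 0"
            using al 3 True by (intro free_left[OF i gx, of "fst h2" "map fst R2"]) (auto simp: alternating_def)
          then show ?thesis using 3 by (simp add: PR_def mult.assoc del: val_simps)
        qed
        ultimately show ?thesis by simp
      qed
    qed
  qed
qed

lemma schwinger_dyson_free: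
  assumes rec: alt_recursion
  shows "schwinger_dyson N C (\<lambda>\<kappa> w. tr \<kappa> (wv b w))"
  unfolding schwinger_dyson_def
proof (intro conjI allI ballI impI)
  fix \<kappa> \<kappa>' and w :: "letter list"
  show "tr \<kappa> (wv b []) = 1" by simp
  show "tr \<kappa> (wv b (Pr \<kappa>' # w)) = (if \<kappa> = \<kappa>' then tr \<kappa> (wv b w) else 0)" by simp
next
  fix i s and w :: "letter list" assume i: "i \<in> {1..N}" and w: "set w \<subseteq> letters N"
  have "tr (\<not> s) (g i s * wv b w) = tr (\<not> s) (pp s * (g i s * wv b w))"
    using type_mult(1)[of b i, OF type[OF i], of s s] by (simp add: mult.assoc[symmetric] del: val_simps)
  then show "tr (\<not> s) (wv b (Ge i s # w)) = 0" by (simp del: val_simps)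
  define ent where "ent e = (case e of Pr \<kappa> \<Rightarrow> (1, pp \<kappa>, \<lambda>\<alpha> \<beta>. 0)
    | Ge j r \<Rightarrow> (j, g j r, \<lambda>\<alpha> \<beta>. if j = i \<and> r = (\<not> s) then tr (\<not> s) \<alpha> * tr s \<beta> else 0))" for e :: letter
  have N: "1 \<in> {1..N}" using i by auto
  have pe: "polys i s [ent e]" if "e \<in> letters N" for e
  proof (cases e)
    case (Pr \<kappa>)
    have "poly i s 1 (p (ix \<kappa>) * 1) (\<lambda>\<alpha> \<beta>. 0)" by (rule poly_p[OF _ poly_1]) simp
    then show ?thesis using N Pr by (simp add: ent_def pp_def)
  next
    case (Ge j r)
    have "poly i s j (g j r * 1) (\<lambda>\<alpha> \<beta>. (if j = i \<and> r = (\<not> s) then tr (\<not> s) \<alpha> * tr s (1 * \<beta>) else 0) + 0)"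
      by (rule poly_g[OF poly_1])
    then show ?thesis using that Ge by (auto simp: ent_def letters_def simp del: val_simps cong: if_cong)
  qed
  have "polys i s (map ent w)" using w
  proof (induction w)
    case (Cons e w)
    then have "polys i s ([ent e] @ map ent w)" unfolding polys_simps(3) using pe by simp
    then show ?case by simp
  qed simp
  from poly_product[OF rec i this] have "tr s (g i s * PR (map ent w)) = C i s * DR (map ent w) 1 1" .
  moreover have PR: "PR (map ent w) = wv b w" for w
  proof (induction w)
    case (Cons e w) then show ?case by (cases e) (simp_all add: ent_def del: val_simps(2))
  qed simp
  moreover have "DR (map ent w) \<alpha> 1 = (\<Sum>j<length w. if w ! j = Ge i (\<not> s) then tr (\<not> s) (\<alpha> * wv b (take j w)) * tr s (wv b (drop (Suc j) w)) else 0)" for \<alpha> w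
  proof (induction w arbitrary: \<alpha>)
    case (Cons e w)
    have "DR (map ent (e # w)) \<alpha> 1 = (if e = Ge i (\<not> s) then tr (\<not> s) \<alpha> * tr s (wv b w) else 0) + DR (map ent w) (\<alpha> * val b e) 1"
      by (cases e) (auto simp: ent_def PR simp del: val_simps(2))
    then show ?case unfolding Cons.IH length_Cons sum.lessThan_Suc_shift by (simp add: mult.assoc del: val_simps cong: if_cong)
  qed simp
  ultimately show "tr s (wv b (Ge i s # w)) = C i s * (\<Sum>j<length w. if w ! j = Ge i (\<not> s) then tr (\<not> s) (wv b (take j w)) * tr s (wv b (drop (Suc j) w)) else 0)"
    by (simp del: val_simps cong: if_cong)
qed

end

context rect_free begin

lemma alt_power: "i \<in> {1..N} \<Longrightarrow> alt i s (2 * h) = pp s * (g i s * g i (\<not> s)) ^ h"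
  by (induction h) (simp_all add: mult.assoc power_Suc2 del: val_simps power_Suc)

lemma moment_recursion:
  assumes c: "\<And>i. i \<in> {1..N} \<Longrightarrow> c i > 0" and le: "weight \<phi> p k \<le> weight \<phi> p l"
    and dist: "\<And>i. i \<in> {1..N} \<Longrightarrow> has_distribution (corner_state \<phi> p k) (b i * adj (b i))
           (distr (marchenko_pastur (weight \<phi> p l / weight \<phi> p k)) borel (\<lambda>t. c i * weight \<phi> p k / weight \<phi> p l * t))"
    and C: "\<And>i s. C i s = of_real (if s then c i * weight \<phi> p k / weight \<phi> p l else c i)"
  shows alt_recursion
  unfolding alt_recursion_def
proof (intro ballI allI)
  fix i s h assume i: "i \<in> {1..N}"
  define la where "la = weight \<phi> p l / weight \<phi> p k"
  have rk: "weight \<phi> p k > 0" "weight \<phi> p l > 0" using weight_pos k l by auto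
  have la: "la \<ge> 1" using le rk by (simp add: la_def)
  define c' where "c' = c i / la"
  have c': "c i * weight \<phi> p k / weight \<phi> p l = c'" "c' > 0" using c[OF i] rk by (simp_all add: c'_def la_def)
  note T = type_mult[of b i, OF type[OF i]]
  define u where "u r = c' ^ r * mp_moment la r" for r
  define v where "v r = (if r = 0 then 1 else u r / la)" for r
  have pu: "pp False * (b i * adj (b i)) ^ r = (b i * adj (b i)) ^ r" if "r \<ge> 1" for r
    using T(1)[of False False] that by (cases r) (auto simp: mult.assoc[symmetric])
  have U: "tr False (alt i False (2 * r)) = of_real (u r)" for r
  proof (cases "r = 0")
    case True then show ?thesis by (simp add: u_def mp_moment_def)
  next
    case False
    have "tr False (alt i False (2 * r)) = corner_state \<phi> p k ((b i * adj (b i)) ^ r)"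
      using pu[of r] False unfolding alt_power[OF i] by (simp add: tr_def corner_state_def ix_def)
    also have "\<dots> = of_real (\<integral>t. t ^ r \<partial>distr (marchenko_pastur la) borel (\<lambda>t. c' * t))"
      using dist[OF i] False unfolding has_distribution_def c'(1) la_def[symmetric] by auto
    also have "(\<integral>t. t ^ r \<partial>distr (marchenko_pastur la) borel (\<lambda>t. c' * t)) = (\<integral>t. (c' * t) ^ r \<partial>marchenko_pastur la)"
      by (rule integral_distr) (auto simp: marchenko_pastur_def)
    also have "\<dots> = u r" using False by (simp add: power_mult_distrib u_def mp_moment_def)
    finally show ?thesis .
  qed
  have V: "tr True (alt i True (2 * r)) = of_real (v r)" for r
  proof (cases r)
    case 0 then show ?thesis by (simp add: v_def)
  next
    case (Suc q)
    have 1: "alt i True (2 * r) = g i True * alt i False (Suc (2 * q))"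
      using alt_Suc_left[OF i, of True "Suc (2 * q)"] Suc by (simp del: alt.simps val_simps)
    have 2: "alt i False (2 * r) = alt i False (Suc (2 * q)) * g i True"
      using alt.simps(2)[of i False "Suc (2 * q)"] Suc by (simp del: alt.simps val_simps)
    have "\<phi> (pp True * alt i True (2 * r)) = \<phi> (alt i True (2 * r))" using alt_pp_left[OF i] by simp
    also have "\<dots> = \<phi> (alt i False (2 * r))" unfolding 1 2 by (rule \<phi>_tr)
    also have "\<dots> = \<phi> (pp False * alt i False (2 * r))" using alt_pp_left[OF i] by simp
    finally have "tr True (alt i True (2 * r)) * of_real (weight \<phi> p l) = tr False (alt i False (2 * r)) * of_real (weight \<phi> p k)"
      using rk by (simp add: tr_def ix_def)
    then have "tr True (alt i True (2 * r)) = of_real (u r) * of_real (weight \<phi> p k) / of_real (weight \<phi> p l)"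
      using rk unfolding U by (simp add: field_simps)
    then show ?thesis using Suc rk by (simp add: v_def la_def)
  qed
  have R: "u (Suc h) = c i * (\<Sum>r\<le>h. v r * u (h - r))" for h
  proof -
    have "mp_moment la (Suc h) = la * (\<Sum>r\<le>h. (if r = 0 then 1 else mp_moment la r / la) * mp_moment la (h - r))"
    proof -
      have "(\<Sum>r\<le>h. mp_moment la r * mp_moment la (h - r)) = mp_moment la h + (\<Sum>r\<in>{..h} - {0}. mp_moment la r * mp_moment la (h - r))"
        by (subst sum.remove[of _ 0]) (auto simp: mp_moment_def)
      moreover have "(\<Sum>r\<le>h. (if r = 0 then 1 else mp_moment la r / la) * mp_moment la (h - r)) =
        mp_moment la h + (\<Sum>r\<in>{..h} - {0}. mp_moment la r * mp_moment la (h - r)) / la"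
        by (subst sum.remove[of _ 0]) (auto simp: sum_divide_distrib intro!: sum.cong)
      ultimately show ?thesis using la mp_moment_rec[OF la, of h] by (simp add: field_simps)
    qed
    then have "u (Suc h) = c' ^ Suc h * (la * (\<Sum>r\<le>h. (if r = 0 then 1 else mp_moment la r / la) * mp_moment la (h - r)))"
      by (simp add: u_def)
    also have "\<dots> = c i * (\<Sum>r\<le>h. c' ^ h * ((if r = 0 then 1 else mp_moment la r / la) * mp_moment la (h - r)))"
      using la by (simp add: c'_def sum_distrib_left mult_ac)
    also have "(\<Sum>r\<le>h. c' ^ h * ((if r = 0 then 1 else mp_moment la r / la) * mp_moment la (h - r))) = (\<Sum>r\<le>h. v r * u (h - r))"
    proof (intro sum.cong refl)
      fix r assume "r \<in> {..h}"
      then have "c' ^ h = c' ^ r * c' ^ (h - r)" by (simp add: power_add[symmetric])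
      then show "c' ^ h * ((if r = 0 then 1 else mp_moment la r / la) * mp_moment la (h - r)) = v r * u (h - r)"
        by (simp add: v_def u_def)
    qed
    finally show ?thesis .
  qed
  show "tr s (alt i s (2 * Suc h)) = C i s * (\<Sum>r\<le>h. tr (\<not> s) (alt i (\<not> s) (2 * r)) * tr s (alt i s (2 * (h - r))))"
  proof (cases s)
    case False
    have "tr s (alt i s (2 * Suc h)) = of_real (u (Suc h))" using U[of "Suc h"] False by (simp del: alt.simps mult_Suc_right)
    also have "\<dots> = C i s * (\<Sum>r\<le>h. of_real (v r) * of_real (u (h - r)))" unfolding R C using False by simp
    finally show ?thesis using False U V by (simp del: alt.simps mult_Suc_right)
  next
    case True
    have "tr s (alt i s (2 * Suc h)) = of_real (v (Suc h))" using V[of "Suc h"] True by (simp del: alt.simps mult_Suc_right)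
    also have "\<dots> = of_real (c' * (\<Sum>r\<le>h. v r * u (h - r)))" unfolding v_def[of "Suc h"] R by (simp add: c'_def)
    also have "(\<Sum>r\<le>h. v r * u (h - r)) = (\<Sum>r\<le>h. u r * v (h - r))"
      by (rule sum.reindex_bij_witness[of _ "\<lambda>r. h - r" "\<lambda>r. h - r"]) auto
    finally show ?thesis using True U V c'(1) by (simp add: C del: alt.simps mult_Suc_right)
  qed
qed

end

context rect begin

text \<open>Simultaneous evaluation of one polynomial at two families.\<close>

inductive twin :: "(nat \<Rightarrow> 'a) \<Rightarrow> (nat \<Rightarrow> 'a) \<Rightarrow> nat set \<Rightarrow> 'a \<Rightarrow> 'a \<Rightarrow> bool" for a b I where
  twin_1: "twin a b I 1 1"
| twin_p: "m \<in> {1..d} \<Longrightarrow> twin a b I x y \<Longrightarrow> twin a b I (p m * x) (p m * y)"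
| twin_g: "i \<in> I \<Longrightarrow> twin a b I x y \<Longrightarrow> twin a b I (val a (Ge i s) * x) (val b (Ge i s) * y)"
| twin_add: "twin a b I x y \<Longrightarrow> twin a b I x' y' \<Longrightarrow> twin a b I (x + x') (y + y')"
| twin_scale: "twin a b I x y \<Longrightarrow> twin a b I (z *\<^sub>C x) (z *\<^sub>C y)"

lemma twin_mult: "twin a b I x y \<Longrightarrow> twin a b I x' y' \<Longrightarrow> twin a b I (x * x') (y * y')"
  by (induction rule: twin.induct)
    (auto simp: mult.assoc distrib_right mult_scaleC_left simp del: val_simps intro: twin.intros)

lemma twin_p1: "m \<in> {1..d} \<Longrightarrow> twin a b I (p m) (p m)"
  using twin_p[OF _ twin_1, of m a b I] by simp

lemma twin_g1: "i \<in> I \<Longrightarrow> twin a b I (val a (Ge i s)) (val b (Ge i s))"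
  using twin_g[OF _ twin_1, of i I a b s] by (simp del: val_simps)

lemma twin_adj: "twin a b I x y \<Longrightarrow> twin a b I (adj x) (adj y)"
proof (induction rule: twin.induct)
  case twin_1 then show ?case using twin.twin_1 by simp
next
  case (twin_p m x y)
  then show ?case using twin_mult[OF twin_p.IH twin_p1[OF twin_p.hyps(1)]] by (simp add: adj_mult p_adj)
next
  case (twin_g i x y s)
  have "adj (val e (Ge i s)) = val e (Ge i (\<not> s))" for e by (simp add: adj_adj)
  then show ?case using twin_mult[OF twin_g.IH twin_g1[OF twin_g.hyps(1), of a b "\<not> s"]]
    by (simp add: adj_mult del: val_simps)
qed (auto simp: adj_add adj_scaleC intro: twin.intros)

lemma twin_mono: "twin a b I x y \<Longrightarrow> I \<subseteq> J \<Longrightarrow> twin a b J x y"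
  by (induction rule: twin.induct) (auto simp del: val_simps intro: twin.intros)

lemma twin_sum: "finite I' \<Longrightarrow> I' \<subseteq> {1..d} \<Longrightarrow> twin a b I (\<Sum>m\<in>I'. z m *\<^sub>C p m) (\<Sum>m\<in>I'. z m *\<^sub>C p m)"
proof (induction I' rule: finite_induct)
  case empty show ?case using twin_scale[OF twin_1, of a b I 0] by simp
next
  case (insert m F) then show ?case by (auto intro!: twin_add twin_scale twin_p1)
qed

lemma trd_val_0: "e \<in> letters N \<Longrightarrow> (\<And>i. i \<in> {1..N} \<Longrightarrow> has_type p k l (a i)) \<Longrightarrow> m \<in> {1..d} \<Longrightarrow> m \<notin> range ix \<Longrightarrow> p m * val a e = 0 \<and> val a e * p m = 0"
  by (cases e) (auto simp: letters_def pp_def p_mult type_mult(3,4) simp del: val_simps(2))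

lemma twin_trd:
  assumes a: "\<And>i. i \<in> {1..N} \<Longrightarrow> has_type p k l (a i)" and b: "\<And>i. i \<in> {1..N} \<Longrightarrow> has_type p k l (b i)"
    and eq: "\<And>\<kappa> w. set w \<subseteq> letters N \<Longrightarrow> tr \<kappa> (wv a w) = tr \<kappa> (wv b w)"
    and t: "twin a b {1..N} x y" and m: "m \<in> {1..d}"
  shows "trd m x = trd m y"
proof -
  define Mon where "Mon = {(wv a w, wv b w) |w. set w \<subseteq> letters N} \<union> {(p m, p m) |m. m \<in> {1..d}} \<union> {(0, 0)}"
  have Mon_trd: "trd m u = trd m v" if "(u, v) \<in> Mon" for u v
  proof -
    have "trd m (wv a w) = trd m (wv b w)" if w: "set w \<subseteq> letters N" for w
    proof (cases "m \<in> range ix")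
      case True
      then show ?thesis using eq[OF w] by (auto simp: tr_trd)
    next
      case False
      show ?thesis
      proof (cases w)
        case (Cons e w')
        then have e: "e \<in> letters N" using w by simp
        show ?thesis using trd_val_0[OF e a m False] trd_val_0[OF e b m False]
          by (simp add: Cons trd_def mult.assoc[symmetric])
      qed simp
    qed
    with that show ?thesis by (auto simp: Mon_def)
  qed
  have zero: "(0, 0) \<in> Mon" by (simp add: Mon_def)
  have Mon_p: "(u * p m', v * p m') \<in> Mon" if uv: "(u, v) \<in> Mon" and m': "m' \<in> {1..d}" for u v m'
  proof -
    consider w where "set w \<subseteq> letters N" "u = wv a w" "v = wv b w" | n where "u = p n" "v = p n" "n \<in> {1..d}" | "u = 0" "v = 0"
      using uv by (auto simp: Mon_def)
    then show ?thesis
    proof cases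
      case 1
      show ?thesis
      proof (cases "m' \<in> range ix")
        case True
        then obtain \<kappa> where "m' = ix \<kappa>" by auto
        then have "u * p m' = wv a (w @ [Pr \<kappa>])" "v * p m' = wv b (w @ [Pr \<kappa>])" using 1 by (auto simp: pp_def)
        moreover have "set (w @ [Pr \<kappa>]) \<subseteq> letters N" using 1 by simp
        ultimately show ?thesis unfolding Mon_def by blast
      next
        case False
        show ?thesis
        proof (cases w rule: rev_cases)
          case Nil
          then show ?thesis using 1 m' by (auto simp: Mon_def)
        next
          case (snoc w' e)
          then have e: "e \<in> letters N" using 1 by simp
          show ?thesis using trd_val_0[OF e a m' False] trd_val_0[OF e b m' False] zero 1 snoc
            by (simp add: mult.assoc)
        qed
      qed
    next
      case 2 then show ?thesis using m' by (auto simp: Mon_def p_mult)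
    qed (use zero in auto)
  qed
  have Mon_g: "(u * val a (Ge i s), v * val b (Ge i s)) \<in> Mon" if uv: "(u, v) \<in> Mon" and i: "i \<in> {1..N}" for u v i s
  proof -
    have L: "Ge i s \<in> letters N" using i by (auto simp: letters_def)
    consider w where "set w \<subseteq> letters N" "u = wv a w" "v = wv b w" | n where "u = p n" "v = p n" "n \<in> {1..d}" | "u = 0" "v = 0"
      using uv by (auto simp: Mon_def)
    then show ?thesis
    proof cases
      case 1
      then have "u * val a (Ge i s) = wv a (w @ [Ge i s])" "v * val b (Ge i s) = wv b (w @ [Ge i s])" by (simp_all del: val_simps)
      moreover have "set (w @ [Ge i s]) \<subseteq> letters N" using 1 L by simp
      ultimately show ?thesis unfolding Mon_def by blast
    next
      case 2
      have "(wv a [Ge i s], wv b [Ge i s]) \<in> Mon" using L unfolding Mon_def by (intro UnI1 CollectI exI[of _ "[Ge i s]"]) auto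
      then show ?thesis using 2 zero type_mult(3)[of a i, OF a[OF i]] type_mult(3)[of b i, OF b[OF i]]
        by (auto simp del: val_simps)
    qed (use zero in auto)
  qed
  have "\<forall>(u, v)\<in>Mon. trd m (u * x) = trd m (v * y)" using t
  proof (induction rule: twin.induct)
    case twin_1 then show ?case using Mon_trd by auto
  next
    case (twin_p m' x y)
    then show ?case using Mon_p[OF _ twin_p.hyps(1)] by (auto simp: mult.assoc[symmetric])
  next
    case (twin_g i x y s)
    then show ?case using Mon_g[OF _ twin_g.hyps(1)] by (auto simp: mult.assoc[symmetric] simp del: val_simps)
  next
    case (twin_add x y x' y')
    have add: "trd m (x + y) = trd m x + trd m y" for x y
      by (simp add: trd_def distrib_left \<phi>_add add_divide_distrib)
    show ?case
    proof (intro ballI, clarify)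
      fix u v assume "(u, v) \<in> Mon"
      with twin_add.IH have "trd m (u * x) = trd m (v * y)" "trd m (u * x') = trd m (v * y')" by fast+
      then show "trd m (u * (x + x')) = trd m (v * (y + y'))" by (simp add: distrib_left add)
    qed
  next
    case (twin_scale x y z)
    have scale: "trd m (z *\<^sub>C x) = z * trd m x" for x by (simp add: trd_def mult_scaleC_right \<phi>_scale)
    show ?case using twin_scale.IH by (auto simp: mult_scaleC_right scale)
  qed
  moreover have "(1, 1) \<in> Mon" unfolding Mon_def by (intro UnI1 CollectI exI[of _ "[]"]) auto
  ultimately show ?thesis by fastforce
qed

lemma free_marchenko_pastur_transfer:
  assumes a: "\<And>i. i \<in> {1..N} \<Longrightarrow> has_type p k l (a i)" and b: "\<And>i. i \<in> {1..N} \<Longrightarrow> has_type p k l (b i)"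
    and eq: "\<And>\<kappa> w. set w \<subseteq> letters N \<Longrightarrow> tr \<kappa> (wv a w) = tr \<kappa> (wv b w)"
    and fb: "free_marchenko_pastur \<phi> d p k l N c b"
  shows "free_marchenko_pastur \<phi> d p k l N c a"
  unfolding free_marchenko_pastur_def
proof (intro conjI ballI)
  obtain B where B: "\<And>i. i \<in> {1..N} \<Longrightarrow> star_subalgebra (B i) \<and> diag_algebra d p \<subseteq> B i \<and> b i \<in> B i" "free_subalgebras \<phi> d p {1..N} B"
    using fb unfolding free_marchenko_pastur_def free_elements_def by blast
  interpret rf: rect_free \<phi> d p k l N b B "\<lambda>_ _. 0"
    by unfold_locales (use B b in auto)
  define A where "A i = {x. \<exists>y. twin a b {i} x y}" for i
  have "star_subalgebra (A i) \<and> diag_algebra d p \<subseteq> A i \<and> a i \<in> A i" for i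
  proof (intro conjI)
    have "twin a b {i} (0 *\<^sub>C 1) (0 *\<^sub>C 1)" by (intro twin_scale twin_1)
    then show "star_subalgebra (A i)" unfolding star_subalgebra_def A_def
      by (auto intro: twin_add twin_mult twin_adj twin_scale)
    show "diag_algebra d p \<subseteq> A i" unfolding diag_algebra_def A_def using twin_sum[of "{1..d}" a b "{i}"] by auto
    show "a i \<in> A i" using twin_g1[of i "{i}" a b False] by (auto simp: A_def)
  qed
  moreover have "free_subalgebras \<phi> d p {1..N} A"
    unfolding free_subalgebras_def
  proof (intro allI impI)
    fix js xs assume h: "js \<noteq> [] \<and> set js \<subseteq> {1..N} \<and> distinct_adj js \<and> list_all2 (\<lambda>j x. x \<in> A j \<and> cond_exp \<phi> d p x = 0) js xs"
    have E: "cond_exp \<phi> d p x = cond_exp \<phi> d p y" if "twin a b {1..N} x y" for x y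
      by (rule cond_exp_eqI) (rule twin_trd[OF a b eq that])
    have inB: "y \<in> B j" if "twin a b {j} x y" "j \<in> {1..N}" for x y j
      using that by (induction rule: twin.induct)
        (auto intro!: rf.B_closed rf.B_1 rf.B_p rf.B_g simp del: val_simps)
    have "\<exists>ys. list_all2 (\<lambda>j y. y \<in> B j \<and> cond_exp \<phi> d p y = 0) js ys \<and> twin a b {1..N} (prod_list xs) (prod_list ys)"
      if "set js \<subseteq> {1..N}" "list_all2 (\<lambda>j x. x \<in> A j \<and> cond_exp \<phi> d p x = 0) js xs" for js xs
      using that(2,1)
    proof (induction rule: list_all2_induct)
      case Nil then show ?case using twin_1 by (intro exI[of _ "[]"]) auto
    next
      case (Cons j js x xs)
      then obtain ys where ys: "list_all2 (\<lambda>j y. y \<in> B j \<and> cond_exp \<phi> d p y = 0) js ys" "twin a b {1..N} (prod_list xs) (prod_list ys)" by auto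
      obtain y where y: "twin a b {j} x y" using Cons.hyps by (auto simp: A_def)
      have j: "j \<in> {1..N}" using Cons.prems by simp
      have y': "twin a b {1..N} x y" by (rule twin_mono[OF y]) (use j in auto)
      have "cond_exp \<phi> d p y = 0" using E[OF y'] Cons.hyps by simp
      then show ?case using ys inB[OF y j] twin_mult[OF y' ys(2)] by (intro exI[of _ "y # ys"]) auto
    qed
    then obtain ys where ys: "list_all2 (\<lambda>j y. y \<in> B j \<and> cond_exp \<phi> d p y = 0) js ys" "twin a b {1..N} (prod_list xs) (prod_list ys)"
      using h by blast
    have "cond_exp \<phi> d p (prod_list ys) = 0" using B(2) h ys(1) unfolding free_subalgebras_def by blast
    then show "cond_exp \<phi> d p (prod_list xs) = 0" using E[OF ys(2)] by simp
  qed
  ultimately show "free_elements \<phi> d p {1..N} a" unfolding free_elements_def by blast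
next
  fix i assume i: "i \<in> {1..N}"
  have "corner_state \<phi> p k ((a i * adj (a i)) ^ m) = corner_state \<phi> p k ((b i * adj (b i)) ^ m)" if m: "m \<ge> 1" for m
  proof -
    let ?w = "concat (replicate m [Ge i False, Ge i True])"
    have wv: "wv e ?w = (e i * adj (e i)) ^ m" for e by (induction m) (auto simp: mult.assoc)
    have pu: "pp False * (e i * adj (e i)) ^ m = (e i * adj (e i)) ^ m" if "has_type p k l (e i)" for e
      using type_mult(1)[of e i False False, OF that] m by (cases m) (auto simp: mult.assoc[symmetric])
    have "set ?w \<subseteq> letters N" using i by (auto simp: letters_def)
    from eq[OF this, of False] show ?thesis
      unfolding wv tr_def pu[of a, OF a[OF i]] pu[of b, OF b[OF i]] by (simp add: corner_state_def ix_def)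
  qed
  then show "has_distribution (corner_state \<phi> p k) (a i * adj (a i))
       (distr (marchenko_pastur (weight \<phi> p l / weight \<phi> p k)) borel (\<lambda>t. c i * weight \<phi> p k / weight \<phi> p l * t))"
    using fb i unfolding free_marchenko_pastur_def has_distribution_def by simp
qed

end

section \<open>Norms of Gaussian matrices\<close>

lemma card_int_lattice:
  fixes I :: "'i set"
  assumes fin: "finite I"
  shows "finite {z \<in> I \<rightarrow>\<^sub>E (UNIV :: int set). (\<Sum>x\<in>I. (z x)\<^sup>2) \<le> int T}"
    and "real (card {z \<in> I \<rightarrow>\<^sub>E (UNIV :: int set). (\<Sum>x\<in>I. (z x)\<^sup>2) \<le> int T}) \<le> exp (real T) * 3 ^ card I"
proof -
  let ?S = "{z \<in> I \<rightarrow>\<^sub>E (UNIV :: int set). (\<Sum>x\<in>I. (z x)\<^sup>2) \<le> int T}"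
  let ?P = "I \<rightarrow>\<^sub>E {- int T..int T}"
  have sub: "?S \<subseteq> ?P"
  proof
    fix z assume z: "z \<in> ?S"
    have "z x \<in> {- int T..int T}" if x: "x \<in> I" for x
    proof -
      have "(z x)\<^sup>2 \<le> (\<Sum>x\<in>I. (z x)\<^sup>2)" using fin x by (intro member_le_sum) auto
      then have "(z x)\<^sup>2 \<le> int T" using z by auto
      moreover have "\<bar>z x\<bar> \<le> (z x)\<^sup>2"
        by (cases "z x = 0") (auto simp: power2_eq_square abs_mult[symmetric] intro: self_le_power[of "\<bar>z x\<bar>" 2, simplified power2_eq_square abs_mult_self_eq])
      ultimately show ?thesis by auto
    qed
    then show "z \<in> ?P" using z by (auto simp: PiE_iff)
  qed
  have finP: "finite ?P" using fin by (intro finite_PiE) auto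
  then show "finite ?S" using sub by (rule rev_finite_subset)
  have pw: "(\<Sum>z\<in>{- int T..int T}. exp (- real_of_int (z\<^sup>2))) \<le> 3"
  proof -
    have s2: "(\<Sum>j\<in>{1..T}. exp (- real (j\<^sup>2))) \<le> 1"
    proof -
      have "(\<Sum>j\<in>{1..T}. exp (- real (j\<^sup>2))) \<le> (\<Sum>j\<in>{1..T}. (1/2) ^ j)"
      proof (intro sum_mono)
        fix j assume "j \<in> {1..T}"
        have "exp (- real (j\<^sup>2)) \<le> exp (- real j)" by (simp only: exp_le_cancel_iff neg_le_iff_le of_nat_le_iff power2_eq_square le_square)
        also have "\<dots> = exp (- 1) ^ j" by (simp add: exp_of_nat_mult[symmetric])
        also have "\<dots> \<le> (1/2) ^ j"
          using exp_ge_add_one_self[of 1] by (intro power_mono) (auto simp: exp_minus field_simps)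
        finally show "exp (- real (j\<^sup>2)) \<le> (1/2) ^ j" .
      qed
      also have "\<dots> = 1 - (1/2) ^ T" by (induction T) (auto simp: field_simps)
      finally show ?thesis using zero_le_power[of "1/2 :: real" T] by linarith
    qed
    have split: "{- int T..int T} = insert 0 ((\<lambda>j. int j) ` {1..T} \<union> (\<lambda>j. - int j) ` {1..T})"
    proof -
      have "z \<in> insert 0 ((\<lambda>j. int j) ` {1..T} \<union> (\<lambda>j. - int j) ` {1..T})" if "z \<in> {- int T..int T}" for z
      proof -
        consider "z = 0" | "z > 0" | "z < 0" by linarith
        then show ?thesis
        proof cases
          case 2 then show ?thesis using that by (auto intro!: image_eqI[of _ _ "nat z"])
        next
          case 3 then show ?thesis using that by (auto intro!: image_eqI[of z "\<lambda>j. - int j" "nat (- z)"])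
        qed simp
      qed
      moreover have "z \<in> {- int T..int T}" if "z \<in> insert 0 ((\<lambda>j. int j) ` {1..T} \<union> (\<lambda>j. - int j) ` {1..T})" for z
        using that by auto
      ultimately show ?thesis by blast
    qed
    have "(\<Sum>z\<in>{- int T..int T}. exp (- real_of_int (z\<^sup>2))) =
      1 + ((\<Sum>z\<in>(\<lambda>j. int j) ` {1..T}. exp (- real_of_int (z\<^sup>2))) + (\<Sum>z\<in>(\<lambda>j. - int j) ` {1..T}. exp (- real_of_int (z\<^sup>2))))"
      unfolding split by (subst sum.insert) (auto intro!: sum.union_disjoint)
    also have "\<dots> = 1 + ((\<Sum>j\<in>{1..T}. exp (- real (j\<^sup>2))) + (\<Sum>j\<in>{1..T}. exp (- real (j\<^sup>2))))"
      by (subst (1 2) sum.reindex) (auto simp: inj_on_def)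
    finally show ?thesis using s2 by simp
  qed
  have "real (card ?S) = (\<Sum>z\<in>?S. 1)" by simp
  also have "\<dots> \<le> (\<Sum>z\<in>?S. exp (real T - real_of_int (\<Sum>x\<in>I. (z x)\<^sup>2)))"
  proof (rule sum_mono)
    fix z assume "z \<in> ?S"
    then have "(\<Sum>x\<in>I. (z x)\<^sup>2) \<le> int T" by simp
    then have "real_of_int (\<Sum>x\<in>I. (z x)\<^sup>2) \<le> real T" by (metis of_int_le_iff of_int_of_nat_eq)
    then show "1 \<le> exp (real T - real_of_int (\<Sum>x\<in>I. (z x)\<^sup>2))" by simp
  qed
  also have "\<dots> \<le> (\<Sum>z\<in>?P. exp (real T - real_of_int (\<Sum>x\<in>I. (z x)\<^sup>2)))"
    by (rule sum_mono2[OF finP sub]) simp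
  also have "\<dots> = exp (real T) * (\<Sum>z\<in>?P. \<Prod>x\<in>I. exp (- real_of_int ((z x)\<^sup>2)))"
    unfolding sum_distrib_left using fin by (intro sum.cong refl) (simp add: exp_add[symmetric] exp_sum[OF fin, symmetric] sum_negf)
  also have "(\<Sum>z\<in>?P. \<Prod>x\<in>I. exp (- real_of_int ((z x)\<^sup>2))) = (\<Prod>x\<in>I. \<Sum>z\<in>{- int T..int T}. exp (- real_of_int (z\<^sup>2)))"
    using fin by (subst prod_sum_PiE) auto
  also have "\<dots> \<le> (\<Prod>x\<in>I. 3)" using pw by (intro prod_mono) (auto intro: sum_nonneg)
  finally show "real (card ?S) \<le> exp (real T) * 3 ^ card I" by simp
qed

abbreviation l2 :: "nat set \<Rightarrow> (nat \<Rightarrow> complex) \<Rightarrow> real" where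
  "l2 K u \<equiv> L2_set (\<lambda>x. cmod (u x)) K"

text \<open>The factor \<open>1 / 6\<close> makes the rounding error in \<open>l2\<close> at most \<open>1 / 4\<close>, and \<open>57 / 36\<close> bounds \<open>(5 / 4)\<^sup>2\<close>.\<close>

definition lattice_pt :: "nat set \<Rightarrow> (nat \<times> bool \<Rightarrow> int) \<Rightarrow> nat \<Rightarrow> complex" where
  "lattice_pt K z x = of_real (1 / (6 * sqrt (real (card K)))) * Complex (of_int (z (x, False))) (of_int (z (x, True)))"

definition net :: "nat set \<Rightarrow> (nat \<Rightarrow> complex) set" where
  "net K = lattice_pt K ` {z \<in> K \<times> UNIV \<rightarrow>\<^sub>E UNIV. (\<Sum>x\<in>K \<times> UNIV. (z x)\<^sup>2) \<le> int (57 * card K)}"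

lemma finite_net: "finite K \<Longrightarrow> finite (net K)"
  and card_net: "finite K \<Longrightarrow> real (card (net K)) \<le> exp (60 * real (card K))"
proof -
  assume K: "finite K"
  then have fin: "finite (K \<times> (UNIV :: bool set))" by simp
  note c = card_int_lattice[OF fin, of "57 * card K"]
  show "finite (net K)" unfolding net_def using c(1) by (rule finite_imageI)
  have "real (card (net K)) \<le> real (card {z \<in> K \<times> UNIV \<rightarrow>\<^sub>E UNIV. (\<Sum>x\<in>K \<times> (UNIV :: bool set). (z x)\<^sup>2) \<le> int (57 * card K)})"
    unfolding net_def using card_image_le[OF c(1)] by (intro of_nat_mono)
  also have "\<dots> \<le> exp (real (57 * card K)) * 3 ^ card (K \<times> (UNIV :: bool set))" by (rule c(2))
  also have "\<dots> \<le> exp (real (57 * card K)) * exp (real (3 * card K))"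
  proof -
    have "(3::real) ^ card (K \<times> (UNIV :: bool set)) = 9 ^ card K"
      by (simp add: card_cartesian_product power_mult[of _ _ 2] mult.commute[of _ 2] power_mult)
    also have "\<dots> \<le> exp 3 ^ card K"
    proof (rule power_mono)
      have "(1 + 3/2 :: real) \<le> exp (3/2)" by (rule exp_ge_add_one_self)
      have "(2 + 3/4 :: real) \<ge> 0" by simp
      have "2 \<le> exp (1::real)" using exp_ge_add_one_self[of 1] by simp
      then have "2 ^ 3 \<le> exp (1::real) ^ 3" by (intro power_mono) auto
      have "(9::real) \<le> (exp (1/2) ^ 3) ^ 2"
      proof -
        have "(3/2 :: real) \<le> exp (1/2)" using exp_ge_add_one_self[of "1/2"] by simp
        then have "(3/2 :: real) ^ 3 \<le> exp (1/2) ^ 3" by (intro power_mono) auto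
        then have "((3/2 :: real) ^ 3) ^ 2 \<le> (exp (1/2) ^ 3) ^ 2" by (intro power_mono) auto
        then show ?thesis by (simp add: power_divide eval_nat_numeral)
      qed
      also have "(exp (1/2) ^ 3) ^ 2 = exp (3::real)" by (simp add: exp_of_nat_mult[symmetric] power_mult[symmetric])
      finally show "(9::real) \<le> exp 3" .
    qed simp
    also have "\<dots> = exp (real (3 * card K))" by (simp add: exp_of_nat_mult[symmetric] mult.commute)
    finally show ?thesis by (intro mult_left_mono) auto
  qed
  also have "\<dots> = exp (60 * real (card K))" by (simp add: exp_add[symmetric])
  finally show "real (card (net K)) \<le> exp (60 * real (card K))" .
qed

lemma l2_triangle: "l2 K (\<lambda>x. u x + v x) \<le> l2 K u + l2 K v"
proof -
  have "l2 K (\<lambda>x. u x + v x) \<le> L2_set (\<lambda>x. cmod (u x) + cmod (v x)) K"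
    by (rule L2_set_mono) (auto intro: norm_triangle_ineq)
  also have "\<dots> \<le> l2 K u + l2 K v" by (rule L2_set_triangle_ineq)
  finally show ?thesis .
qed

lemma net_approx:
  assumes K: "finite K" "K \<noteq> {}" and u: "l2 K u \<le> 1"
  shows "\<exists>u'\<in>net K. l2 K (\<lambda>x. u x - u' x) \<le> 1/4 \<and> l2 K u' \<le> 5/4"
proof -
  define h where "h = 6 * sqrt (real (card K))"
  have cK: "real (card K) > 0" using K by (simp add: card_gt_0_iff)
  have h: "h > 0" "h\<^sup>2 = 36 * real (card K)" using cK by (auto simp: h_def power_mult_distrib)
  define z where "z = (\<lambda>e\<in>K \<times> UNIV. case e of (x, r) \<Rightarrow> \<lfloor>h * (if r then Im (u x) else Re (u x))\<rfloor>)"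
  define u' where "u' = lattice_pt K z"
  have u'x: "u' x = Complex (of_int \<lfloor>h * Re (u x)\<rfloor> / h) (of_int \<lfloor>h * Im (u x)\<rfloor> / h)" if "x \<in> K" for x
    using that by (simp add: u'_def lattice_pt_def z_def h_def complex_eq_iff)
  have fl: "\<bar>y - of_int \<lfloor>h * y\<rfloor> / h\<bar> \<le> 1 / h" for y :: real
  proof -
    have "\<bar>h * y - of_int \<lfloor>h * y\<rfloor>\<bar> \<le> 1" by linarith
    moreover have "y - of_int \<lfloor>h * y\<rfloor> / h = (h * y - of_int \<lfloor>h * y\<rfloor>) / h" using h by (simp add: field_simps)
    ultimately show ?thesis using h by (simp add: divide_right_mono)
  qed
  have d: "(cmod (u x - u' x))\<^sup>2 \<le> 2 / h\<^sup>2" if "x \<in> K" for x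
  proof -
    have "(cmod (u x - u' x))\<^sup>2 = (Re (u x) - of_int \<lfloor>h * Re (u x)\<rfloor> / h)\<^sup>2 + (Im (u x) - of_int \<lfloor>h * Im (u x)\<rfloor> / h)\<^sup>2"
      unfolding u'x[OF that] by (simp add: cmod_power2)
    also have "\<dots> \<le> (1 / h)\<^sup>2 + (1 / h)\<^sup>2"
      using fl by (intro add_mono) (metis abs_ge_zero power2_abs power_mono)+
    finally show ?thesis by (simp add: power_divide)
  qed
  have e1: "l2 K (\<lambda>x. u x - u' x) \<le> 1/4"
  proof -
    have "(\<Sum>x\<in>K. (cmod (u x - u' x))\<^sup>2) \<le> (\<Sum>x\<in>K. 2 / h\<^sup>2)" by (intro sum_mono d)
    also have "\<dots> = 1 / 18" using cK by (simp add: h(2))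
    also have "\<dots> \<le> (1/4)\<^sup>2" by (simp add: power2_eq_square)
    finally show ?thesis unfolding L2_set_def by (intro real_le_lsqrt) (auto intro: sum_nonneg)
  qed
  have e2: "l2 K u' \<le> 5/4"
  proof -
    have "l2 K u' = l2 K (\<lambda>x. u x + (u' x - u x))" by simp
    also have "\<dots> \<le> l2 K u + l2 K (\<lambda>x. u' x - u x)" by (rule l2_triangle)
    also have "l2 K (\<lambda>x. u' x - u x) = l2 K (\<lambda>x. u x - u' x)" by (simp add: norm_minus_commute)
    finally show ?thesis using u e1 by simp
  qed
  have "(\<Sum>e\<in>K \<times> UNIV. (z e)\<^sup>2) \<le> int (57 * card K)"
  proof -
    have "real_of_int (\<Sum>e\<in>K \<times> UNIV. (z e)\<^sup>2) = (\<Sum>x\<in>K. \<Sum>r\<in>UNIV. (real_of_int (z (x, r)))\<^sup>2)"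
      by (simp add: sum.cartesian_product)
    also have "\<dots> = (\<Sum>x\<in>K. h\<^sup>2 * (cmod (u' x))\<^sup>2)"
    proof (intro sum.cong refl)
      fix x assume x: "x \<in> K"
      show "(\<Sum>r\<in>UNIV. (real_of_int (z (x, r)))\<^sup>2) = h\<^sup>2 * (cmod (u' x))\<^sup>2"
        using h x cK by (simp add: u'x[OF x] UNIV_bool z_def cmod_power2 power_divide field_simps)
    qed
    also have "\<dots> = h\<^sup>2 * (l2 K u')\<^sup>2" by (simp add: L2_set_def sum_nonneg sum_distrib_left)
    also have "\<dots> \<le> h\<^sup>2 * (5/4)\<^sup>2" using e2 by (intro mult_left_mono power_mono) auto
    also have "\<dots> \<le> real (57 * card K)" unfolding h(2) using cK by (simp add: power2_eq_square)
    finally show ?thesis by linarith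
  qed
  then have "u' \<in> net K" unfolding u'_def net_def by (intro imageI) (auto simp: z_def PiE_iff extensional_def)
  with e1 e2 show ?thesis by blast
qed

lemma net_l2:
  assumes K: "finite K" and u: "u \<in> net K"
  shows "(l2 K u)\<^sup>2 \<le> 57 / 36"
proof (cases "K = {}")
  case False
  then have cK: "real (card K) > 0" using K by (simp add: card_gt_0_iff)
  obtain z where z: "u = lattice_pt K z" "(\<Sum>x\<in>K \<times> UNIV. (z x)\<^sup>2) \<le> int (57 * card K)" using u by (auto simp: net_def)
  have "(l2 K u)\<^sup>2 = (\<Sum>x\<in>K. \<Sum>r\<in>UNIV. (real_of_int (z (x, r)))\<^sup>2 / (36 * real (card K)))"
    unfolding L2_set_def using cK
    by (auto simp: sum_nonneg z lattice_pt_def norm_mult UNIV_bool cmod_power2 power_mult_distrib power_divide field_simps intro!: sum.cong)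
  also have "\<dots> = real_of_int (\<Sum>x\<in>K \<times> UNIV. (z x)\<^sup>2) / (36 * real (card K))"
    by (simp add: sum_divide_distrib sum.cartesian_product)
  also have "\<dots> \<le> real (57 * card K) / (36 * real (card K))"
    using z(2) cK by (intro divide_right_mono) linarith+
  finally show ?thesis using cK by simp
qed simp

definition bil :: "nat set \<Rightarrow> nat set \<Rightarrow> (nat \<Rightarrow> nat \<Rightarrow> complex) \<Rightarrow> (nat \<Rightarrow> complex) \<Rightarrow> (nat \<Rightarrow> complex) \<Rightarrow> complex" where
  "bil K L a u v = (\<Sum>x\<in>K. \<Sum>y\<in>L. u x * a x y * v y)"

lemma bil_net:
  assumes K: "finite K" "K \<noteq> {}" and L: "finite L" "L \<noteq> {}"
    and t: "\<And>u v. u \<in> net K \<Longrightarrow> v \<in> net L \<Longrightarrow> Re (bil K L a u v) \<le> t"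
  shows "cmod (bil K L a u v) \<le> 16 / 7 * t * l2 K u * l2 L v"
proof -
  have bd: "cmod (u x) \<le> l2 K' u" if "finite K'" "x \<in> K'" for u x K' using that by (rule member_le_L2_set)
  let ?S = "(\<lambda>(u, v). Re (bil K L a u v)) ` {(u, v). l2 K u \<le> 1 \<and> l2 L v \<le> 1}"
  have bdd: "bdd_above ?S"
  proof (rule bdd_aboveI2)
    fix uv assume "uv \<in> {(u, v). l2 K u \<le> 1 \<and> l2 L v \<le> 1}"
    then obtain u v where uv: "uv = (u, v)" "l2 K u \<le> 1" "l2 L v \<le> 1" by auto
    have "Re (bil K L a u v) \<le> cmod (bil K L a u v)" by (rule complex_Re_le_cmod)
    also have "\<dots> \<le> (\<Sum>x\<in>K. \<Sum>y\<in>L. cmod (u x * a x y * v y))" unfolding bil_def by (intro sum_norm_le order_refl)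
    also have "\<dots> \<le> (\<Sum>x\<in>K. \<Sum>y\<in>L. cmod (a x y))"
    proof (intro sum_mono)
      fix x y assume "x \<in> K" "y \<in> L"
      then have "cmod (u x) \<le> 1" "cmod (v y) \<le> 1" using bd[OF K(1)] bd[OF L(1)] uv by (meson order_trans)+
      then have "cmod (u x) * cmod (a x y) * cmod (v y) \<le> 1 * cmod (a x y) * 1" by (intro mult_mono) auto
      then show "cmod (u x * a x y * v y) \<le> cmod (a x y)" by (simp add: norm_mult)
    qed
    finally show "(case uv of (u, v) \<Rightarrow> Re (bil K L a u v)) \<le> (\<Sum>x\<in>K. \<Sum>y\<in>L. cmod (a x y))" using uv by simp
  qed
  define m where "m = Sup ?S"
  have up: "Re (bil K L a u v) \<le> m" if "l2 K u \<le> 1" "l2 L v \<le> 1" for u v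
    unfolding m_def using that by (intro cSup_upper[OF _ bdd]) auto
  have m0: "0 \<le> m" using up[of "\<lambda>_. 0" "\<lambda>_. 0"] by (simp add: bil_def L2_set_def)
  have zero: "bil K L a u v = 0" if "l2 K u = 0 \<or> l2 L v = 0" for u v
  proof -
    have "(\<forall>x\<in>K. u x = 0) \<or> (\<forall>y\<in>L. v y = 0)" using that K L by (auto simp: L2_set_eq_0_iff)
    then show ?thesis by (auto simp: bil_def)
  qed
  have sc: "bil K L a (\<lambda>x. r * u x) (\<lambda>y. r' * v y) = r * r' * bil K L a u v" for r r' u v
    by (simp add: bil_def sum_distrib_left mult_ac)
  have l2s: "l2 K' (\<lambda>x. of_real r * u x) = r * l2 K' u" if "r \<ge> 0" for r u K'
    using that by (simp add: norm_mult L2_set_right_distrib)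
  have hom: "Re (bil K L a u v) \<le> m * l2 K u * l2 L v" for u v
  proof (cases "l2 K u = 0 \<or> l2 L v = 0")
    case True then show ?thesis using zero by auto
  next
    case False
    then have pos: "l2 K u > 0" "l2 L v > 0" by (auto simp: less_le L2_set_nonneg)
    let ?r = "1 / l2 K u" and ?r' = "1 / l2 L v"
    have "Re (bil K L a (\<lambda>x. of_real ?r * u x) (\<lambda>y. of_real ?r' * v y)) \<le> m"
      using pos by (intro up) (simp_all only: l2s zero_le_divide_1_iff L2_set_nonneg, simp_all)
    also have "bil K L a (\<lambda>x. of_real ?r * u x) (\<lambda>y. of_real ?r' * v y) = of_real (?r * ?r') * bil K L a u v"
      unfolding sc by simp
    finally show ?thesis using pos by (simp add: field_simps)
  qed
  have "m \<le> t + 9/16 * m"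
    unfolding m_def
  proof (rule cSup_least)
    show "?S \<noteq> {}" by (auto intro!: exI[of _ "\<lambda>_. 0"] simp: L2_set_def)
    fix r assume "r \<in> ?S"
    then obtain u v where uv: "r = Re (bil K L a u v)" "l2 K u \<le> 1" "l2 L v \<le> 1" by auto
    obtain u' where u': "u' \<in> net K" "l2 K (\<lambda>x. u x - u' x) \<le> 1/4" "l2 K u' \<le> 5/4" using net_approx[OF K uv(2)] by blast
    obtain v' where v': "v' \<in> net L" "l2 L (\<lambda>x. v x - v' x) \<le> 1/4" "l2 L v' \<le> 5/4" using net_approx[OF L uv(3)] by blast
    have "bil K L a u v = bil K L a u' v' + bil K L a (\<lambda>x. u x - u' x) v' + bil K L a u (\<lambda>x. v x - v' x)"
      unfolding bil_def sum.distrib[symmetric] by (intro sum.cong refl) (simp add: algebra_simps)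
    then have "r = Re (bil K L a u' v') + Re (bil K L a (\<lambda>x. u x - u' x) v') + Re (bil K L a u (\<lambda>x. v x - v' x))"
      using uv(1) by simp
    also have "\<dots> \<le> t + m * (1/4) * (5/4) + m * 1 * (1/4)"
    proof (intro add_mono t u'(1) v'(1) order_trans[OF hom])
      show "m * l2 K (\<lambda>x. u x - u' x) * l2 L v' \<le> m * (1/4) * (5/4)"
        using u' v' m0 by (intro mult_mono) (auto simp: L2_set_nonneg)
      show "m * l2 K u * l2 L (\<lambda>x. v x - v' x) \<le> m * 1 * (1/4)"
        using uv v' m0 by (intro mult_mono) (auto simp: L2_set_nonneg)
    qed
    finally show "r \<le> t + 9/16 * Sup ?S" unfolding m_def[symmetric] by simp
  qed
  then have mt: "m \<le> 16/7 * t" by simp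
  show ?thesis
  proof (cases "bil K L a u v = 0")
    case True
    have "0 \<le> 16 / 7 * t * (l2 K u * l2 L v)" using mt m0 by (intro mult_nonneg_nonneg) (auto simp: L2_set_nonneg)
    then show ?thesis using True by (simp add: mult.assoc)
  next
    case False
    define e where "e = cnj (bil K L a u v) / of_real (cmod (bil K L a u v))"
    have e: "cmod e = 1" using False by (simp add: e_def norm_divide)
    have "e * bil K L a u v = of_real (cmod (bil K L a u v))"
      using False by (simp add: e_def mult.commute[of _ "bil K L a u v"] complex_norm_square[symmetric] power2_eq_square)
    then have "cmod (bil K L a u v) = Re (bil K L a (\<lambda>x. e * u x) (\<lambda>y. 1 * v y))" unfolding sc by simp
    also have "\<dots> \<le> m * l2 K (\<lambda>x. e * u x) * l2 L (\<lambda>y. 1 * v y)" by (rule hom)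
    also have "\<dots> = m * (l2 K u * l2 L v)" using e by (simp add: norm_mult)
    also have "\<dots> \<le> 16/7 * t * (l2 K u * l2 L v)" using mt by (intro mult_right_mono) (auto simp: L2_set_nonneg)
    finally show ?thesis by (simp add: mult.assoc)
  qed
qed

lemma sum_Times: "(\<Sum>p\<in>A \<times> B. F p) = (\<Sum>x\<in>A. \<Sum>y\<in>B. F (x, y))"
  by (simp add: sum.cartesian_product)

context gauss begin

lemma normal_mgf:
  assumes "\<sigma> > 0"
  shows "(\<integral>\<^sup>+t. ennreal (normal_density 0 \<sigma> t) * ennreal (exp (c * t)) \<partial>lborel) = ennreal (exp (\<sigma>\<^sup>2 * c\<^sup>2 / 2))"
proof -
  have "normal_density 0 \<sigma> t * exp (c * t) = exp (\<sigma>\<^sup>2 * c\<^sup>2 / 2) * normal_density (\<sigma>\<^sup>2 * c) \<sigma> t" for t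
  proof -
    have "- (t - 0)\<^sup>2 / (2 * \<sigma>\<^sup>2) + c * t = \<sigma>\<^sup>2 * c\<^sup>2 / 2 + - (t - \<sigma>\<^sup>2 * c)\<^sup>2 / (2 * \<sigma>\<^sup>2)"
      using assms by (simp add: field_simps power2_eq_square)
    then have "exp (- (t - 0)\<^sup>2 / (2 * \<sigma>\<^sup>2)) * exp (c * t) = exp (\<sigma>\<^sup>2 * c\<^sup>2 / 2) * exp (- (t - \<sigma>\<^sup>2 * c)\<^sup>2 / (2 * \<sigma>\<^sup>2))"
      by (simp only: exp_add[symmetric])
    then show ?thesis unfolding normal_density_def by simp
  qed
  then have "(\<integral>\<^sup>+t. ennreal (normal_density 0 \<sigma> t) * ennreal (exp (c * t)) \<partial>lborel) =
    (\<integral>\<^sup>+t. ennreal (exp (\<sigma>\<^sup>2 * c\<^sup>2 / 2)) * ennreal (normal_density (\<sigma>\<^sup>2 * c) \<sigma> t) \<partial>lborel)"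
    by (simp add: ennreal_mult[symmetric])
  also have "\<dots> = ennreal (exp (\<sigma>\<^sup>2 * c\<^sup>2 / 2)) * (\<integral>\<^sup>+t. ennreal (normal_density (\<sigma>\<^sup>2 * c) \<sigma> t) \<partial>lborel)"
    by (rule nn_integral_cmult) simp
  also have "(\<integral>\<^sup>+t. ennreal (normal_density (\<sigma>\<^sup>2 * c) \<sigma> t) \<partial>lborel) = 1"
    using assms by (simp add: nn_integral_eq_integral)
  finally show ?thesis by simp
qed

lemma chernoff:
  "emeasure M {w \<in> space M. (\<Sum>a\<in>A. co a * x a w) \<ge> t} \<le> ennreal (exp ((\<Sum>a\<in>A. (s a)\<^sup>2 * (co a)\<^sup>2) / 2 - t))"
proof -
  let ?S = "{w \<in> space M. (\<Sum>a\<in>A. co a * x a w) \<ge> t}"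
  have m: "?S \<in> sets M" by measurable
  have "emeasure M ?S = (\<integral>\<^sup>+w. indicator ?S w \<partial>M)" using m by simp
  also have "\<dots> \<le> (\<integral>\<^sup>+w. ennreal (exp (- t)) * (\<Prod>a\<in>A. ennreal (exp (co a * x a w))) \<partial>M)"
  proof (intro nn_integral_mono)
    fix w
    have "(\<Prod>a\<in>A. ennreal (exp (co a * x a w))) = ennreal (exp (\<Sum>a\<in>A. co a * x a w))"
      by (simp add: prod_ennreal exp_sum[OF finA])
    then have e: "ennreal (exp (- t)) * (\<Prod>a\<in>A. ennreal (exp (co a * x a w))) = ennreal (exp ((\<Sum>a\<in>A. co a * x a w) - t))"
      by (simp add: ennreal_mult[symmetric] exp_add[symmetric])
    show "indicator ?S w \<le> ennreal (exp (- t)) * (\<Prod>a\<in>A. ennreal (exp (co a * x a w)))"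
      unfolding e by (auto simp: indicator_def)
  qed
  also have "\<dots> = ennreal (exp (- t)) * (\<integral>\<^sup>+w. (\<Prod>a\<in>A. ennreal (exp (co a * x a w))) \<partial>M)"
    by (rule nn_integral_cmult) (auto intro!: borel_measurable_prod_ennreal)
  also have "(\<integral>\<^sup>+w. (\<Prod>a\<in>A. ennreal (exp (co a * x a w))) \<partial>M) = (\<Prod>a\<in>A. \<integral>\<^sup>+t. ennreal (normal_density 0 (s a) t) * ennreal (exp (co a * t)) \<partial>lborel)"
    by (rule nn_indep) auto
  also have "\<dots> = (\<Prod>a\<in>A. ennreal (exp ((s a)\<^sup>2 * (co a)\<^sup>2 / 2)))"
    by (intro prod.cong refl normal_mgf s_pos)
  also have "\<dots> = ennreal (exp ((\<Sum>a\<in>A. (s a)\<^sup>2 * (co a)\<^sup>2) / 2))"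
    by (simp add: prod_ennreal exp_sum[OF finA, symmetric] sum_divide_distrib)
  also have "ennreal (exp (- t)) * \<dots> = ennreal (exp ((\<Sum>a\<in>A. (s a)\<^sup>2 * (co a)\<^sup>2) / 2 - t))"
    by (simp add: ennreal_mult[symmetric] exp_add[symmetric])
  finally show ?thesis .
qed

end

context gaussian_matrices begin

abbreviation Gm :: "nat \<Rightarrow> 'w \<Rightarrow> nat \<Rightarrow> nat \<Rightarrow> complex" where
  "Gm i w x y \<equiv> Complex (X (i, (x, y), False) w) (X (i, (x, y), True) w)"

lemma bil_tail:
  assumes i: "i \<in> {1..N}" and u: "(l2 (blk False) u)\<^sup>2 \<le> 57/36" and vv: "(l2 (blk True) f)\<^sup>2 \<le> 57/36" and t: "t \<ge> 0"
  shows "emeasure M {w \<in> space M. Re (bil (blk False) (blk True) (Gm i w) u f) \<ge> t} \<le> ennreal (exp (- (t\<^sup>2 / (4 * v i))))"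
proof -
  have vi: "v i > 0" by (rule v_pos[OF i])
  define r where "r = t / (2 * v i)"
  define co where "co \<alpha> = (case \<alpha> of (j, (x, y), b) \<Rightarrow> if j = i then r * (if b then - Im (u x * f y) else Re (u x * f y)) else 0)" for \<alpha>
  have sm: "(\<Sum>\<alpha>\<in>gindex N blk. F \<alpha>) = (\<Sum>j\<in>{1..N}. \<Sum>x\<in>blk False. \<Sum>y\<in>blk True. F (j, (x, y), False) + F (j, (x, y), True))" for F :: "_ \<Rightarrow> real"
    unfolding gindex_def sum_Times by (simp only: UNIV_bool, intro sum.cong refl) (simp add: add.commute)
  have one: "(\<Sum>j\<in>{1..N}. if j = i then c else 0) = c" for c :: real using i by simp
  have S1: "(\<Sum>\<alpha>\<in>gindex N blk. co \<alpha> * X \<alpha> w) = r * Re (bil (blk False) (blk True) (Gm i w) u f)" for w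
  proof -
    have "(\<Sum>\<alpha>\<in>gindex N blk. co \<alpha> * X \<alpha> w) = (\<Sum>j\<in>{1..N}. if j = i then (\<Sum>x\<in>blk False. \<Sum>y\<in>blk True. r * Re (u x * Gm i w x y * f y)) else 0)"
      unfolding sm
    proof (intro sum.cong refl)
      fix j assume "j \<in> {1..N}"
      have e: "co (i, (x, y), False) * X (i, (x, y), False) w + co (i, (x, y), True) * X (i, (x, y), True) w = r * Re (u x * Gm i w x y * f y)" for x y
        by (simp add: co_def algebra_simps)
      show "(\<Sum>x\<in>blk False. \<Sum>y\<in>blk True. co (j, (x, y), False) * X (j, (x, y), False) w + co (j, (x, y), True) * X (j, (x, y), True) w) =
        (if j = i then (\<Sum>x\<in>blk False. \<Sum>y\<in>blk True. r * Re (u x * Gm i w x y * f y)) else 0)"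
      proof (cases "j = i")
        case True then show ?thesis by (simp only: e simp_thms if_True)
      next
        case False then show ?thesis by (simp add: co_def)
      qed
    qed
    then show ?thesis unfolding one by (simp add: bil_def sum_distrib_left)
  qed
  have S2: "(\<Sum>\<alpha>\<in>gindex N blk. (sqrt (v (fst \<alpha>) / 2))\<^sup>2 * (co \<alpha>)\<^sup>2) = v i / 2 * r\<^sup>2 * ((l2 (blk False) u)\<^sup>2 * (l2 (blk True) f)\<^sup>2)"
  proof -
    have "(\<Sum>\<alpha>\<in>gindex N blk. (sqrt (v (fst \<alpha>) / 2))\<^sup>2 * (co \<alpha>)\<^sup>2) =
      (\<Sum>j\<in>{1..N}. if j = i then (\<Sum>x\<in>blk False. \<Sum>y\<in>blk True. v i / 2 * r\<^sup>2 * ((cmod (u x))\<^sup>2 * (cmod (f y))\<^sup>2)) else 0)"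
      unfolding sm
    proof (intro sum.cong refl)
      fix j assume "j \<in> {1..N}"
      show "(\<Sum>x\<in>blk False. \<Sum>y\<in>blk True. (sqrt (v (fst (j, (x, y), False)) / 2))\<^sup>2 * (co (j, (x, y), False))\<^sup>2 + (sqrt (v (fst (j, (x, y), True)) / 2))\<^sup>2 * (co (j, (x, y), True))\<^sup>2) =
        (if j = i then (\<Sum>x\<in>blk False. \<Sum>y\<in>blk True. v i / 2 * r\<^sup>2 * ((cmod (u x))\<^sup>2 * (cmod (f y))\<^sup>2)) else 0)"
      proof (cases "j = i")
        case True
        have e: "(sqrt (v (fst (i, (x, y), False)) / 2))\<^sup>2 * (co (i, (x, y), False))\<^sup>2 + (sqrt (v (fst (i, (x, y), True)) / 2))\<^sup>2 * (co (i, (x, y), True))\<^sup>2 =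
          v i / 2 * r\<^sup>2 * ((cmod (u x))\<^sup>2 * (cmod (f y))\<^sup>2)" for x y
        proof -
          have 1: "(cmod (u x))\<^sup>2 * (cmod (f y))\<^sup>2 = (Re (u x * f y))\<^sup>2 + (Im (u x * f y))\<^sup>2"
            unfolding cmod_power2[of "u x * f y", symmetric] by (simp add: norm_mult power_mult_distrib)
          have 2: "(sqrt (v (fst (i, (x, y), b)) / 2))\<^sup>2 = v i / 2" for b using vi by simp
          have 3: "co (i, (x, y), False) = r * Re (u x * f y)" "co (i, (x, y), True) = - (r * Im (u x * f y))" by (simp_all add: co_def algebra_simps)
          show ?thesis unfolding 1 2 3 by (simp only: power_mult_distrib power2_minus distrib_left mult_ac)
        qed
        show ?thesis using True by (simp only: e simp_thms if_True)
      next
        case False then show ?thesis by (simp add: co_def)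
      qed
    qed
    also have "\<dots> = v i / 2 * r\<^sup>2 * ((\<Sum>x\<in>blk False. (cmod (u x))\<^sup>2) * (\<Sum>y\<in>blk True. (cmod (f y))\<^sup>2))"
      unfolding one by (subst sum_product) (simp only: sum_distrib_left)
    finally show ?thesis by (simp add: L2_set_def sum_nonneg)
  qed
  show ?thesis
  proof (cases "t = 0")
    case True
    then show ?thesis using emeasure_space[of M] emeasure_space_eq_1 by simp
  next
    case False
    then have rp: "r > 0" using t vi by (simp add: r_def)
    have "{w \<in> space M. Re (bil (blk False) (blk True) (Gm i w) u f) \<ge> t} = {w \<in> space M. (\<Sum>\<alpha>\<in>gindex N blk. co \<alpha> * X \<alpha> w) \<ge> r * t}"
      unfolding S1 using rp by simp
    then have "emeasure M {w \<in> space M. Re (bil (blk False) (blk True) (Gm i w) u f) \<ge> t} \<le> ennreal (exp ((v i / 2 * r\<^sup>2 * ((l2 (blk False) u)\<^sup>2 * (l2 (blk True) f)\<^sup>2)) / 2 - r * t))"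
      using chernoff[of "r * t" co] unfolding S2 by simp
    also have "\<dots> \<le> ennreal (exp (- (t\<^sup>2 / (4 * v i))))"
    proof (intro ennreal_leI exp_le_cancel_iff[THEN iffD2])
      have "(l2 (blk False) u)\<^sup>2 * (l2 (blk True) f)\<^sup>2 \<le> (57/36) * (57/36)" using u vv by (intro mult_mono) auto
      also have "\<dots> \<le> 4" by simp
      finally have "v i / 2 * r\<^sup>2 * ((l2 (blk False) u)\<^sup>2 * (l2 (blk True) f)\<^sup>2) \<le> v i / 2 * r\<^sup>2 * 4"
        using vi by (intro mult_left_mono) auto
      then have "(v i / 2 * r\<^sup>2 * ((l2 (blk False) u)\<^sup>2 * (l2 (blk True) f)\<^sup>2)) / 2 - r * t \<le> v i * r\<^sup>2 - r * t" by simp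
      also have "\<dots> = - (t\<^sup>2 / (4 * v i))" using vi by (simp add: r_def power2_eq_square field_simps)
      finally show "(v i / 2 * r\<^sup>2 * ((l2 (blk False) u)\<^sup>2 * (l2 (blk True) f)\<^sup>2)) / 2 - r * t \<le> - (t\<^sup>2 / (4 * v i))" .
    qed
    finally show ?thesis .
  qed
qed

lemma bil_measurable [measurable]:
  assumes "i \<in> {1..N}"
  shows "(\<lambda>w. Re (bil (blk False) (blk True) (Gm i w) u f)) \<in> borel_measurable M"
proof -
  have [measurable]: "X (i, (x, y), b) \<in> borel_measurable M" if "x \<in> blk False" "y \<in> blk True" for x y b
    using assms that by (intro x_measurable) (auto simp: gindex_def)
  have "(\<lambda>w. Re (bil (blk False) (blk True) (Gm i w) u f)) =
    (\<lambda>w. \<Sum>x\<in>blk False. \<Sum>y\<in>blk True. Re (u x * f y) * X (i, (x, y), False) w - Im (u x * f y) * X (i, (x, y), True) w)"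
    unfolding bil_def by (auto simp: fun_eq_iff algebra_simps intro!: sum.cong)
  also have "\<dots> \<in> borel_measurable M" by measurable
  finally show ?thesis .
qed

lemma norm_bound:
  assumes i: "i \<in> {1..N}" and t: "t \<ge> 0" and cle: "card (blk False) \<le> card (blk True)"
  shows "emeasure M {w \<in> space M. \<exists>u\<in>net (blk False). \<exists>f\<in>net (blk True). Re (bil (blk False) (blk True) (Gm i w) u f) \<ge> t}
    \<le> ennreal (exp (120 * real (card (blk True)) - t\<^sup>2 / (4 * v i)))"
proof -
  let ?E = "\<lambda>uf. {w \<in> space M. Re (bil (blk False) (blk True) (Gm i w) (fst uf) (snd uf)) \<ge> t}"
  let ?I = "net (blk False) \<times> net (blk True)"
  have fI: "finite ?I" by (simp add: finite_net)
  have "{w \<in> space M. \<exists>u\<in>net (blk False). \<exists>f\<in>net (blk True). Re (bil (blk False) (blk True) (Gm i w) u f) \<ge> t} = (\<Union>uf\<in>?I. ?E uf)" by force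
  also have "emeasure M \<dots> \<le> (\<Sum>uf\<in>?I. emeasure M (?E uf))"
  proof (rule emeasure_subadditive_finite[OF fI])
    have "?E uf \<in> sets M" for uf using bil_measurable[OF i, of "fst uf" "snd uf"] by measurable
    then show "?E ` ?I \<subseteq> sets M" by blast
  qed
  also have "\<dots> \<le> (\<Sum>uf\<in>?I. ennreal (exp (- (t\<^sup>2 / (4 * v i)))))"
    by (intro sum_mono bil_tail[OF i _ _ t] net_l2 fin_blk) auto
  also have "\<dots> = ennreal (real (card ?I) * exp (- (t\<^sup>2 / (4 * v i))))"
    by (simp add: ennreal_mult ennreal_of_nat_eq_real_of_nat)
  also have "\<dots> \<le> ennreal (exp (120 * real (card (blk True))) * exp (- (t\<^sup>2 / (4 * v i))))"
  proof (intro ennreal_leI mult_right_mono)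
    have "real (card ?I) = real (card (net (blk False))) * real (card (net (blk True)))" by (simp add: card_cartesian_product)
    also have "\<dots> \<le> exp (60 * real (card (blk False))) * exp (60 * real (card (blk True)))"
      by (intro mult_mono card_net) auto
    also have "\<dots> \<le> exp (120 * real (card (blk True)))" unfolding exp_add[symmetric] using cle by simp
    finally show "real (card ?I) \<le> exp (120 * real (card (blk True)))" .
  qed simp
  finally show ?thesis by (simp add: exp_add[symmetric])
qed

end

section \<open>Lipschitz estimate for moments\<close>

context gaussian_matrices begin

lemma cnj_W: "set l \<subseteq> letters N \<Longrightarrow> x \<in> U \<Longrightarrow> y \<in> U \<Longrightarrow> cnj (W l x y w) = W (rev (map adjl l)) y x w"
proof (induction l arbitrary: x)
  case (Cons e l)
  have ce: "cnj (ent e x z w) = ent (adjl e) z x w" for z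
    by (cases e) auto
  have "cnj (W (e # l) x y w) = (\<Sum>z\<in>U. W (rev (map adjl l)) y z w * ent (adjl e) z x w)"
    using Cons by (simp add: ce cnj_sum mult.commute del: ent.simps)
  also have "\<dots> = (\<Sum>z\<in>U. W (rev (map adjl l)) y z w * W [adjl e] z x w)"
  proof (intro sum.cong refl)
    fix z assume "z \<in> U"
    have "W [adjl e] z x w = (\<Sum>z'\<in>U. if z' = x then ent (adjl e) z z' w else 0)"
      unfolding W.simps by (intro sum.cong) auto
    then show "W (rev (map adjl l)) y z w * ent (adjl e) z x w = W (rev (map adjl l)) y z w * W [adjl e] z x w"
      using Cons.prems finU by simp
  qed
  finally show ?case using Cons.prems by (simp add: W_append del: W.simps(2))
qed auto

definition hs :: "(nat \<Rightarrow> nat \<Rightarrow> complex) \<Rightarrow> real" where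
  "hs f = L2_set (\<lambda>(x, y). cmod (f x y)) (U \<times> U)"

lemma hs_nonneg [simp]: "0 \<le> hs f" by (simp add: hs_def L2_set_nonneg)

lemma hs_rows: "(hs f)\<^sup>2 = (\<Sum>x\<in>U. (L2_set (\<lambda>y. cmod (f x y)) U)\<^sup>2)"
  by (simp add: hs_def L2_set_def sum_nonneg sum.cartesian_product case_prod_unfold)

lemma hs_trace: "cmod (\<Sum>x\<in>U. \<Sum>y\<in>U. f x y * g y x) \<le> hs f * hs g"
proof -
  have "cmod (\<Sum>x\<in>U. \<Sum>y\<in>U. f x y * g y x) \<le> (\<Sum>x\<in>U. \<Sum>y\<in>U. cmod (f x y) * cmod (g y x))"
    by (intro sum_norm_le) (simp add: norm_mult)
  also have "\<dots> = (\<Sum>xy\<in>U \<times> U. \<bar>cmod (f (fst xy) (snd xy))\<bar> * \<bar>cmod (g (snd xy) (fst xy))\<bar>)"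
    by (simp add: sum.cartesian_product case_prod_unfold)
  also have "\<dots> \<le> L2_set (\<lambda>xy. cmod (f (fst xy) (snd xy))) (U \<times> U) * L2_set (\<lambda>xy. cmod (g (snd xy) (fst xy))) (U \<times> U)"
    by (rule L2_set_mult_ineq)
  also have "L2_set (\<lambda>xy. cmod (g (snd xy) (fst xy))) (U \<times> U) = hs g"
    unfolding hs_def L2_set_def by (simp add: case_prod_unfold) (rule sum.reindex_bij_witness[of _ prod.swap prod.swap], auto)
  finally show ?thesis by (simp add: hs_def case_prod_unfold)
qed

text \<open>The operator norm of the matrices at \<open>w\<close> is at most \<open>R\<close>.\<close>

definition bounded_at :: "real \<Rightarrow> 'w \<Rightarrow> bool" where
  "bounded_at R w \<longleftrightarrow> (\<forall>i\<in>{1..N}. \<forall>u f. cmod (bil (blk False) (blk True) (Gm i w) u f) \<le> R * l2 (blk False) u * l2 (blk True) f)"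

lemma ent_Gm: "x \<in> blk False \<Longrightarrow> y \<in> blk True \<Longrightarrow> ent (Ge i False) x y w = Gm i w x y"
  "x \<in> blk False \<Longrightarrow> y \<in> blk True \<Longrightarrow> ent (Ge i True) y x w = cnj (Gm i w x y)"
  by (auto simp: complex_eq_iff)

lemma l2_row_mult:
  assumes R: "R \<ge> 1" and bw: "bounded_at R w" and e: "e \<in> letters N"
  shows "L2_set (\<lambda>y. cmod (\<Sum>x\<in>U. r x * ent e x y w)) U \<le> R * L2_set (\<lambda>x. cmod (r x)) U"
proof -
  define c where "c y = (\<Sum>x\<in>U. r x * ent e x y w)" for y
  have sub: "l2 (blk \<kappa>) f \<le> L2_set (\<lambda>x. cmod (f x)) U" for \<kappa> f
    unfolding L2_set_def using finU blkU by (intro real_sqrt_le_mono sum_mono2) auto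
  show ?thesis
  proof (cases e)
    case (Pr \<kappa>)
    have "c y = (if y \<in> blk \<kappa> then r y else 0)" if "y \<in> U" for y
    proof -
      have "c y = (\<Sum>x\<in>U. if x = y then (if y \<in> blk \<kappa> then r y else 0) else 0)"
        unfolding c_def Pr by (intro sum.cong) auto
      then show ?thesis using that finU by simp
    qed
    then have "L2_set (\<lambda>y. cmod (c y)) U \<le> L2_set (\<lambda>x. cmod (r x)) U" by (intro L2_set_mono) auto
    also have "\<dots> \<le> R * L2_set (\<lambda>x. cmod (r x)) U" using R by (intro mult_right_mono[of 1 R, simplified]) (auto simp: L2_set_nonneg)
    finally show ?thesis by (simp add: c_def)
  next
    case (Ge i s)
    have i: "i \<in> {1..N}" using e Ge by (auto simp: letters_def)
    have c0: "c y = 0" if "y \<notin> blk (\<not> s)" for y using that unfolding c_def Ge by simp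
    have c1: "c y = (\<Sum>x\<in>blk s. r x * ent e x y w)" for y
      unfolding c_def Ge using finU blkU by (intro sum.mono_neutral_right) auto
    have cU: "L2_set (\<lambda>y. cmod (c y)) U = l2 (blk (\<not> s)) c"
      unfolding L2_set_def using finU blkU c0 by (intro arg_cong[of _ _ sqrt] sum.mono_neutral_right) auto
    have sq: "(l2 (blk (\<not> s)) c)\<^sup>2 = cmod (\<Sum>y\<in>blk (\<not> s). c y * cnj (c y))"
    proof -
      have "(\<Sum>y\<in>blk (\<not> s). c y * cnj (c y)) = of_real (\<Sum>y\<in>blk (\<not> s). (cmod (c y))\<^sup>2)"
        by (simp only: of_real_sum complex_norm_square)
      then show ?thesis by (simp add: L2_set_def sum_nonneg norm_of_real del: of_real_sum)
    qed
    have "cmod (\<Sum>y\<in>blk (\<not> s). c y * cnj (c y)) \<le> R * l2 (blk s) r * l2 (blk (\<not> s)) c"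
    proof (cases s)
      case False
      have "(\<Sum>y\<in>blk (\<not> s). c y * cnj (c y)) = (\<Sum>y\<in>blk True. \<Sum>x\<in>blk False. r x * Gm i w x y * cnj (c y))"
        unfolding c1 Ge using False by (intro sum.cong) (auto simp: sum_distrib_right ent_Gm simp del: ent.simps)
      also have "\<dots> = bil (blk False) (blk True) (Gm i w) r (\<lambda>y. cnj (c y))" unfolding bil_def by (rule sum.swap)
      also have "cmod \<dots> \<le> R * l2 (blk False) r * l2 (blk True) (\<lambda>y. cnj (c y))" using bw i unfolding bounded_at_def by blast
      finally show ?thesis using False by simp
    next
      case True
      have "(\<Sum>y\<in>blk (\<not> s). c y * cnj (c y)) = (\<Sum>y\<in>blk False. \<Sum>x\<in>blk True. cnj (c y) * cnj (Gm i w y x) * r x)"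
        unfolding c1 Ge using True by (intro sum.cong) (auto simp: sum_distrib_right ent_Gm mult_ac simp del: ent.simps)
      also have "\<dots> = cnj (bil (blk False) (blk True) (Gm i w) c (\<lambda>x. cnj (r x)))" unfolding bil_def by (simp add: cnj_sum)
      also have "cmod \<dots> = cmod (bil (blk False) (blk True) (Gm i w) c (\<lambda>x. cnj (r x)))" by (rule complex_mod_cnj)
      also have "\<dots> \<le> R * l2 (blk False) c * l2 (blk True) (\<lambda>x. cnj (r x))"
        using bw i unfolding bounded_at_def by blast
      finally show ?thesis using True by (simp add: mult_ac)
    qed
    then have "l2 (blk (\<not> s)) c * l2 (blk (\<not> s)) c \<le> R * l2 (blk s) r * l2 (blk (\<not> s)) c"
      unfolding sq[symmetric] by (simp add: power2_eq_square)
    moreover have "0 \<le> R * l2 (blk s) r" using R by (simp add: L2_set_nonneg)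
    ultimately have "l2 (blk (\<not> s)) c \<le> R * l2 (blk s) r"
      by (cases "l2 (blk (\<not> s)) c = 0") (auto dest: mult_right_le_imp_le simp: less_le L2_set_nonneg)
    also have "\<dots> \<le> R * L2_set (\<lambda>x. cmod (r x)) U" using R sub by (intro mult_left_mono) auto
    finally show ?thesis unfolding c_def[symmetric] cU .
  qed
qed

lemma hs_mult_W:
  assumes R: "R \<ge> 1" and bw: "bounded_at R w" and l: "set l \<subseteq> letters N"
  shows "hs (\<lambda>x y. \<Sum>z\<in>U. f x z * W l z y w) \<le> R ^ length l * hs f"
  using l
proof (induction l arbitrary: f)
  case Nil
  have "(\<Sum>z\<in>U. f x z * W [] z y w) = (if y \<in> U then f x y else 0)" for x y
  proof -
    have "(\<Sum>z\<in>U. f x z * W [] z y w) = (\<Sum>z\<in>U. if z = y then f x y else 0)" by (intro sum.cong) auto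
    then show ?thesis using finU by simp
  qed
  then have "hs (\<lambda>x y. \<Sum>z\<in>U. f x z * W [] z y w) = hs f" unfolding hs_def by (intro L2_set_cong) auto
  then show ?case by simp
next
  case (Cons e l)
  define f' where "f' x z = (\<Sum>z'\<in>U. f x z' * ent e z' z w)" for x z
  have "(\<Sum>z\<in>U. f x z * W (e # l) z y w) = (\<Sum>z\<in>U. f' x z * W l z y w)" for x y
    unfolding f'_def W.simps sum_distrib_left sum_distrib_right by (subst sum.swap) (simp add: mult.assoc)
  then have "hs (\<lambda>x y. \<Sum>z\<in>U. f x z * W (e # l) z y w) = hs (\<lambda>x y. \<Sum>z\<in>U. f' x z * W l z y w)" by presburger
  also have "\<dots> \<le> R ^ length l * hs f'" using Cons by simp
  also have "hs f' \<le> R * hs f"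
  proof (rule power2_le_imp_le)
    have "(hs f')\<^sup>2 = (\<Sum>x\<in>U. (L2_set (\<lambda>y. cmod (f' x y)) U)\<^sup>2)" by (rule hs_rows)
    also have "\<dots> \<le> (\<Sum>x\<in>U. (R * L2_set (\<lambda>y. cmod (f x y)) U)\<^sup>2)"
      unfolding f'_def using Cons.prems by (intro sum_mono power_mono l2_row_mult[OF R bw]) (auto simp: L2_set_nonneg)
    also have "\<dots> = (R * hs f)\<^sup>2" by (simp add: power_mult_distrib sum_distrib_left hs_rows)
    finally show "(hs f')\<^sup>2 \<le> (R * hs f)\<^sup>2" .
    show "0 \<le> R * hs f" using R by simp
  qed
  then have "R ^ length l * hs f' \<le> R ^ length l * (R * hs f)" using R by (intro mult_left_mono) auto
  finally show ?case by (simp add: mult_ac)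
qed

definition dist_at :: "nat \<Rightarrow> 'w \<Rightarrow> 'w \<Rightarrow> real" where
  "dist_at i w w' = sqrt (\<Sum>x\<in>blk False. \<Sum>y\<in>blk True. (cmod (Gm i w x y - Gm i w' x y))\<^sup>2)"

lemma dist_at_nonneg [simp]: "0 \<le> dist_at i w w'" by (simp add: dist_at_def sum_nonneg)

lemma hs_ent_diff:
  assumes D: "\<And>i. i \<in> {1..N} \<Longrightarrow> dist_at i w w' \<le> D" "0 \<le> D" and e: "e \<in> letters N"
  shows "hs (\<lambda>x y. ent e x y w' - ent e x y w) \<le> D"
proof (cases e)
  case (Pr \<kappa>)
  then have "hs (\<lambda>x y. ent e x y w' - ent e x y w) = 0" by (simp add: hs_def L2_set_def)
  then show ?thesis using D by simp
next
  case (Ge i s)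
  have i: "i \<in> {1..N}" using e Ge by (auto simp: letters_def)
  have "(hs (\<lambda>x y. ent e x y w' - ent e x y w))\<^sup>2 = (\<Sum>x\<in>U. \<Sum>y\<in>U. (cmod (ent e x y w' - ent e x y w))\<^sup>2)"
    by (simp add: hs_def L2_set_def sum_nonneg sum.cartesian_product case_prod_unfold)
  also have "\<dots> = (\<Sum>x\<in>blk s. \<Sum>y\<in>blk (\<not> s). (cmod (ent e x y w' - ent e x y w))\<^sup>2)"
  proof -
    have "(\<Sum>x\<in>U. \<Sum>y\<in>U. (cmod (ent e x y w' - ent e x y w))\<^sup>2) = (\<Sum>x\<in>blk s. \<Sum>y\<in>U. (cmod (ent e x y w' - ent e x y w))\<^sup>2)"
      using Ge finU blkU by (intro sum.mono_neutral_right) auto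
    also have "\<dots> = (\<Sum>x\<in>blk s. \<Sum>y\<in>blk (\<not> s). (cmod (ent e x y w' - ent e x y w))\<^sup>2)"
      using Ge finU blkU by (intro sum.cong refl sum.mono_neutral_right) auto
    finally show ?thesis .
  qed
  also have "\<dots> = (dist_at i w w')\<^sup>2"
  proof (cases s)
    case False
    have "cmod (ent e x y w' - ent e x y w) = cmod (Gm i w x y - Gm i w' x y)" if "x \<in> blk False" "y \<in> blk True" for x y
      using that False Ge ent_Gm(1)[OF that, of i] by (simp add: norm_minus_commute del: ent.simps)
    then show ?thesis using False by (simp add: dist_at_def sum_nonneg)
  next
    case True
    have "cmod (ent e y x w' - ent e y x w) = cmod (Gm i w x y - Gm i w' x y)" if "x \<in> blk False" "y \<in> blk True" for x y
      using that True Ge ent_Gm(2)[OF that, of i] complex_mod_cnj[of "Gm i w' x y - Gm i w x y"]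
      by (simp add: norm_minus_commute del: ent.simps complex_mod_cnj)
    then show ?thesis using True by (simp add: dist_at_def sum_nonneg sum.swap[of _ "blk True"])
  qed
  finally have "hs (\<lambda>x y. ent e x y w' - ent e x y w) = dist_at i w w'" by (simp add: power2_eq_iff_nonneg)
  then show ?thesis using D i by simp
qed

lemma hs_W:
  assumes l: "set l \<subseteq> letters N"
  shows "(hs (\<lambda>x y. W (Pr \<kappa> # l) x y w))\<^sup>2 = real (card (blk \<kappa>)) * cmod (T \<kappa> (l @ rev (map adjl l)) w)"
proof -
  have "(hs (\<lambda>x y. W (Pr \<kappa> # l) x y w))\<^sup>2 = (\<Sum>x\<in>U. \<Sum>y\<in>U. (cmod (W (Pr \<kappa> # l) x y w))\<^sup>2)"
    by (simp add: hs_def L2_set_def sum_nonneg sum.cartesian_product case_prod_unfold del: W.simps)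
  then have "complex_of_real ((hs (\<lambda>x y. W (Pr \<kappa> # l) x y w))\<^sup>2) = (\<Sum>x\<in>U. \<Sum>y\<in>U. W (Pr \<kappa> # l) x y w * cnj (W (Pr \<kappa> # l) x y w))"
    by (simp only: of_real_sum complex_norm_square)
  also have "\<dots> = (\<Sum>x\<in>U. if x \<in> blk \<kappa> then \<Sum>y\<in>U. W l x y w * cnj (W l x y w) else 0)"
    by (intro sum.cong refl) (simp add: W_Pr del: W.simps)
  also have "\<dots> = (\<Sum>x\<in>blk \<kappa>. \<Sum>y\<in>U. W l x y w * cnj (W l x y w))"
    using finU blkU by (simp add: sum.inter_restrict[symmetric] Int_absorb1)
  also have "\<dots> = (\<Sum>x\<in>blk \<kappa>. W (l @ rev (map adjl l)) x x w)"
    using blkU l by (intro sum.cong refl) (auto simp: W_append cnj_W subset_iff simp del: W.simps intro!: sum.cong)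
  also have "\<dots> = q \<kappa> * T \<kappa> (l @ rev (map adjl l)) w" by (simp add: T_def)
  finally have e: "complex_of_real ((hs (\<lambda>x y. W (Pr \<kappa> # l) x y w))\<^sup>2) = q \<kappa> * T \<kappa> (l @ rev (map adjl l)) w" .
  have "(hs (\<lambda>x y. W (Pr \<kappa> # l) x y w))\<^sup>2 = cmod (complex_of_real ((hs (\<lambda>x y. W (Pr \<kappa> # l) x y w))\<^sup>2))"
    by (simp only: norm_of_real abs_of_nonneg zero_le_power2)
  then show ?thesis unfolding e by (simp add: norm_mult)
qed

text \<open>The letters are exchanged one at a time. The word to the left of the exchanged letter enters through its
  Hilbert-Schmidt norm, which is a moment at \<open>w\<close>, so an operator norm bound is needed at \<open>w'\<close> only.\<close>

lemma T_diff_le: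
  assumes R: "R \<ge> 1" and bw: "bounded_at R w'" and l: "set l \<subseteq> letters N"
    and D: "\<And>i. i \<in> {1..N} \<Longrightarrow> dist_at i w w' \<le> D" "0 \<le> D"
    and H: "\<And>j. j \<le> length l \<Longrightarrow> cmod (T \<kappa> (take j l @ rev (map adjl (take j l))) w) \<le> H"
  shows "real (card (blk \<kappa>)) * cmod (T \<kappa> l w - T \<kappa> l w') \<le> real (length l) * (sqrt (real (card (blk \<kappa>)) * H) * R ^ length l * D)"
proof -
  define F where "F u r = (\<Sum>x\<in>U. \<Sum>z\<in>U. W (Pr \<kappa> # u) x z w * W r z x w')" for u r
  let ?K = "sqrt (real (card (blk \<kappa>)) * H) * R ^ length l * D"
  have H0: "0 \<le> H" using H[of 0] norm_ge_zero order_trans by blast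
  have step: "cmod (F (take j l) (drop j l) - F (take (Suc j) l) (drop (Suc j) l)) \<le> ?K" if j: "j < length l" for j
  proof -
    let ?u = "take j l" and ?e = "l ! j" and ?r = "drop (Suc j) l"
    have e: "?e \<in> letters N" using l j by auto
    have r: "set ?r \<subseteq> letters N" using l by (rule set_drop_letters)
    have u: "set ?u \<subseteq> letters N" using l by (rule set_take_letters)
    have t: "take (Suc j) l = ?u @ [?e]" "drop j l = ?e # ?r" using j by (simp_all add: take_Suc_conv_app_nth Cons_nth_drop_Suc)
    have W1: "W (Pr \<kappa> # ?u @ [?e]) x y w = (\<Sum>z\<in>U. W (Pr \<kappa> # ?u) x z w * ent ?e z y w)" if "x \<in> U" "y \<in> U" for x y
    proof -
      have "W [?e] z y w = ent ?e z y w" for z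
      proof -
        have "W [?e] z y w = (\<Sum>z'\<in>U. if z' = y then ent ?e z z' w else 0)" unfolding W.simps by (intro sum.cong) auto
        then show ?thesis using that finU by simp
      qed
      then show ?thesis using W_append[OF that(1), of "Pr \<kappa> # ?u" "[?e]" y w] by (simp del: W.simps)
    qed
    have "F ?u (?e # ?r) = (\<Sum>x\<in>U. \<Sum>z\<in>U. W (Pr \<kappa> # ?u) x z w * (\<Sum>y\<in>U. ent ?e z y w' * W ?r y x w'))"
      unfolding F_def W.simps(2)[of ?e] ..
    moreover have "F (?u @ [?e]) ?r = (\<Sum>x\<in>U. \<Sum>z\<in>U. W (Pr \<kappa> # ?u) x z w * (\<Sum>y\<in>U. ent ?e z y w * W ?r y x w'))"
    proof -
      have "(\<Sum>y\<in>U. W (Pr \<kappa> # ?u @ [?e]) x y w * W ?r y x w') = (\<Sum>z\<in>U. W (Pr \<kappa> # ?u) x z w * (\<Sum>y\<in>U. ent ?e z y w * W ?r y x w'))" if "x \<in> U" for x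
      proof -
        have "(\<Sum>y\<in>U. W (Pr \<kappa> # ?u @ [?e]) x y w * W ?r y x w') = (\<Sum>y\<in>U. (\<Sum>z\<in>U. W (Pr \<kappa> # ?u) x z w * ent ?e z y w) * W ?r y x w')"
          by (intro sum.cong refl) (simp only: W1[OF that])
        also have "\<dots> = (\<Sum>y\<in>U. \<Sum>z\<in>U. W (Pr \<kappa> # ?u) x z w * (ent ?e z y w * W ?r y x w'))"
          by (simp only: sum_distrib_right mult.assoc)
        also have "\<dots> = (\<Sum>z\<in>U. \<Sum>y\<in>U. W (Pr \<kappa> # ?u) x z w * (ent ?e z y w * W ?r y x w'))" by (rule sum.swap)
        finally show ?thesis by (simp only: sum_distrib_left)
      qed
      then show ?thesis unfolding F_def by (rule sum.cong[OF refl])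
    qed
    ultimately have eq: "F ?u (?e # ?r) - F (?u @ [?e]) ?r = (\<Sum>x\<in>U. \<Sum>z\<in>U. W (Pr \<kappa> # ?u) x z w * (\<Sum>y\<in>U. (ent ?e z y w' - ent ?e z y w) * W ?r y x w'))"
      by (simp only: sum_subtractf left_diff_distrib right_diff_distrib)
    have "cmod (F ?u (?e # ?r) - F (?u @ [?e]) ?r) \<le> hs (\<lambda>x y. W (Pr \<kappa> # ?u) x y w) * hs (\<lambda>z x. \<Sum>y\<in>U. (ent ?e z y w' - ent ?e z y w) * W ?r y x w')"
      unfolding eq by (rule hs_trace)
    also have "\<dots> \<le> sqrt (real (card (blk \<kappa>)) * H) * (R ^ length ?r * D)"
    proof (rule mult_mono)
      show "hs (\<lambda>x y. W (Pr \<kappa> # ?u) x y w) \<le> sqrt (real (card (blk \<kappa>)) * H)"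
        using H[of j] j by (intro real_le_rsqrt) (simp add: hs_W[OF u] mult_left_mono del: W.simps)
      have "hs (\<lambda>z x. \<Sum>y\<in>U. (ent ?e z y w' - ent ?e z y w) * W ?r y x w') \<le> R ^ length ?r * hs (\<lambda>x y. ent ?e x y w' - ent ?e x y w)"
        by (rule hs_mult_W[OF R bw r])
      also have "\<dots> \<le> R ^ length ?r * D" using R hs_ent_diff[OF D e] by (intro mult_left_mono) auto
      finally show "hs (\<lambda>z x. \<Sum>y\<in>U. (ent ?e z y w' - ent ?e z y w) * W ?r y x w') \<le> R ^ length ?r * D" .
    qed (use H0 in auto)
    also have "\<dots> \<le> ?K"
      using R D H0 by (auto simp: mult.assoc intro!: mult_left_mono mult_right_mono power_increasing)
    finally show ?thesis unfolding t .
  qed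
  have e: "(\<Sum>j<length l. F (take j l) (drop j l) - F (take (Suc j) l) (drop (Suc j) l)) = F [] l - F l []"
    using sum_lessThan_telescope'[of "\<lambda>j. F (take j l) (drop j l)" "length l"] by simp
  have "cmod (F [] l - F l []) \<le> (\<Sum>j<length l. ?K)"
    unfolding e[symmetric] by (rule sum_norm_le) (use step in simp)
  then have "cmod (F [] l - F l []) \<le> real (length l) * ?K" by simp
  moreover have "F [] l = q \<kappa> * T \<kappa> l w'"
  proof -
    have "(\<Sum>z\<in>U. W [Pr \<kappa>] x z w * W l z x w') = (if x \<in> blk \<kappa> then W l x x w' else 0)" if x: "x \<in> U" for x
    proof -
      have "(\<Sum>z\<in>U. W [Pr \<kappa>] x z w * W l z x w') = (\<Sum>z\<in>U. if z = x then (if x \<in> blk \<kappa> then W l x x w' else 0) else 0)"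
        using x by (intro sum.cong) (auto simp: W_Pr simp del: W.simps(2))
      then show ?thesis using x finU by simp
    qed
    then have "F [] l = (\<Sum>x\<in>U. if x \<in> blk \<kappa> then W l x x w' else 0)" unfolding F_def by (intro sum.cong refl) simp
    also have "\<dots> = (\<Sum>x\<in>blk \<kappa>. W l x x w')" using finU blkU by (simp add: sum.inter_restrict[symmetric] Int_absorb1)
    finally show ?thesis by (simp add: T_def)
  qed
  moreover have "F l [] = q \<kappa> * T \<kappa> l w"
  proof -
    have "(\<Sum>z\<in>U. W (Pr \<kappa> # l) x z w * W [] z x w') = (if x \<in> blk \<kappa> then W l x x w else 0)" if x: "x \<in> U" for x
    proof -
      have "(\<Sum>z\<in>U. W (Pr \<kappa> # l) x z w * W [] z x w') = (\<Sum>z\<in>U. if z = x then (if x \<in> blk \<kappa> then W l x x w else 0) else 0)"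
        using x by (intro sum.cong) (auto simp: W_Pr simp del: W.simps(2))
      then show ?thesis using x finU by simp
    qed
    then have "F l [] = (\<Sum>x\<in>U. if x \<in> blk \<kappa> then W l x x w else 0)" unfolding F_def by (intro sum.cong refl) simp
    also have "\<dots> = (\<Sum>x\<in>blk \<kappa>. W l x x w)" using finU blkU by (simp add: sum.inter_restrict[symmetric] Int_absorb1)
    finally show ?thesis by (simp add: T_def)
  qed
  ultimately show ?thesis
    by (simp add: right_diff_distrib[symmetric] norm_mult norm_minus_commute[of "T \<kappa> l w'"])
qed

end

section \<open>Gaussian and Lebesgue measure on matrices\<close>

definition block_mat :: "nat \<Rightarrow> nat set \<Rightarrow> nat set \<Rightarrow> (nat \<times> nat \<Rightarrow> complex) \<Rightarrow> complex mat" where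
  "block_mat n K L f = Matrix.mat n n (\<lambda>ij. if ij \<in> K \<times> L then f ij else 0)"

definition block_leb :: "nat \<Rightarrow> nat set \<Rightarrow> nat set \<Rightarrow> complex mat measure" where
  "block_leb n K L = embed_measure (\<Pi>\<^sub>M ij\<in>K \<times> L. lborel) (block_mat n K L)"

definition blocks_leb :: "nat \<Rightarrow> nat set \<Rightarrow> nat set \<Rightarrow> nat \<Rightarrow> (nat \<Rightarrow> complex mat) measure" where
  "blocks_leb n K L N = (\<Pi>\<^sub>M i\<in>{1..N}. block_leb n K L)"

lemma bmat_index: "x < n \<Longrightarrow> y < n \<Longrightarrow> block_mat n K L f $$ (x, y) = (if x \<in> K \<and> y \<in> L then f (x, y) else 0)"
  by (simp add: block_mat_def)

lemma lborel_psf: "product_sigma_finite (\<lambda>_. lborel :: 'b :: euclidean_space measure)"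
  by (simp add: product_sigma_finite_def lborel.sigma_finite_measure_axioms)

lemma nn_integral_lborel_complex:
  fixes f g :: "real \<Rightarrow> ennreal"
  assumes [measurable]: "f \<in> borel_measurable borel" "g \<in> borel_measurable borel"
  shows "(\<integral>\<^sup>+z. f (Re z) * g (Im z) \<partial>lborel) = (\<integral>\<^sup>+t. f t \<partial>lborel) * (\<integral>\<^sup>+t. g t \<partial>lborel)"
proof -
  interpret product_sigma_finite "\<lambda>_::complex. lborel :: real measure" by (rule lborel_psf)
  have B: "Basis = {1, \<i>}" by (rule Basis_complex_def)
  let ?h = "\<lambda>b::complex. if b = 1 then f else g"
  have "(\<integral>\<^sup>+z. f (Re z) * g (Im z) \<partial>lborel) = (\<integral>\<^sup>+w. f (Re (\<Sum>b\<in>Basis. w b *\<^sub>R b)) * g (Im (\<Sum>b\<in>Basis. w b *\<^sub>R b)) \<partial>(\<Pi>\<^sub>M b\<in>(Basis::complex set). lborel))"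
    by (subst lborel_eq) (rule nn_integral_distr, measurable)
  also have "\<dots> = (\<integral>\<^sup>+w. (\<Prod>b\<in>Basis. ?h b (w b)) \<partial>(\<Pi>\<^sub>M b\<in>(Basis::complex set). lborel))"
    by (intro nn_integral_cong) (simp add: B)
  also have "\<dots> = (\<Prod>b\<in>Basis. \<integral>\<^sup>+t. ?h b t \<partial>lborel)"
    by (rule product_nn_integral_prod[where f = ?h]) auto
  finally show ?thesis by (simp add: B)
qed

definition mat_midpoint :: "nat \<Rightarrow> complex mat \<Rightarrow> complex mat \<Rightarrow> complex mat" where
  "mat_midpoint n A B = Matrix.mat n n (\<lambda>ij. (1/2) *\<^sub>R (A $$ ij + B $$ ij))"

definition coord :: "nat \<times> (nat \<times> nat) \<times> bool \<Rightarrow> (nat \<Rightarrow> complex mat) \<Rightarrow> real" where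
  "coord \<alpha> A = (if snd (snd \<alpha>) then Im (A (fst \<alpha>) $$ fst (snd \<alpha>)) else Re (A (fst \<alpha>) $$ fst (snd \<alpha>)))"

context
  fixes n :: nat and K L :: "nat set"
  assumes K: "K \<subseteq> {..<n}" and L: "L \<subseteq> {..<n}"
begin

lemma finKL: "finite K" "finite L" "finite (K \<times> L)"
proof -
  show 1: "finite K" "finite L" using K L by (auto intro: finite_subset)
  then show "finite (K \<times> L)" by simp
qed

lemma bmat_KL: "x \<in> K \<Longrightarrow> y \<in> L \<Longrightarrow> block_mat n K L f $$ (x, y) = f (x, y)"
  using K L by (subst bmat_index) auto

lemma inj_bmat: "inj_on (block_mat n K L) (space (\<Pi>\<^sub>M ij\<in>K \<times> L. lborel))"
proof (rule inj_onI)
  fix f g assume f: "f \<in> space (\<Pi>\<^sub>M ij\<in>K \<times> L. lborel)" and g: "g \<in> space (\<Pi>\<^sub>M ij\<in>K \<times> L. lborel)"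
    and e: "block_mat n K L f = block_mat n K L g"
  show "f = g"
  proof
    fix xy
    show "f xy = g xy"
    proof (cases "xy \<in> K \<times> L")
      case True
      then obtain x y where xy: "xy = (x, y)" "x \<in> K" "y \<in> L" by auto
      then show ?thesis using e bmat_KL[of x y f] bmat_KL[of x y g] by simp
    next
      case False
      then show ?thesis using f g by (cases xy) (auto simp: space_PiM PiE_iff extensional_def)
    qed
  qed
qed

lemma space_bleb: "space (block_leb n K L) = block_mat n K L ` (K \<times> L \<rightarrow>\<^sub>E UNIV)"
  by (simp add: block_leb_def space_embed_measure space_PiM)

lemma bmat_measurable: "block_mat n K L \<in> measurable (\<Pi>\<^sub>M ij\<in>K \<times> L. lborel) (block_leb n K L)"
  unfolding block_leb_def by (rule measurable_embed_measure2'[OF inj_bmat])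

lemma entry_measurable: "x < n \<Longrightarrow> y < n \<Longrightarrow> (\<lambda>A. A $$ (x, y)) \<in> borel_measurable (block_leb n K L)"
  unfolding block_leb_def
proof (rule measurable_embed_measure1)
  assume xy: "x < n" "y < n"
  show "(\<lambda>f. block_mat n K L f $$ (x, y)) \<in> borel_measurable (\<Pi>\<^sub>M ij\<in>K \<times> L. lborel)"
  proof (cases "x \<in> K \<and> y \<in> L")
    case True
    have "(\<lambda>f. f (x, y)) \<in> measurable (\<Pi>\<^sub>M ij\<in>K \<times> L. lborel) (lborel :: complex measure)"
      by (rule measurable_component_singleton) (use True in auto)
    then show ?thesis using True xy by (simp add: bmat_index)
  next
    case False then show ?thesis using xy by (auto simp: bmat_index)
  qed
qed

lemma sigma_finite_bleb: "sigma_finite_measure (block_leb n K L)"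
proof -
  interpret product_sigma_finite "\<lambda>_::nat \<times> nat. lborel :: complex measure" by (rule lborel_psf)
  interpret fp: finite_product_sigma_finite "\<lambda>_::nat \<times> nat. lborel :: complex measure" "K \<times> L"
    by standard (rule finKL)
  obtain A where A: "countable A" "A \<subseteq> sets (\<Pi>\<^sub>M ij\<in>K \<times> L. lborel)" "\<Union> A = space (\<Pi>\<^sub>M ij\<in>K \<times> L. lborel :: complex measure)"
     "\<forall>a\<in>A. emeasure (\<Pi>\<^sub>M ij\<in>K \<times> L. lborel) a \<noteq> \<infinity>"
    using fp.sigma_finite_countable by blast
  show ?thesis
  proof (standard, intro exI conjI)
    show "countable ((\<lambda>a. block_mat n K L ` a) ` A)" using A(1) by (rule countable_image)
    show "(\<lambda>a. block_mat n K L ` a) ` A \<subseteq> sets (block_leb n K L)"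
      unfolding block_leb_def using A(2) by (auto intro: in_sets_embed_measure)
    show "\<Union> ((\<lambda>a. block_mat n K L ` a) ` A) = space (block_leb n K L)"
      unfolding block_leb_def space_embed_measure A(3)[symmetric] by blast
    show "\<forall>a\<in>(\<lambda>a. block_mat n K L ` a) ` A. emeasure (block_leb n K L) a \<noteq> \<infinity>"
      unfolding block_leb_def using A(2,4) by (auto simp: emeasure_embed_measure_image'[OF inj_bmat] subset_iff)
  qed
qed

lemma tleb_psf: "product_sigma_finite (\<lambda>_::nat. block_leb n K L)"
  by (simp add: product_sigma_finite_def sigma_finite_bleb)

lemma nn_integral_bleb_prod:
  fixes h :: "nat \<times> nat \<Rightarrow> complex \<Rightarrow> ennreal"
  assumes h: "\<And>ij. ij \<in> K \<times> L \<Longrightarrow> h ij \<in> borel_measurable borel"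
  shows "(\<integral>\<^sup>+A. (\<Prod>ij\<in>K \<times> L. h ij (A $$ ij)) \<partial>block_leb n K L) = (\<Prod>ij\<in>K \<times> L. \<integral>\<^sup>+z. h ij z \<partial>lborel)"
proof -
  interpret product_sigma_finite "\<lambda>_::nat \<times> nat. lborel :: complex measure" by (rule lborel_psf)
  have "(\<lambda>A. A $$ ij) \<in> borel_measurable (block_leb n K L)" if "ij \<in> K \<times> L" for ij
  proof -
    have "fst ij < n" "snd ij < n" using that K L by auto
    then show ?thesis using entry_measurable[of "fst ij" "snd ij"] by simp
  qed
  then have m: "(\<lambda>A. \<Prod>ij\<in>K \<times> L. h ij (A $$ ij)) \<in> borel_measurable (block_leb n K L)"
    using h by (intro borel_measurable_prod_ennreal measurable_compose[of "\<lambda>A. A $$ _" _ borel "h _"])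
  have "(\<integral>\<^sup>+A. (\<Prod>ij\<in>K \<times> L. h ij (A $$ ij)) \<partial>block_leb n K L) = (\<integral>\<^sup>+f. (\<Prod>ij\<in>K \<times> L. h ij (block_mat n K L f $$ ij)) \<partial>(\<Pi>\<^sub>M ij\<in>K \<times> L. lborel))"
    using m unfolding block_leb_def by (rule nn_integral_embed_measure'[OF inj_bmat])
  also have "\<dots> = (\<integral>\<^sup>+f. (\<Prod>ij\<in>K \<times> L. h ij (f ij)) \<partial>(\<Pi>\<^sub>M ij\<in>K \<times> L. lborel))"
    by (intro nn_integral_cong prod.cong refl) (auto simp: bmat_KL)
  also have "\<dots> = (\<Prod>ij\<in>K \<times> L. \<integral>\<^sup>+z. h ij z \<partial>lborel)"
    using h by (intro product_nn_integral_prod finKL) auto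
  finally show ?thesis .
qed

lemma midm_bmat: "mat_midpoint n (block_mat n K L f) (block_mat n K L g) = block_mat n K L (\<lambda>ij\<in>K \<times> L. (1/2) *\<^sub>R (f ij + g ij))"
  by (rule eq_matI) (auto simp: mat_midpoint_def block_mat_def)

lemma prekopa_tleb: "prekopa (blocks_leb n K L N) (\<lambda>A B. \<lambda>i\<in>{1..N}. mat_midpoint n (A i) (B i))"
  unfolding blocks_leb_def
proof (rule prekopa_PiM)
  show "sigma_finite_measure (block_leb n K L)" by (rule sigma_finite_bleb)
  have "prekopa (\<Pi>\<^sub>M ij\<in>K \<times> L. lborel :: complex measure) (\<lambda>x y. \<lambda>ij\<in>K \<times> L. (1/2) *\<^sub>R (x ij + y ij))"
    by (intro prekopa_PiM finKL) (auto simp: prekopa_lborel lborel.sigma_finite_measure_axioms)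
  then have "prekopa (distr (\<Pi>\<^sub>M ij\<in>K \<times> L. lborel) (block_leb n K L) (block_mat n K L)) (mat_midpoint n)"
    by (rule prekopa_distr[OF _ bmat_measurable]) (simp add: midm_bmat)
  then show "prekopa (block_leb n K L) (mat_midpoint n)"
    using embed_measure_eq_distr'[OF inj_bmat] by (simp add: block_leb_def)
  fix x y assume "x \<in> space (block_leb n K L)" "y \<in> space (block_leb n K L)"
  then show "mat_midpoint n x y \<in> space (block_leb n K L)" unfolding space_bleb by (auto simp: midm_bmat)
qed simp

end

lemma prod_Times: "(\<Prod>p\<in>A \<times> B. F p) = (\<Prod>x\<in>A. \<Prod>y\<in>B. F (x, y))"
  by (simp add: prod.cartesian_product)

locale blocks =
  fixes n :: nat and blk :: "bool \<Rightarrow> nat set" and N :: nat and v :: "nat \<Rightarrow> real"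
  assumes blkn: "blk \<kappa> \<subseteq> {..<n}" and dj: "blk False \<inter> blk True = {}" and ne: "blk \<kappa> \<noteq> {}"
    and vp: "\<And>i. i \<in> {1..N} \<Longrightarrow> v i > 0"
begin

abbreviation "leb \<equiv> blocks_leb n (blk False) (blk True) N"

definition G :: "(nat \<Rightarrow> complex mat) \<Rightarrow> real" where
  "G A = (\<Prod>\<alpha>\<in>gindex N blk. normal_density 0 (sqrt (v (fst \<alpha>) / 2)) (coord \<alpha> A))"

definition GM :: "(nat \<Rightarrow> complex mat) measure" where "GM = density leb (\<lambda>A. ennreal (G A))"

lemma coord_measurable [measurable]: "\<alpha> \<in> gindex N blk \<Longrightarrow> coord \<alpha> \<in> borel_measurable leb"
proof -
  assume a: "\<alpha> \<in> gindex N blk"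
  then obtain i x y r where \<alpha>: "\<alpha> = (i, (x, y), r)" "i \<in> {1..N}" "x \<in> blk False" "y \<in> blk True"
    by (auto simp: gindex_def)
  have "(\<lambda>A. A i) \<in> measurable leb (block_leb n (blk False) (blk True))"
    unfolding blocks_leb_def by (rule measurable_component_singleton) (use \<alpha> in auto)
  moreover have "(\<lambda>A. A $$ (x, y)) \<in> borel_measurable (block_leb n (blk False) (blk True))"
    using \<alpha> blkn by (intro entry_measurable) auto
  ultimately have "(\<lambda>A. A i $$ (x, y)) \<in> borel_measurable leb" by (rule measurable_compose)
  then show ?thesis unfolding coord_def[abs_def] \<alpha> by (cases r) auto
qed

lemma fin_gindex [simp]: "finite (gindex N blk)"
  unfolding gindex_def using blkn by (auto intro!: finite_cartesian_product intro: finite_subset[of _ "{..<n}"])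

lemma nn_integral_leb_prod:
  assumes h: "\<And>\<alpha>. \<alpha> \<in> gindex N blk \<Longrightarrow> h \<alpha> \<in> borel_measurable borel"
  shows "(\<integral>\<^sup>+A. (\<Prod>\<alpha>\<in>gindex N blk. h \<alpha> (coord \<alpha> A)) \<partial>leb) = (\<Prod>\<alpha>\<in>gindex N blk. \<integral>\<^sup>+t. h \<alpha> t \<partial>lborel)"
proof -
  let ?K = "blk False" and ?L = "blk True"
  interpret product_sigma_finite "\<lambda>_::nat. block_leb n ?K ?L" by (rule tleb_psf[OF blkn blkn])
  let ?c = "\<lambda>i ij z. h (i, ij, False) (Re z) * h (i, ij, True) (Im z)"
  have cm: "?c i ij \<in> borel_measurable borel" if "i \<in> {1..N}" "ij \<in> ?K \<times> ?L" for i ij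
  proof -
    have [measurable]: "h (i, ij, b) \<in> borel_measurable borel" for b using that by (intro h) (auto simp: gindex_def)
    show ?thesis by measurable
  qed
  have em: "(\<lambda>A. A $$ ij) \<in> borel_measurable (block_leb n ?K ?L)" if "ij \<in> ?K \<times> ?L" for ij
  proof -
    have "fst ij < n" "snd ij < n" using that blkn[of False] blkn[of True] by auto
    then show ?thesis using entry_measurable[OF blkn blkn, of "fst ij" "snd ij"] by simp
  qed
  have "(\<integral>\<^sup>+A. (\<Prod>\<alpha>\<in>gindex N blk. h \<alpha> (coord \<alpha> A)) \<partial>leb) = (\<integral>\<^sup>+A. (\<Prod>i\<in>{1..N}. \<Prod>ij\<in>?K \<times> ?L. ?c i ij (A i $$ ij)) \<partial>leb)"
    unfolding gindex_def prod_Times[where A = "{1..N}"] prod_Times[where A = "?K \<times> ?L"] by (simp add: coord_def UNIV_bool mult.commute)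
  also have "\<dots> = (\<Prod>i\<in>{1..N}. \<integral>\<^sup>+A. (\<Prod>ij\<in>?K \<times> ?L. ?c i ij (A $$ ij)) \<partial>block_leb n ?K ?L)"
    unfolding blocks_leb_def
    by (rule product_nn_integral_prod) (auto intro!: borel_measurable_prod_ennreal measurable_compose[OF em cm])
  also have "\<dots> = (\<Prod>i\<in>{1..N}. \<Prod>ij\<in>?K \<times> ?L. \<integral>\<^sup>+z. ?c i ij z \<partial>lborel)"
    by (intro prod.cong refl nn_integral_bleb_prod[OF blkn blkn] cm)
  also have "\<dots> = (\<Prod>i\<in>{1..N}. \<Prod>ij\<in>?K \<times> ?L. (\<integral>\<^sup>+t. h (i, ij, False) t \<partial>lborel) * (\<integral>\<^sup>+t. h (i, ij, True) t \<partial>lborel))"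
    by (intro prod.cong refl nn_integral_lborel_complex h) (auto simp: gindex_def)
  also have "\<dots> = (\<Prod>\<alpha>\<in>gindex N blk. \<integral>\<^sup>+t. h \<alpha> t \<partial>lborel)"
    unfolding gindex_def prod_Times[where A = "{1..N}"] prod_Times[where A = "?K \<times> ?L"] by (simp add: UNIV_bool mult.commute)
  finally show ?thesis .
qed

lemma G_measurable [measurable]: "G \<in> borel_measurable leb"
  unfolding G_def[abs_def] by measurable

lemma G_nonneg [simp]: "0 \<le> G A" by (auto simp: G_def intro!: prod_nonneg)

lemma gaussian_matrices: "gaussian_matrices GM N blk coord v {..<n}"
proof unfold_locales
  show "finite (gindex N blk)" by simp
  show "0 < sqrt (v (fst a) / 2)" if "a \<in> gindex N blk" for a using that vp by (auto simp: gindex_def)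
  show "coord a \<in> borel_measurable GM" if "a \<in> gindex N blk" for a using that by (simp add: GM_def)
  fix f :: "_ \<Rightarrow> real \<Rightarrow> ennreal" assume f: "\<And>a. a \<in> gindex N blk \<Longrightarrow> f a \<in> borel_measurable borel"
  have [measurable]: "(\<lambda>A. \<Prod>a\<in>gindex N blk. f a (coord a A)) \<in> borel_measurable leb"
    by (intro borel_measurable_prod_ennreal measurable_compose[OF coord_measurable f])
  have "(\<integral>\<^sup>+A. (\<Prod>a\<in>gindex N blk. f a (coord a A)) \<partial>GM) = (\<integral>\<^sup>+A. ennreal (G A) * (\<Prod>a\<in>gindex N blk. f a (coord a A)) \<partial>leb)"
    unfolding GM_def by (rule nn_integral_density) auto
  also have "\<dots> = (\<integral>\<^sup>+A. (\<Prod>a\<in>gindex N blk. ennreal (normal_density 0 (sqrt (v (fst a) / 2)) (coord a A)) * f a (coord a A)) \<partial>leb)"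
    by (simp add: G_def prod_ennreal[symmetric] prod.distrib)
  also have "\<dots> = (\<Prod>a\<in>gindex N blk. \<integral>\<^sup>+t. ennreal (normal_density 0 (sqrt (v (fst a) / 2)) t) * f a t \<partial>lborel)"
    using f by (intro nn_integral_leb_prod) auto
  finally show "(\<integral>\<^sup>+A. (\<Prod>a\<in>gindex N blk. f a (coord a A)) \<partial>GM) = (\<Prod>a\<in>gindex N blk. \<integral>\<^sup>+t. ennreal (normal_density 0 (sqrt (v (fst a) / 2)) t) * f a t \<partial>lborel)" .
qed (use vp blkn dj ne in auto)

sublocale gaussian_matrices GM N blk coord v "{..<n}" by (rule gaussian_matrices)

definition Q :: "(nat \<Rightarrow> complex mat) \<Rightarrow> real" where
  "Q A = (\<Sum>\<alpha>\<in>gindex N blk. (coord \<alpha> A)\<^sup>2 / v (fst \<alpha>))"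

definition Z :: real where "Z = (\<Prod>\<alpha>\<in>gindex N blk. sqrt (pi * v (fst \<alpha>)))"

lemma v_gindex: "\<alpha> \<in> gindex N blk \<Longrightarrow> v (fst \<alpha>) > 0" using vp by (auto simp: gindex_def)

lemma Z_pos: "Z > 0" unfolding Z_def using v_gindex by (intro prod_pos) (auto simp: )

lemma G_Q: "G A = exp (- Q A) / Z"
proof -
  have "normal_density 0 (sqrt (v (fst \<alpha>) / 2)) (coord \<alpha> A) = exp (- ((coord \<alpha> A)\<^sup>2 / v (fst \<alpha>))) / sqrt (pi * v (fst \<alpha>))"
    if "\<alpha> \<in> gindex N blk" for \<alpha>
    using v_gindex[OF that] by (simp add: normal_density_def)
  then have "G A = (\<Prod>\<alpha>\<in>gindex N blk. exp (- ((coord \<alpha> A)\<^sup>2 / v (fst \<alpha>))) / sqrt (pi * v (fst \<alpha>)))"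
    unfolding G_def by (intro prod.cong refl)
  then show ?thesis unfolding Q_def Z_def by (simp add: prod_dividef exp_sum[symmetric] sum_negf)
qed

lemma nn_integral_G: "(\<integral>\<^sup>+A. ennreal (G A) \<partial>leb) = 1"
  using emeasure_space_eq_1 unfolding GM_def by (simp add: emeasure_density)

lemma emeasure_GM: "S \<in> sets leb \<Longrightarrow> emeasure GM S = (\<integral>\<^sup>+A. ennreal (G A) * indicator S A \<partial>leb)"
  unfolding GM_def by (rule emeasure_density) auto

lemma leb_le:
  assumes S: "S \<in> sets leb" and Qb: "\<And>A. A \<in> S \<Longrightarrow> Q A \<le> b"
  shows "emeasure leb S \<le> ennreal (Z * exp b) * emeasure GM S"
proof -
  have "emeasure leb S = (\<integral>\<^sup>+A. indicator S A \<partial>leb)" using S by simp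
  also have "\<dots> \<le> (\<integral>\<^sup>+A. ennreal (Z * exp b) * (ennreal (G A) * indicator S A) \<partial>leb)"
  proof (intro nn_integral_mono)
    fix A
    have "1 \<le> Z * exp b * G A" if "A \<in> S" using Qb[OF that] Z_pos by (simp add: G_Q exp_add[symmetric] exp_minus[symmetric] mult.assoc)
    then show "indicator S A \<le> ennreal (Z * exp b) * (ennreal (G A) * indicator S A)"
      using Z_pos by (auto simp: indicator_def ennreal_mult[symmetric] ennreal_1[symmetric] simp del: ennreal_1 intro!: ennreal_leI)
  qed
  also have "\<dots> = ennreal (Z * exp b) * emeasure GM S"
    unfolding emeasure_GM[OF S] using S by (intro nn_integral_cmult) auto
  finally show ?thesis .
qed

lemma leb_ge:
  assumes S: "S \<in> sets leb" and Qa: "\<And>A. A \<in> S \<Longrightarrow> Q A \<ge> a"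
  shows "emeasure leb S \<ge> ennreal (Z * exp a) * emeasure GM S"
proof -
  have "ennreal (Z * exp a) * emeasure GM S = (\<integral>\<^sup>+A. ennreal (Z * exp a) * (ennreal (G A) * indicator S A) \<partial>leb)"
    unfolding emeasure_GM[OF S] using S by (intro nn_integral_cmult[symmetric]) auto
  also have "\<dots> \<le> (\<integral>\<^sup>+A. indicator S A \<partial>leb)"
  proof (intro nn_integral_mono)
    fix A
    have "Z * exp a * G A \<le> 1" if "A \<in> S" using Qa[OF that] Z_pos by (simp add: G_Q exp_add[symmetric] exp_minus[symmetric] mult.assoc)
    then show "ennreal (Z * exp a) * (ennreal (G A) * indicator S A) \<le> indicator S A"
      using Z_pos by (auto simp: indicator_def ennreal_mult[symmetric])
  qed
  also have "\<dots> = emeasure leb S" using S by simp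
  finally show ?thesis .
qed

lemma separated_sets:
  assumes S: "S \<in> sets leb" and S': "S' \<in> sets leb"
    and D: "\<And>A B. A \<in> S \<Longrightarrow> B \<in> S' \<Longrightarrow> (\<Sum>\<alpha>\<in>gindex N blk. (coord \<alpha> A - coord \<alpha> B)\<^sup>2 / v (fst \<alpha>)) \<ge> \<Delta>"
  shows "emeasure GM S * emeasure GM S' \<le> ennreal (exp (- \<Delta> / 2))"
proof -
  let ?mid = "\<lambda>A B. \<lambda>i\<in>{1..N}. mat_midpoint n (A i) (B i)"
  have Xm: "coord \<alpha> (?mid A B) = (coord \<alpha> A + coord \<alpha> B) / 2" if a: "\<alpha> \<in> gindex N blk" for \<alpha> A B
  proof -
    obtain i x y r where \<alpha>: "\<alpha> = (i, (x, y), r)" "i \<in> {1..N}" "x \<in> blk False" "y \<in> blk True"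
      using a by (auto simp: gindex_def)
    then have "x < n" "y < n" using blkn by blast+
    with \<alpha> show ?thesis by (simp add: coord_def mat_midpoint_def)
  qed
  have key: "G A * G B = (exp (- (\<Sum>\<alpha>\<in>gindex N blk. (coord \<alpha> A - coord \<alpha> B)\<^sup>2 / v (fst \<alpha>)) / 4) * G (?mid A B))\<^sup>2" for A B
  proof -
    have "Q A + Q B = 2 * Q (?mid A B) + (\<Sum>\<alpha>\<in>gindex N blk. (coord \<alpha> A - coord \<alpha> B)\<^sup>2 / v (fst \<alpha>)) / 2"
      unfolding Q_def sum.distrib[symmetric] sum_distrib_left sum_divide_distrib
    proof (intro sum.cong refl)
      fix \<alpha> assume a: "\<alpha> \<in> gindex N blk"
      have "x\<^sup>2 / w + y\<^sup>2 / w = 2 * (((x + y) / 2)\<^sup>2 / w) + (x - y)\<^sup>2 / w / 2" if "w > 0" for x y w :: real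
        using that by (simp add: field_simps power2_eq_square)
      from this[OF v_gindex[OF a]] show "(coord \<alpha> A)\<^sup>2 / v (fst \<alpha>) + (coord \<alpha> B)\<^sup>2 / v (fst \<alpha>) = 2 * ((coord \<alpha> (?mid A B))\<^sup>2 / v (fst \<alpha>)) + (coord \<alpha> A - coord \<alpha> B)\<^sup>2 / v (fst \<alpha>) / 2"
        unfolding Xm[OF a] .
    qed
    then have e: "- Q A + - Q B = (- (\<Sum>\<alpha>\<in>gindex N blk. (coord \<alpha> A - coord \<alpha> B)\<^sup>2 / v (fst \<alpha>)) / 4 + - Q (?mid A B)) * 2" by simp
    have "G A * G B = exp (- Q A + - Q B) / Z\<^sup>2" by (simp add: G_Q mult_exp_exp power2_eq_square)
    also have "\<dots> = (exp (- (\<Sum>\<alpha>\<in>gindex N blk. (coord \<alpha> A - coord \<alpha> B)\<^sup>2 / v (fst \<alpha>)) / 4) * exp (- Q (?mid A B)))\<^sup>2 / Z\<^sup>2"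
      unfolding e by (simp add: exp_add[symmetric] exp_double[symmetric] mult.commute)
    finally show ?thesis by (simp add: G_Q power_divide)
  qed
  have "emeasure GM S * emeasure GM S' \<le> (\<integral>\<^sup>+A. ennreal (exp (- \<Delta> / 4)) * ennreal (G A) \<partial>leb)\<^sup>2"
    unfolding emeasure_GM[OF S] emeasure_GM[OF S']
  proof (rule prekopa_tleb[OF blkn blkn, unfolded prekopa_def, rule_format])
    fix A B assume "A \<in> space leb" "B \<in> space leb"
    show "ennreal (G A) * indicator S A * (ennreal (G B) * indicator S' B) \<le> (ennreal (exp (- \<Delta> / 4)) * ennreal (G (?mid A B)))\<^sup>2"
    proof (cases "A \<in> S \<and> B \<in> S'")
      case True
      have "G A * G B \<le> (exp (- \<Delta> / 4) * G (?mid A B))\<^sup>2"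
        unfolding key using D[of A B] True by (intro power_mono mult_right_mono) auto
      then show ?thesis using True by (simp add: ennreal_mult[symmetric] ennreal_power)
    qed auto
  qed (use S S' in auto)
  also have "(\<integral>\<^sup>+A. ennreal (exp (- \<Delta> / 4)) * ennreal (G A) \<partial>leb) = ennreal (exp (- \<Delta> / 4))"
    by (subst nn_integral_cmult) (auto simp: nn_integral_G)
  also have "(ennreal (exp (- \<Delta> / 4)))\<^sup>2 = ennreal (exp (- \<Delta> / 2))"
    by (simp add: ennreal_power exp_double[symmetric])
  finally show ?thesis .
qed

end

section \<open>Matricial microstates\<close>

definition letter_of :: "nat \<times> bool \<Rightarrow> letter" where "letter_of e = Ge (fst e) (snd e)"

context rect begin

lemma card_block: "j \<in> {1..d} \<Longrightarrow> card (block \<phi> p n j) = block_size \<phi> p n j"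
  unfolding block_def by (cases j) (auto simp: atLeastLessThanSuc_atLeastAtMost)

lemma block_subset: "j \<in> {1..d} \<Longrightarrow> block \<phi> p n j \<subseteq> {..<n}"
proof -
  assume j: "j \<in> {1..d}"
  have "(\<Sum>i=1..j. block_size \<phi> p n i) \<le> (\<Sum>i=1..d. block_size \<phi> p n i)" using j by (intro sum_mono2) auto
  moreover have "real (\<Sum>i=1..d. block_size \<phi> p n i) \<le> (\<Sum>i=1..d. weight \<phi> p i * real n)"
    unfolding of_nat_sum block_size_def using weight_pos by (intro sum_mono) (auto intro!: of_nat_floor simp: less_imp_le)
  moreover have "(\<Sum>i=1..d. weight \<phi> p i * real n) = real n" by (simp only: sum_distrib_right[symmetric] weight_sum mult_1)
  ultimately have "(\<Sum>i=1..j. block_size \<phi> p n i) \<le> n" by linarith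
  then show "block \<phi> p n j \<subseteq> {..<n}" unfolding block_def by auto
qed

lemma block_disjoint: "i \<noteq> j \<Longrightarrow> block \<phi> p n i \<inter> block \<phi> p n j = {}"
proof (induction i j rule: linorder_wlog)
  case (le i j)
  then have "(\<Sum>m=1..i. block_size \<phi> p n m) \<le> (\<Sum>m=1..<j. block_size \<phi> p n m)" by (intro sum_mono2) auto
  then show ?case unfolding block_def by auto
next
  case (sym i j)
  then show ?case by blast
qed

end

locale rect_blocks = rect \<phi> d p k l + blocks n "\<lambda>\<kappa>. block \<phi> p n (rect.ix k l \<kappa>)" N v
  for \<phi> :: "'a::cstar_algebra \<Rightarrow> complex" and d p k l n N v
begin

abbreviation "blk \<equiv> \<lambda>\<kappa>. block \<phi> p n (ix \<kappa>)"

lemma tuple_leb: "tuple_lebesgue \<phi> p n k l N = leb"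
  by (simp add: tuple_lebesgue_def blocks_leb_def block_lebesgue_def block_leb_def block_mat_def[abs_def] ix_def)

lemma sb: "space (block_leb n (blk False) (blk True)) = block_mat n (blk False) (blk True) ` (blk False \<times> blk True \<rightarrow>\<^sub>E UNIV)"
  by (rule space_bleb[OF blkn blkn])

lemma block_matrix_index:
  assumes "M \<in> carrier_mat n n" "x < n" "y < n"
  shows "(block_proj \<phi> p n i * M * block_proj \<phi> p n j) $$ (x, y) = (if x \<in> block \<phi> p n i \<and> y \<in> block \<phi> p n j then M $$ (x, y) else 0)"
proof -
  have "block_proj \<phi> p n i * M = Matrix.mat n n (\<lambda>(x, y). (if x \<in> block \<phi> p n i then 1 else 0) * M $$ (x, y))" (is "_ = ?M")
    unfolding block_proj_def by (rule mat_diag_mult_left[OF assms(1)])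
  moreover have "?M * block_proj \<phi> p n j = Matrix.mat n n (\<lambda>(x, y). ?M $$ (x, y) * (if y \<in> block \<phi> p n j then 1 else 0))"
    unfolding block_proj_def by (rule mat_diag_mult_right) simp
  ultimately show ?thesis using assms by simp
qed

lemma block_matrix_dim: "block_proj \<phi> p n i * M * block_proj \<phi> p n j \<in> carrier_mat n n"
  by (auto simp: block_proj_def mat_diag_def)

lemma block_matrices_eq: "block_matrices \<phi> p n k l = space (block_leb n (blk False) (blk True))"
proof (intro equalityI subsetI)
  fix A assume "A \<in> block_matrices \<phi> p n k l"
  then obtain M where M: "M \<in> carrier_mat n n" "A = block_proj \<phi> p n k * M * block_proj \<phi> p n l" by (auto simp: block_matrices_def)
  have "A = block_mat n (blk False) (blk True) (\<lambda>ij\<in>blk False \<times> blk True. M $$ ij)"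
  proof (rule eq_matI)
    show "dim_row A = dim_row (block_mat n (blk False) (blk True) (\<lambda>ij\<in>blk False \<times> blk True. M $$ ij))"
      "dim_col A = dim_col (block_mat n (blk False) (blk True) (\<lambda>ij\<in>blk False \<times> blk True. M $$ ij))"
      using block_matrix_dim[of k M l] M(2) by (auto simp: block_mat_def)
    fix x y assume "x < dim_row (block_mat n (blk False) (blk True) (\<lambda>ij\<in>blk False \<times> blk True. M $$ ij))"
      "y < dim_col (block_mat n (blk False) (blk True) (\<lambda>ij\<in>blk False \<times> blk True. M $$ ij))"
    then have "x < n" "y < n" by (auto simp: block_mat_def)
    then show "A $$ (x, y) = block_mat n (blk False) (blk True) (\<lambda>ij\<in>blk False \<times> blk True. M $$ ij) $$ (x, y)"
      unfolding M(2) using block_matrix_index[OF M(1)] by (simp add: bmat_index ix_def)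
  qed
  then show "A \<in> space (block_leb n (blk False) (blk True))" unfolding sb by auto
next
  fix A assume "A \<in> space (block_leb n (blk False) (blk True))"
  then obtain f where f: "A = block_mat n (blk False) (blk True) f" using sb by auto
  have A: "A \<in> carrier_mat n n" by (simp add: f block_mat_def)
  have "A = block_proj \<phi> p n k * A * block_proj \<phi> p n l"
  proof (rule eq_matI)
    show "dim_row A = dim_row (block_proj \<phi> p n k * A * block_proj \<phi> p n l)" "dim_col A = dim_col (block_proj \<phi> p n k * A * block_proj \<phi> p n l)"
      using A block_matrix_dim[of k A l] by auto
    fix x y assume "x < dim_row (block_proj \<phi> p n k * A * block_proj \<phi> p n l)" "y < dim_col (block_proj \<phi> p n k * A * block_proj \<phi> p n l)"
    then have xy: "x < n" "y < n" using block_matrix_dim[of k A l] by auto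
    show "A $$ (x, y) = (block_proj \<phi> p n k * A * block_proj \<phi> p n l) $$ (x, y)"
      unfolding block_matrix_index[OF A xy] using xy by (simp add: f bmat_index ix_def)
  qed
  then show "A \<in> block_matrices \<phi> p n k l" using A unfolding block_matrices_def by auto
qed

lemma space_leb: "space leb = {1..N} \<rightarrow>\<^sub>E block_matrices \<phi> p n k l"
  by (simp add: blocks_leb_def space_PiM block_matrices_eq)

lemma space_lebD:
  assumes "A \<in> space leb" "i \<in> {1..N}"
  obtains M where "M \<in> carrier_mat n n" "A i = block_proj \<phi> p n k * M * block_proj \<phi> p n l"
proof -
  have "A i \<in> block_matrices \<phi> p n k l" using assms unfolding space_leb by (rule PiE_mem)
  then show ?thesis using that by (auto simp: block_matrices_def)
qed

lemma space_leb_dim: "A \<in> space leb \<Longrightarrow> i \<in> {1..N} \<Longrightarrow> A i \<in> carrier_mat n n"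
  by (metis space_lebD block_matrix_dim)

lemma space_leb_zero: "A \<in> space leb \<Longrightarrow> i \<in> {1..N} \<Longrightarrow> x < n \<Longrightarrow> y < n \<Longrightarrow> \<not> (x \<in> blk False \<and> y \<in> blk True) \<Longrightarrow> A i $$ (x, y) = 0"
  by (rule space_lebD[of A i]) (auto simp: block_matrix_index ix_def)

lemma Gm_entry: "Gm i A x y = A i $$ (x, y)" by (simp add: coord_def complex_eq_iff)

lemma ent_lt:
  assumes A: "A \<in> space leb" and i: "i \<in> {1..N}" and xy: "x < n" "y < n"
  shows "ent (letter_of (i, s)) x y A = (if s then mat_adjoint (A i) else A i) $$ (x, y)"
proof -
  have d: "A i \<in> carrier_mat n n" by (rule space_leb_dim[OF A i])
  have adj: "mat_adjoint (A i) $$ (x, y) = cnj (A i $$ (y, x))"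
    using d xy by (simp add: mat_adjoint_def mat_of_rows_index)
  show ?thesis
  proof (cases s)
    case False
    show ?thesis
    proof (cases "x \<in> blk False \<and> y \<in> blk True")
      case True then show ?thesis using False ent_Gm(1)[of x y i A] Gm_entry by (simp add: letter_of_def del: ent.simps)
    next
      case c: False then show ?thesis using False space_leb_zero[OF A i xy] by (auto simp: letter_of_def)
    qed
  next
    case True
    show ?thesis
    proof (cases "y \<in> blk False \<and> x \<in> blk True")
      case c: True then show ?thesis using True ent_Gm(2)[of y x i A] Gm_entry adj by (simp add: letter_of_def del: ent.simps)
    next
      case c: False then show ?thesis using True space_leb_zero[OF A i xy(2,1)] adj by (auto simp: letter_of_def)
    qed
  qed
qed

lemma mat_word_W:
  assumes A: "A \<in> space leb" and w: "fst ` set w \<subseteq> {1..N}"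
  shows "mat_word_eval n A w \<in> carrier_mat n n \<and> (\<forall>x<n. \<forall>y<n. mat_word_eval n A w $$ (x, y) = W (map letter_of w) x y A)"
  using w
proof (induction w)
  case Nil
  then show ?case by (simp add: mat_word_eval_def)
next
  case (Cons e w)
  obtain i s where e: "e = (i, s)" by (cases e)
  have i: "i \<in> {1..N}" using Cons.prems e by auto
  let ?M = "if s then mat_adjoint (A i) else A i"
  have d: "?M \<in> carrier_mat n n" using space_leb_dim[OF A i] by (auto simp: mat_adjoint_def)
  have IH: "mat_word_eval n A w \<in> carrier_mat n n" "\<And>x y. x < n \<Longrightarrow> y < n \<Longrightarrow> mat_word_eval n A w $$ (x, y) = W (map letter_of w) x y A"
    using Cons by auto
  have eq: "mat_word_eval n A (e # w) = ?M * mat_word_eval n A w" by (simp add: mat_word_eval_def e)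
  have "(?M * mat_word_eval n A w) $$ (x, y) = W (map letter_of (e # w)) x y A" if "x < n" "y < n" for x y
  proof -
    have "(?M * mat_word_eval n A w) $$ (x, y) = (\<Sum>z\<in>{0..<n}. ?M $$ (x, z) * mat_word_eval n A w $$ (z, y))"
      using that d IH(1) by (simp add: scalar_prod_def)
    also have "\<dots> = (\<Sum>z\<in>{..<n}. ent (letter_of e) x z A * W (map letter_of w) z y A)"
      unfolding e using that by (intro sum.cong) (auto simp: ent_lt[OF A i] IH(2))
    finally show ?thesis by simp
  qed
  then show ?case unfolding eq using d IH(1) by (auto simp del: W.simps)
qed

lemma T_lt_word:
  assumes A: "A \<in> space leb" and w: "fst ` set w \<subseteq> {1..N}" "w \<noteq> []"
  shows "mat_cond_exp \<phi> d p n (mat_word_eval n A w) = T False (map letter_of w) A *\<^sub>C pp False + T True (map letter_of w) A *\<^sub>C pp True"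
proof -
  let ?M = "mat_word_eval n A w"
  note M = mat_word_W[OF A w(1)]
  have tr: "mat_trace (block_proj \<phi> p n j * ?M * block_proj \<phi> p n j) = (\<Sum>x\<in>block \<phi> p n j. W (map letter_of w) x x A)" if j: "j \<in> {1..d}" for j
  proof -
    have "dim_row (block_proj \<phi> p n j * ?M * block_proj \<phi> p n j) = n" using block_matrix_dim[of j ?M j] by auto
    then have "mat_trace (block_proj \<phi> p n j * ?M * block_proj \<phi> p n j) = (\<Sum>x\<in>{..<n}. if x \<in> block \<phi> p n j then W (map letter_of w) x x A else 0)"
      unfolding mat_trace_def using M by (intro sum.cong) (auto simp: block_matrix_index)
    also have "\<dots> = (\<Sum>x\<in>block \<phi> p n j. W (map letter_of w) x x A)"
      using block_subset[OF j, of n] by (simp add: sum.inter_restrict[symmetric] Int_absorb1)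
    finally show ?thesis .
  qed
  have off: "(\<Sum>x\<in>block \<phi> p n j. W (map letter_of w) x x A) = 0" if j: "j \<in> {1..d} - range ix" for j
  proof (intro sum.neutral ballI)
    fix x assume x: "x \<in> block \<phi> p n j"
    obtain i s w' where w': "w = (i, s) # w'" using w(2) by (metis list.exhaust prod.exhaust)
    have "x \<notin> blk s" using block_disjoint[of j "ix s" n] x j by auto
    then show "W (map letter_of w) x x A = 0" unfolding w' by (simp add: letter_of_def)
  qed
  have "mat_cond_exp \<phi> d p n ?M = (\<Sum>j\<in>{1..d}. ((\<Sum>x\<in>block \<phi> p n j. W (map letter_of w) x x A) / of_nat (block_size \<phi> p n j)) *\<^sub>C p j)"
    unfolding mat_cond_exp_def by (intro sum.cong refl) (simp add: tr)
  also have "\<dots> = (\<Sum>j\<in>range ix. ((\<Sum>x\<in>block \<phi> p n j. W (map letter_of w) x x A) / of_nat (block_size \<phi> p n j)) *\<^sub>C p j)"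
    by (intro sum.mono_neutral_right) (auto simp: off)
  also have "\<dots> = (\<Sum>\<kappa>\<in>UNIV. T \<kappa> (map letter_of w) A *\<^sub>C pp \<kappa>)"
    by (subst sum.reindex) (auto intro!: inj_onI sum.cong simp: T_def pp_def card_block)
  finally show ?thesis by (simp add: UNIV_bool add.commute)
qed

lemma norm_pp: "norm (z *\<^sub>C pp False + z' *\<^sub>C pp True) \<le> cmod z + cmod z'"
  "cmod z \<le> norm (z *\<^sub>C pp False + z' *\<^sub>C pp True)" "cmod z' \<le> norm (z *\<^sub>C pp False + z' *\<^sub>C pp True)"
proof -
  have n1: "norm (pp \<kappa>) = 1" for \<kappa> by (simp add: pp_def norm_p)
  show "norm (z *\<^sub>C pp False + z' *\<^sub>C pp True) \<le> cmod z + cmod z'"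
    by (rule order_trans[OF norm_triangle_ineq]) (simp add: norm_scaleC n1)
  have "norm (pp \<kappa> * x) \<le> norm x" for \<kappa> x using norm_mult_ineq[of "pp \<kappa>" x] by (simp add: n1)
  from this[of False "z *\<^sub>C pp False + z' *\<^sub>C pp True"] this[of True "z *\<^sub>C pp False + z' *\<^sub>C pp True"]
  show "cmod z \<le> norm (z *\<^sub>C pp False + z' *\<^sub>C pp True)" "cmod z' \<le> norm (z *\<^sub>C pp False + z' *\<^sub>C pp True)"
    by (simp_all add: distrib_left mult_scaleC_right norm_scaleC n1)
qed

lemma cond_exp_word:
  assumes a: "\<And>i. i \<in> {1..N} \<Longrightarrow> has_type p k l (a i)" and w: "fst ` set w \<subseteq> {1..N}" "w \<noteq> []"
  shows "cond_exp \<phi> d p (word_eval a w) = tr False (wv a (map letter_of w)) *\<^sub>C pp False + tr True (wv a (map letter_of w)) *\<^sub>C pp True"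
proof -
  have e: "word_eval a w = wv a (map letter_of w)"
    by (simp add: word_eval_def wv_def letter_of_def case_prod_unfold comp_def cong: map_cong)
  have "trd j (wv a (map letter_of w)) = 0" if j: "j \<in> {1..d} - range ix" for j
  proof -
    obtain i s w' where w': "w = (i, s) # w'" using w(2) by (metis list.exhaust prod.exhaust)
    have "i \<in> {1..N}" using w w' by auto
    from type_mult(3)[of a i, OF a[OF this], of j s] j have "p j * val a (Ge i s) = 0" by (auto simp del: val_simps)
    then show ?thesis unfolding w' by (simp add: trd_def letter_of_def mult.assoc[symmetric] \<phi>_0 del: val_simps)
  qed
  then have "cond_exp \<phi> d p (wv a (map letter_of w)) = (\<Sum>j\<in>range ix. trd j (wv a (map letter_of w)) *\<^sub>C p j)"
    unfolding cond_exp_trd by (intro sum.mono_neutral_right) auto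
  also have "\<dots> = (\<Sum>\<kappa>\<in>UNIV. tr \<kappa> (wv a (map letter_of w)) *\<^sub>C pp \<kappa>)"
    by (subst sum.reindex) (auto intro!: inj_onI sum.cong simp: tr_trd pp_def)
  finally show ?thesis unfolding e by (simp add: UNIV_bool add.commute)
qed

lemma cond_exp_diff:
  assumes a: "\<And>i. i \<in> {1..N} \<Longrightarrow> has_type p k l (a i)" and A: "A \<in> space leb" and w: "fst ` set w \<subseteq> {1..N}" "w \<noteq> []"
  shows "mat_cond_exp \<phi> d p n (mat_word_eval n A w) - cond_exp \<phi> d p (word_eval a w) =
    (T False (map letter_of w) A - tr False (wv a (map letter_of w))) *\<^sub>C pp False + (T True (map letter_of w) A - tr True (wv a (map letter_of w))) *\<^sub>C pp True"
proof -
  have m: "(z - z') *\<^sub>C x = z *\<^sub>C x - z' *\<^sub>C (x::'a)" for z z' x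
    using scaleC_add_left[of "z - z'" z' x] by simp
  have ce: "cond_exp \<phi> d p (word_eval a w) = tr False (wv a (map letter_of w)) *\<^sub>C pp False + tr True (wv a (map letter_of w)) *\<^sub>C pp True"
    by (rule cond_exp_word) (use a w in auto)
  show ?thesis unfolding T_lt_word[OF A w] ce m by simp
qed

lemma microstates_moments:
  assumes a: "\<And>i. i \<in> {1..N} \<Longrightarrow> has_type p k l (a i)" and A: "A \<in> microstates \<phi> d p k l N a R n r \<epsilon>"
  shows "A \<in> space leb"
    and "1 \<le> length w \<Longrightarrow> length w \<le> r \<Longrightarrow> fst ` set w \<subseteq> {1..N} \<Longrightarrow> cmod (T \<kappa> (map letter_of w) A - tr \<kappa> (wv a (map letter_of w))) \<le> \<epsilon>"
proof -
  show sp: "A \<in> space leb" using A unfolding space_leb microstates_def by auto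
  assume w: "1 \<le> length w" "length w \<le> r" "fst ` set w \<subseteq> {1..N}"
  then have ne: "w \<noteq> []" by auto
  have "norm (mat_cond_exp \<phi> d p n (mat_word_eval n A w) - cond_exp \<phi> d p (word_eval a w)) \<le> \<epsilon>"
    using A w unfolding microstates_def by auto
  moreover have "mat_cond_exp \<phi> d p n (mat_word_eval n A w) - cond_exp \<phi> d p (word_eval a w) =
    (T False (map letter_of w) A - tr False (wv a (map letter_of w))) *\<^sub>C pp False + (T True (map letter_of w) A - tr True (wv a (map letter_of w))) *\<^sub>C pp True"
    by (rule cond_exp_diff) (use a sp w ne in auto)
  ultimately show "cmod (T \<kappa> (map letter_of w) A - tr \<kappa> (wv a (map letter_of w))) \<le> \<epsilon>"
    using norm_pp(2,3)[where z = "T False (map letter_of w) A - tr False (wv a (map letter_of w))" and z' = "T True (map letter_of w) A - tr True (wv a (map letter_of w))"]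
    by (cases \<kappa>) auto
qed

end

lemma vec_l2_norm_l2: "v \<in> carrier_vec n \<Longrightarrow> vec_l2_norm v = l2 {..<n} (\<lambda>i. vec_index v i)"
  by (auto simp: vec_l2_norm_def L2_set_def)

lemma l2_eq_0: "finite K \<Longrightarrow> l2 K u = 0 \<Longrightarrow> x \<in> K \<Longrightarrow> u x = 0"
  by (simp add: L2_set_eq_0_iff)

lemma bil_bound: "finite K \<Longrightarrow> finite L \<Longrightarrow> cmod (bil K L g u f) \<le> (\<Sum>x\<in>K. \<Sum>y\<in>L. cmod (g x y)) * l2 K u * l2 L f"
proof -
  assume K: "finite K" and L: "finite L"
  have "cmod (bil K L g u f) \<le> (\<Sum>x\<in>K. \<Sum>y\<in>L. cmod (g x y) * (l2 K u * l2 L f))"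
    unfolding bil_def
  proof (intro sum_norm_le)
    fix x y assume x: "x \<in> K" and y: "y \<in> L"
    have "cmod (u x) * cmod (f y) \<le> l2 K u * l2 L f"
      using member_le_L2_set[OF K x, of "\<lambda>x. cmod (u x)"] member_le_L2_set[OF L y, of "\<lambda>x. cmod (f x)"]
      by (intro mult_mono) (auto simp: L2_set_nonneg)
    then have "cmod (g x y) * (cmod (u x) * cmod (f y)) \<le> cmod (g x y) * (l2 K u * l2 L f)" by (rule mult_left_mono) simp
    then show "cmod (u x * g x y * f y) \<le> cmod (g x y) * (l2 K u * l2 L f)" by (simp add: norm_mult mult_ac)
  qed
  then show ?thesis by (simp add: sum_distrib_right mult.assoc)
qed

context rect_blocks begin

lemma mult_vec_entry:
  assumes A: "A \<in> space leb" and i: "i \<in> {1..N}" and f: "f \<in> carrier_vec n" and x: "x < n"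
  shows "vec_index (A i *\<^sub>v f) x = (if x \<in> blk False then \<Sum>y\<in>blk True. Gm i A x y * vec_index f y else 0)"
proof -
  have "vec_index (A i *\<^sub>v f) x = (\<Sum>y\<in>{..<n}. A i $$ (x, y) * vec_index f y)"
    using space_leb_dim[OF A i] f x by (simp add: scalar_prod_def lessThan_atLeast0)
  also have "\<dots> = (if x \<in> blk False then \<Sum>y\<in>blk True. Gm i A x y * vec_index f y else 0)"
  proof (cases "x \<in> blk False")
    case True
    have "(\<Sum>y\<in>{..<n}. A i $$ (x, y) * vec_index f y) = (\<Sum>y\<in>blk True. A i $$ (x, y) * vec_index f y)"
      using blkn[of True] x space_leb_zero[OF A i x] by (intro sum.mono_neutral_right) auto
    then show ?thesis using True by (simp add: Gm_entry del: ent.simps)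
  next
    case False
    then show ?thesis using space_leb_zero[OF A i x] by simp
  qed
  finally show ?thesis .
qed

lemma l2_mult_vec:
  assumes A: "A \<in> space leb" and i: "i \<in> {1..N}" and f: "f \<in> carrier_vec n"
  shows "vec_l2_norm (A i *\<^sub>v f) = l2 (blk False) (\<lambda>x. \<Sum>y\<in>blk True. Gm i A x y * vec_index f y)"
proof -
  have "A i *\<^sub>v f \<in> carrier_vec n" by (rule mult_mat_vec_carrier[OF space_leb_dim[OF A i] f])
  then have "vec_l2_norm (A i *\<^sub>v f) = l2 {..<n} (\<lambda>x. if x \<in> blk False then \<Sum>y\<in>blk True. Gm i A x y * vec_index f y else 0)"
    unfolding vec_l2_norm_l2[OF \<open>A i *\<^sub>v f \<in> carrier_vec n\<close>] by (intro L2_set_cong) (auto simp: mult_vec_entry[OF A i f])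
  also have "\<dots> = l2 (blk False) (\<lambda>x. \<Sum>y\<in>blk True. Gm i A x y * vec_index f y)"
    unfolding L2_set_def using blkn[of False] by (intro arg_cong[of _ _ sqrt] sum.mono_neutral_cong_right) auto
  finally show ?thesis .
qed

lemma bil_l2_le:
  assumes R: "R \<ge> 0" and b: "\<And>u. cmod (bil (blk False) (blk True) g u f) \<le> R * l2 (blk False) u * l2 (blk True) f"
  shows "l2 (blk False) (\<lambda>x. \<Sum>y\<in>blk True. g x y * f y) \<le> R * l2 (blk True) f"
proof -
  define h where "h x = (\<Sum>y\<in>blk True. g x y * f y)" for x
  have "bil (blk False) (blk True) g (\<lambda>x. cnj (h x)) f = of_real ((l2 (blk False) h)\<^sup>2)"
  proof -
    have "bil (blk False) (blk True) g (\<lambda>x. cnj (h x)) f = (\<Sum>x\<in>blk False. cnj (h x) * h x)"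
      unfolding bil_def h_def[of _, symmetric] by (simp add: h_def sum_distrib_left mult.assoc del: cnj_sum)
    also have "\<dots> = of_real (\<Sum>x\<in>blk False. (cmod (h x))\<^sup>2)"
      by (simp only: of_real_sum complex_norm_square mult.commute[of "cnj _"])
    finally show ?thesis by (simp add: L2_set_def sum_nonneg del: of_real_sum)
  qed
  then have "(l2 (blk False) h)\<^sup>2 \<le> R * l2 (blk False) h * l2 (blk True) f"
    using b[of "\<lambda>x. cnj (h x)"] by (simp add: norm_of_real del: of_real_power)
  then have "l2 (blk False) h * l2 (blk False) h \<le> (R * l2 (blk True) f) * l2 (blk False) h"
    by (simp add: power2_eq_square mult_ac)
  moreover have "0 \<le> R * l2 (blk True) f" using R by (simp add: L2_set_nonneg)
  ultimately have "l2 (blk False) h \<le> R * l2 (blk True) f"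
    by (cases "l2 (blk False) h = 0") (auto dest: mult_right_le_imp_le simp: less_le L2_set_nonneg)
  then show ?thesis by (simp add: h_def[abs_def])
qed

lemma l2_blk_le: "f \<in> carrier_vec n \<Longrightarrow> l2 (blk True) (\<lambda>y. vec_index f y) \<le> vec_l2_norm f"
  unfolding vec_l2_norm_l2 L2_set_def using blkn[of True] by (intro real_sqrt_le_mono sum_mono2) auto

lemma op_norm_vec:
  assumes A: "A \<in> space leb" and i: "i \<in> {1..N}" and R: "R \<ge> 0"
    and b: "\<And>u f. cmod (bil (blk False) (blk True) (Gm i A) u f) \<le> R * l2 (blk False) u * l2 (blk True) f"
    and f: "f \<in> carrier_vec n" "vec_l2_norm f \<le> 1"
  shows "vec_l2_norm (A i *\<^sub>v f) \<le> R"
proof -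
  have "vec_l2_norm (A i *\<^sub>v f) \<le> R * l2 (blk True) (\<lambda>y. vec_index f y)"
    unfolding l2_mult_vec[OF A i f(1)] by (rule bil_l2_le[OF R b])
  also have "\<dots> \<le> R * 1" using R l2_blk_le[OF f(1)] f(2) by (intro mult_left_mono) auto
  finally show ?thesis by simp
qed

lemma op_norm_le_iff:
  assumes A: "A \<in> space leb" and i: "i \<in> {1..N}" and R: "R \<ge> 0"
  shows "mat_op_norm (A i) \<le> R \<longleftrightarrow> (\<forall>u f. cmod (bil (blk False) (blk True) (Gm i A) u f) \<le> R * l2 (blk False) u * l2 (blk True) f)"
proof -
  let ?V = "{f \<in> carrier_vec n. vec_l2_norm f \<le> 1}"
  have dim: "dim_col (A i) = n" using space_leb_dim[OF A i] by auto
  have ne: "?V \<noteq> {}"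
  proof -
    have "0\<^sub>v n \<in> ?V" by (simp add: vec_l2_norm_def)
    then show ?thesis by blast
  qed
  have bdd: "bdd_above ((\<lambda>f. vec_l2_norm (A i *\<^sub>v f)) ` ?V)"
  proof (rule bdd_aboveI2)
    fix f assume "f \<in> ?V"
    then show "vec_l2_norm (A i *\<^sub>v f) \<le> (\<Sum>x\<in>blk False. \<Sum>y\<in>blk True. cmod (Gm i A x y))"
      by (intro op_norm_vec[OF A i _ bil_bound]) (auto intro!: sum_nonneg)
  qed
  have "mat_op_norm (A i) \<le> R \<longleftrightarrow> (\<forall>f\<in>?V. vec_l2_norm (A i *\<^sub>v f) \<le> R)"
    unfolding mat_op_norm_def dim by (rule cSUP_le_iff[OF ne bdd])
  also have "\<dots> \<longleftrightarrow> (\<forall>u f. cmod (bil (blk False) (blk True) (Gm i A) u f) \<le> R * l2 (blk False) u * l2 (blk True) f)"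
  proof (intro iffI allI ballI)
    fix f assume b: "\<forall>u f. cmod (bil (blk False) (blk True) (Gm i A) u f) \<le> R * l2 (blk False) u * l2 (blk True) f" and "f \<in> ?V"
    then show "vec_l2_norm (A i *\<^sub>v f) \<le> R" by (intro op_norm_vec[OF A i R]) auto
  next
    fix u f :: "nat \<Rightarrow> complex" assume b: "\<forall>f\<in>?V. vec_l2_norm (A i *\<^sub>v f) \<le> R"
    show "cmod (bil (blk False) (blk True) (Gm i A) u f) \<le> R * l2 (blk False) u * l2 (blk True) f"
    proof (cases "l2 (blk True) f = 0")
      case True
      then have "f y = 0" if "y \<in> blk True" for y using l2_eq_0[of "blk True" f y] that by simp
      then show ?thesis using R by (simp add: bil_def L2_set_nonneg)
    next
      case False
      then have pos: "l2 (blk True) f > 0" by (simp add: less_le L2_set_nonneg)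
      define g where "g = Matrix.vec n (\<lambda>y. if y \<in> blk True then f y / of_real (l2 (blk True) f) else 0)"
      have g: "g \<in> carrier_vec n" by (simp add: g_def)
      have gy: "vec_index g y = f y / of_real (l2 (blk True) f)" if "y \<in> blk True" for y
        using that blkn[of True] by (auto simp: g_def)
      have "vec_l2_norm g = l2 (blk True) (\<lambda>y. vec_index g y)"
        unfolding vec_l2_norm_l2[OF g] L2_set_def using blkn[of True]
        by (intro arg_cong[of _ _ sqrt] sum.mono_neutral_right) (auto simp: g_def)
      also have "\<dots> = L2_set (\<lambda>y. (1 / l2 (blk True) f) * cmod (f y)) (blk True)"
        using pos by (intro L2_set_cong) (auto simp: gy norm_divide)
      also have "\<dots> = 1" using pos by (subst L2_set_right_distrib[symmetric]) auto
      finally have "g \<in> ?V" using g by simp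
      then have "l2 (blk False) (\<lambda>x. \<Sum>y\<in>blk True. Gm i A x y * vec_index g y) \<le> R"
        using b l2_mult_vec[OF A i g] by auto
      moreover have "bil (blk False) (blk True) (Gm i A) u f =
          of_real (l2 (blk True) f) * (\<Sum>x\<in>blk False. u x * (\<Sum>y\<in>blk True. Gm i A x y * vec_index g y))"
        unfolding bil_def sum_distrib_left using pos by (intro sum.cong refl) (simp add: gy)
      moreover have "cmod (\<Sum>x\<in>blk False. u x * (\<Sum>y\<in>blk True. Gm i A x y * vec_index g y)) \<le>
          l2 (blk False) u * l2 (blk False) (\<lambda>x. \<Sum>y\<in>blk True. Gm i A x y * vec_index g y)"
        by (rule order_trans[OF sum_norm_le[OF order_refl]])
          (use L2_set_mult_ineq[of "\<lambda>x. cmod (u x)" "\<lambda>x. cmod (\<Sum>y\<in>blk True. Gm i A x y * vec_index g y)" "blk False"] in \<open>simp add: norm_mult del: ent.simps\<close>)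
      ultimately have "cmod (bil (blk False) (blk True) (Gm i A) u f) \<le> l2 (blk True) f * (l2 (blk False) u * R)"
        by (simp add: norm_mult L2_set_nonneg) (meson L2_set_nonneg mult_left_mono order_trans)
      then show ?thesis by (simp add: mult_ac)
    qed
  qed
  finally show ?thesis .
qed

lemma Gm_measurable [measurable]: "i \<in> {1..N} \<Longrightarrow> x \<in> blk False \<Longrightarrow> y \<in> blk True \<Longrightarrow> (\<lambda>A. Gm i A x y) \<in> borel_measurable leb"
proof -
  assume "i \<in> {1..N}" "x \<in> blk False" "y \<in> blk True"
  then have [measurable]: "coord (i, (x, y), r) \<in> borel_measurable leb" for r by (intro coord_measurable) (auto simp: gindex_def)
  have "(\<lambda>A. of_real (coord (i, (x, y), False) A) + \<i> * of_real (coord (i, (x, y), True) A)) \<in> borel_measurable leb" by measurable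
  moreover have "Gm i A x y = of_real (coord (i, (x, y), False) A) + \<i> * of_real (coord (i, (x, y), True) A)" for A
    by (simp add: complex_eq_iff)
  ultimately show ?thesis by presburger
qed

lemma op_norm_measurable:
  assumes i: "i \<in> {1..N}" and R: "R \<ge> 0"
  shows "{A \<in> space leb. mat_op_norm (A i) \<le> R} \<in> sets leb"
proof -
  let ?g = "\<lambda>A uf. R * l2 (blk False) (fst uf) * l2 (blk True) (snd uf) - cmod (bil (blk False) (blk True) (Gm i A) (fst uf) (snd uf))"
  obtain D :: "((nat \<Rightarrow> complex) \<times> (nat \<Rightarrow> complex)) set" where D: "countable D" "\<And>X. open X \<Longrightarrow> X \<noteq> {} \<Longrightarrow> \<exists>d\<in>D. d \<in> X"
    by (rule countable_dense_setE) blast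
  have cont: "continuous_on UNIV (?g A)" for A
    unfolding bil_def L2_set_def
    by (intro continuous_intros continuous_on_product_coordinates[THEN continuous_on_compose2, where s = UNIV]) auto
  have "(\<forall>u f. cmod (bil (blk False) (blk True) (Gm i A) u f) \<le> R * l2 (blk False) u * l2 (blk True) f) \<longleftrightarrow> (\<forall>d\<in>D. 0 \<le> ?g A d)" for A
  proof
    assume d: "\<forall>d\<in>D. 0 \<le> ?g A d"
    have o: "open (?g A -` {..<0})" by (rule open_vimage[OF open_lessThan cont])
    show "\<forall>u f. cmod (bil (blk False) (blk True) (Gm i A) u f) \<le> R * l2 (blk False) u * l2 (blk True) f"
    proof (rule ccontr)
      assume "\<not> ?thesis"
      then obtain u f where "cmod (bil (blk False) (blk True) (Gm i A) u f) > R * l2 (blk False) u * l2 (blk True) f" by (auto simp: not_le)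
      then have "(u, f) \<in> ?g A -` {..<0}" by simp
      then obtain d' where "d' \<in> D" "d' \<in> ?g A -` {..<0}" using D(2)[OF o] by blast
      then show False using d by auto
    qed
  qed auto
  then have "{A \<in> space leb. mat_op_norm (A i) \<le> R} = {A \<in> space leb. \<forall>d\<in>D. 0 \<le> ?g A d}"
    using op_norm_le_iff[OF _ i R] by blast
  also have "\<dots> \<in> sets leb"
  proof (rule sets.sets_Collect_countable_All'[OF _ D(1)])
    fix d
    have [measurable]: "(\<lambda>A. bil (blk False) (blk True) (Gm i A) (fst d) (snd d)) \<in> borel_measurable leb"
      unfolding bil_def using i by (intro borel_measurable_sum borel_measurable_times Gm_measurable) auto
    show "{A \<in> space leb. 0 \<le> ?g A d} \<in> sets leb" by measurable
  qed
  finally show ?thesis .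
qed

lemma T_measurable:
  assumes l: "set u \<subseteq> letters N" and N: "N \<ge> 1"
  shows "T \<kappa> u \<in> borel_measurable leb"
proof -
  have "integrable GM (TP [(\<kappa>, u)])" by (rule integrable_TP) (use l N in auto)
  then have "TP [(\<kappa>, u)] \<in> borel_measurable GM" by (rule borel_measurable_integrable)
  then have "TP [(\<kappa>, u)] \<in> borel_measurable leb" by (simp add: GM_def)
  moreover have "TP [(\<kappa>, u)] = T \<kappa> u" by (simp add: fun_eq_iff)
  ultimately show ?thesis by simp
qed

lemma set_lt: "fst ` set w \<subseteq> {1..N} \<Longrightarrow> set (map letter_of w) \<subseteq> letters N"
  by (force simp: letter_of_def letters_def)

lemma finite_words: "finite {w :: (nat \<times> bool) list. 1 \<le> length w \<and> length w \<le> r \<and> fst ` set w \<subseteq> {1..N}}"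
  by (rule finite_subset[OF _ finite_lists_length_le[of "{1..N} \<times> (UNIV :: bool set)" r]]) force+

lemma microstates_measurable:
  assumes a: "\<And>i. i \<in> {1..N} \<Longrightarrow> has_type p k l (a i)" and R: "R \<ge> 0" and N: "N \<ge> 1"
  shows "microstates \<phi> d p k l N a R n r \<epsilon> \<in> sets leb"
proof -
  let ?S = "{w :: (nat \<times> bool) list. 1 \<le> length w \<and> length w \<le> r \<and> fst ` set w \<subseteq> {1..N}}"
  let ?D = "\<lambda>\<kappa> w A. T \<kappa> (map letter_of w) A - tr \<kappa> (wv a (map letter_of w))"
  have e: "mat_cond_exp \<phi> d p n (mat_word_eval n A w) - cond_exp \<phi> d p (word_eval a w) = ?D False w A *\<^sub>C pp False + ?D True w A *\<^sub>C pp True"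
    if "A \<in> space leb" "w \<in> ?S" for A w
    by (rule cond_exp_diff) (use a that in auto)
  have "microstates \<phi> d p k l N a R n r \<epsilon> = {A \<in> space leb. \<forall>i\<in>{1..N}. mat_op_norm (A i) \<le> R} \<inter>
      {A \<in> space leb. \<forall>w\<in>?S. norm (?D False w A *\<^sub>C pp False + ?D True w A *\<^sub>C pp True) \<le> \<epsilon>}"
    unfolding microstates_def space_leb[symmetric] using e by auto
  also have "\<dots> \<in> sets leb"
  proof (intro sets.Int sets.sets_Collect_finite_All op_norm_measurable R)
    fix w assume "w \<in> ?S"
    then have [measurable]: "T \<kappa> (map letter_of w) \<in> borel_measurable leb" for \<kappa>
      using N by (intro T_measurable set_lt) auto
    have [measurable]: "?D \<kappa> w \<in> borel_measurable leb" for \<kappa> by measurable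
    have eq: "z *\<^sub>C x = Re z *\<^sub>R x + Im z *\<^sub>R (\<i> *\<^sub>C x)" for z and x :: 'a
    proof -
      have "z *\<^sub>C x = (of_real (Re z) + of_real (Im z) * \<i>) *\<^sub>C x" using complex_eq[of z] by (simp add: mult.commute)
      then show ?thesis by (simp add: scaleC_add_left scaleC_of_real scaleC_scaleC[symmetric])
    qed
    have "continuous_on UNIV (\<lambda>z. norm (fst z *\<^sub>C pp False + snd z *\<^sub>C pp True))"
      unfolding eq[of "fst _"] eq[of "snd _"] by (intro continuous_intros)
    then have "(\<lambda>A. norm (?D False w A *\<^sub>C pp False + ?D True w A *\<^sub>C pp True)) \<in> borel_measurable leb"
      by (rule borel_measurable_continuous_Pair[rotated 2]) measurable
    then show "{A \<in> space leb. norm (?D False w A *\<^sub>C pp False + ?D True w A *\<^sub>C pp True) \<le> \<epsilon>} \<in> sets leb" by measurable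
  qed (use finite_words in auto)
  finally show ?thesis .
qed

lemma microstatesI:
  assumes a: "\<And>i. i \<in> {1..N} \<Longrightarrow> has_type p k l (a i)" and A: "A \<in> space leb" and R: "R \<ge> 0" and b: "bounded_at R A"
    and m: "\<And>w \<kappa>. 1 \<le> length w \<Longrightarrow> length w \<le> r \<Longrightarrow> fst ` set w \<subseteq> {1..N} \<Longrightarrow> cmod (T \<kappa> (map letter_of w) A - tr \<kappa> (wv a (map letter_of w))) \<le> \<epsilon> / 2"
  shows "A \<in> microstates \<phi> d p k l N a R n r \<epsilon>"
  unfolding microstates_def space_leb[symmetric]
proof (intro CollectI conjI A ballI allI impI)
  show "mat_op_norm (A i) \<le> R" if "i \<in> {1..N}" for i
    using b that unfolding op_norm_le_iff[OF A that R] bounded_at_def by blast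
  fix w :: "(nat \<times> bool) list" assume w: "1 \<le> length w \<and> length w \<le> r \<and> fst ` set w \<subseteq> {1..N}"
  have e: "mat_cond_exp \<phi> d p n (mat_word_eval n A w) - cond_exp \<phi> d p (word_eval a w) =
    (T False (map letter_of w) A - tr False (wv a (map letter_of w))) *\<^sub>C pp False + (T True (map letter_of w) A - tr True (wv a (map letter_of w))) *\<^sub>C pp True"
    by (rule cond_exp_diff) (use a w A in auto)
  show "norm (mat_cond_exp \<phi> d p n (mat_word_eval n A w) - cond_exp \<phi> d p (word_eval a w)) \<le> \<epsilon>"
    unfolding e by (rule order_trans[OF norm_pp(1)]) (use m[of w False] m[of w True] w in auto)
qed

lemma Q_T: "Q A = (\<Sum>i\<in>{1..N}. real (card (blk False)) * Re (T False [Ge i False, Ge i True] A) / v i)"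
proof -
  have Tii: "q False * T False [Ge i False, Ge i True] A = of_real (\<Sum>x\<in>blk False. \<Sum>y\<in>blk True. (cmod (Gm i A x y))\<^sup>2)" if "i \<in> {1..N}" for i
  proof -
    have "W [Ge i False, Ge i True] x x A = (\<Sum>y\<in>blk True. Gm i A x y * cnj (Gm i A x y))" if x: "x \<in> blk False" for x
    proof -
      have "W [Ge i False, Ge i True] x x A = (\<Sum>y\<in>{..<n}. ent (Ge i False) x y A * ent (Ge i True) y x A)"
      proof -
        have "W [Ge i True] y x A = ent (Ge i True) y x A" for y
        proof -
          have "W [Ge i True] y x A = (\<Sum>z\<in>{..<n}. if z = x then ent (Ge i True) y z A else 0)"
            unfolding W.simps by (intro sum.cong) auto
          then show ?thesis using x blkn[of False] by auto
        qed
        then show ?thesis by (simp only: W.simps(2)[of "Ge i False"])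
      qed
      also have "\<dots> = (\<Sum>y\<in>blk True. ent (Ge i False) x y A * ent (Ge i True) y x A)"
        using blkn[of True] by (intro sum.mono_neutral_right) auto
      also have "\<dots> = (\<Sum>y\<in>blk True. Gm i A x y * cnj (Gm i A x y))"
        using x by (intro sum.cong refl) (simp add: ent_Gm del: ent.simps)
      finally show ?thesis .
    qed
    then have "q False * T False [Ge i False, Ge i True] A = (\<Sum>x\<in>blk False. \<Sum>y\<in>blk True. Gm i A x y * cnj (Gm i A x y))"
      by (simp add: T_def del: W.simps)
    then show ?thesis by (simp only: of_real_sum complex_norm_square)
  qed
  have "Q A = (\<Sum>i\<in>{1..N}. (\<Sum>x\<in>blk False. \<Sum>y\<in>blk True. (cmod (Gm i A x y))\<^sup>2) / v i)"
    unfolding Q_def gindex_def sum_Times by (simp add: UNIV_bool cmod_power2 sum_divide_distrib add_divide_distrib add.commute)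
  also have "\<dots> = (\<Sum>i\<in>{1..N}. real (card (blk False)) * Re (T False [Ge i False, Ge i True] A) / v i)"
  proof (intro sum.cong refl)
    fix i assume "i \<in> {1..N}"
    from arg_cong[OF Tii[OF this], of Re] show "(\<Sum>x\<in>blk False. \<Sum>y\<in>blk True. (cmod (Gm i A x y))\<^sup>2) / v i = real (card (blk False)) * Re (T False [Ge i False, Ge i True] A) / v i"
      by simp
  qed
  finally show ?thesis .
qed

lemma sum_dist: "(\<Sum>\<alpha>\<in>gindex N blk. (coord \<alpha> A - coord \<alpha> B)\<^sup>2 / v (fst \<alpha>)) = (\<Sum>i\<in>{1..N}. (dist_at i A B)\<^sup>2 / v i)"
  unfolding gindex_def sum_Times dist_at_def
  by (simp add: UNIV_bool cmod_power2 sum_divide_distrib add_divide_distrib add.commute sum_nonneg)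

end

context rect begin

lemma projection_words:
  assumes a: "\<And>i. i \<in> {1..N} \<Longrightarrow> has_type p k l (a i)" and b: "\<And>i. i \<in> {1..N} \<Longrightarrow> has_type p k l (b i)"
    and eq: "\<And>\<kappa> w. w \<noteq> [] \<Longrightarrow> fst ` set w \<subseteq> {1..N} \<Longrightarrow> tr \<kappa> (wv a (map letter_of w)) = tr \<kappa> (wv b (map letter_of w))"
    and u: "fst ` set u \<subseteq> {1..N}" and w: "set w \<subseteq> letters N"
  shows "tr \<kappa> (wv a (map letter_of u @ w)) = tr \<kappa> (wv b (map letter_of u @ w))"
  using u w
proof (induction w arbitrary: u)
  case Nil
  then show ?case using eq[of u] by (cases "u = []") auto
next
  case (Cons e w)
  show ?case
  proof (cases e)
    case (Ge i s)
    have "i \<in> {1..N}" using Cons.prems(2) Ge by (auto simp: letters_def)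
    then show ?thesis using Cons.IH[of "u @ [(i, s)]"] Cons.prems Ge by (simp add: letter_of_def mult.assoc)
  next
    case (Pr \<kappa>')
    show ?thesis
    proof (cases u rule: rev_cases)
      case Nil
      then show ?thesis using Cons.IH[of "[]"] Cons.prems Pr by (cases "\<kappa> = \<kappa>'") auto
    next
      case (snoc u' f)
      obtain i s where f: "f = (i, s)" by (cases f)
      have i: "i \<in> {1..N}" using Cons.prems snoc f by auto
      have m: "val c (Ge i s) * (pp \<kappa>' * x) = (if \<kappa>' = s then 0 else val c (Ge i s) * x)" if "has_type p k l (c i)" for c x
        unfolding mult.assoc[symmetric] type_mult(2)[where a = c and i = i, OF that] by simp
      show ?thesis
        using Cons.IH[of u] Cons.prems m[where c = a, OF a[OF i]] m[where c = b, OF b[OF i]]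
        unfolding Pr snoc f by (simp add: letter_of_def mult.assoc del: val_simps(2))
    qed
  qed
qed

end

context rect_blocks begin

definition Phi :: "(bool \<times> letter list) list \<Rightarrow> complex" where "Phi L = (\<integral>A. TP L A \<partial>GM)"

lemma T_Nil [simp]: "T \<kappa> [] A = 1"
  by (simp add: T_def)

lemma T_Pr: "T \<kappa> (Pr \<kappa>' # u) A = (if \<kappa> = \<kappa>' then T \<kappa> u A else 0)"
proof -
  have "W (Pr \<kappa>' # u) x x A = (if \<kappa> = \<kappa>' then W u x x A else 0)" if "x \<in> blk \<kappa>" for x
  proof -
    have "x \<in> {..<n}" using that blkn by blast
    moreover have "x \<in> blk \<kappa>' \<longleftrightarrow> \<kappa> = \<kappa>'" using that dj by (cases \<kappa>; cases \<kappa>') auto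
    ultimately show ?thesis by (simp add: W_Pr del: W.simps)
  qed
  then show ?thesis by (auto simp: T_def simp del: W.simps)
qed

lemma T_off: "T (\<not> s) (Ge i s # u) A = 0"
proof -
  have "x \<notin> blk s" if "x \<in> blk (\<not> s)" for x using that dj by (cases s) auto
  then show ?thesis by (simp add: T_def)
qed

lemma Phi_Nil: "Phi [] = 1"
  by (simp add: Phi_def prob_space)

lemma Phi_emp: "Phi ((\<kappa>, []) # L) = Phi L"
  by (simp add: Phi_def)

lemma Phi_Pr: "Phi ((\<kappa>, Pr \<kappa>' # u) # L) = (if \<kappa> = \<kappa>' then Phi ((\<kappa>, u) # L) else 0)"
  by (simp add: Phi_def T_Pr)

lemma Phi_off: "Phi ((\<not> s, Ge i s # u) # L) = 0"
  by (simp add: Phi_def T_off)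

lemma integral_sum_if:
  fixes F :: "nat \<Rightarrow> _ \<Rightarrow> complex"
  assumes "\<And>j. j < J \<Longrightarrow> P j \<Longrightarrow> integrable GM (F j)"
  shows "integrable GM (\<lambda>A. \<Sum>j<J. if P j then F j A else 0)"
    and "(\<integral>A. (\<Sum>j<J. if P j then F j A else 0) \<partial>GM) = (\<Sum>j<J. if P j then \<integral>A. F j A \<partial>GM else 0)"
proof -
  have I: "integrable GM (\<lambda>A. if P j then F j A else 0)" if "j < J" for j
    using assms[OF that] by (intro integrable_If)
  then show "integrable GM (\<lambda>A. \<Sum>j<J. if P j then F j A else 0)" by (intro Bochner_Integration.integrable_sum) auto
  show "(\<integral>A. (\<Sum>j<J. if P j then F j A else 0) \<partial>GM) = (\<Sum>j<J. if P j then \<integral>A. F j A \<partial>GM else 0)"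
    using I by (subst Bochner_Integration.integral_sum) (auto intro!: sum.cong)
qed

lemma Phi_loop:
  assumes v: "lvalid N ((s, u) # L)" and i: "i \<in> {1..N}"
  shows "Phi ((s, Ge i s # u) # L) =
        (of_real (v i) * q (\<not> s)) * (\<Sum>j<length u. if u ! j = Ge i (\<not> s) then Phi ((\<not> s, take j u) # (s, drop (Suc j) u) # L) else 0) +
        (\<Sum>m<length L. \<Sum>j<length (snd (L ! m)). if snd (L ! m) ! j = Ge i (\<not> s) then
          (of_real (v i) * q (\<not> s) / (q s * q (fst (L ! m)))) * Phi ((\<not> s, u @ Pr s # drop (Suc j) (snd (L ! m)) @ Pr (fst (L ! m)) # take j (snd (L ! m))) # take m L @ drop (Suc m) L)
          else 0)"
proof -
  have N: "N \<ge> 1" using i by auto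
  have u: "set u \<subseteq> letters N" "\<forall>(\<kappa>, u)\<in>set L. set u \<subseteq> letters N" using v by (auto simp: lvalid_def)
  have Pl: "Pr \<kappa> \<in> letters N" for \<kappa> by (simp add: letters_def)
  have 1: "(\<integral>A. split_sum i s u L A \<partial>GM) = (\<Sum>j<length u. if u ! j = Ge i (\<not> s) then Phi ((\<not> s, take j u) # (s, drop (Suc j) u) # L) else 0)"
  proof -
    have "integrable GM (TP ((\<not> s, take j u) # (s, drop (Suc j) u) # L))" for j
      by (rule integrable_TP) (use u N in \<open>auto dest: in_set_takeD in_set_dropD\<close>)
    then show ?thesis unfolding split_sum_def Phi_def
      by (rule integral_sum_if(2))
  qed
  have 2: "(\<integral>A. merge_sum i s u L A \<partial>GM) = (\<Sum>m<length L. \<Sum>j<length (snd (L ! m)). if snd (L ! m) ! j = Ge i (\<not> s) then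
       Phi ((\<not> s, u @ Pr s # drop (Suc j) (snd (L ! m)) @ Pr (fst (L ! m)) # take j (snd (L ! m))) # take m L @ drop (Suc m) L) / q (fst (L ! m)) else 0)"
  proof -
    have I: "integrable GM (TP ((\<not> s, u @ Pr s # drop (Suc j) (snd (L ! m)) @ Pr (fst (L ! m)) # take j (snd (L ! m))) # take m L @ drop (Suc m) L))"
      if "m < length L" for m j
    proof -
      have "set (snd (L ! m)) \<subseteq> letters N" using u(2) nth_mem[OF that] by (auto simp: case_prod_unfold)
      then show ?thesis
        by (intro integrable_TP N) (use u Pl in \<open>auto dest!: in_set_takeD in_set_dropD\<close>)
    qed
    define F where "F m j A = TP ((\<not> s, u @ Pr s # drop (Suc j) (snd (L ! m)) @ Pr (fst (L ! m)) # take j (snd (L ! m))) # take m L @ drop (Suc m) L) A / q (fst (L ! m))" for m j A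
    have IF: "integrable GM (F m j)" if "m < length L" for m j
      unfolding F_def[abs_def] using I[OF that] by (rule integrable_divide)
    have FE: "(\<integral>A. F m j A \<partial>GM) = Phi ((\<not> s, u @ Pr s # drop (Suc j) (snd (L ! m)) @ Pr (fst (L ! m)) # take j (snd (L ! m))) # take m L @ drop (Suc m) L) / q (fst (L ! m))" for m j
      unfolding F_def Phi_def by (rule integral_divide_zero)
    have "(\<integral>A. merge_sum i s u L A \<partial>GM) = (\<Sum>m<length L. \<integral>A. (\<Sum>j<length (snd (L ! m)). if snd (L ! m) ! j = Ge i (\<not> s) then F m j A else 0) \<partial>GM)"
      unfolding merge_sum_def F_def[symmetric]
      by (rule Bochner_Integration.integral_sum) (auto intro!: integral_sum_if(1) IF)
    also have "\<dots> = (\<Sum>m<length L. \<Sum>j<length (snd (L ! m)). if snd (L ! m) ! j = Ge i (\<not> s) then \<integral>A. F m j A \<partial>GM else 0)"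
      by (intro sum.cong refl integral_sum_if(2) IF) auto
    finally show ?thesis unfolding FE .
  qed
  have 3: "x * (\<Sum>m<length L. \<Sum>j<length (snd (L ! m)). if P m j then F m j / q (fst (L ! m)) else 0) =
     (\<Sum>m<length L. \<Sum>j<length (snd (L ! m)). if P m j then x / q (fst (L ! m)) * F m j else 0)" for x :: complex and P F
    unfolding sum_distrib_left by (intro sum.cong refl) simp
  show ?thesis unfolding Phi_def[of "(s, Ge i s # u) # L"] loop_equation[OF u i] 1 2 3 by (simp cong: if_cong)
qed

definition dev :: "bool \<Rightarrow> letter list \<Rightarrow> complex \<Rightarrow> real" where
  "dev \<kappa> u z = Re (Phi [(\<kappa>, u), (\<kappa>, rev (map adjl u))] - cnj z * Phi [(\<kappa>, u)] - z * Phi [(\<kappa>, rev (map adjl u))] + z * cnj z)"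

lemma adjl_letters: "set u \<subseteq> letters N \<Longrightarrow> set (rev (map adjl u)) \<subseteq> letters N"
  by (auto simp: letters_def subset_iff)

lemma cnj_T: "set u \<subseteq> letters N \<Longrightarrow> cnj (T \<kappa> u A) = T \<kappa> (rev (map adjl u)) A"
  unfolding T_def using blkn by (auto simp: subset_iff intro!: sum.cong arg_cong2[of _ _ _ _ "(/)"] cnj_W simp del: W.simps)

lemma prob_dev:
  assumes u: "set u \<subseteq> letters N" and N: "N \<ge> 1" and \<delta>: "\<delta> > 0"
  shows "measure GM {A \<in> space leb. \<delta> < cmod (T \<kappa> u A - z)} \<le> dev \<kappa> u z / \<delta>\<^sup>2"
proof -
  let ?u = "rev (map adjl u)"
  let ?F = "\<lambda>A. T \<kappa> u A * T \<kappa> ?u A - cnj z * T \<kappa> u A - z * T \<kappa> ?u A + z * cnj z"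
  have i1: "integrable GM (\<lambda>A. T \<kappa> u A * T \<kappa> ?u A)" "integrable GM (T \<kappa> u)" "integrable GM (T \<kappa> ?u)"
    using integrable_TP[of "[(\<kappa>, u), (\<kappa>, ?u)]"] integrable_TP[of "[(\<kappa>, u)]"] integrable_TP[of "[(\<kappa>, ?u)]"] u adjl_letters[OF u] N
    by (simp_all add: TP_def[abs_def])
  have I: "integrable GM ?F"
    using i1 by (intro Bochner_Integration.integrable_add Bochner_Integration.integrable_diff integrable_mult_right) auto
  have e: "?F A = of_real ((cmod (T \<kappa> u A - z))\<^sup>2)" for A
    unfolding complex_norm_square by (simp add: cnj_T[OF u] algebra_simps)
  have "integral\<^sup>L GM ?F = Phi [(\<kappa>, u), (\<kappa>, ?u)] - cnj z * Phi [(\<kappa>, u)] - z * Phi [(\<kappa>, ?u)] + z * cnj z"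
    using i1 by (simp add: Phi_def prob_space)
  then have "complex_of_real (\<integral>A. (cmod (T \<kappa> u A - z))\<^sup>2 \<partial>GM) = Phi [(\<kappa>, u), (\<kappa>, ?u)] - cnj z * Phi [(\<kappa>, u)] - z * Phi [(\<kappa>, ?u)] + z * cnj z"
    unfolding e by (simp del: of_real_power)
  from arg_cong[OF this, of Re] have E: "(\<integral>A. (cmod (T \<kappa> u A - z))\<^sup>2 \<partial>GM) = dev \<kappa> u z"
    unfolding dev_def by (simp only: Re_complex_of_real)
  have I2: "integrable GM (\<lambda>A. (cmod (T \<kappa> u A - z))\<^sup>2)"
    using integrable_Re[OF I] unfolding e by (simp del: of_real_power)
  have "{A \<in> space leb. \<delta> < cmod (T \<kappa> u A - z)} \<subseteq> {A \<in> space GM. \<delta>\<^sup>2 \<le> (cmod (T \<kappa> u A - z))\<^sup>2}"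
    using \<delta> by (auto simp: GM_def intro: power_mono)
  moreover have "{A \<in> space GM. \<delta>\<^sup>2 \<le> (cmod (T \<kappa> u A - z))\<^sup>2} \<in> sets GM"
    using borel_measurable_integrable[OF I2] by measurable
  ultimately have "measure GM {A \<in> space leb. \<delta> < cmod (T \<kappa> u A - z)} \<le> measure GM {A \<in> space GM. \<delta>\<^sup>2 \<le> (cmod (T \<kappa> u A - z))\<^sup>2}"
    by (rule finite_measure_mono)
  also have "\<dots> \<le> (\<integral>A. (cmod (T \<kappa> u A - z))\<^sup>2 \<partial>GM) / \<delta>\<^sup>2"
    by (rule integral_Markov_inequality_measure[OF I2, where A = "space GM"]) (use \<delta> in auto)
  finally show ?thesis unfolding E .
qed

lemma space_GM: "space GM = space leb" and sets_GM [simp]: "sets GM = sets leb"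
  by (simp_all add: GM_def)

lemma microstates_prob:
  assumes b: "\<And>i. i \<in> {1..N} \<Longrightarrow> has_type p k l (b i)" and N: "N \<ge> 1" and cle: "card (blk False) \<le> card (blk True)"
    and R: "R \<ge> 0" and t: "\<And>i. i \<in> {1..N} \<Longrightarrow> t i \<ge> 0 \<and> 16 / 7 * t i \<le> R" and \<epsilon>: "\<epsilon> > 0"
  shows "1 - (\<Sum>i\<in>{1..N}. exp (120 * real (card (blk True)) - (t i)\<^sup>2 / (4 * v i)))
      - (\<Sum>w\<in>{w. 1 \<le> length w \<and> length w \<le> r \<and> fst ` set w \<subseteq> {1..N}}. \<Sum>\<kappa>\<in>UNIV. dev \<kappa> (map letter_of w) (tr \<kappa> (wv b (map letter_of w))) / (\<epsilon> / 2)\<^sup>2)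
    \<le> measure GM (microstates \<phi> d p k l N b R n r \<epsilon>)"
proof -
  let ?S = "{w :: (nat \<times> bool) list. 1 \<le> length w \<and> length w \<le> r \<and> fst ` set w \<subseteq> {1..N}}"
  let ?t = "\<lambda>\<kappa> w. tr \<kappa> (wv b (map letter_of w))"
  let ?M = "microstates \<phi> d p k l N b R n r \<epsilon>"
  let ?B = "\<lambda>i. {A \<in> space leb. \<exists>u\<in>net (blk False). \<exists>f\<in>net (blk True). Re (bil (blk False) (blk True) (Gm i A) u f) \<ge> t i}"
  let ?D = "\<lambda>w \<kappa>. {A \<in> space leb. \<epsilon> / 2 < cmod (T \<kappa> (map letter_of w) A - ?t \<kappa> w)}"
  have Mm: "?M \<in> sets leb" by (rule microstates_measurable) (use b R N in auto)
  have Bm: "?B i \<in> sets leb" if i: "i \<in> {1..N}" for i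
  proof -
    have "(\<lambda>A. Re (bil (blk False) (blk True) (Gm i A) u f)) \<in> borel_measurable leb" for u f
      using bil_measurable[OF i, of u f] by (simp add: GM_def)
    then show ?thesis
      by (intro sets.sets_Collect_finite_Ex finite_net) auto
  qed
  have Dm: "?D w \<kappa> \<in> sets leb" if "w \<in> ?S" for w \<kappa>
  proof -
    have [measurable]: "T \<kappa> (map letter_of w) \<in> borel_measurable leb" using that N by (intro T_measurable set_lt) auto
    show ?thesis by measurable
  qed
  have cover: "space leb \<subseteq> ?M \<union> ((\<Union>i\<in>{1..N}. ?B i) \<union> (\<Union>w\<in>?S. \<Union>\<kappa>\<in>UNIV. ?D w \<kappa>))"
  proof
    fix A assume A: "A \<in> space leb"
    show "A \<in> ?M \<union> ((\<Union>i\<in>{1..N}. ?B i) \<union> (\<Union>w\<in>?S. \<Union>\<kappa>\<in>UNIV. ?D w \<kappa>))"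
    proof (rule ccontr)
      assume c: "\<not> ?thesis"
      have "bounded_at R A" unfolding bounded_at_def
      proof (intro ballI allI)
        fix i u f assume i: "i \<in> {1..N}"
        have "Re (bil (blk False) (blk True) (Gm i A) u f) \<le> t i" if "u \<in> net (blk False)" "f \<in> net (blk True)" for u f
        proof (rule ccontr)
          assume "\<not> ?thesis"
          then have "t i \<le> Re (bil (blk False) (blk True) (Gm i A) u f)" by linarith
          then have "A \<in> ?B i" using A that by (intro CollectI conjI bexI[of _ u] bexI[of _ f]) auto
          then show False using c i by blast
        qed
        then have "cmod (bil (blk False) (blk True) (Gm i A) u f) \<le> 16 / 7 * t i * l2 (blk False) u * l2 (blk True) f"
          by (intro bil_net) (use t[OF i] blk_ne in auto)
        also have "\<dots> \<le> R * l2 (blk False) u * l2 (blk True) f"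
          using t[OF i] by (intro mult_right_mono) (auto simp: L2_set_nonneg)
        finally show "cmod (bil (blk False) (blk True) (Gm i A) u f) \<le> R * l2 (blk False) u * l2 (blk True) f" .
      qed
      moreover have "cmod (T \<kappa> (map letter_of w) A - ?t \<kappa> w) \<le> \<epsilon> / 2" if "1 \<le> length w" "length w \<le> r" "fst ` set w \<subseteq> {1..N}" for w \<kappa>
      proof -
        have "w \<in> ?S" using that by simp
        then have "A \<notin> ?D w \<kappa>" using c by blast
        then show ?thesis using A by simp
      qed
      ultimately have "A \<in> ?M" using b A R by (intro microstatesI) auto
      then show False using c by blast
    qed
  qed
  have "1 = measure GM (space leb)" using prob_space by (simp add: space_GM)
  also have "\<dots> \<le> measure GM (?M \<union> ((\<Union>i\<in>{1..N}. ?B i) \<union> (\<Union>w\<in>?S. \<Union>\<kappa>\<in>UNIV. ?D w \<kappa>)))"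
    using Mm Bm Dm finite_words by (intro finite_measure_mono cover) (auto intro!: sets.Un sets.finite_UN)
  also have "\<dots> \<le> measure GM ?M + measure GM ((\<Union>i\<in>{1..N}. ?B i) \<union> (\<Union>w\<in>?S. \<Union>\<kappa>\<in>UNIV. ?D w \<kappa>))"
    using Mm Bm Dm finite_words by (intro measure_Un_le) (auto intro!: sets.Un sets.finite_UN)
  also have "measure GM ((\<Union>i\<in>{1..N}. ?B i) \<union> (\<Union>w\<in>?S. \<Union>\<kappa>\<in>UNIV. ?D w \<kappa>)) \<le>
      measure GM (\<Union>i\<in>{1..N}. ?B i) + measure GM (\<Union>w\<in>?S. \<Union>\<kappa>\<in>UNIV. ?D w \<kappa>)"
    using Bm Dm finite_words by (intro measure_Un_le) (auto intro!: sets.Un sets.finite_UN)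
  also have "measure GM (\<Union>i\<in>{1..N}. ?B i) \<le> (\<Sum>i\<in>{1..N}. measure GM (?B i))"
    using Bm by (intro finite_measure_subadditive_finite) auto
  also have "\<dots> \<le> (\<Sum>i\<in>{1..N}. exp (120 * real (card (blk True)) - (t i)\<^sup>2 / (4 * v i)))"
  proof (intro sum_mono)
    fix i assume i: "i \<in> {1..N}"
    show "measure GM (?B i) \<le> exp (120 * real (card (blk True)) - (t i)\<^sup>2 / (4 * v i))"
      using norm_bound[OF i _ cle, of "t i"] t[OF i] by (simp add: emeasure_eq_measure space_GM)
  qed
  also have "measure GM (\<Union>w\<in>?S. \<Union>\<kappa>\<in>UNIV. ?D w \<kappa>) \<le> (\<Sum>w\<in>?S. measure GM (\<Union>\<kappa>\<in>UNIV. ?D w \<kappa>))"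
    using Dm finite_words by (intro finite_measure_subadditive_finite) (auto intro!: sets.finite_UN)
  also have "\<dots> \<le> (\<Sum>w\<in>?S. \<Sum>\<kappa>\<in>UNIV. dev \<kappa> (map letter_of w) (?t \<kappa> w) / (\<epsilon> / 2)\<^sup>2)"
  proof (intro sum_mono)
    fix w assume w: "w \<in> ?S"
    have "measure GM (\<Union>\<kappa>\<in>UNIV. ?D w \<kappa>) \<le> (\<Sum>\<kappa>\<in>UNIV. measure GM (?D w \<kappa>))"
      using Dm[OF w] by (intro finite_measure_subadditive_finite) auto
    also have "\<dots> \<le> (\<Sum>\<kappa>\<in>UNIV. dev \<kappa> (map letter_of w) (?t \<kappa> w) / (\<epsilon> / 2)\<^sup>2)"
      using w N \<epsilon> by (intro sum_mono prob_dev set_lt) auto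
    finally show "measure GM (\<Union>\<kappa>\<in>UNIV. ?D w \<kappa>) \<le> \<dots>" .
  qed
  finally show ?thesis by simp
qed

end

section \<open>Gaussian matrices as microstates\<close>

lemma floor_ratio:
  assumes "\<rho> \<ge> (0 :: real)"
  shows "(\<lambda>n. real (nat \<lfloor>\<rho> * real n\<rfloor>) / real n) \<longlonglongrightarrow> \<rho>"
proof (rule tendsto_sandwich)
  show "\<forall>\<^sub>F n in sequentially. \<rho> - 1 / real n \<le> real (nat \<lfloor>\<rho> * real n\<rfloor>) / real n"
    using eventually_gt_at_top[of 0]
  proof eventually_elim
    case (elim n)
    have "\<rho> * real n - 1 \<le> real (nat \<lfloor>\<rho> * real n\<rfloor>)" by linarith
    then have "(\<rho> * real n - 1) / real n \<le> real (nat \<lfloor>\<rho> * real n\<rfloor>) / real n" by (rule divide_right_mono) simp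
    then show ?case using elim by (simp add: diff_divide_distrib)
  qed
  show "\<forall>\<^sub>F n in sequentially. real (nat \<lfloor>\<rho> * real n\<rfloor>) / real n \<le> \<rho>"
    using eventually_gt_at_top[of 0]
  proof eventually_elim
    case (elim n)
    have "real (nat \<lfloor>\<rho> * real n\<rfloor>) \<le> \<rho> * real n" using assms by (intro of_nat_floor) simp
    then show ?case using elim by (simp add: divide_le_eq)
  qed
  have "(\<lambda>n. \<rho> - 1 / real n) \<longlonglongrightarrow> \<rho> - 0" by (intro tendsto_intros lim_1_over_n)
  then show "(\<lambda>n. \<rho> - 1 / real n) \<longlonglongrightarrow> \<rho>" by simp
qed simp

locale free_mp_family = rect \<phi> d p k l for \<phi> :: "'a::cstar_algebra \<Rightarrow> complex" and d p k l +
  fixes N :: nat and c :: "nat \<Rightarrow> real" and b :: "nat \<Rightarrow> 'a"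
  assumes N1: "N \<ge> 1" and cpos: "\<And>i. i \<in> {1..N} \<Longrightarrow> c i > 0" and le: "weight \<phi> p k \<le> weight \<phi> p l"
    and bt: "\<And>i. i \<in> {1..N} \<Longrightarrow> has_type p k l (b i)"
    and fb: "free_marchenko_pastur \<phi> d p k l N c b"
begin

definition qn :: "nat \<Rightarrow> bool \<Rightarrow> real" where "qn n \<kappa> = real (card (block \<phi> p n (ix \<kappa>)))"

definition vn :: "nat \<Rightarrow> nat \<Rightarrow> real" where "vn n i = c i / qn n True"

abbreviation rb :: "nat \<Rightarrow> bool" where "rb n \<equiv> rect_blocks \<phi> d p k l n N (vn n)"

definition t :: "bool \<Rightarrow> letter list \<Rightarrow> complex" where "t \<kappa> w = tr \<kappa> (wv b w)"

lemma qn_floor: "qn n \<kappa> = real (nat \<lfloor>rho \<kappa> * real n\<rfloor>)"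
  by (simp add: qn_def card_block block_size_def)

lemma rho_le: "rho False \<le> rho True" using le by (simp add: ix_def)

lemma qn_le: "qn n False \<le> qn n True"
  unfolding qn_floor using rho_le by (intro of_nat_mono nat_mono floor_mono mult_right_mono) auto

lemma qn_limit: "(\<lambda>n. qn n \<kappa> / real n) \<longlonglongrightarrow> rho \<kappa>"
  unfolding qn_floor by (rule floor_ratio) (use rho_pos[of \<kappa>] in simp)

lemma qn_at_top: "filterlim (\<lambda>n. qn n \<kappa>) at_top sequentially"
proof -
  have "filterlim (\<lambda>n. qn n \<kappa> / real n * real n) at_top sequentially"
    by (rule filterlim_tendsto_pos_mult_at_top[OF qn_limit rho_pos filterlim_real_sequentially])
  moreover have "\<forall>\<^sub>F n in sequentially. qn n \<kappa> / real n * real n = qn n \<kappa>"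
    using eventually_gt_at_top[of 0] by eventually_elim simp
  ultimately show ?thesis using filterlim_cong[OF refl refl] by fast
qed

lemma ev_rb: "\<forall>\<^sub>F n in sequentially. rb n"
proof -
  have ev: "\<forall>\<^sub>F n in sequentially. qn n \<kappa> > 0" for \<kappa>
    using qn_at_top[of \<kappa>] unfolding filterlim_at_top_dense by blast
  show ?thesis using ev[of False] ev[of True]
  proof eventually_elim
    case (elim n)
    have pos: "qn n \<kappa> > 0" for \<kappa> using elim by (cases \<kappa>) auto
    have ne: "block \<phi> p n (ix \<kappa>) \<noteq> {}" for \<kappa> using pos[of \<kappa>] by (auto simp: qn_def)
    show ?case
      by unfold_locales (use ne elim cpos block_subset block_disjoint in \<open>auto simp: vn_def\<close>)
  qed
qed

lemma qn_pos: "rb n \<Longrightarrow> qn n \<kappa> > 0"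
proof -
  assume "rb n"
  then interpret rect_blocks \<phi> d p k l n N "vn n" .
  show ?thesis unfolding qn_def by (rule neq0_conv[THEN iffD1, OF q_ne, THEN of_nat_0_less_iff[THEN iffD2]])
qed

lemma ratio_limit: "(\<lambda>n. qn n \<kappa> / qn n \<kappa>') \<longlonglongrightarrow> rho \<kappa> / rho \<kappa>'"
proof (rule Lim_transform_eventually)
  show "(\<lambda>n. (qn n \<kappa> / real n) / (qn n \<kappa>' / real n)) \<longlonglongrightarrow> rho \<kappa> / rho \<kappa>'"
    by (intro tendsto_divide qn_limit) (use rho_pos[of \<kappa>'] in simp)
  show "\<forall>\<^sub>F n in sequentially. (qn n \<kappa> / real n) / (qn n \<kappa>' / real n) = qn n \<kappa> / qn n \<kappa>'"
    using eventually_gt_at_top[of 0] by eventually_elim simp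
qed

lemma inverse_limit: "(\<lambda>n. 1 / qn n \<kappa>) \<longlonglongrightarrow> 0"
  by (rule tendsto_divide_0[OF tendsto_const]) (use qn_at_top in \<open>auto intro: filterlim_at_top_imp_at_infinity\<close>)

abbreviation Ph :: "nat \<Rightarrow> (bool \<times> letter list) list \<Rightarrow> complex" where
  "Ph n \<equiv> rect_blocks.Phi \<phi> p k l n N (vn n)"

lemma schwinger_dyson_t: "schwinger_dyson N (\<lambda>i s. of_real (if s then c i * weight \<phi> p k / weight \<phi> p l else c i)) t"
proof -
  obtain B where B: "\<And>i. i \<in> {1..N} \<Longrightarrow> star_subalgebra (B i) \<and> diag_algebra d p \<subseteq> B i \<and> b i \<in> B i" "free_subalgebras \<phi> d p {1..N} B"
    using fb unfolding free_marchenko_pastur_def free_elements_def by blast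
  interpret rf: rect_free \<phi> d p k l N b B "\<lambda>i s. of_real (if s then c i * weight \<phi> p k / weight \<phi> p l else c i)"
    by unfold_locales (use B bt in auto)
  have "rf.alt_recursion"
    by (rule rf.moment_recursion[of c]) (use cpos le fb in \<open>auto simp: free_marchenko_pastur_def\<close>)
  from rf.schwinger_dyson_free[OF this] show ?thesis unfolding t_def[abs_def] .
qed

lemma moment_limit:
  assumes L: "lvalid N L"
  shows "(\<lambda>n. Ph n L) \<longlonglongrightarrow> prod_list (map (\<lambda>(\<kappa>, u). t \<kappa> u) L)"
proof (rule schwinger_dyson_limit[where C = "\<lambda>n i s. of_real (vn n i * qn n (\<not> s))" and B = "\<lambda>n i s \<kappa>. of_real (vn n i * qn n (\<not> s) / (qn n s * qn n \<kappa>))", OF schwinger_dyson_t _ _ _ _ _ _ _ L])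
  show "\<forall>\<^sub>F n in sequentially. Ph n [] = 1"
    using ev_rb by eventually_elim (rule rect_blocks.Phi_Nil)
  show "\<forall>\<^sub>F n in sequentially. Ph n ((\<kappa>, []) # L) = Ph n L" for \<kappa> L
    using ev_rb by eventually_elim (rule rect_blocks.Phi_emp)
  show "\<forall>\<^sub>F n in sequentially. Ph n ((\<kappa>, Pr \<kappa>' # u) # L) = (if \<kappa> = \<kappa>' then Ph n ((\<kappa>, u) # L) else 0)" for \<kappa> \<kappa>' u L
    using ev_rb by eventually_elim (rule rect_blocks.Phi_Pr)
  show "\<forall>\<^sub>F n in sequentially. Ph n ((\<not> s, Ge i s # u) # L) = 0" for s i u L
    using ev_rb by eventually_elim (rule rect_blocks.Phi_off)
  show "\<forall>\<^sub>F n in sequentially. Ph n ((s, Ge i s # u) # L) =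
        of_real (vn n i * qn n (\<not> s)) * (\<Sum>j<length u. if u ! j = Ge i (\<not> s) then Ph n ((\<not> s, take j u) # (s, drop (Suc j) u) # L) else 0) +
        (\<Sum>m<length L. \<Sum>j<length (snd (L ! m)). if snd (L ! m) ! j = Ge i (\<not> s) then
          of_real (vn n i * qn n (\<not> s) / (qn n s * qn n (fst (L ! m)))) * Ph n ((\<not> s, u @ Pr s # drop (Suc j) (snd (L ! m)) @ Pr (fst (L ! m)) # take j (snd (L ! m))) # take m L @ drop (Suc m) L)
          else 0)" if v: "lvalid N ((s, u) # L)" and i: "i \<in> {1..N}" for s i u L
    using ev_rb
  proof eventually_elim
    case (elim n)
    show ?case using rect_blocks.Phi_loop[OF elim v i] by (simp add: qn_def cong: if_cong)
  qed
  fix i s assume i: "i \<in> {1..N}"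
  have l1: "(\<lambda>n. vn n i * qn n (\<not> s)) \<longlonglongrightarrow> (if s then c i * weight \<phi> p k / weight \<phi> p l else c i)"
  proof -
    have "(\<lambda>n. c i * (qn n (\<not> s) / qn n True)) \<longlonglongrightarrow> c i * (rho (\<not> s) / rho True)"
      by (intro tendsto_intros ratio_limit)
    moreover have "c i * (rho (\<not> s) / rho True) = (if s then c i * weight \<phi> p k / weight \<phi> p l else c i)"
      using rho_pos[of True] by (auto simp: ix_def)
    ultimately show ?thesis by (simp add: vn_def)
  qed
  then show "(\<lambda>n. complex_of_real (vn n i * qn n (\<not> s))) \<longlonglongrightarrow> of_real (if s then c i * weight \<phi> p k / weight \<phi> p l else c i)"
    by (rule tendsto_of_real)
  show "(\<lambda>n. complex_of_real (vn n i * qn n (\<not> s) / (qn n s * qn n \<kappa>))) \<longlonglongrightarrow> 0" for \<kappa>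
  proof -
    have "(\<lambda>n. vn n i * qn n (\<not> s) * ((1 / qn n s) * (1 / qn n \<kappa>))) \<longlonglongrightarrow> (if s then c i * weight \<phi> p k / weight \<phi> p l else c i) * (0 * 0)"
      by (intro tendsto_mult l1 inverse_limit)
    then have "(\<lambda>n. vn n i * qn n (\<not> s) / (qn n s * qn n \<kappa>)) \<longlonglongrightarrow> 0" by simp
    from tendsto_of_real[OF this, where 'a = complex] show ?thesis by simp
  qed
qed

lemma t_adj: "t \<kappa> (rev (map adjl u)) = cnj (t \<kappa> u)"
proof -
  have "val b (adjl e) = adj (val b e)" for e by (cases e) (auto simp: adj_adj)
  then have "wv b (rev (map adjl u)) = adj (wv b u)"
    by (induction u) (auto simp: adj_mult)
  then show ?thesis by (simp add: t_def tr_adj)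
qed

lemma dev_limit:
  assumes u: "set u \<subseteq> letters N"
  shows "(\<lambda>n. rect_blocks.dev \<phi> p k l n N (vn n) \<kappa> u (t \<kappa> u)) \<longlonglongrightarrow> 0"
proof (rule Lim_transform_eventually)
  let ?u = "rev (map adjl u)"
  let ?f = "\<lambda>n. Ph n [(\<kappa>, u), (\<kappa>, ?u)] - cnj (t \<kappa> u) * Ph n [(\<kappa>, u)] - t \<kappa> u * Ph n [(\<kappa>, ?u)] + t \<kappa> u * cnj (t \<kappa> u)"
  have u': "set ?u \<subseteq> letters N" using u by (auto simp: letters_def subset_iff)
  have "?f \<longlonglongrightarrow> t \<kappa> u * t \<kappa> ?u - cnj (t \<kappa> u) * t \<kappa> u - t \<kappa> u * t \<kappa> ?u + t \<kappa> u * cnj (t \<kappa> u)"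
    using moment_limit[of "[(\<kappa>, u), (\<kappa>, ?u)]"] moment_limit[of "[(\<kappa>, u)]"] moment_limit[of "[(\<kappa>, ?u)]"] u u'
    by (intro tendsto_intros) (auto simp: lvalid_def)
  then have "?f \<longlonglongrightarrow> 0" by (simp add: t_adj)
  from tendsto_Re[OF this] show "(\<lambda>n. Re (?f n)) \<longlonglongrightarrow> 0" by simp
  show "\<forall>\<^sub>F n in sequentially. Re (?f n) = rect_blocks.dev \<phi> p k l n N (vn n) \<kappa> u (t \<kappa> u)"
    using ev_rb by eventually_elim (simp only: rect_blocks.dev_def)
qed

definition R0 :: real where "R0 = 1 + 16 / 7 * (\<Sum>i\<in>{1..N}. 22 * sqrt (c i))"

lemma R0_ge: "R0 \<ge> 1" unfolding R0_def using sum_nonneg[of "{1..N}" "\<lambda>i. 22 * sqrt (c i)"] less_imp_le[OF cpos] by simp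

lemma microstates_half:
  assumes \<epsilon>: "\<epsilon> > 0"
  shows "\<forall>\<^sub>F n in sequentially. measure (blocks.GM n (\<lambda>\<kappa>. block \<phi> p n (ix \<kappa>)) N (vn n)) (microstates \<phi> d p k l N b R0 n r \<epsilon>) \<ge> 1 / 2"
proof -
  let ?S = "{w :: (nat \<times> bool) list. 1 \<le> length w \<and> length w \<le> r \<and> fst ` set w \<subseteq> {1..N}}"
  let ?t = "\<lambda>i. 22 * sqrt (c i)"
  let ?b = "\<lambda>n. 1 - (\<Sum>i\<in>{1..N}. exp (- qn n True))
      - (\<Sum>w\<in>?S. \<Sum>\<kappa>\<in>UNIV. rect_blocks.dev \<phi> p k l n N (vn n) \<kappa> (map letter_of w) (t \<kappa> (map letter_of w)) / (\<epsilon> / 2)\<^sup>2)"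
  have E: "(\<lambda>n. exp (- qn n True)) \<longlonglongrightarrow> 0"
    by (rule filterlim_compose[OF exp_at_bot]) (use qn_at_top in \<open>simp add: filterlim_uminus_at_bot\<close>)
  have 1: "(\<lambda>n. \<Sum>i\<in>{1..N}. exp (- qn n True)) \<longlonglongrightarrow> (\<Sum>i\<in>{1..N}. 0)" by (intro tendsto_sum E)
  have 2: "(\<lambda>n. rect_blocks.dev \<phi> p k l n N (vn n) \<kappa> (map letter_of w) (t \<kappa> (map letter_of w)) / (\<epsilon> / 2)\<^sup>2) \<longlonglongrightarrow> 0"
    if "w \<in> ?S" for w \<kappa>
  proof -
    have "set (map letter_of w) \<subseteq> letters N" using that by (force simp: letter_of_def letters_def)
    from tendsto_divide[OF dev_limit[OF this, of \<kappa>] tendsto_const, of "(\<epsilon> / 2)\<^sup>2"] show ?thesis using \<epsilon> by simp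
  qed
  have "?b \<longlonglongrightarrow> 1 - (\<Sum>i\<in>{1..N}. 0) - (\<Sum>w\<in>?S. \<Sum>\<kappa>\<in>(UNIV :: bool set). 0)"
    by (intro tendsto_diff tendsto_const 1 tendsto_sum 2)
  then have "?b \<longlonglongrightarrow> 1" by simp
  then have "\<forall>\<^sub>F n in sequentially. ?b n > 1 / 2" by (rule order_tendstoD) simp
  then show ?thesis using ev_rb
  proof eventually_elim
    case (elim n)
    interpret rect_blocks \<phi> d p k l n N "vn n" by (rule elim(2))
    have q: "qn n True > 0" by (rule qn_pos[OF elim(2)])
    have "exp (120 * real (card (blk True)) - (?t i)\<^sup>2 / (4 * vn n i)) = exp (- qn n True)" if "i \<in> {1..N}" for i
      using cpos[OF that] q by (simp add: vn_def qn_def[symmetric] power_mult_distrib)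
    then have s: "(\<Sum>i\<in>{1..N}. exp (120 * real (card (blk True)) - (?t i)\<^sup>2 / (4 * vn n i))) = (\<Sum>i\<in>{1..N}. exp (- qn n True))"
      by (intro sum.cong refl)
    have "1 - (\<Sum>i\<in>{1..N}. exp (120 * real (card (blk True)) - (?t i)\<^sup>2 / (4 * vn n i)))
      - (\<Sum>w\<in>?S. \<Sum>\<kappa>\<in>UNIV. dev \<kappa> (map letter_of w) (tr \<kappa> (wv b (map letter_of w))) / (\<epsilon> / 2)\<^sup>2)
      \<le> measure GM (microstates \<phi> d p k l N b R0 n r \<epsilon>)"
    proof (rule microstates_prob[OF bt N1 _ _ _ \<epsilon>])
      show "card (blk False) \<le> card (blk True)" using qn_le[of n] by (simp add: qn_def)
      show "0 \<le> R0" using R0_ge by simp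
      fix i assume i: "i \<in> {1..N}"
      have "?t i \<le> (\<Sum>i\<in>{1..N}. ?t i)" using cpos i by (intro member_le_sum) (auto intro: less_imp_le)
      then show "0 \<le> ?t i \<and> 16 / 7 * ?t i \<le> R0" using cpos[OF i] unfolding R0_def by (simp add: less_imp_le)
    qed
    then show ?case using elim(1) unfolding s t_def by simp
  qed
qed

end

section \<open>Comparison of free entropies\<close>

lemma log_ennreal_le:
  assumes "x \<le> ennreal y" "y > 0" "n > 0"
  shows "ereal (1 / (real n)\<^sup>2) * log_ennreal x + ereal z \<le> ereal (ln y / (real n)\<^sup>2 + z)"
proof (cases "x = 0")
  case True
  then show ?thesis using assms by (simp add: log_ennreal_def)
next
  case False
  have fin: "x < \<infinity>" using assms(1) by (simp add: le_less_trans)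
  have "enn2real x > 0" using False fin by (simp add: enn2real_positive_iff zero_less_iff_neq_zero)
  moreover have "enn2real x \<le> y" using assms by (intro enn2real_leI) auto
  ultimately have "ln (enn2real x) \<le> ln y" by simp
  then have "1 / (real n)\<^sup>2 * ln (enn2real x) + z \<le> ln y / (real n)\<^sup>2 + z"
    by (simp add: divide_right_mono)
  then show ?thesis using False fin by (simp add: log_ennreal_def)
qed

lemma log_ennreal_ge:
  assumes "ennreal y \<le> x" "y > 0" "n > 0"
  shows "ereal (ln y / (real n)\<^sup>2 + z) \<le> ereal (1 / (real n)\<^sup>2) * log_ennreal x + ereal z"
proof (cases "x = \<infinity>")
  case True
  then show ?thesis using assms by (simp add: log_ennreal_def)
next
  case False
  have x0: "x \<noteq> 0" using assms by auto
  have "y \<le> enn2real x" using assms False by (metis enn2real_ennreal enn2real_mono ennreal_less_top infinity_ennreal_def less_imp_le top.not_eq_extremum)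
  then have "ln y \<le> ln (enn2real x)" using assms by simp
  then have "ln y / (real n)\<^sup>2 + z \<le> 1 / (real n)\<^sup>2 * ln (enn2real x) + z"
    by (simp add: divide_right_mono)
  then show ?thesis using False x0 by (simp add: log_ennreal_def)
qed

lemma microstates_mono:
  "r \<le> r' \<Longrightarrow> \<epsilon>' \<le> \<epsilon> \<Longrightarrow> microstates \<phi> d p k l N a R n r' \<epsilon>' \<subseteq> microstates \<phi> d p k l N a R n r \<epsilon>"
proof
  fix A assume r: "r \<le> r'" "\<epsilon>' \<le> \<epsilon>" and A: "A \<in> microstates \<phi> d p k l N a R n r' \<epsilon>'"
  have "norm (mat_cond_exp \<phi> d p n (mat_word_eval n A w) - cond_exp \<phi> d p (word_eval a w)) \<le> \<epsilon>"
    if w: "1 \<le> length w" "length w \<le> r" "fst ` set w \<subseteq> {1..N}" for w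
  proof -
    have "norm (mat_cond_exp \<phi> d p n (mat_word_eval n A w) - cond_exp \<phi> d p (word_eval a w)) \<le> \<epsilon>'"
      using A w r(1) unfolding microstates_def by auto
    then show ?thesis using r(2) by linarith
  qed
  then show "A \<in> microstates \<phi> d p k l N a R n r \<epsilon>" using A unfolding microstates_def by auto
qed

context free_mp_family begin

definition E :: "nat \<Rightarrow> real" where
  "E n = (qn n False * qn n True * (\<Sum>i\<in>{1..N}. ln (pi * vn n i) + 1)) / (real n)\<^sup>2 + real N * rho False * rho True * ln (real n)"

definition F :: "(nat \<Rightarrow> 'a) \<Rightarrow> real \<Rightarrow> nat \<Rightarrow> real \<Rightarrow> nat \<Rightarrow> ereal" where
  "F a R r \<epsilon> n = ereal (1 / (real n)\<^sup>2) * log_ennreal (emeasure (tuple_lebesgue \<phi> p n k l N) (microstates \<phi> d p k l N a R n r \<epsilon>))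
     + ereal (real N * weight \<phi> p k * weight \<phi> p l * ln (real n))"

lemma free_entropy_F:
  "free_entropy \<phi> d p k l N a = (SUP R\<in>{0<..}. INF (r, \<epsilon>)\<in>{1..} \<times> {0<..}. limsup (F a R r \<epsilon>))"
  unfolding free_entropy_def F_def[abs_def] ..

lemma rho_kl: "weight \<phi> p k = rho False" "weight \<phi> p l = rho True" by (simp_all add: ix_def)

lemma ln_Z:
  assumes "rb n"
  shows "ln (blocks.Z (\<lambda>\<kappa>. block \<phi> p n (ix \<kappa>)) N (vn n)) + real N * (qn n False * qn n True)
    = qn n False * qn n True * (\<Sum>i\<in>{1..N}. ln (pi * vn n i) + 1)"
proof -
  interpret rect_blocks \<phi> d p k l n N "vn n" by (rule assms)
  have pos: "0 < sqrt (pi * vn n (fst \<alpha>))" if "\<alpha> \<in> gindex N blk" for \<alpha> using v_gindex[OF that] by simp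
  have ls: "ln (sqrt (pi * vn n i)) = ln (pi * vn n i) / 2" if "i \<in> {1..N}" for i
    using vp[OF that] by (simp add: ln_sqrt)
  have "ln Z = (\<Sum>\<alpha>\<in>gindex N blk. ln (sqrt (pi * vn n (fst \<alpha>))))"
    unfolding Z_def by (intro ln_prod fin_gindex pos pos[THEN less_imp_neq, THEN not_sym])
  also have "\<dots> = (\<Sum>i\<in>{1..N}. qn n False * qn n True * ln (pi * vn n i))"
    unfolding gindex_def sum_Times by (intro sum.cong refl) (simp only: fst_conv ls, simp add: qn_def)
  finally show ?thesis by (simp add: sum.distrib distrib_left sum_distrib_left)
qed

lemma density_limit: "(\<lambda>n. qn n False * qn n True / (real n)\<^sup>2) \<longlonglongrightarrow> rho False * rho True"
proof -
  have "(\<lambda>n. (qn n False / real n) * (qn n True / real n)) \<longlonglongrightarrow> rho False * rho True"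
    by (intro tendsto_mult qn_limit)
  then show ?thesis by (simp add: power2_eq_square)
qed

lemma E_bounded: "\<exists>K. \<forall>\<^sub>F n in sequentially. \<bar>E n\<bar> \<le> K"
proof -
  let ?g = "\<lambda>n. qn n False * qn n True / (real n)\<^sup>2"
  let ?h = "\<lambda>n. ?g n * (\<Sum>i\<in>{1..N}. ln (pi * c i) + 1 - ln (qn n True / real n))"
  have "?h \<longlonglongrightarrow> rho False * rho True * (\<Sum>i\<in>{1..N}. ln (pi * c i) + 1 - ln (rho True))"
    using rho_pos[of True] by (intro tendsto_intros density_limit qn_limit) auto
  then have "Bseq ?h" by (intro convergent_imp_Bseq convergentI)
  then obtain K where K: "\<And>n. \<bar>?h n\<bar> \<le> K" by (auto simp: Bseq_def)
  have "\<forall>\<^sub>F n in sequentially. \<bar>E n\<bar> \<le> K + real N * 2"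
    using eventually_gt_at_top[of 0] ev_rb
  proof eventually_elim
    case (elim n)
    interpret rect_blocks \<phi> d p k l n N "vn n" by (rule elim(2))
    have n: "real n > 0" using elim by simp
    have q: "qn n \<kappa> > 0" for \<kappa> by (rule qn_pos[OF elim(2)])
    have "(\<Sum>i\<in>{1..N}. ln (pi * vn n i) + 1) = (\<Sum>i\<in>{1..N}. (ln (pi * c i) + 1 - ln (qn n True / real n)) - ln (real n))"
    proof (intro sum.cong refl)
      fix i assume "i \<in> {1..N}"
      from cpos[OF this] show "ln (pi * vn n i) + 1 = (ln (pi * c i) + 1 - ln (qn n True / real n)) - ln (real n)"
        using q[of True] n by (simp add: vn_def ln_mult ln_div)
    qed
    then have s: "(\<Sum>i\<in>{1..N}. ln (pi * vn n i) + 1) = (\<Sum>i\<in>{1..N}. ln (pi * c i) + 1 - ln (qn n True / real n)) - real N * ln (real n)"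
      by (simp only: sum_subtractf[of _ "\<lambda>_. ln (real n)"]) simp
    have e: "E n = ?h n + real N * ((rho False * rho True - ?g n) * ln (real n))"
      unfolding E_def s by (simp add: algebra_simps diff_divide_distrib)
    have up: "?g n \<le> rho False * rho True"
    proof -
      have "qn n \<kappa> \<le> rho \<kappa> * real n" for \<kappa> unfolding qn_floor using rho_pos[of \<kappa>] by (intro of_nat_floor) simp
      then have "qn n False * qn n True \<le> (rho False * real n) * (rho True * real n)"
        using q[of False] q[of True] rho_pos[of False] by (intro mult_mono) (auto intro: less_imp_le)
      then show ?thesis using n by (simp add: divide_le_eq power2_eq_square mult_ac)
    qed
    have lo: "rho False * rho True - ?g n \<le> 2 / real n"
    proof -
      have r1: "rho \<kappa> \<le> 1" for \<kappa>
      proof -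
        have "rho \<kappa> \<le> (\<Sum>i=1..d. weight \<phi> p i)"
          using weight_pos by (intro member_le_sum) (auto intro: less_imp_le)
        then show ?thesis using weight_sum by simp
      qed
      have a: "rho \<kappa> * real n \<le> qn n \<kappa> + 1" for \<kappa> unfolding qn_floor by linarith
      have "(rho False * real n) * (rho True * real n) \<le> (qn n False + 1) * (rho True * real n)"
        using a[of False] rho_pos[of True] n by (intro mult_right_mono) auto
      also have "\<dots> = qn n False * (rho True * real n) + rho True * real n" by (simp add: algebra_simps)
      also have "\<dots> \<le> qn n False * (qn n True + 1) + rho True * real n"
        using a[of True] q[of False] rho_pos[of True] by (intro add_mono mult_left_mono) auto
      also have "\<dots> = qn n False * qn n True + qn n False + rho True * real n" by (simp add: algebra_simps)
      also have "\<dots> \<le> qn n False * qn n True + 2 * real n"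
      proof -
        have "qn n False \<le> rho False * real n" unfolding qn_floor using rho_pos[of False] by (intro of_nat_floor) simp
        moreover have "rho \<kappa> * real n \<le> 1 * real n" for \<kappa> using r1[of \<kappa>] by (intro mult_right_mono) auto
        from this[of False] this[of True] calculation show ?thesis by linarith
      qed
      finally have "rho False * rho True * (real n)\<^sup>2 - qn n False * qn n True \<le> 2 * real n"
        by (simp add: power2_eq_square algebra_simps)
      then have "(rho False * rho True * (real n)\<^sup>2 - qn n False * qn n True) / (real n)\<^sup>2 \<le> 2 * real n / (real n)\<^sup>2"
        by (rule divide_right_mono) simp
      then show ?thesis using n by (simp add: diff_divide_distrib power2_eq_square)
    qed
    have l: "0 \<le> ln (real n)" "ln (real n) \<le> real n" using elim(1) ln_le_minus_one[OF n] by auto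
    have "(rho False * rho True - ?g n) * ln (real n) \<le> 2 / real n * real n"
      using lo l up by (intro mult_mono) auto
    then have "(rho False * rho True - ?g n) * ln (real n) \<le> 2" using n by simp
    moreover have "0 \<le> (rho False * rho True - ?g n) * ln (real n)" using up l by simp
    ultimately have "\<bar>real N * ((rho False * rho True - ?g n) * ln (real n))\<bar> \<le> real N * 2"
      by (simp add: abs_mult mult_left_mono)
    then show ?case unfolding e using K[of n] by linarith
  qed
  then show ?thesis by blast
qed

lemma limsup_E_finite: "\<bar>limsup (\<lambda>n. ereal (E n))\<bar> \<noteq> \<infinity>"
proof -
  obtain K where K: "\<forall>\<^sub>F n in sequentially. \<bar>E n\<bar> \<le> K" using E_bounded by blast
  have "limsup (\<lambda>n. ereal (E n)) \<le> ereal K"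
    by (rule Limsup_bounded) (use K in eventually_elim, auto)
  moreover have "limsup (\<lambda>n. ereal (E n)) \<ge> ereal (- K)"
    by (rule le_Limsup) (simp, use K in eventually_elim, auto)
  ultimately show ?thesis by auto
qed

definition inv_c_sum :: real where "inv_c_sum = (\<Sum>i\<in>{1..N}. 1 / c i)"

lemma inv_c_sum_pos: "inv_c_sum > 0" unfolding inv_c_sum_def using cpos N1 by (intro sum_pos) auto

lemma Q_bound:
  assumes a: "a \<in> admissible_tuples \<phi> p k l N c" and "rb n" and r: "r \<ge> 2"
    and A: "A \<in> microstates \<phi> d p k l N a R n r \<epsilon>"
  shows "\<bar>blocks.Q (\<lambda>\<kappa>. block \<phi> p n (ix \<kappa>)) N (vn n) A - real N * (qn n False * qn n True)\<bar> \<le> qn n False * qn n True * (\<epsilon> * inv_c_sum)"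
proof -
  interpret rect_blocks \<phi> d p k l n N "vn n" by fact
  have q: "qn n \<kappa> > 0" for \<kappa> using \<open>rb n\<close> by (rule qn_pos)
  have at: "has_type p k l (a i)" if "i \<in> {1..N}" for i using a that by (auto simp: admissible_tuples_def)
  let ?T = "\<lambda>i. T False [Ge i False, Ge i True] A"
  have T: "\<bar>Re (?T i) - c i\<bar> \<le> \<epsilon>" if i: "i \<in> {1..N}" for i
  proof -
    have "cmod (T False (map letter_of [(i, False), (i, True)]) A - tr False (wv a (map letter_of [(i, False), (i, True)]))) \<le> \<epsilon>"
      by (rule microstates_moments(2)[OF _ A]) (use at i r in auto)
    moreover have "tr False (wv a (map letter_of [(i, False), (i, True)])) = of_real (c i)"
    proof -
      have "pp False * a i = a i" using type_mult(1)[where a = a and i = i, OF at[OF i], of False False] by simp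
      then have "tr False (a i * adj (a i)) = corner_state \<phi> p k (a i * adj (a i))"
        by (simp add: tr_def corner_state_def mult.assoc[symmetric] rho_kl)
      then show ?thesis using a i by (simp add: letter_of_def admissible_tuples_def)
    qed
    ultimately have "cmod (?T i - of_real (c i)) \<le> \<epsilon>" by (simp add: letter_of_def)
    then show ?thesis using abs_Re_le_cmod[of "?T i - of_real (c i)"] by simp
  qed
  have QS: "Q A - real N * (qn n False * qn n True) = (\<Sum>i\<in>{1..N}. qn n False * qn n True * ((Re (?T i) - c i) / c i))"
    (is "_ = ?S")
  proof -
    have "real N * (qn n False * qn n True) = (\<Sum>i\<in>{1..N}. qn n False * qn n True)" by simp
    then show ?thesis
      unfolding Q_T sum_subtractf[symmetric]
    proof (simp only: sum_subtractf[symmetric], intro sum.cong refl)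
      fix i assume i: "i \<in> {1..N}"
      show "real (card (blk False)) * Re (?T i) / vn n i - qn n False * qn n True = qn n False * qn n True * ((Re (?T i) - c i) / c i)"
        using cpos[OF i] q[of True] unfolding vn_def qn_def[of n False, symmetric] by (simp add: field_simps)
    qed
  qed
  have "\<bar>?S\<bar> \<le> (\<Sum>i\<in>{1..N}. qn n False * qn n True * (\<epsilon> * (1 / c i)))"
  proof (rule order_trans[OF sum_abs sum_mono])
    fix i assume i: "i \<in> {1..N}"
    have "\<bar>Re (?T i) - c i\<bar> / c i \<le> \<epsilon> / c i" using T[OF i] cpos[OF i] by (intro divide_right_mono) auto
    then have "(qn n False * qn n True) * (\<bar>Re (?T i) - c i\<bar> / c i) \<le> (qn n False * qn n True) * (\<epsilon> / c i)"
      using q[of False] q[of True] by (intro mult_left_mono) auto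
    then show "\<bar>qn n False * qn n True * ((Re (?T i) - c i) / c i)\<bar> \<le> qn n False * qn n True * (\<epsilon> * (1 / c i))"
      using q[of False] q[of True] cpos[OF i] by (simp add: abs_mult abs_divide)
  qed
  also have "\<dots> = qn n False * qn n True * (\<epsilon> * inv_c_sum)" by (simp add: inv_c_sum_def sum_distrib_left)
  finally show ?thesis unfolding QS .
qed

end

context free_mp_family begin

lemma b_admissible: "b \<in> admissible_tuples \<phi> p k l N c"
proof -
  have "corner_state \<phi> p k (b i * adj (b i)) = of_real (c i)" if i: "i \<in> {1..N}" for i
  proof -
    have "set [Ge i True] \<subseteq> letters N" using i by (auto simp: letters_def)
    then have "t False [Ge i False, Ge i True] = of_real (c i)"
      using schwinger_dyson_t i unfolding schwinger_dyson_def by fastforce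
    moreover have "pp False * b i = b i" using type_mult(1)[where a = b and i = i, OF bt[OF i], of False False] by simp
    then have "tr False (b i * adj (b i)) = corner_state \<phi> p k (b i * adj (b i))"
      by (simp add: tr_def corner_state_def mult.assoc[symmetric] rho_kl)
    ultimately show ?thesis by (simp add: t_def)
  qed
  then show ?thesis using bt by (simp add: admissible_tuples_def)
qed

lemma F_b_ge:
  assumes \<epsilon>: "\<epsilon> > 0" and r: "r \<ge> 1" and \<eta>: "\<eta> > 0"
  shows "limsup (\<lambda>n. ereal (E n)) - ereal \<eta> \<le> limsup (F b R0 r \<epsilon>)"
proof -
  define r' where "r' = max r 2"
  define \<epsilon>' where "\<epsilon>' = min \<epsilon> (\<eta> / (2 * inv_c_sum * (rho False * rho True + 1)))"
  have rr: "rho False * rho True > 0" using rho_pos by simp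
  have \<epsilon>': "\<epsilon>' > 0" using \<epsilon> \<eta> inv_c_sum_pos rr by (simp add: \<epsilon>'_def)
  have sub: "microstates \<phi> d p k l N b R0 n r' \<epsilon>' \<subseteq> microstates \<phi> d p k l N b R0 n r \<epsilon>" for n
    by (rule microstates_mono) (auto simp: r'_def \<epsilon>'_def)
  have d1: "\<forall>\<^sub>F n in sequentially. qn n False * qn n True / (real n)\<^sup>2 < rho False * rho True + 1"
    by (rule order_tendstoD(2)[OF density_limit]) simp
  have d2: "\<forall>\<^sub>F n in sequentially. 1 / (real n)\<^sup>2 < \<eta> / (2 * ln 2)"
  proof -
    have "(\<lambda>n. (1 / real n) * (1 / real n)) \<longlonglongrightarrow> 0 * 0" by (intro tendsto_mult lim_1_over_n)
    then show ?thesis by (intro order_tendstoD(2)[of _ 0]) (use \<eta> in \<open>auto simp: power2_eq_square\<close>)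
  qed
  have "\<forall>\<^sub>F n in sequentially. ereal (E n - \<eta>) \<le> F b R0 r \<epsilon> n"
    using microstates_half[OF \<epsilon>', of r'] ev_rb eventually_gt_at_top[of 0] d1 d2
  proof eventually_elim
    case (elim n)
    interpret rect_blocks \<phi> d p k l n N "vn n" by (rule elim(2))
    let ?M = "microstates \<phi> d p k l N b R0 n r' \<epsilon>'"
    have q: "qn n False * qn n True > 0" using qn_pos[OF elim(2)] by simp
    have R0: "R0 \<ge> 0" using R0_ge by simp
    have m': "?M \<in> sets leb" by (rule microstates_measurable) (use bt R0 N1 in auto)
    have m: "microstates \<phi> d p k l N b R0 n r \<epsilon> \<in> sets leb" by (rule microstates_measurable) (use bt R0 N1 in auto)
    let ?q = "real N * (qn n False * qn n True) - qn n False * qn n True * (\<epsilon>' * inv_c_sum)"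
    have Q: "?q \<le> Q A" if "A \<in> ?M" for A
      using Q_bound[OF b_admissible elim(2) _ that] by (simp add: r'_def)
    have "Z * exp ?q * (1 / 2) \<le> Z * exp ?q * measure GM ?M"
      using elim(1) Z_pos by (intro mult_left_mono) auto
    then have "ennreal (Z * exp ?q * (1 / 2)) \<le> ennreal (Z * exp ?q * measure GM ?M)" by (rule ennreal_leI)
    also have "\<dots> = ennreal (Z * exp ?q) * emeasure GM ?M"
      unfolding emeasure_eq_measure using Z_pos by (intro ennreal_mult) auto
    also have "\<dots> \<le> emeasure leb ?M" by (rule leb_ge[OF m' Q])
    also have "\<dots> \<le> emeasure leb (microstates \<phi> d p k l N b R0 n r \<epsilon>)" by (rule emeasure_mono[OF sub m])
    finally have "ennreal (Z * exp ?q * (1 / 2)) \<le> emeasure (tuple_lebesgue \<phi> p n k l N) (microstates \<phi> d p k l N b R0 n r \<epsilon>)"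
      unfolding tuple_leb .
    from log_ennreal_ge[OF this _ elim(3)] Z_pos
    have *: "ereal (ln (Z * exp ?q * (1 / 2)) / (real n)\<^sup>2 + real N * weight \<phi> p k * weight \<phi> p l * ln (real n)) \<le> F b R0 r \<epsilon> n"
      unfolding F_def by simp
    have "ln (Z * exp ?q * (1 / 2)) = ln Z + ?q - ln 2" using Z_pos by (simp add: ln_mult ln_div)
    also have "\<dots> = qn n False * qn n True * (\<Sum>i\<in>{1..N}. ln (pi * vn n i) + 1) - qn n False * qn n True * (\<epsilon>' * inv_c_sum) - ln 2"
      using ln_Z[OF elim(2)] by simp
    finally have L: "ln (Z * exp ?q * (1 / 2)) / (real n)\<^sup>2 + real N * weight \<phi> p k * weight \<phi> p l * ln (real n) =
      E n - (qn n False * qn n True / (real n)\<^sup>2) * (\<epsilon>' * inv_c_sum) - ln 2 * (1 / (real n)\<^sup>2)"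
      by (simp add: E_def rho_kl diff_divide_distrib)
    have "(qn n False * qn n True / (real n)\<^sup>2) * (\<epsilon>' * inv_c_sum) \<le> (rho False * rho True + 1) * (\<eta> / (2 * inv_c_sum * (rho False * rho True + 1)) * inv_c_sum)"
      using elim(4) \<epsilon>' inv_c_sum_pos rr by (intro mult_mono) (auto simp: \<epsilon>'_def)
    also have "\<dots> = \<eta> / 2"
    proof -
      have *: "x * (\<eta> / (2 * y * x) * y) = \<eta> / 2" if "x > 0" "y > 0" for x y :: real using that by (simp add: field_simps)
      show ?thesis by (rule *) (use inv_c_sum_pos rr in linarith)+
    qed
    finally have "(qn n False * qn n True / (real n)\<^sup>2) * (\<epsilon>' * inv_c_sum) \<le> \<eta> / 2" .
    moreover have "ln 2 * (1 / (real n)\<^sup>2) \<le> ln 2 * (\<eta> / (2 * ln 2))"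
      using elim(5) by (intro mult_left_mono) auto
    then have "ln 2 * (1 / (real n)\<^sup>2) \<le> \<eta> / 2" by simp
    ultimately have "E n - \<eta> \<le> E n - (qn n False * qn n True / (real n)\<^sup>2) * (\<epsilon>' * inv_c_sum) - ln 2 * (1 / (real n)\<^sup>2)" by linarith
    then have "ereal (E n - \<eta>) \<le> ereal (ln (Z * exp ?q * (1 / 2)) / (real n)\<^sup>2 + real N * weight \<phi> p k * weight \<phi> p l * ln (real n))"
      unfolding L by simp
    then show ?case using * by (rule order_trans)
  qed
  then have "limsup (\<lambda>n. ereal (E n - \<eta>)) \<le> limsup (F b R0 r \<epsilon>)" by (rule Limsup_mono)
  moreover have "limsup (\<lambda>n. ereal (E n - \<eta>)) = limsup (\<lambda>n. ereal (E n)) - ereal \<eta>"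
    using Limsup_add_ereal_right[of sequentially "ereal (- \<eta>)" "\<lambda>n. ereal (E n)"] by (simp add: minus_ereal_def)
  ultimately show ?thesis by simp
qed

lemma free_entropy_b_ge: "limsup (\<lambda>n. ereal (E n)) \<le> free_entropy \<phi> d p k l N b"
proof (rule ereal_le_epsilon2)
  fix \<eta> :: real assume \<eta>: "0 < \<eta>"
  have "limsup (\<lambda>n. ereal (E n)) - ereal \<eta> \<le> (INF (r, \<epsilon>)\<in>{1..} \<times> {0<..}. limsup (F b R0 r \<epsilon>))"
    by (rule INF_greatest) (use F_b_ge[OF _ _ \<eta>] in auto)
  also have "\<dots> \<le> free_entropy \<phi> d p k l N b"
    unfolding free_entropy_F by (rule SUP_upper) (use R0_ge in simp)
  finally show "limsup (\<lambda>n. ereal (E n)) \<le> free_entropy \<phi> d p k l N b + ereal \<eta>"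
    by (simp add: ereal_minus_le_iff add.commute)
qed

text \<open>The constant \<open>\<delta>\<close> must not depend on the norm bound \<open>R\<close> of the microstates of \<open>a\<close>, over which the free entropy
  takes the supremum.\<close>

lemma separation:
  assumes a: "a \<in> admissible_tuples \<phi> p k l N c" and w: "w \<noteq> []" "fst ` set w \<subseteq> {1..N}"
    and \<eta>: "\<eta> > 0" "\<eta> \<le> cmod (tr \<kappa> (wv a (map letter_of w)) - t \<kappa> (map letter_of w))"
  shows "\<exists>\<delta>>0. \<forall>n R \<epsilon> A B. rb n \<longrightarrow> \<epsilon> \<le> 1 \<longrightarrow> \<epsilon> \<le> \<eta> / 4 \<longrightarrow>
    A \<in> microstates \<phi> d p k l N a R n (2 * length w) \<epsilon> \<longrightarrow> B \<in> microstates \<phi> d p k l N b R0 n (2 * length w) \<epsilon> \<longrightarrow>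
    qn n False * qn n True * \<delta> \<le> (\<Sum>\<alpha>\<in>gindex N (\<lambda>\<kappa>. block \<phi> p n (ix \<kappa>)). (coord \<alpha> A - coord \<alpha> B)\<^sup>2 / vn n (fst \<alpha>))"
proof -
  let ?l = "map letter_of w" and ?m = "real (length w)"
  have at: "has_type p k l (a i)" if "i \<in> {1..N}" for i using a that by (auto simp: admissible_tuples_def)
  have m: "?m > 0" using w by simp
  define u where "u j = take j w @ rev (map (\<lambda>(i, s). (i, \<not> s)) (take j w))" for j
  have lu: "map letter_of (u j) = take j ?l @ rev (map adjl (take j ?l))" for j
    by (simp add: u_def take_map rev_map letter_of_def case_prod_unfold comp_def)
  define H where "H = 1 + (\<Sum>j\<le>length w. cmod (tr \<kappa> (wv a (map letter_of (u j)))))"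
  have H: "H \<ge> 1" by (simp add: H_def sum_nonneg)
  define Cm where "Cm = (\<Sum>i\<in>{1..N}. c i)"
  have Cm: "Cm > 0" unfolding Cm_def using cpos N1 by (intro sum_pos) auto
  define \<beta> where "\<beta> = (\<eta> / 2) / (?m * sqrt H * R0 ^ length w)"
  have R0: "R0 > 0" using R0_ge by simp
  have \<beta>: "\<beta> > 0" using \<eta> m H R0 by (simp add: \<beta>_def)
  show ?thesis
  proof (intro exI[of _ "\<beta>\<^sup>2 / Cm"] conjI allI impI)
    show "\<beta>\<^sup>2 / Cm > 0" using \<beta> Cm by simp
    fix n R \<epsilon> A B
    assume rb: "rb n" and \<epsilon>: "\<epsilon> \<le> 1" "\<epsilon> \<le> \<eta> / 4" and A: "A \<in> microstates \<phi> d p k l N a R n (2 * length w) \<epsilon>"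
      and B: "B \<in> microstates \<phi> d p k l N b R0 n (2 * length w) \<epsilon>"
    interpret rect_blocks \<phi> d p k l n N "vn n" by (rule rb)
    have q: "qn n \<kappa> > 0" for \<kappa> by (rule qn_pos[OF rb])
    have sB: "B \<in> space leb" by (rule microstates_moments(1)[OF _ B]) (use bt in auto)
    have bB: "bounded_at R0 B" unfolding bounded_at_def
    proof (intro ballI)
      fix i assume i: "i \<in> {1..N}"
      have "mat_op_norm (B i) \<le> R0" using B i unfolding microstates_def by blast
      then show "\<forall>u f. cmod (bil (blk False) (blk True) (Gm i B) u f) \<le> R0 * l2 (blk False) u * l2 (blk True) f"
        using op_norm_le_iff[OF sB i, of R0] R0 by simp
    qed
    have mA: "cmod (T \<kappa> (map letter_of w') A - tr \<kappa> (wv a (map letter_of w'))) \<le> \<epsilon>" if "1 \<le> length w'" "length w' \<le> 2 * length w" "fst ` set w' \<subseteq> {1..N}" for w'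
      by (rule microstates_moments(2)[OF _ A]) (use at that in auto)
    have mB: "cmod (T \<kappa> (map letter_of w) B - tr \<kappa> (wv b (map letter_of w))) \<le> \<epsilon>"
      by (rule microstates_moments(2)[OF _ B]) (use bt w in \<open>auto simp: Suc_le_eq\<close>)
    define D where "D = sqrt (\<Sum>i\<in>{1..N}. (dist_at i A B)\<^sup>2)"
    have D0: "D \<ge> 0" by (simp add: D_def sum_nonneg)
    have D: "dist_at i A B \<le> D" if i: "i \<in> {1..N}" for i
      unfolding D_def using i by (intro real_le_rsqrt member_le_sum) auto
    have HA: "cmod (T \<kappa> (take j ?l @ rev (map adjl (take j ?l))) A) \<le> H" if j: "j \<le> length ?l" for j
    proof (cases "j = 0")
      case True then show ?thesis using H by simp
    next
      case False
      have "fst ` set (u j) \<subseteq> {1..N}" using w(2) by (auto simp: u_def dest!: in_set_takeD)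
      then have "cmod (T \<kappa> (map letter_of (u j)) A - tr \<kappa> (wv a (map letter_of (u j)))) \<le> \<epsilon>"
        using False j w(1) by (intro mA) (auto simp: u_def)
      moreover have "cmod (tr \<kappa> (wv a (map letter_of (u j)))) \<le> (\<Sum>j\<le>length w. cmod (tr \<kappa> (wv a (map letter_of (u j)))))"
        using j by (intro member_le_sum) auto
      ultimately have "cmod (T \<kappa> (map letter_of (u j)) A) \<le> H"
        using norm_triangle_sub[of "T \<kappa> (map letter_of (u j)) A" "tr \<kappa> (wv a (map letter_of (u j)))"] \<epsilon>(1) unfolding H_def by linarith
      then show ?thesis unfolding lu .
    qed
    have "\<eta> / 2 \<le> cmod (T \<kappa> ?l A - T \<kappa> ?l B)"
    proof -
      have "cmod (T \<kappa> ?l A - tr \<kappa> (wv a ?l)) \<le> \<epsilon>" by (rule mA) (use w in \<open>auto simp: Suc_le_eq\<close>)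
      moreover have "cmod (tr \<kappa> (wv a ?l) - t \<kappa> ?l) \<le> cmod (tr \<kappa> (wv a ?l) - T \<kappa> ?l A) + cmod (T \<kappa> ?l A - T \<kappa> ?l B) + cmod (T \<kappa> ?l B - t \<kappa> ?l)"
        using norm_triangle_ineq[of "tr \<kappa> (wv a ?l) - T \<kappa> ?l A" "T \<kappa> ?l A - t \<kappa> ?l"]
          norm_triangle_ineq[of "T \<kappa> ?l A - T \<kappa> ?l B" "T \<kappa> ?l B - t \<kappa> ?l"] by simp
      ultimately show ?thesis using mB \<epsilon>(2) \<eta>(2) unfolding t_def by (simp add: norm_minus_commute)
    qed
    then have "qn n \<kappa> * (\<eta> / 2) \<le> qn n \<kappa> * cmod (T \<kappa> ?l A - T \<kappa> ?l B)" using q[of \<kappa>] by (intro mult_left_mono) auto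
    also have "\<dots> \<le> ?m * (sqrt (qn n \<kappa> * H) * R0 ^ length w * D)"
      using T_diff_le[OF R0_ge bB set_lt[OF w(2)] D D0 HA] by (simp add: qn_def)
    also have "\<dots> = sqrt (qn n \<kappa>) * (?m * sqrt H * R0 ^ length w) * D" by (simp add: real_sqrt_mult mult_ac)
    finally have "sqrt (qn n \<kappa>) * (sqrt (qn n \<kappa>) * (\<eta> / 2)) \<le> sqrt (qn n \<kappa>) * ((?m * sqrt H * R0 ^ length w) * D)"
      using q[of \<kappa>] by (simp add: mult.assoc[symmetric])
    then have "sqrt (qn n \<kappa>) * (\<eta> / 2) \<le> (?m * sqrt H * R0 ^ length w) * D"
      using q[of \<kappa>] by simp
    then have "sqrt (qn n \<kappa>) * \<beta> \<le> D"
      using m H R0 by (simp add: \<beta>_def divide_le_eq mult_ac)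
    then have "(sqrt (qn n \<kappa>) * \<beta>)\<^sup>2 \<le> D\<^sup>2" using q[of \<kappa>] \<beta> by (intro power_mono) auto
    then have D2: "qn n \<kappa> * \<beta>\<^sup>2 \<le> (\<Sum>i\<in>{1..N}. (dist_at i A B)\<^sup>2)"
      using q[of \<kappa>] by (simp add: power_mult_distrib D_def sum_nonneg)
    have "qn n False * qn n True * (\<beta>\<^sup>2 / Cm) \<le> qn n True / Cm * (qn n \<kappa> * \<beta>\<^sup>2)"
    proof -
      have "qn n False \<le> qn n \<kappa>" using qn_le by (cases \<kappa>) auto
      then have "qn n False * (qn n True * (\<beta>\<^sup>2 / Cm)) \<le> qn n \<kappa> * (qn n True * (\<beta>\<^sup>2 / Cm))"
        using q[of True] Cm by (intro mult_right_mono) auto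
      then show ?thesis by (simp add: mult_ac)
    qed
    also have "\<dots> \<le> qn n True / Cm * (\<Sum>i\<in>{1..N}. (dist_at i A B)\<^sup>2)"
      using D2 q[of True] Cm by (intro mult_left_mono) auto
    also have "\<dots> = (\<Sum>i\<in>{1..N}. qn n True * (dist_at i A B)\<^sup>2 / Cm)"
      by (simp add: sum_distrib_left sum_divide_distrib)
    also have "\<dots> \<le> (\<Sum>i\<in>{1..N}. (dist_at i A B)\<^sup>2 / vn n i)"
    proof (intro sum_mono)
      fix i assume i: "i \<in> {1..N}"
      have "c i \<le> Cm" unfolding Cm_def using i cpos by (intro member_le_sum) (auto intro: less_imp_le)
      then have "qn n True * (dist_at i A B)\<^sup>2 / Cm \<le> qn n True * (dist_at i A B)\<^sup>2 / c i"
        using cpos[OF i] q[of True] Cm by (intro divide_left_mono) auto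
      then show "qn n True * (dist_at i A B)\<^sup>2 / Cm \<le> (dist_at i A B)\<^sup>2 / vn n i" by (simp add: vn_def mult.commute)
    qed
    finally show "qn n False * qn n True * (\<beta>\<^sup>2 / Cm) \<le> (\<Sum>\<alpha>\<in>gindex N blk. (coord \<alpha> A - coord \<alpha> B)\<^sup>2 / vn n (fst \<alpha>))"
      unfolding sum_dist .
  qed
qed

lemma free_entropy_less:
  assumes a: "a \<in> admissible_tuples \<phi> p k l N c" and w: "w \<noteq> []" "fst ` set w \<subseteq> {1..N}"
    and ne: "tr \<kappa> (wv a (map letter_of w)) \<noteq> t \<kappa> (map letter_of w)"
  shows "free_entropy \<phi> d p k l N a < free_entropy \<phi> d p k l N b"
proof -
  define \<eta> where "\<eta> = cmod (tr \<kappa> (wv a (map letter_of w)) - t \<kappa> (map letter_of w))"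
  have \<eta>: "\<eta> > 0" using ne by (simp add: \<eta>_def)
  obtain \<delta> where \<delta>: "\<delta> > 0" and sep: "\<And>n R \<epsilon> A B. rb n \<Longrightarrow> \<epsilon> \<le> 1 \<Longrightarrow> \<epsilon> \<le> \<eta> / 4 \<Longrightarrow>
    A \<in> microstates \<phi> d p k l N a R n (2 * length w) \<epsilon> \<Longrightarrow> B \<in> microstates \<phi> d p k l N b R0 n (2 * length w) \<epsilon> \<Longrightarrow>
    qn n False * qn n True * \<delta> \<le> (\<Sum>\<alpha>\<in>gindex N (\<lambda>\<kappa>. block \<phi> p n (ix \<kappa>)). (coord \<alpha> A - coord \<alpha> B)\<^sup>2 / vn n (fst \<alpha>))"
    using separation[OF a w \<eta>, of \<kappa>] unfolding \<eta>_def by blast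
  let ?r = "2 * length w"
  define \<epsilon> where "\<epsilon> = min (min 1 (\<eta> / 4)) (\<delta> / (4 * inv_c_sum))"
  have \<epsilon>: "\<epsilon> > 0" "\<epsilon> \<le> 1" "\<epsilon> \<le> \<eta> / 4" "\<epsilon> * inv_c_sum \<le> \<delta> / 4"
  proof -
    show "\<epsilon> > 0" "\<epsilon> \<le> 1" "\<epsilon> \<le> \<eta> / 4" using \<eta> \<delta> inv_c_sum_pos by (auto simp: \<epsilon>_def)
    have "\<epsilon> \<le> \<delta> / (4 * inv_c_sum)" by (simp add: \<epsilon>_def)
    then have "\<epsilon> * inv_c_sum \<le> \<delta> / (4 * inv_c_sum) * inv_c_sum" using inv_c_sum_pos by (intro mult_right_mono) auto
    then show "\<epsilon> * inv_c_sum \<le> \<delta> / 4" using inv_c_sum_pos by simp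
  qed
  have at: "has_type p k l (a i)" if "i \<in> {1..N}" for i using a that by (auto simp: admissible_tuples_def)
  have r: "?r \<ge> 2" using w(1) by (simp add: Suc_le_eq)
  define g where "g = rho False * rho True"
  have g: "g > 0" using rho_pos by (simp add: g_def)
  have d1: "\<forall>\<^sub>F n in sequentially. g / 2 < qn n False * qn n True / (real n)\<^sup>2"
    by (rule order_tendstoD(1)[OF density_limit]) (use g in \<open>simp add: g_def\<close>)
  have d2: "\<forall>\<^sub>F n in sequentially. 1 / (real n)\<^sup>2 < g * \<delta> / (16 * ln 2)"
  proof -
    have "(\<lambda>n. (1 / real n) * (1 / real n)) \<longlonglongrightarrow> 0 * 0" by (intro tendsto_mult lim_1_over_n)
    then show ?thesis by (intro order_tendstoD(2)[of _ 0]) (use g \<delta> in \<open>auto simp: power2_eq_square\<close>)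
  qed
  define \<theta> where "\<theta> = g * \<delta> / 16"
  have \<theta>: "\<theta> > 0" using g \<delta> by (simp add: \<theta>_def)
  have up: "limsup (F a R ?r \<epsilon>) \<le> limsup (\<lambda>n. ereal (E n)) - ereal \<theta>" if R: "R > 0" for R
  proof -
    have "\<forall>\<^sub>F n in sequentially. F a R ?r \<epsilon> n \<le> ereal (E n - \<theta>)"
      using microstates_half[OF \<epsilon>(1), of ?r] ev_rb eventually_gt_at_top[of 0] d1 d2
    proof eventually_elim
      case (elim n)
      interpret rect_blocks \<phi> d p k l n N "vn n" by (rule elim(2))
      let ?A = "microstates \<phi> d p k l N a R n ?r \<epsilon>" and ?B = "microstates \<phi> d p k l N b R0 n ?r \<epsilon>"
      define Y where "Y = qn n False * qn n True"
      have Y: "Y > 0" using qn_pos[OF elim(2)] by (simp add: Y_def)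
      have mA: "?A \<in> sets leb" by (rule microstates_measurable) (use at R N1 in auto)
      have mB: "?B \<in> sets leb" by (rule microstates_measurable) (use bt R0_ge N1 in auto)
      have "emeasure GM ?A * emeasure GM ?B \<le> ennreal (exp (- (Y * \<delta>) / 2))"
        unfolding Y_def by (rule separated_sets[OF mA mB sep]) (use elim(2) \<epsilon> in auto)
      then have "measure GM ?A * measure GM ?B \<le> exp (- (Y * \<delta>) / 2)"
        by (simp add: emeasure_eq_measure ennreal_mult[symmetric])
      moreover have "measure GM ?A * (1 / 2) \<le> measure GM ?A * measure GM ?B"
        using elim(1) by (intro mult_left_mono) auto
      ultimately have MA: "measure GM ?A \<le> 2 * exp (- (Y * \<delta>) / 2)" by linarith
      let ?q = "real N * Y + Y * (\<epsilon> * inv_c_sum)"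
      have Q: "Q A \<le> ?q" if "A \<in> ?A" for A
        using Q_bound[OF a elim(2) r that] by (simp add: Y_def)
      have "emeasure leb ?A \<le> ennreal (Z * exp ?q) * emeasure GM ?A" by (rule leb_le[OF mA Q])
      also have "\<dots> \<le> ennreal (Z * exp ?q * (2 * exp (- (Y * \<delta>) / 2)))"
        using MA Z_pos by (simp add: emeasure_eq_measure ennreal_mult[symmetric] mult_left_mono ennreal_leI)
      finally have "emeasure (tuple_lebesgue \<phi> p n k l N) ?A \<le> ennreal (Z * exp ?q * (2 * exp (- (Y * \<delta>) / 2)))"
        unfolding tuple_leb .
      from log_ennreal_le[OF this _ elim(3)] Z_pos
      have *: "F a R ?r \<epsilon> n \<le> ereal (ln (Z * exp ?q * (2 * exp (- (Y * \<delta>) / 2))) / (real n)\<^sup>2 + real N * weight \<phi> p k * weight \<phi> p l * ln (real n))"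
        unfolding F_def by simp
      have "ln (Z * exp ?q * (2 * exp (- (Y * \<delta>) / 2))) = ln Z + ?q + ln 2 - Y * \<delta> / 2" using Z_pos by (simp add: ln_mult)
      also have "\<dots> = Y * (\<Sum>i\<in>{1..N}. ln (pi * vn n i) + 1) + Y * (\<epsilon> * inv_c_sum) + ln 2 - Y * \<delta> / 2"
        using ln_Z[OF elim(2)] by (simp add: Y_def)
      finally have L: "ln (Z * exp ?q * (2 * exp (- (Y * \<delta>) / 2))) / (real n)\<^sup>2 + real N * weight \<phi> p k * weight \<phi> p l * ln (real n) =
        E n + (Y / (real n)\<^sup>2) * (\<epsilon> * inv_c_sum) + ln 2 * (1 / (real n)\<^sup>2) - (Y / (real n)\<^sup>2) * (\<delta> / 2)"
        by (simp add: E_def rho_kl diff_divide_distrib add_divide_distrib Y_def)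
      let ?W = "(Y / (real n)\<^sup>2) * (\<delta> / 4)"
      have lin: "e + x1 + x2 - x3 \<le> e - z" if "x1 \<le> W" "2 * z \<le> W" "x2 \<le> z" "x3 = 2 * W" for e x1 x2 x3 z W :: real
        using that by linarith
      have "E n + (Y / (real n)\<^sup>2) * (\<epsilon> * inv_c_sum) + ln 2 * (1 / (real n)\<^sup>2) - (Y / (real n)\<^sup>2) * (\<delta> / 2) \<le> E n - \<theta>"
      proof (rule lin)
        show "(Y / (real n)\<^sup>2) * (\<epsilon> * inv_c_sum) \<le> ?W" using Y \<epsilon>(4) by (intro mult_left_mono) auto
        have "g / 2 * (\<delta> / 4) \<le> ?W" using elim(4) \<delta> unfolding Y_def by (intro mult_right_mono) auto
        then show "2 * \<theta> \<le> ?W" by (simp add: \<theta>_def mult.commute)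
        have "ln 2 * (1 / (real n)\<^sup>2) \<le> ln 2 * (g * \<delta> / (16 * ln 2))" using elim(5) by (intro mult_left_mono) auto
        then show "ln 2 * (1 / (real n)\<^sup>2) \<le> \<theta>" by (simp add: \<theta>_def)
      qed simp
      then have "ereal (E n + (Y / (real n)\<^sup>2) * (\<epsilon> * inv_c_sum) + ln 2 * (1 / (real n)\<^sup>2) - (Y / (real n)\<^sup>2) * (\<delta> / 2)) \<le> ereal (E n - \<theta>)" by simp
      with * show ?case unfolding L by (rule order_trans)
    qed
    then have "limsup (F a R ?r \<epsilon>) \<le> limsup (\<lambda>n. ereal (E n - \<theta>))" by (rule Limsup_mono)
    moreover have "limsup (\<lambda>n. ereal (E n - \<theta>)) = limsup (\<lambda>n. ereal (E n)) - ereal \<theta>"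
      using Limsup_add_ereal_right[of sequentially "ereal (- \<theta>)" "\<lambda>n. ereal (E n)"] by (simp add: minus_ereal_def)
    ultimately show ?thesis by simp
  qed
  have "free_entropy \<phi> d p k l N a \<le> limsup (\<lambda>n. ereal (E n)) - ereal \<theta>"
    unfolding free_entropy_F
  proof (rule SUP_least)
    fix R :: real assume "R \<in> {0<..}"
    then show "(INF (r, \<epsilon>)\<in>{1..} \<times> {0<..}. limsup (F a R r \<epsilon>)) \<le> limsup (\<lambda>n. ereal (E n)) - ereal \<theta>"
      using r \<epsilon>(1) by (intro INF_lower2[of "(?r, \<epsilon>)"]) (auto intro: up)
  qed
  also have "\<dots> < limsup (\<lambda>n. ereal (E n))"
    using limsup_E_finite \<theta> by (cases "limsup (\<lambda>n. ereal (E n))") auto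
  also have "\<dots> \<le> free_entropy \<phi> d p k l N b" by (rule free_entropy_b_ge)
  finally show ?thesis .
qed

end

theorem theorem5p14:
  fixes \<phi> :: "'a::cstar_algebra \<Rightarrow> complex"
    and p a :: "nat \<Rightarrow> 'a"
    and c :: "nat \<Rightarrow> real"
    and d k l N :: nat
  assumes "tracial_wstar_prob_space \<phi>"
    and "projection_decomposition d p"
    and "k \<in> {1..d}" and "l \<in> {1..d}" and "k \<noteq> l"
    and "weight \<phi> p k \<le> weight \<phi> p l"
    and "N \<ge> 1"
    and "\<And>i. i \<in> {1..N} \<Longrightarrow> c i > 0"
    and "\<exists>b\<in>admissible_tuples \<phi> p k l N c. free_marchenko_pastur \<phi> d p k l N c b"
    and "a \<in> admissible_tuples \<phi> p k l N c"
    and "\<And>b. b \<in> admissible_tuples \<phi> p k l N c \<Longrightarrow>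
           free_entropy \<phi> d p k l N b \<le> free_entropy \<phi> d p k l N a"
  shows "free_marchenko_pastur \<phi> d p k l N c a"
proof -
  obtain b where b: "b \<in> admissible_tuples \<phi> p k l N c" "free_marchenko_pastur \<phi> d p k l N c b" using assms(9) by blast
  have types: "has_type p k l (a i)" "has_type p k l (b i)" if "i \<in> {1..N}" for i
    using assms(10) b(1) that by (auto simp: admissible_tuples_def)
  interpret free_mp_family \<phi> d p k l N c b
    by unfold_locales (use assms(1-8) b types in auto)
  have eq: "tr \<kappa> (wv a (map letter_of w)) = tr \<kappa> (wv b (map letter_of w))" if "w \<noteq> []" "fst ` set w \<subseteq> {1..N}" for \<kappa> w
    using free_entropy_less[OF assms(10) that] assms(11)[OF b(1)] unfolding t_def by (meson leD)
  show ?thesis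
  proof (rule free_marchenko_pastur_transfer[OF types(1) types(2) _ b(2)])
    fix \<kappa> w assume w: "set w \<subseteq> letters N"
    show "tr \<kappa> (wv a w) = tr \<kappa> (wv b w)"
      using projection_words[of N a b "[]" w \<kappa>] types eq w by simp
  qed
qed

end
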